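(* Let $\mathbb{G}$ be a Carnot group of topological dimension $m$, step $s$ and rank $k$, with Endpoint map $\mathrm{End}:L^2([0,1],\mathbb{R}^k)\to\mathbb{G}\cong\mathbb{R}^m$, and let $I=[0,1]$. For every $\ell\in\mathbb{N}$ there exists $r=r(m,s,k,\ell)>0$ such that, with $V=\mathcal{C}^\omega(I,\mathbb{R}^k;r,\ell)$, $$\mu\big(\mathrm{End}(\mathrm{Crit}(\mathrm{End})\cap V)\big)=\mu\big(\mathrm{End}(\mathrm{Crit}(\mathrm{End}|_V))\big)=0.$$ Moreover, with $W=\mathcal{C}^\omega(I,\mathbb{R}^k;\infty,\ell)$, $$\dim_{\mathcal{H}}\big(\mathrm{End}(\mathrm{Crit}(\mathrm{End})\cap W)\big)\le\dim_{\mathcal{H}}\big(\mathrm{End}(\mathrm{Crit}(\mathrm{End}|_W))\big)\le m-1.$$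
   Context: Carnot group of step $s$, rank $k$, dimension $m$: connected simply connected Lie group with stratified Lie algebra $\mathfrak{g}=\mathfrak{g}_1\oplus\cdots\oplus\mathfrak{g}_s$, $\mathfrak{g}_{i+1}=[\mathfrak{g}_1,\mathfrak{g}_i]$, $[\mathfrak{g}_1,\mathfrak{g}_s]=0$, $\mathfrak{g}_i\neq0$, $k=\dim\mathfrak{g}_1$, identified with $\mathbb{R}^m$ by exponential coordinates of an adapted basis; $X_1,\dots,X_k$ left-invariant vector fields forming a basis of $\mathfrak{g}_1$; $\mathrm{End}(u)=\gamma_u(1)$ where $\dot\gamma_u=\sum_ju_jX_j(\gamma_u)$, $\gamma_u(0)=e$. For a closed interval $J$ and $r\in(0,\infty]$, $\mathcal{C}^\omega(J,\mathbb{R}^k;r)$ is the set of real-analytic $u:J\to\mathbb{R}^k$ whose radius of convergence (the largest $\rho$ such that $u$ extends holomorphically to $\{z\in\mathbb{C}:\mathrm{dist}(z,J)\le\rho\}$) is strictly greater than $r$ (for $r=\infty$: entire). For $\ell\in\mathbb{N}$, with $I_a=[(a-1)/\ell,a/\ell]$, $\mathcal{C}^\omega(I,\mathbb{R}^k;r,\ell)=\{u\in L^2(I,\mathbb{R}^k):u|_{I_a}\in\mathcal{C}^\omega(I_a,\mathbb{R}^k;r)\ \forall a=1,\dots,\ell\}$. $\mathrm{End}|_V$ is $C^1$ on the normed space $V\subset L^2$ with differential $(D_u\mathrm{End})|_V$; $\mathrm{Crit}(g)$ is the set where the differential has rank $\le m-1$. $\mu$ is Lebesgue measure, $\dim_{\mathcal{H}}$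 Hausdorff dimension. *)

theory Defs
  imports "HOL-Analysis.Analysis"
begin

coinductive smooth_fun :: "('a::euclidean_space \<Rightarrow> 'b::real_normed_vector) \<Rightarrow> bool" where
  "(\<forall>x. f differentiable (at x)) \<Longrightarrow>
   (\<forall>i\<in>Basis. smooth_fun (\<lambda>x. frechet_derivative f (at x) i)) \<Longrightarrow> smooth_fun f"

definition linv_field :: "('g::euclidean_space \<Rightarrow> 'g \<Rightarrow> 'g) \<Rightarrow> 'g \<Rightarrow> 'g \<Rightarrow> 'g" where
  "linv_field gmul w x = frechet_derivative (gmul x) (at 0) w"

text \<open>Lie bracket of the Lie algebra (= tangent space at 0), computed as the
  bracket of the left-invariant vector fields, evaluated at the identity.\<close>
definition lie_br :: "('g::euclidean_space \<Rightarrow> 'g \<Rightarrow> 'g) \<Rightarrow> 'g \<Rightarrow> 'g \<Rightarrow> 'g" where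
  "lie_br gmul v w =
     frechet_derivative (linv_field gmul w) (at 0) v - frechet_derivative (linv_field gmul v) (at 0) w"

text \<open>carnot_group gmul s Vs Xmap: (R^m, gmul) is a Lie group with identity 0 written in
  exponential coordinates (t \<mapsto> t v is the one-parameter subgroup with velocity v) of a basis
  adapted to the stratification Vs 1 + ... + Vs s of step s; Xmap : R^k \<rightarrow> Vs 1 is a linear
  isomorphism, i.e. Xmap c = sum_j c_j X_j for a basis X_1..X_k of the first layer.\<close>
definition carnot_group ::
  "('g::euclidean_space \<Rightarrow> 'g \<Rightarrow> 'g) \<Rightarrow> nat \<Rightarrow> (nat \<Rightarrow> 'g set) \<Rightarrow> ('k::euclidean_space \<Rightarrow> 'g) \<Rightarrow> bool" where
  "carnot_group gmul s Vs Xmap \<longleftrightarrow>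
     s \<ge> 1 \<and>
     (\<forall>x y z. gmul (gmul x y) z = gmul x (gmul y z)) \<and>
     (\<forall>x. gmul 0 x = x \<and> gmul x 0 = x) \<and>
     (\<forall>x. \<exists>y. gmul x y = 0 \<and> gmul y x = 0) \<and>
     smooth_fun (\<lambda>p::'g \<times> 'g. gmul (fst p) (snd p)) \<and>
     (\<forall>v a b. gmul (a *\<^sub>R v) (b *\<^sub>R v) = (a + b) *\<^sub>R v) \<and>
     (\<forall>i\<in>{1..s}. subspace (Vs i) \<and> Vs i \<noteq> {0} \<and> (\<exists>B\<subseteq>Basis. Vs i = span B)) \<and>
     (\<Sum>i=1..s. dim (Vs i)) = DIM('g) \<and>
     span (\<Union>i\<in>{1..s}. Vs i) = UNIV \<and>
     (\<forall>i\<in>{1..<s}. span {lie_br gmul v w | v w. v \<in> Vs 1 \<and> w \<in> Vs i} = Vs (Suc i)) \<and>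
     (\<forall>v\<in>Vs 1. \<forall>w\<in>Vs s. lie_br gmul v w = 0) \<and>
     linear Xmap \<and> inj Xmap \<and> range Xmap = Vs 1"

definition L2 :: "(real \<Rightarrow> 'k::euclidean_space) set" where
  "L2 = {u. u \<in> borel_measurable (lebesgue_on {0..1}) \<and>
            integrable (lebesgue_on {0..1}) (\<lambda>t. (norm (u t))\<^sup>2)}"

definition L2norm :: "(real \<Rightarrow> 'k::euclidean_space) \<Rightarrow> real" where
  "L2norm u = sqrt (integral\<^sup>L (lebesgue_on {0..1}) (\<lambda>t. (norm (u t))\<^sup>2))"

text \<open>End(u) = gamma_u(1), where gamma_u is the (absolutely continuous) solution of
  gamma' = sum_j u_j X_j(gamma), gamma(0) = 0 (the identity), in integral form.\<close>
definition End_map ::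
  "('g::euclidean_space \<Rightarrow> 'g \<Rightarrow> 'g) \<Rightarrow> ('k::euclidean_space \<Rightarrow> 'g) \<Rightarrow> (real \<Rightarrow> 'k) \<Rightarrow> 'g" where
  "End_map gmul Xmap u =
     (THE y. \<exists>\<gamma>. continuous_on {0..1} \<gamma> \<and>
        (\<forall>t\<in>{0..1}. ((\<lambda>\<tau>. linv_field gmul (Xmap (u \<tau>)) (\<gamma> \<tau>)) has_integral \<gamma> t) {0..t}) \<and>
        y = \<gamma> 1)"

definition has_End_deriv ::
  "('g::euclidean_space \<Rightarrow> 'g \<Rightarrow> 'g) \<Rightarrow> ('k::euclidean_space \<Rightarrow> 'g) \<Rightarrow> (real \<Rightarrow> 'k)
     \<Rightarrow> ((real \<Rightarrow> 'k) \<Rightarrow> 'g) \<Rightarrow> bool" where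
  "has_End_deriv gmul Xmap u L \<longleftrightarrow>
     (\<forall>v\<in>L2. \<forall>w\<in>L2. L (\<lambda>t. v t + w t) = L v + L w) \<and>
     (\<forall>c. \<forall>v\<in>L2. L (\<lambda>t. c *\<^sub>R v t) = c *\<^sub>R L v) \<and>
     (\<exists>C. \<forall>v\<in>L2. norm (L v) \<le> C * L2norm v) \<and>
     (\<forall>\<epsilon>>0. \<exists>\<delta>>0. \<forall>v\<in>L2. L2norm v < \<delta> \<longrightarrow>
        norm (End_map gmul Xmap (\<lambda>t. u t + v t) - End_map gmul Xmap u - L v) \<le> \<epsilon> * L2norm v)"

definition Crit_End ::
  "('g::euclidean_space \<Rightarrow> 'g \<Rightarrow> 'g) \<Rightarrow> ('k::euclidean_space \<Rightarrow> 'g) \<Rightarrow> (real \<Rightarrow> 'k) set" where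
  "Crit_End gmul Xmap =
     {u\<in>L2. \<exists>L. has_End_deriv gmul Xmap u L \<and> dim (L ` L2) \<le> DIM('g) - 1}"

text \<open>Crit(End|_V): the differential of End|_V at u is (D_u End)|_V.\<close>
definition Crit_End_on ::
  "('g::euclidean_space \<Rightarrow> 'g \<Rightarrow> 'g) \<Rightarrow> ('k::euclidean_space \<Rightarrow> 'g) \<Rightarrow> (real \<Rightarrow> 'k) set \<Rightarrow> (real \<Rightarrow> 'k) set" where
  "Crit_End_on gmul Xmap V =
     {u\<in>V. \<exists>L. has_End_deriv gmul Xmap u L \<and> dim (L ` V) \<le> DIM('g) - 1}"

text \<open>u|_J (as an L^2 class, i.e. up to null sets) is real-analytic with radius of
  convergence > r: it extends holomorphically to {z. dist(z,J) \<le> rho} for some rho > r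
  (equivalently to the open neighbourhood {z. dist(z,J) < rho}, rho > r).\<close>
definition analytic_radius_gt :: "real set \<Rightarrow> real \<Rightarrow> (real \<Rightarrow> 'k::euclidean_space) \<Rightarrow> bool" where
  "analytic_radius_gt J r u \<longleftrightarrow>
     (\<exists>\<rho>>r. \<forall>b\<in>Basis. \<exists>F. F holomorphic_on {z. infdist z (complex_of_real ` J) < \<rho>} \<and>
        (AE t in lebesgue_on J. F (complex_of_real t) = complex_of_real (u t \<bullet> b)))"

definition analytic_entire :: "real set \<Rightarrow> (real \<Rightarrow> 'k::euclidean_space) \<Rightarrow> bool" where
  "analytic_entire J u \<longleftrightarrow>
     (\<forall>b\<in>Basis. \<exists>F. F holomorphic_on UNIV \<and>
        (AE t in lebesgue_on J. F (complex_of_real t) = complex_of_real (u t \<bullet> b)))"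

definition piece :: "nat \<Rightarrow> nat \<Rightarrow> real set" where
  "piece l a = {(real a - 1) / real l .. real a / real l}"

definition Cw_pw :: "real \<Rightarrow> nat \<Rightarrow> (real \<Rightarrow> 'k::euclidean_space) set" where
  "Cw_pw r l = {u\<in>L2. \<forall>a\<in>{1..l}. analytic_radius_gt (piece l a) r u}"

definition Cw_pw_entire :: "nat \<Rightarrow> (real \<Rightarrow> 'k::euclidean_space) set" where
  "Cw_pw_entire l = {u\<in>L2. \<forall>a\<in>{1..l}. analytic_entire (piece l a) u}"

definition hausdorff_pre :: "real \<Rightarrow> real \<Rightarrow> 'a::metric_space set \<Rightarrow> ennreal" where
  "hausdorff_pre d \<delta> A =
     (INF C\<in>{C :: nat \<Rightarrow> 'a set. A \<subseteq> (\<Union>i. C i) \<and> (\<forall>i. bounded (C i) \<and> diameter (C i) \<le> \<delta>)}.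
        \<Sum>i. ennreal (if C i = {} then 0 else diameter (C i) powr d))"

definition hausdorff_measure :: "real \<Rightarrow> 'a::metric_space set \<Rightarrow> ennreal" where
  "hausdorff_measure d A = (SUP \<delta>\<in>{0<..}. hausdorff_pre d \<delta> A)"

definition hausdorff_dim :: "'a::metric_space set \<Rightarrow> real" where
  "hausdorff_dim A = Inf {d. d > 0 \<and> hausdorff_measure d A = 0}"

end

(* By nilpotency the Picard iteration for the control equation terminates after s steps, so on every
   finite-dimensional space of controls the endpoint map is a polynomial whose degree depends only on s and
   whose coefficients are bounded independently of the dimension N.  A control with radius of convergence
   greater than r is, up to an error M q^n with q ~ 1/r, a combination of N = O(n) piecewise monomials, and
   the endpoint polynomial is near-critical there whenever the control is critical.

   The near-critical values of a polynomial map to R^m are covered as follows.  Lagrange multipliers, together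
   with an eps-grid in m - 1 of the coordinates, reduce to the near-critical values of a scalar polynomial in
   N + m variables.  After adding a small multiple of the sum of D-th powers, its complexification has at most
   (D - 1)^(N + m) critical points, and every near-critical point is joined to one of them by an arc along
   which the value hardly changes.  This gives about eps^(-(m - 1)) beta^n balls of radius nearly eps.  The
   factor beta^n is exponential in n, hence absorbed by taking eps = theta^(n P) with theta small and P large;
   this is possible once q, that is 1/r, is small enough. *)
theory Submission
  imports Defs "HOL-Complex_Analysis.Complex_Analysis" "Jordan_Normal_Form.Determinant"
begin

section \<open>Polynomial functions of several complex variables\<close>

text \<open>The obstacle is uniformity in the number N of variables: the approximation error decays
  only like q^n while N grows in proportion to n, so the number of balls may grow at most
  exponentially in N. The count (D - 1)^(N + m) is admissible; it is Bezout's number for a gradient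
  whose leading terms are pure powers, and for such systems it follows from linear algebra.

  Complexification is what allows critical points to be followed: the critical values of the
  gradient map lie in a complex hypersurface, which does not separate, whereas real critical points
  can merge and disappear along a path. The quantity tracked is a Legendre transform, whose
  derivative is, up to sign, the moving point; so only the size R of the points matters. The
  exponent P makes this size harmless: the gradient of the perturbation exceeds the degree bound of
  the original gradient by P, so R may be taken to be eps^(-2/P), and the radius eps is worsened
  only to eps^(1 - 3/P). Such a loss is affordable only in dimension m - 1 + tau with tau > 0, and P
  has to grow as tau shrinks.\<close>

inductive mpoly :: "nat \<Rightarrow> nat \<Rightarrow> ((nat \<Rightarrow> complex) \<Rightarrow> complex) \<Rightarrow> bool" for N where
  mpoly_const: "mpoly N d (\<lambda>_. c)"
| mpoly_var: "i < N \<Longrightarrow> 1 \<le> d \<Longrightarrow> mpoly N d (\<lambda>x. x i)"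
| mpoly_add: "mpoly N d f \<Longrightarrow> mpoly N d g \<Longrightarrow> mpoly N d (\<lambda>x. f x + g x)"
| mpoly_mult: "mpoly N d f \<Longrightarrow> mpoly N e g \<Longrightarrow> d + e \<le> k \<Longrightarrow> mpoly N k (\<lambda>x. f x * g x)"

lemma mpoly_mono: "mpoly N d f \<Longrightarrow> d \<le> e \<Longrightarrow> mpoly N e f"
proof (induction arbitrary: e rule: mpoly.induct)
  case (mpoly_mult d f e' g k)
  then show ?case using mpoly.mpoly_mult[of N d f e' g e] by simp
qed (auto intro: mpoly.intros)

lemma mpoly_cong: "mpoly N d f \<Longrightarrow> (\<And>i. i < N \<Longrightarrow> x i = y i) \<Longrightarrow> f x = f y"
  by (induction rule: mpoly.induct) auto

lemma mpoly_scale: "mpoly N d f \<Longrightarrow> mpoly N d (\<lambda>x. c * f x)"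
  using mpoly_mult[OF mpoly_const[of N 0 c], of d f d] by simp

lemma mpoly_uminus: "mpoly N d f \<Longrightarrow> mpoly N d (\<lambda>x. - f x)"
  using mpoly_scale[of N d f "-1"] by simp

lemma mpoly_diff: "mpoly N d f \<Longrightarrow> mpoly N d g \<Longrightarrow> mpoly N d (\<lambda>x. f x - g x)"
  using mpoly_add[OF _ mpoly_uminus, of N d f g] by simp

lemma mpoly_sum: "(\<And>i. i \<in> A \<Longrightarrow> mpoly N d (f i)) \<Longrightarrow> mpoly N d (\<lambda>x. \<Sum>i\<in>A. f i x)"
  by (induction A rule: infinite_finite_induct) (auto intro: mpoly.intros)

lemma mpoly_prod:
  "finite A \<Longrightarrow> (\<And>i. i \<in> A \<Longrightarrow> mpoly N (d i) (f i)) \<Longrightarrow> mpoly N (\<Sum>i\<in>A. d i) (\<lambda>x. \<Prod>i\<in>A. f i x)"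
proof (induction A rule: finite_induct)
  case empty
  then show ?case using mpoly_const[of N 0 1] by simp
next
  case (insert a A)
  then show ?case using mpoly_mult[of N "d a" "f a" "sum d A" "\<lambda>x. \<Prod>i\<in>A. f i x" "d a + sum d A"] by simp
qed

lemma mpoly_power: "mpoly N d f \<Longrightarrow> mpoly N (k * d) (\<lambda>x. f x ^ k)"
proof (induction k)
  case 0
  then show ?case using mpoly_const[of N 0 1] by simp
next
  case (Suc k)
  then show ?case using mpoly_mult[of N d f "k * d" "\<lambda>x. f x ^ k" "d + k * d"] by simp
qed

lemma mpoly_var_power: "i < N \<Longrightarrow> mpoly N k (\<lambda>x. x i ^ k)"
  using mpoly_power[OF mpoly_var[of i N 1], of k] by simp

lemma mpoly_line:
  "mpoly N d f \<Longrightarrow> \<exists>p. \<forall>t. f (\<lambda>i. x i + t * h i) = poly p t"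
proof (induction rule: mpoly.induct)
  case (mpoly_const d c)
  then show ?case by (intro exI[of _ "[:c:]"]) simp
next
  case (mpoly_var i d)
  then show ?case by (intro exI[of _ "[:x i, h i:]"]) simp
next
  case (mpoly_add d f g)
  then obtain p q where "\<forall>t. f (\<lambda>i. x i + t * h i) = poly p t" "\<forall>t. g (\<lambda>i. x i + t * h i) = poly q t"
    by blast
  then show ?case by (intro exI[of _ "p + q"]) simp
next
  case (mpoly_mult d f e g k)
  then obtain p q where "\<forall>t. f (\<lambda>i. x i + t * h i) = poly p t" "\<forall>t. g (\<lambda>i. x i + t * h i) = poly q t"
    by blast
  then show ?case by (intro exI[of _ "p * q"]) simp
qed

text \<open>Restriction to the line through \<open>x\<close> and \<open>x1\<close> reduces the claim
  to polynomials in one variable, which have no zero divisors; the restriction of \<open>g\<close>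
  is nonzero because of its value at \<open>x1\<close>.\<close>

lemma mpoly_idom:
  assumes f: "mpoly N d f" and g: "mpoly N e g" and fg: "\<And>x. f x * g x = 0" and nz: "g x1 \<noteq> 0"
  shows "f x = 0"
proof -
  let ?h = "\<lambda>i. x1 i - x i"
  obtain p where p: "\<And>t. f (\<lambda>i. x i + t * ?h i) = poly p t" using mpoly_line[OF f, of x ?h] by blast
  obtain q where q: "\<And>t. g (\<lambda>i. x i + t * ?h i) = poly q t" using mpoly_line[OF g, of x ?h] by blast
  have "poly (p * q) t = 0" for t using fg p q by (metis poly_mult)
  then have "p * q = 0" using poly_all_0_iff_0 by blast
  moreover have "q \<noteq> 0" using q[of 1] nz by auto
  ultimately have "p = 0" by auto
  then show ?thesis using p[of 0] by simp
qed

section \<open>Growth and gradients\<close>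

lemma mpoly_bound:
  "mpoly N d f \<Longrightarrow> \<exists>K\<ge>0. \<forall>x r. 1 \<le> r \<longrightarrow> (\<forall>i<N. norm (x i) \<le> r) \<longrightarrow> norm (f x) \<le> K * r ^ d"
proof (induction rule: mpoly.induct)
  case (mpoly_const d c)
  have "norm c * 1 \<le> norm c * r ^ d" if "1 \<le> r" for r :: real
    using that by (intro mult_left_mono) auto
  then show ?case by (intro exI[of _ "norm c"]) auto
next
  case (mpoly_var i d)
  have "r ^ 1 \<le> r ^ d" if "1 \<le> r" for r :: real
    using that mpoly_var by (intro power_increasing) auto
  then show ?case using mpoly_var by (intro exI[of _ 1]) force
next
  case (mpoly_add d f g)
  then obtain K L where KL: "K \<ge> 0" "L \<ge> 0"
    "\<And>x r. 1 \<le> r \<Longrightarrow> (\<forall>i<N. norm (x i) \<le> r) \<Longrightarrow> norm (f x) \<le> K * r ^ d"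
    "\<And>x r. 1 \<le> r \<Longrightarrow> (\<forall>i<N. norm (x i) \<le> r) \<Longrightarrow> norm (g x) \<le> L * r ^ d" by metis
  have "norm (f x + g x) \<le> (K + L) * r ^ d" if "1 \<le> r" "\<forall>i<N. norm (x i) \<le> r" for x r
    using KL(3)[OF that] KL(4)[OF that] norm_triangle_ineq[of "f x" "g x"] by (simp add: algebra_simps)
  then show ?case using KL by (intro exI[of _ "K + L"]) auto
next
  case (mpoly_mult d f e g k)
  then obtain K L where KL: "K \<ge> 0" "L \<ge> 0"
    "\<And>x r. 1 \<le> r \<Longrightarrow> (\<forall>i<N. norm (x i) \<le> r) \<Longrightarrow> norm (f x) \<le> K * r ^ d"
    "\<And>x r. 1 \<le> r \<Longrightarrow> (\<forall>i<N. norm (x i) \<le> r) \<Longrightarrow> norm (g x) \<le> L * r ^ e" by metis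
  have "norm (f x * g x) \<le> (K * L) * r ^ k" if "1 \<le> r" "\<forall>i<N. norm (x i) \<le> r" for x r
  proof -
    have "norm (f x * g x) \<le> (K * r ^ d) * (L * r ^ e)"
      unfolding norm_mult using that KL by (intro mult_mono) auto
    also have "\<dots> = K * L * r ^ (d + e)" by (simp add: power_add)
    also have "\<dots> \<le> K * L * r ^ k"
      using KL that mpoly_mult by (intro mult_left_mono power_increasing) auto
    finally show ?thesis .
  qed
  then show ?case using KL by (intro exI[of _ "K * L"]) auto
qed

text \<open>The remainder is quadratic uniformly on each polydisc. This expresses differentiability
  without a norm on the sequence space, and it already contains the second-order bound needed by
  Newton's method and by the tracking of critical values.\<close>

definition has_grad :: "nat \<Rightarrow> ((nat \<Rightarrow> complex) \<Rightarrow> complex) \<Rightarrow> (nat \<Rightarrow> (nat \<Rightarrow> complex) \<Rightarrow> complex) \<Rightarrow> bool" where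
  "has_grad N f g \<longleftrightarrow> (\<forall>r\<ge>1. \<exists>K\<ge>0. \<forall>x h s. (\<forall>i<N. norm (x i) \<le> r) \<longrightarrow> (\<forall>i<N. norm (h i) \<le> s) \<longrightarrow> 0 \<le> s \<longrightarrow> s \<le> 1 \<longrightarrow>
     norm (f (\<lambda>i. x i + h i) - f x - (\<Sum>j<N. h j * g j x)) \<le> K * s\<^sup>2)"

lemma has_gradD:
  assumes "has_grad N f g" "r \<ge> 1"
  obtains K where "K \<ge> 0" "\<And>x h s. (\<And>i. i < N \<Longrightarrow> norm (x i) \<le> r) \<Longrightarrow> (\<And>i. i < N \<Longrightarrow> norm (h i) \<le> s) \<Longrightarrow> 0 \<le> s \<Longrightarrow> s \<le> 1 \<Longrightarrow>
     norm (f (\<lambda>i. x i + h i) - f x - (\<Sum>j<N. h j * g j x)) \<le> K * s\<^sup>2"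
proof -
  obtain K where K: "K \<ge> 0" "\<forall>x h s. (\<forall>i<N. norm (x i) \<le> r) \<longrightarrow> (\<forall>i<N. norm (h i) \<le> s) \<longrightarrow> 0 \<le> s \<longrightarrow> s \<le> 1 \<longrightarrow>
     norm (f (\<lambda>i. x i + h i) - f x - (\<Sum>j<N. h j * g j x)) \<le> K * s\<^sup>2"
    using assms unfolding has_grad_def by blast
  show thesis by (rule that[OF K(1)]) (use K(2) in simp)
qed

lemma has_grad_add:
  assumes "has_grad N f f'" "has_grad N g g'"
  shows "has_grad N (\<lambda>x. f x + g x) (\<lambda>j x. f' j x + g' j x)"
  unfolding has_grad_def
proof (intro allI impI)
  fix r :: real assume r: "r \<ge> 1"
  obtain K where K: "K \<ge> 0" "\<And>x h s. (\<And>i. i < N \<Longrightarrow> norm (x i) \<le> r) \<Longrightarrow> (\<And>i. i < N \<Longrightarrow> norm (h i) \<le> s) \<Longrightarrow> 0 \<le> s \<Longrightarrow> s \<le> 1 \<Longrightarrow>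
     norm (f (\<lambda>i. x i + h i) - f x - (\<Sum>j<N. h j * f' j x)) \<le> K * s\<^sup>2" using has_gradD[OF assms(1) r] by blast
  obtain L where L: "L \<ge> 0" "\<And>x h s. (\<And>i. i < N \<Longrightarrow> norm (x i) \<le> r) \<Longrightarrow> (\<And>i. i < N \<Longrightarrow> norm (h i) \<le> s) \<Longrightarrow> 0 \<le> s \<Longrightarrow> s \<le> 1 \<Longrightarrow>
     norm (g (\<lambda>i. x i + h i) - g x - (\<Sum>j<N. h j * g' j x)) \<le> L * s\<^sup>2" using has_gradD[OF assms(2) r] by blast
  show "\<exists>K\<ge>0. \<forall>x h s. (\<forall>i<N. norm (x i) \<le> r) \<longrightarrow> (\<forall>i<N. norm (h i) \<le> s) \<longrightarrow> 0 \<le> s \<longrightarrow> s \<le> 1 \<longrightarrow>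
     norm (f (\<lambda>i. x i + h i) + g (\<lambda>i. x i + h i) - (f x + g x) - (\<Sum>j<N. h j * (f' j x + g' j x))) \<le> K * s\<^sup>2"
  proof (intro exI[of _ "K + L"] conjI allI impI)
    fix x h :: "nat \<Rightarrow> complex" and s :: real
    assume a: "\<forall>i<N. norm (x i) \<le> r" "\<forall>i<N. norm (h i) \<le> s" "0 \<le> s" "s \<le> 1"
    have e: "f (\<lambda>i. x i + h i) + g (\<lambda>i. x i + h i) - (f x + g x) - (\<Sum>j<N. h j * (f' j x + g' j x))
      = (f (\<lambda>i. x i + h i) - f x - (\<Sum>j<N. h j * f' j x)) + (g (\<lambda>i. x i + h i) - g x - (\<Sum>j<N. h j * g' j x))"
      by (simp add: algebra_simps sum.distrib)
    show "norm (f (\<lambda>i. x i + h i) + g (\<lambda>i. x i + h i) - (f x + g x) - (\<Sum>j<N. h j * (f' j x + g' j x))) \<le> (K + L) * s\<^sup>2"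
      unfolding e using K(2)[of x h s] L(2)[of x h s] a
      by (intro order_trans[OF norm_triangle_ineq]) (simp add: algebra_simps)
  qed (use K L in auto)
qed

lemma has_grad_const: "has_grad N (\<lambda>_. c) (\<lambda>_ _. 0)"
  unfolding has_grad_def by (auto intro!: exI[of _ 0])

lemma has_grad_var: "i < N \<Longrightarrow> has_grad N (\<lambda>x. x i) (\<lambda>j _. if j = i then 1 else 0)"
  unfolding has_grad_def by (auto intro!: exI[of _ 0] simp: if_distrib cong: if_cong)

text \<open>Polynomiality provides bounds for the functions and their gradients on the polydisc of
  radius \<open>r + 1\<close>, which contains \<open>x\<close> together with the shifted
  point.\<close>

lemma has_grad_mult:
  assumes "has_grad N f f'" "has_grad N g g'" "mpoly N d f" "mpoly N e g"
    "\<And>j. mpoly N d' (f' j)" "\<And>j. mpoly N e' (g' j)"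
  shows "has_grad N (\<lambda>x. f x * g x) (\<lambda>j x. f' j x * g x + f x * g' j x)"
  unfolding has_grad_def
proof (intro allI impI)
  fix r :: real assume r: "r \<ge> 1"
  have r1: "r + 1 \<ge> 1" using r by simp
  obtain K where K: "K \<ge> 0" "\<And>x h s. (\<And>i. i < N \<Longrightarrow> norm (x i) \<le> r) \<Longrightarrow> (\<And>i. i < N \<Longrightarrow> norm (h i) \<le> s) \<Longrightarrow> 0 \<le> s \<Longrightarrow> s \<le> 1 \<Longrightarrow>
     norm (f (\<lambda>i. x i + h i) - f x - (\<Sum>j<N. h j * f' j x)) \<le> K * s\<^sup>2" using has_gradD[OF assms(1) r] by blast
  obtain L where L: "L \<ge> 0" "\<And>x h s. (\<And>i. i < N \<Longrightarrow> norm (x i) \<le> r) \<Longrightarrow> (\<And>i. i < N \<Longrightarrow> norm (h i) \<le> s) \<Longrightarrow> 0 \<le> s \<Longrightarrow> s \<le> 1 \<Longrightarrow>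
     norm (g (\<lambda>i. x i + h i) - g x - (\<Sum>j<N. h j * g' j x)) \<le> L * s\<^sup>2" using has_gradD[OF assms(2) r] by blast
  have bd: "\<exists>B\<ge>0. \<forall>x. (\<forall>i<N. norm (x i) \<le> r + 1) \<longrightarrow> norm (\<phi> x) \<le> B" if m: "mpoly N k \<phi>" for \<phi> k
  proof -
    obtain B where B: "B \<ge> 0" "\<forall>x r. 1 \<le> r \<longrightarrow> (\<forall>i<N. norm (x i) \<le> r) \<longrightarrow> norm (\<phi> x) \<le> B * r ^ k"
      using mpoly_bound[OF m] by metis
    then show ?thesis using r1 by (intro exI[of _ "B * (r+1)^k"]) auto
  qed
  obtain A where A: "A \<ge> 0" "\<And>x. (\<forall>i<N. norm (x i) \<le> r + 1) \<Longrightarrow> norm (f x) \<le> A" using bd[OF assms(3)] by metis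
  obtain B where B: "B \<ge> 0" "\<And>x. (\<forall>i<N. norm (x i) \<le> r + 1) \<Longrightarrow> norm (g x) \<le> B" using bd[OF assms(4)] by metis
  obtain A' where A': "\<And>j. A' j \<ge> 0" "\<And>j x. (\<forall>i<N. norm (x i) \<le> r + 1) \<Longrightarrow> norm (f' j x) \<le> A' j" using bd[OF assms(5)] by metis
  obtain B' where B': "\<And>j. B' j \<ge> 0" "\<And>j x. (\<forall>i<N. norm (x i) \<le> r + 1) \<Longrightarrow> norm (g' j x) \<le> B' j" using bd[OF assms(6)] by metis
  define C where "C = (\<Sum>j<N. A' j) * (\<Sum>j<N. B' j)"
  have C0: "C \<ge> 0" unfolding C_def using A' B' by (auto intro!: mult_nonneg_nonneg sum_nonneg)
  show "\<exists>K\<ge>0. \<forall>x h s. (\<forall>i<N. norm (x i) \<le> r) \<longrightarrow> (\<forall>i<N. norm (h i) \<le> s) \<longrightarrow> 0 \<le> s \<longrightarrow> s \<le> 1 \<longrightarrow>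
     norm (f (\<lambda>i. x i + h i) * g (\<lambda>i. x i + h i) - f x * g x - (\<Sum>j<N. h j * (f' j x * g x + f x * g' j x))) \<le> K * s\<^sup>2"
  proof (intro exI[of _ "K * B + L * (A + (\<Sum>j<N. A' j)) + C"] conjI allI impI)
    fix x h :: "nat \<Rightarrow> complex" and s :: real
    assume a: "\<forall>i<N. norm (x i) \<le> r" "\<forall>i<N. norm (h i) \<le> s" "0 \<le> s" "s \<le> 1"
    define F where "F = (\<Sum>j<N. h j * f' j x)"
    define G where "G = (\<Sum>j<N. h j * g' j x)"
    define u where "u = f (\<lambda>i. x i + h i) - f x - F"
    define v where "v = g (\<lambda>i. x i + h i) - g x - G"
    have u: "norm u \<le> K * s\<^sup>2" unfolding u_def F_def using K(2)[of x h s] a by blast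
    have v: "norm v \<le> L * s\<^sup>2" unfolding v_def G_def using L(2)[of x h s] a by blast
    have xr: "\<forall>i<N. norm (x i) \<le> r + 1" using a(1) by fastforce
    have xh: "\<forall>i<N. norm (x i + h i) \<le> r + 1"
      using a by (meson add_mono norm_triangle_le order_trans)
    have F: "norm F \<le> s * (\<Sum>j<N. A' j)" unfolding F_def sum_distrib_left
      by (intro order_trans[OF norm_sum] sum_mono) (use a A'(2)[OF xr] in \<open>auto simp: norm_mult intro!: mult_mono\<close>)
    have G: "norm G \<le> s * (\<Sum>j<N. B' j)" unfolding G_def sum_distrib_left
      by (intro order_trans[OF norm_sum] sum_mono) (use a B'(2)[OF xr] in \<open>auto simp: norm_mult intro!: mult_mono\<close>)
    \<comment> \<open>With increments \<open>F + u\<close> and \<open>G + v\<close> this is the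
      product rule with exact remainder; \<open>F * G\<close> is quadratic because both factors are
      linear in the step.\<close>
    have e: "f (\<lambda>i. x i + h i) * g (\<lambda>i. x i + h i) - f x * g x - (\<Sum>j<N. h j * (f' j x * g x + f x * g' j x))
      = u * g (\<lambda>i. x i + h i) + (f x + F) * v + F * G"
    proof -
      have 1: "(\<Sum>j<N. h j * (f' j x * g x + f x * g' j x)) = F * g x + f x * G"
        unfolding F_def G_def by (simp add: sum_distrib_left sum_distrib_right sum.distrib[symmetric] algebra_simps)
      show ?thesis unfolding 1 u_def v_def by (simp add: algebra_simps)
    qed
    have "norm (u * g (\<lambda>i. x i + h i)) \<le> (K * s\<^sup>2) * B"
      unfolding norm_mult using u B K xh by (intro mult_mono) auto
    moreover have "norm ((f x + F) * v) \<le> (A + (\<Sum>j<N. A' j)) * (L * s\<^sup>2)"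
    proof -
      have "s * (\<Sum>j<N. A' j) \<le> 1 * (\<Sum>j<N. A' j)" using a A' by (intro mult_right_mono sum_nonneg) auto
      then have "norm (f x + F) \<le> A + (\<Sum>j<N. A' j)"
        using A(2)[OF xr] F norm_triangle_ineq[of "f x" F] by linarith
      then show ?thesis unfolding norm_mult using v by (intro mult_mono) (auto intro: order_trans[OF norm_ge_zero])
    qed
    moreover have "norm (F * G) \<le> (s * (\<Sum>j<N. A' j)) * (s * (\<Sum>j<N. B' j))"
      unfolding norm_mult using F G by (intro mult_mono) (auto intro: order_trans[OF norm_ge_zero])
    ultimately show "norm (f (\<lambda>i. x i + h i) * g (\<lambda>i. x i + h i) - f x * g x - (\<Sum>j<N. h j * (f' j x * g x + f x * g' j x)))
       \<le> (K * B + L * (A + (\<Sum>j<N. A' j)) + C) * s\<^sup>2"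
      unfolding e C_def
      using norm_triangle_ineq[of "u * g (\<lambda>i. x i + h i) + (f x + F) * v" "F * G"]
       norm_triangle_ineq[of "u * g (\<lambda>i. x i + h i)" "(f x + F) * v"]
      by (simp add: algebra_simps power2_eq_square)
  qed (use K L A B A' C0 in \<open>auto intro!: add_nonneg_nonneg mult_nonneg_nonneg sum_nonneg\<close>)
qed

text \<open>Truncated subtraction turns \<open>d - 1\<close> into \<open>0\<close> for
  \<open>d = 0\<close>. The clause on vanishing gradients repairs this in the product case: a
  constant factor would otherwise contribute a term of degree \<open>e\<close> where
  \<open>k - 1\<close> is wanted.\<close>

lemma mpoly_has_grad:
  assumes "mpoly N d f"
  shows "\<exists>g. (\<forall>j. mpoly N (d - 1) (g j)) \<and> (d = 0 \<longrightarrow> (\<forall>j x. g j x = 0)) \<and> has_grad N f g"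
  using assms
proof (induction rule: mpoly.induct)
  case (mpoly_const d c)
  then show ?case using has_grad_const by (intro exI[of _ "\<lambda>_ _. 0"]) (auto intro: mpoly.mpoly_const)
next
  case (mpoly_var i d)
  then show ?case using has_grad_var[of i N]
    by (intro exI[of _ "\<lambda>j _. if j = i then 1 else 0"]) (auto intro: mpoly.mpoly_const)
next
  case (mpoly_add d f g)
  then obtain f' g' where "\<And>j. mpoly N (d - 1) (f' j)" "d = 0 \<Longrightarrow> (\<forall>j x. f' j x = 0)" "has_grad N f f'"
    "\<And>j. mpoly N (d - 1) (g' j)" "d = 0 \<Longrightarrow> (\<forall>j x. g' j x = 0)" "has_grad N g g'" by blast
  then show ?case
    by (intro exI[of _ "\<lambda>j x. f' j x + g' j x"] conjI allI impI mpoly.mpoly_add has_grad_add) auto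
next
  case (mpoly_mult d f e g k)
  then obtain f' g' where *: "\<And>j. mpoly N (d - 1) (f' j)" "d = 0 \<Longrightarrow> (\<forall>j x. f' j x = 0)" "has_grad N f f'"
    "\<And>j. mpoly N (e - 1) (g' j)" "e = 0 \<Longrightarrow> (\<forall>j x. g' j x = 0)" "has_grad N g g'" by blast
  have "mpoly N (k - 1) (\<lambda>x. f' j x * g x)" for j
  proof (cases "d = 0")
    case True
    then show ?thesis using * mpoly.mpoly_const[of N "k-1" 0] by simp
  next
    case False
    then show ?thesis using *(1)[of j] mpoly_mult by (intro mpoly.mpoly_mult[of N "d - 1" _ e]) auto
  qed
  moreover have "mpoly N (k - 1) (\<lambda>x. f x * g' j x)" for j
  proof (cases "e = 0")
    case True
    then show ?thesis using * mpoly.mpoly_const[of N "k-1" 0] by simp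
  next
    case False
    then show ?thesis using *(4)[of j] mpoly_mult by (intro mpoly.mpoly_mult[of N d _ "e - 1"]) auto
  qed
  moreover have "has_grad N (\<lambda>x. f x * g x) (\<lambda>j x. f' j x * g x + f x * g' j x)"
    by (rule has_grad_mult[OF *(3,6) mpoly_mult(1,2) *(1,4)])
  ultimately show ?case using * mpoly_mult
    by (intro exI[of _ "\<lambda>j x. f' j x * g x + f x * g' j x"] conjI allI impI mpoly.mpoly_add) auto
qed

section \<open>Monomial expansions and the size of finite fibres\<close>

definition mmon :: "nat \<Rightarrow> (nat \<Rightarrow> nat) \<Rightarrow> (nat \<Rightarrow> complex) \<Rightarrow> complex" where
  "mmon N \<alpha> x = (\<Prod>i<N. x i ^ \<alpha> i)"

text \<open>Here and in \<open>mtot\<close> the exponents vanish from \<open>N\<close> on, so that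
  each monomial in \<open>N\<close> variables has exactly one exponent function and the index sets
  are finite.\<close>

definition mbox :: "nat \<Rightarrow> nat \<Rightarrow> (nat \<Rightarrow> nat) set" where
  "mbox N J = {\<alpha>. (\<forall>i<N. \<alpha> i \<le> J) \<and> (\<forall>i\<ge>N. \<alpha> i = 0)}"

definition mtot :: "nat \<Rightarrow> nat \<Rightarrow> (nat \<Rightarrow> nat) set" where
  "mtot N d = {\<alpha>. (\<forall>i\<ge>N. \<alpha> i = 0) \<and> sum \<alpha> {..<N} \<le> d}"

lemma mbox_Suc: "mbox (Suc N) J = (\<lambda>(\<alpha>, k). \<alpha>(N := k)) ` (mbox N J \<times> {..J})"
proof (intro equalityI subsetI)
  fix \<alpha> assume "\<alpha> \<in> mbox (Suc N) J"
  then have "(\<alpha>(N := 0), \<alpha> N) \<in> mbox N J \<times> {..J}" "\<alpha> = (\<lambda>(\<alpha>, k). \<alpha>(N := k)) (\<alpha>(N := 0), \<alpha> N)"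
    by (auto simp: mbox_def)
  then show "\<alpha> \<in> (\<lambda>(\<alpha>, k). \<alpha>(N := k)) ` (mbox N J \<times> {..J})" by blast
qed (auto simp: mbox_def)

lemma inj_mbox: "inj_on (\<lambda>(\<alpha>, k). \<alpha>(N := k)) (mbox N J \<times> {..J})"
proof (rule inj_onI, clarsimp)
  fix a b :: "nat \<Rightarrow> nat" and k l
  assume *: "a \<in> mbox N J" "b \<in> mbox N J" "a(N := k) = b(N := l)"
  have "k = l" using fun_cong[OF *(3), of N] by simp
  moreover have "a i = b i" for i
    using fun_cong[OF *(3), of i] *(1,2) by (cases "i = N") (auto simp: mbox_def)
  ultimately show "a = b \<and> k = l" by auto
qed

lemma mbox_card: "finite (mbox N J) \<and> card (mbox N J) = (J + 1) ^ N"
proof (induction N)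
  case 0
  have "mbox 0 J = {\<lambda>_. 0}" by (auto simp: mbox_def)
  then show ?case by simp
next
  case (Suc N)
  then show ?case unfolding mbox_Suc by (simp add: card_image[OF inj_mbox] card_cartesian_product)
qed

lemma mtot_subset_mbox: "mtot N d \<subseteq> mbox N d"
proof
  fix \<alpha> assume "\<alpha> \<in> mtot N d"
  moreover have "\<alpha> i \<le> sum \<alpha> {..<N}" if "i < N" for i using that by (intro member_le_sum) auto
  ultimately show "\<alpha> \<in> mbox N d" by (force simp: mtot_def mbox_def)
qed

lemma finite_mtot: "finite (mtot N d)"
  using finite_subset[OF mtot_subset_mbox] mbox_card by blast

lemma card_mtot: "card (mtot N d) \<le> (d + 1) ^ N"
  using card_mono[OF _ mtot_subset_mbox, of N d] mbox_card[of N d] by simp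

lemma mmon_add: "mmon N (\<lambda>i. \<alpha> i + \<beta> i) x = mmon N \<alpha> x * mmon N \<beta> x"
  by (simp add: mmon_def power_add prod.distrib)

lemma mpoly_repr:
  "mpoly N d f \<Longrightarrow> \<exists>c. \<forall>x. f x = (\<Sum>\<alpha>\<in>mtot N d. c \<alpha> * mmon N \<alpha> x)"
proof (induction rule: mpoly.induct)
  case (mpoly_const d a)
  have z: "(\<lambda>_. 0) \<in> mtot N d" by (simp add: mtot_def)
  have "a = (\<Sum>\<alpha>\<in>mtot N d. (if \<alpha> = (\<lambda>_. 0) then a else 0) * mmon N \<alpha> x)" for x
  proof -
    have "(\<Sum>\<alpha>\<in>mtot N d. (if \<alpha> = (\<lambda>_. 0) then a else 0) * mmon N \<alpha> x)
      = (\<Sum>\<alpha>\<in>mtot N d. if \<alpha> = (\<lambda>_. 0) then a * mmon N (\<lambda>_. 0) x else 0)"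
      by (intro sum.cong) auto
    also have "\<dots> = a" using z finite_mtot by (simp add: mmon_def)
    finally show ?thesis by simp
  qed
  then show ?case by (intro exI allI)
next
  case (mpoly_var i d)
  define e where "e = (\<lambda>j. if j = i then 1 else 0 :: nat)"
  have z: "e \<in> mtot N d" using mpoly_var by (auto simp: mtot_def e_def sum.delta)
  have m: "mmon N e x = x i" for x
  proof -
    have "mmon N e x = (\<Prod>j<N. if j = i then x i else 1)"
      unfolding mmon_def e_def by (intro prod.cong) auto
    then show ?thesis using mpoly_var by simp
  qed
  have "x i = (\<Sum>\<alpha>\<in>mtot N d. (if \<alpha> = e then 1 else 0) * mmon N \<alpha> x)" for x
  proof -
    have "(\<Sum>\<alpha>\<in>mtot N d. (if \<alpha> = e then 1 else 0) * mmon N \<alpha> x)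
      = (\<Sum>\<alpha>\<in>mtot N d. if \<alpha> = e then mmon N e x else 0)"
      by (intro sum.cong) auto
    also have "\<dots> = x i" using z finite_mtot m by simp
    finally show ?thesis by simp
  qed
  then show ?case by (intro exI allI)
next
  case (mpoly_add d f g)
  then obtain a b where "\<And>x. f x = (\<Sum>\<alpha>\<in>mtot N d. a \<alpha> * mmon N \<alpha> x)" "\<And>x. g x = (\<Sum>\<alpha>\<in>mtot N d. b \<alpha> * mmon N \<alpha> x)"
    by blast
  then show ?case by (intro exI[of _ "\<lambda>\<alpha>. a \<alpha> + b \<alpha>"]) (simp add: sum.distrib algebra_simps)
next
  case (mpoly_mult d f e g k)
  then obtain a b where ab: "\<And>x. f x = (\<Sum>\<alpha>\<in>mtot N d. a \<alpha> * mmon N \<alpha> x)" "\<And>x. g x = (\<Sum>\<alpha>\<in>mtot N e. b \<alpha> * mmon N \<alpha> x)"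
    by blast
  define T where "T = mtot N d \<times> mtot N e"
  define s where "s = (\<lambda>(\<alpha>::nat\<Rightarrow>nat, \<beta>::nat\<Rightarrow>nat) i. \<alpha> i + \<beta> i)"
  have fT: "finite T" unfolding T_def using finite_mtot by auto
  have sT: "s ` T \<subseteq> mtot N k" unfolding T_def s_def mtot_def using mpoly_mult(3) by (auto simp: sum.distrib)
  define c where "c = (\<lambda>\<gamma>. \<Sum>z\<in>{z\<in>T. s z = \<gamma>}. a (fst z) * b (snd z))"
  have "f x * g x = (\<Sum>\<gamma>\<in>mtot N k. c \<gamma> * mmon N \<gamma> x)" for x
  proof -
    have "f x * g x = (\<Sum>z\<in>T. (a (fst z) * mmon N (fst z) x) * (b (snd z) * mmon N (snd z) x))"
      unfolding ab T_def sum_product by (simp add: sum.cartesian_product case_prod_beta)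
    also have "\<dots> = (\<Sum>z\<in>T. a (fst z) * b (snd z) * mmon N (s z) x)"
      by (intro sum.cong) (auto simp: s_def mmon_add algebra_simps)
    also have "\<dots> = (\<Sum>\<gamma>\<in>mtot N k. \<Sum>z\<in>{z\<in>T. s z = \<gamma>}. a (fst z) * b (snd z) * mmon N (s z) x)"
      using sum.group[OF fT finite_mtot sT, symmetric] .
    also have "\<dots> = (\<Sum>\<gamma>\<in>mtot N k. c \<gamma> * mmon N \<gamma> x)"
      unfolding c_def sum_distrib_right by (intro sum.cong) auto
    finally show ?thesis .
  qed
  then show ?case by blast
qed

text \<open>Gaussian elimination by induction on the equations: an equation with a nonzero
  coefficient is solved for that unknown, which costs one equation and one unknown.\<close>

lemma homogeneous_system:
  fixes A :: "'e \<Rightarrow> 'u \<Rightarrow> 'a::field"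
  assumes "finite E" "finite U" "card E < card U"
  shows "\<exists>w. (\<exists>u\<in>U. w u \<noteq> 0) \<and> (\<forall>e\<in>E. (\<Sum>u\<in>U. A e u * w u) = 0)"
  using assms
proof (induction E arbitrary: U A rule: finite_induct)
  case empty
  then obtain u where "u \<in> U" by fastforce
  then show ?case by (intro exI[of _ "\<lambda>_. 1"]) auto
next
  case (insert e E)
  show ?case
  proof (cases "\<forall>u\<in>U. A e u = 0")
    case True
    obtain w where "\<exists>u\<in>U. w u \<noteq> 0" "\<forall>e\<in>E. (\<Sum>u\<in>U. A e u * w u) = 0"
      using insert.IH[of U A] insert.prems insert.hyps by auto
    then show ?thesis using True by (intro exI[of _ w]) auto
  next
    case False
    then obtain u0 where u0: "u0 \<in> U" "A e u0 \<noteq> 0" by blast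
    define U' where "U' = U - {u0}"
    have U: "U = insert u0 U'" "u0 \<notin> U'" "finite U'" using u0 insert.prems unfolding U'_def by auto
    then have "card E < card U'" using insert.prems insert.hyps by auto
    then obtain w where w: "\<exists>u\<in>U'. w u \<noteq> 0"
      "\<forall>e'\<in>E. (\<Sum>u\<in>U'. (A e' u - A e' u0 * A e u / A e u0) * w u) = 0"
      using insert.IH[of U' "\<lambda>e' u. A e' u - A e' u0 * A e u / A e u0"] U by auto
    define w0 where "w0 = - (\<Sum>u\<in>U'. A e u * w u) / A e u0"
    define w' where "w' = w(u0 := w0)"
    have s: "(\<Sum>u\<in>U. A e' u * w' u) = A e' u0 * w0 + (\<Sum>u\<in>U'. A e' u * w u)" for e'
    proof -
      have "(\<Sum>u\<in>U'. A e' u * w' u) = (\<Sum>u\<in>U'. A e' u * w u)"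
        using U by (intro sum.cong) (auto simp: w'_def)
      then show ?thesis unfolding U(1) using U by (simp add: w'_def)
    qed
    have "(\<Sum>u\<in>U. A e' u * w' u) = 0" if "e' \<in> insert e E" for e'
    proof (cases "e' = e")
      case True
      then show ?thesis unfolding s using u0 by (simp add: w0_def)
    next
      case False
      then have "(\<Sum>u\<in>U'. (A e' u - A e' u0 * A e u / A e u0) * w u) = 0" using that w by auto
      then have "(\<Sum>u\<in>U'. A e' u * w u) = A e' u0 / A e u0 * (\<Sum>u\<in>U'. A e u * w u)"
        by (simp add: left_diff_distrib sum_subtractf sum_distrib_left mult.assoc)
      then show ?thesis unfolding s w0_def by simp
    qed
    moreover have "\<exists>u\<in>U. w' u \<noteq> 0" using w(1) U by (auto simp: w'_def)
    ultimately show ?thesis by blast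
  qed
qed

text \<open>Bezout's bound for systems with pure leading powers. Modulo the equations every monomial
  is a combination of the \<open>q ^ N\<close> monomials with exponents below \<open>q\<close>, so
  these span the polynomial functions on \<open>F\<close>; as polynomials separate the points of
  \<open>F\<close>, there are at most that many points.\<close>

lemma reduced_fibre_card:
  assumes q: "q \<ge> 1" and h: "\<And>i. i < N \<Longrightarrow> mpoly N (q - 1) (h i)"
    and F: "finite F" "\<And>x i. x \<in> F \<Longrightarrow> i \<ge> N \<Longrightarrow> x i = 0" "\<And>x i. x \<in> F \<Longrightarrow> i < N \<Longrightarrow> x i ^ q = h i x"
  shows "card F \<le> q ^ N"
proof (rule ccontr)
  assume "\<not> card F \<le> q ^ N"
  then have "card (mbox N (q - 1)) < card F" using mbox_card[of N "q - 1"] q by simp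
  \<comment> \<open>With more points than reduced monomials, some nonzero weight on the points
    annihilates all these monomials.\<close>
  then obtain w where w: "\<exists>x\<in>F. w x \<noteq> 0" "\<And>\<alpha>. \<alpha> \<in> mbox N (q - 1) \<Longrightarrow> (\<Sum>x\<in>F. mmon N \<alpha> x * w x) = 0"
    using homogeneous_system[of "mbox N (q - 1)" F "mmon N"] mbox_card F(1) by blast
  have mon: "(\<Sum>x\<in>F. mmon N \<alpha> x * w x) = 0" if "sum \<alpha> {..<N} = D" "\<forall>i\<ge>N. \<alpha> i = 0" for \<alpha> D
    using that
  proof (induction D arbitrary: \<alpha> rule: less_induct)
    case (less D)
    show ?case
    proof (cases "\<alpha> \<in> mbox N (q - 1)")
      case False
      then obtain i where i: "i < N" "\<alpha> i \<ge> q" using less.prems by (auto simp: mbox_def not_le)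
      \<comment> \<open>Replacing the factor \<open>x i ^ q\<close> by \<open>h i x\<close> strictly
        lowers the total degree, because \<open>h i\<close> has degree at most
        \<open>q - 1\<close>.\<close>
      define \<alpha>' where "\<alpha>' = \<alpha>(i := \<alpha> i - q)"
      obtain c where c: "\<And>x. h i x = (\<Sum>\<beta>\<in>mtot N (q - 1). c \<beta> * mmon N \<beta> x)"
        using mpoly_repr[OF h[OF i(1)]] by blast
      have "sum \<alpha> {..<N} = \<alpha> i + sum \<alpha> ({..<N} - {i})" using i by (simp add: sum.remove)
      moreover have "sum \<alpha>' {..<N} = \<alpha> i - q + sum \<alpha> ({..<N} - {i})"
        using i by (subst sum.remove[of _ i]) (auto simp: \<alpha>'_def intro!: sum.cong)
      ultimately have D: "sum \<alpha>' {..<N} + q = D" using i less.prems by simp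
      have e: "mmon N \<alpha> x = (\<Sum>\<beta>\<in>mtot N (q - 1). c \<beta> * mmon N (\<lambda>j. \<alpha>' j + \<beta> j) x)" if "x \<in> F" for x
      proof -
        have "mmon N \<alpha> x = x i ^ \<alpha> i * (\<Prod>j\<in>{..<N} - {i}. x j ^ \<alpha> j)"
          unfolding mmon_def using i by (simp add: prod.remove)
        also have "\<dots> = x i ^ q * (x i ^ (\<alpha> i - q) * (\<Prod>j\<in>{..<N} - {i}. x j ^ \<alpha>' j))"
          using i by (simp add: \<alpha>'_def power_add[symmetric] mult.assoc[symmetric])
        also have "x i ^ (\<alpha> i - q) * (\<Prod>j\<in>{..<N} - {i}. x j ^ \<alpha>' j) = mmon N \<alpha>' x"
          unfolding mmon_def using i by (simp add: prod.remove[of "{..<N}" i] \<alpha>'_def)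
        also have "x i ^ q = h i x" using F(3) that i by blast
        finally show ?thesis unfolding c by (simp add: mmon_add sum_distrib_left algebra_simps)
      qed
      have z: "(\<Sum>x\<in>F. mmon N (\<lambda>j. \<alpha>' j + \<beta> j) x * w x) = 0" if "\<beta> \<in> mtot N (q - 1)" for \<beta>
      proof (rule less.IH[OF _ refl])
        show "(\<Sum>j<N. \<alpha>' j + \<beta> j) < D" using that D q by (auto simp: mtot_def sum.distrib)
        show "\<forall>j\<ge>N. \<alpha>' j + \<beta> j = 0" using that less.prems i by (auto simp: mtot_def \<alpha>'_def)
      qed
      have "(\<Sum>x\<in>F. mmon N \<alpha> x * w x) = (\<Sum>x\<in>F. \<Sum>\<beta>\<in>mtot N (q - 1). c \<beta> * (mmon N (\<lambda>j. \<alpha>' j + \<beta> j) x * w x))"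
        by (intro sum.cong refl) (simp add: e sum_distrib_right mult.assoc)
      also have "\<dots> = (\<Sum>\<beta>\<in>mtot N (q - 1). c \<beta> * (\<Sum>x\<in>F. mmon N (\<lambda>j. \<alpha>' j + \<beta> j) x * w x))"
        by (subst sum.swap) (simp add: sum_distrib_left)
      also have "\<dots> = 0" using z by simp
      finally show ?thesis .
    qed (use w in blast)
  qed
  have all: "(\<Sum>x\<in>F. f x * w x) = 0" if f: "mpoly N d f" for f d
  proof -
    obtain c where c: "\<And>x. f x = (\<Sum>\<beta>\<in>mtot N d. c \<beta> * mmon N \<beta> x)" using mpoly_repr[OF f] by blast
    have "(\<Sum>x\<in>F. f x * w x) = (\<Sum>x\<in>F. \<Sum>\<beta>\<in>mtot N d. c \<beta> * (mmon N \<beta> x * w x))"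
      by (simp add: c sum_distrib_right mult.assoc)
    also have "\<dots> = (\<Sum>\<beta>\<in>mtot N d. c \<beta> * (\<Sum>x\<in>F. mmon N \<beta> x * w x))"
      by (subst sum.swap) (simp add: sum_distrib_left)
    also have "\<dots> = 0" using mon by (intro sum.neutral) (auto simp: mtot_def)
    finally show ?thesis .
  qed
  obtain x0 where x0: "x0 \<in> F" "w x0 \<noteq> 0" using w by blast
  have "\<exists>i<N. x i \<noteq> x0 i" if "x \<in> F - {x0}" for x
  proof (rule ccontr)
    assume "\<not> (\<exists>i<N. x i \<noteq> x0 i)"
    then have "x i = x0 i" for i using F(2)[of x i] F(2)[of x0 i] that x0 by (cases "i < N") auto
    then show False using that by auto
  qed
  then obtain \<iota> where \<iota>: "\<And>x. x \<in> F - {x0} \<Longrightarrow> \<iota> x < N \<and> x (\<iota> x) \<noteq> x0 (\<iota> x)" by metis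
  \<comment> \<open>A polynomial that vanishes on \<open>F\<close> except at one point of nonzero
    weight; pairing it with \<open>w\<close> gives the contradiction.\<close>
  define f where "f = (\<lambda>y. \<Prod>x\<in>F - {x0}. y (\<iota> x) - x (\<iota> x))"
  have m: "mpoly N (\<Sum>x\<in>F - {x0}. 1) f" unfolding f_def using F(1) \<iota>
    by (intro mpoly_prod mpoly_diff mpoly_var mpoly_const) auto
  have "f x0 \<noteq> 0" unfolding f_def using F(1) \<iota> by (force simp: prod_zero_iff)
  moreover have "f x = 0" if "x \<in> F" "x \<noteq> x0" for x unfolding f_def using F(1) that by (auto simp: prod_zero_iff)
  then have "(\<Sum>x\<in>F. f x * w x) = f x0 * w x0" using F(1) x0 by (subst sum.remove[of _ x0]) auto
  ultimately show False using all[OF m] x0 by auto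
qed

section \<open>Elimination: critical values of a polynomial map lie in a hypersurface\<close>

lemma mbox_coeff_zero:
  assumes "\<And>a. (\<Sum>\<beta>\<in>mbox N J. c \<beta> * mmon N \<beta> a) = 0" "\<beta> \<in> mbox N J"
  shows "c \<beta> = 0"
  using assms
proof (induction N arbitrary: c \<beta>)
  case 0
  have "mbox 0 J = {\<lambda>_. 0}" by (auto simp: mbox_def)
  then show ?case using 0 by (simp add: mmon_def)
next
  case (Suc N)
  have m: "mmon (Suc N) (\<alpha>(N := k)) a = mmon N \<alpha> a * a N ^ k" for \<alpha> k a
    unfolding mmon_def by (auto intro!: prod.cong)
  have e: "(\<Sum>\<beta>\<in>mbox (Suc N) J. c \<beta> * mmon (Suc N) \<beta> a)
    = (\<Sum>k\<le>J. (\<Sum>\<alpha>\<in>mbox N J. c (\<alpha>(N := k)) * mmon N \<alpha> a) * a N ^ k)" for a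
  proof -
    have "(\<Sum>\<beta>\<in>mbox (Suc N) J. c \<beta> * mmon (Suc N) \<beta> a)
      = (\<Sum>(\<alpha>,k)\<in>mbox N J \<times> {..J}. c (\<alpha>(N := k)) * (mmon N \<alpha> a * a N ^ k))"
      unfolding mbox_Suc by (subst sum.reindex[OF inj_mbox]) (simp add: case_prod_beta m)
    also have "\<dots> = (\<Sum>k\<le>J. \<Sum>\<alpha>\<in>mbox N J. c (\<alpha>(N := k)) * (mmon N \<alpha> a * a N ^ k))"
      by (subst sum.cartesian_product[symmetric], subst sum.swap) simp
    finally show ?thesis by (simp add: sum_distrib_right mult.assoc)
  qed
  have z: "(\<Sum>\<alpha>\<in>mbox N J. c (\<alpha>(N := k)) * mmon N \<alpha> a) = 0" if "k \<le> J" for k a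
  proof -
    \<comment> \<open>For fixed values of the other variables the sum is a polynomial in the last
      variable alone, so its coefficients vanish.\<close>
    define p where "p = (\<Sum>k\<le>J. monom (\<Sum>\<alpha>\<in>mbox N J. c (\<alpha>(N := k)) * mmon N \<alpha> a) k)"
    have "poly p t = 0" for t
    proof -
      have "mmon N \<alpha> (a(N := t)) = mmon N \<alpha> a" for \<alpha> unfolding mmon_def by (intro prod.cong) auto
      then show ?thesis using Suc.prems(1)[of "a(N := t)"] unfolding e p_def
        by (simp add: poly_sum poly_monom)
    qed
    then have "p = 0" using poly_all_0_iff_0 by blast
    moreover have "coeff p k = (\<Sum>\<alpha>\<in>mbox N J. c (\<alpha>(N := k)) * mmon N \<alpha> a)"
      unfolding p_def using that by (simp add: coeff_sum coeff_monom)
    ultimately show ?thesis by simp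
  qed
  obtain \<alpha> k where "\<alpha> \<in> mbox N J" "k \<le> J" "\<beta> = \<alpha>(N := k)"
    using Suc.prems(2) unfolding mbox_Suc by auto
  then show ?case using Suc.IH[of "\<lambda>\<alpha>. c (\<alpha>(N := k))" \<alpha>] z by blast
qed

lemma mpoly_mono_comp:
  assumes "\<beta> \<in> mbox N J" "\<And>j. j < N \<Longrightarrow> mpoly N k (G j)"
  shows "mpoly N (N * J * k) (\<lambda>x. mmon N \<beta> (\<lambda>j. G j x))"
proof -
  have "mpoly N (\<Sum>j<N. \<beta> j * k) (\<lambda>x. mmon N \<beta> (\<lambda>j. G j x))"
    unfolding mmon_def using assms(2) by (intro mpoly_prod mpoly_power) auto
  moreover have "(\<Sum>j<N. \<beta> j * k) \<le> (\<Sum>j<N. J * k)"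
    using assms(1) by (intro sum_mono mult_right_mono) (auto simp: mbox_def)
  ultimately show ?thesis by (auto elim!: mpoly_mono)
qed

text \<open>Perron's argument: the monomials in \<open>w\<close> and the \<open>G j\<close> outnumber the coefficients of the
  polynomials of the degree in which they live.\<close>
lemma mpoly_dependent:
  assumes w: "mpoly N e w" and G: "\<And>j. j < N \<Longrightarrow> mpoly N k (G j)"
  shows "\<exists>I J c. (\<exists>i\<le>I. \<exists>\<beta>\<in>mbox N J. c i \<beta> \<noteq> 0) \<and>
    (\<forall>x. (\<Sum>i\<le>I. \<Sum>\<beta>\<in>mbox N J. c i \<beta> * (w x ^ i * mmon N \<beta> (\<lambda>j. G j x))) = 0)"
proof -
  \<comment> \<open>Since \<open>J = I * e\<close>, the degree \<open>D\<close> satisfies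
    \<open>D + 1 \<le> (J + 1) * (1 + N * k)\<close>. Hence there are at most
    \<open>I * (J + 1) ^ N\<close> coefficients, fewer than the \<open>(I + 1) * (J + 1) ^ N\<close>
    products.\<close>
  define I where "I = (1 + N * k) ^ N"
  define J where "J = I * e"
  define D where "D = I * e + N * J * k"
  define U where "U = {..I} \<times> mbox N J"
  have fU: "finite U" "card U = (I + 1) * (J + 1) ^ N"
    unfolding U_def using mbox_card[of N J] by (auto simp: card_cartesian_product)
  have "D + 1 \<le> (J + 1) * (1 + N * k)" unfolding D_def J_def by (simp add: algebra_simps)
  then have "(D + 1) ^ N \<le> ((J + 1) * (1 + N * k)) ^ N" by (intro power_mono) auto
  also have "\<dots> = I * (J + 1) ^ N" unfolding I_def power_mult_distrib by simp
  also have "\<dots> < card U" unfolding fU by simp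
  finally have card: "card (mtot N D) < card U" using card_mtot[of N D] by simp
  define fn where "fn = (\<lambda>(i, \<beta>) x. w x ^ i * mmon N \<beta> (\<lambda>j. G j x))"
  have "\<exists>a. \<forall>x. fn u x = (\<Sum>\<alpha>\<in>mtot N D. a \<alpha> * mmon N \<alpha> x)" if uU: "u \<in> U" for u
  proof -
    obtain i \<beta> where u: "u = (i, \<beta>)" "i \<le> I" "\<beta> \<in> mbox N J" using uU unfolding U_def by blast
    have "i * e + N * J * k \<le> D" unfolding D_def using u(2) by (intro add_mono mult_right_mono) simp_all
    then have "mpoly N D (fn u)" unfolding u(1) fn_def prod.case
      by (intro mpoly_mult[OF mpoly_power[OF w] mpoly_mono_comp[OF u(3)]]) (auto intro: G)
    then show ?thesis by (rule mpoly_repr)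
  qed
  then have "\<forall>u\<in>U. \<exists>a. \<forall>x. fn u x = (\<Sum>\<alpha>\<in>mtot N D. a \<alpha> * mmon N \<alpha> x)" by blast
  from bchoice[OF this] obtain a where a: "\<And>u x. u \<in> U \<Longrightarrow> fn u x = (\<Sum>\<alpha>\<in>mtot N D. a u \<alpha> * mmon N \<alpha> x)" by blast
  obtain c where c: "\<exists>u\<in>U. c u \<noteq> 0" "\<And>\<alpha>. \<alpha> \<in> mtot N D \<Longrightarrow> (\<Sum>u\<in>U. a u \<alpha> * c u) = 0"
    using homogeneous_system[OF finite_mtot fU(1) card, of "\<lambda>\<alpha> u. a u \<alpha>"] by blast
  have "(\<Sum>i\<le>I. \<Sum>\<beta>\<in>mbox N J. c (i, \<beta>) * (w x ^ i * mmon N \<beta> (\<lambda>j. G j x))) = 0" for x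
  proof -
    have "(\<Sum>i\<le>I. \<Sum>\<beta>\<in>mbox N J. c (i, \<beta>) * (w x ^ i * mmon N \<beta> (\<lambda>j. G j x))) = (\<Sum>u\<in>U. c u * fn u x)"
      unfolding U_def sum.cartesian_product fn_def by (simp add: case_prod_beta)
    also have "\<dots> = (\<Sum>u\<in>U. \<Sum>\<alpha>\<in>mtot N D. (a u \<alpha> * c u) * mmon N \<alpha> x)"
      by (intro sum.cong refl) (simp add: a sum_distrib_left algebra_simps)
    also have "\<dots> = (\<Sum>\<alpha>\<in>mtot N D. (\<Sum>u\<in>U. a u \<alpha> * c u) * mmon N \<alpha> x)"
      by (subst sum.swap) (simp add: sum_distrib_right)
    also have "\<dots> = 0" using c by simp
    finally show ?thesis .
  qed
  moreover have "\<exists>i\<le>I. \<exists>\<beta>\<in>mbox N J. c (i, \<beta>) \<noteq> 0"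
  proof -
    from c(1) obtain u where "u \<in> {..I} \<times> mbox N J" "c u \<noteq> 0" unfolding U_def by blast
    then show ?thesis by (cases u) auto
  qed
  ultimately show ?thesis
    by - (rule exI[of _ I], rule exI[of _ J], rule exI[of _ "\<lambda>i \<beta>. c (i, \<beta>)"], rule conjI, assumption, rule allI)
qed

text \<open>Take an algebraic relation between \<open>w\<close> and the \<open>G j\<close> and
  cancel the lowest power of \<open>w\<close> occurring in it, which is legitimate in an integral
  domain. On the zero set of \<open>w\<close> only the terms free of \<open>w\<close> survive, and
  they form the relation \<open>q\<close>. For \<open>w\<close> the Jacobian determinant of
  \<open>G\<close> this is an algebraic Sard theorem.\<close>

lemma mpoly_eliminate:
  assumes w: "mpoly N e w" and G: "\<And>j. j < N \<Longrightarrow> mpoly N k (G j)" and nz: "w x1 \<noteq> 0"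
  shows "\<exists>d q. mpoly N d q \<and> (\<exists>a. q a \<noteq> 0) \<and> (\<forall>x. w x = 0 \<longrightarrow> q (\<lambda>j. G j x) = 0)"
proof -
  obtain I J c where c: "\<exists>i\<le>I. \<exists>\<beta>\<in>mbox N J. c i \<beta> \<noteq> 0"
    "\<And>x. (\<Sum>i\<le>I. \<Sum>\<beta>\<in>mbox N J. c i \<beta> * (w x ^ i * mmon N \<beta> (\<lambda>j. G j x))) = 0"
  proof -
    have "\<exists>I J c. (\<exists>i\<le>I. \<exists>\<beta>\<in>mbox N J. c i \<beta> \<noteq> 0) \<and>
      (\<forall>x. (\<Sum>i\<le>I. \<Sum>\<beta>\<in>mbox N J. c i \<beta> * (w x ^ i * mmon N \<beta> (\<lambda>j. G j x))) = 0)"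
      by (rule mpoly_dependent[OF w]) (rule G)
    then show ?thesis by (elim exE conjE) (rule that, auto)
  qed
  define i0 where "i0 = (LEAST i. i \<le> I \<and> (\<exists>\<beta>\<in>mbox N J. c i \<beta> \<noteq> 0))"
  have i0: "i0 \<le> I" "\<exists>\<beta>\<in>mbox N J. c i0 \<beta> \<noteq> 0"
    using LeastI_ex[OF c(1)] unfolding i0_def by simp_all
  have small: "c i \<beta> = 0" if "i < i0" "\<beta> \<in> mbox N J" for i \<beta>
  proof (rule ccontr)
    assume "c i \<beta> \<noteq> 0"
    then have "i \<le> I \<and> (\<exists>\<beta>\<in>mbox N J. c i \<beta> \<noteq> 0)" using that i0 by fastforce
    then have "i0 \<le> i" unfolding i0_def by (rule Least_le)
    then show False using that by simp
  qed
  define t where "t = (\<lambda>i x. \<Sum>\<beta>\<in>mbox N J. c i \<beta> * mmon N \<beta> (\<lambda>j. G j x))"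
  define R where "R = (\<lambda>x. \<Sum>i\<in>{i0..I}. t i x * w x ^ (i - i0))"
  have tm: "mpoly N (N * J * k) (t i)" for i
    unfolding t_def by (intro mpoly_sum mpoly_scale mpoly_mono_comp G) auto
  have R: "mpoly N (N * J * k + I * e) R"
    unfolding R_def by (intro mpoly_sum mpoly_mult[OF tm mpoly_power[OF w]]) (auto intro: mult_right_mono)
  have "R x * w x ^ i0 = 0" for x
  proof -
    have "(\<Sum>i\<le>I. \<Sum>\<beta>\<in>mbox N J. c i \<beta> * (w x ^ i * mmon N \<beta> (\<lambda>j. G j x))) = (\<Sum>i\<le>I. t i x * w x ^ i)"
      unfolding t_def sum_distrib_right by (intro sum.cong refl) (simp add: algebra_simps)
    also have "\<dots> = (\<Sum>i\<in>{i0..I}. t i x * w x ^ i)"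
      using small by (intro sum.mono_neutral_right) (auto simp: t_def not_le)
    also have "\<dots> = R x * w x ^ i0"
      unfolding R_def sum_distrib_right by (intro sum.cong) (auto simp: power_add[symmetric] mult.assoc)
    finally show ?thesis using c(2) by simp
  qed
  then have R0: "R x = 0" for x
    using mpoly_idom[OF R mpoly_power[OF w, of i0], of x1 x] nz by simp
  define q where "q = (\<lambda>a. \<Sum>\<beta>\<in>mbox N J. c i0 \<beta> * mmon N \<beta> a)"
  have "mpoly N (N * J * 1) q" unfolding q_def
    by (intro mpoly_sum mpoly_scale, rule mpoly_mono_comp[where G = "\<lambda>j x. x j"]) (auto intro: mpoly_var)
  moreover have "\<exists>a. q a \<noteq> 0" using i0(2) mbox_coeff_zero[where c = "c i0" and N = N and J = J] unfolding q_def by blast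
  moreover have "q (\<lambda>j. G j x) = 0" if "w x = 0" for x
  proof -
    have "R x = t i0 x" unfolding R_def using i0(1) that
      by (subst sum.remove[of _ i0]) (auto intro!: sum.neutral simp: power_0_left)
    then show ?thesis using R0[of x] by (simp add: q_def t_def)
  qed
  ultimately show ?thesis by blast
qed

section \<open>Continuity, lines and gradients of powers\<close>

lemma mpoly_tendsto:
  "mpoly N d f \<Longrightarrow> (\<And>i. i < N \<Longrightarrow> ((\<lambda>k. y k i) \<longlongrightarrow> x i) F) \<Longrightarrow> ((\<lambda>k. f (y k)) \<longlongrightarrow> f x) F"
proof (induction rule: mpoly.induct)
  case (mpoly_const d c)
  show ?case by (rule tendsto_const)
next
  case (mpoly_var i d)
  then show ?case by blast
next
  case (mpoly_add d f g)
  from mpoly_add.IH[OF mpoly_add.prems] show ?case by (rule tendsto_add)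
next
  case (mpoly_mult d f e g k)
  from mpoly_mult.IH[OF mpoly_mult.prems] show ?case by (rule tendsto_mult)
qed

lemma mpoly_comp:
  assumes G: "\<And>j. j < N \<Longrightarrow> mpoly N k (G j)"
  shows "mpoly N d q \<Longrightarrow> mpoly N (d * k) (\<lambda>x. q (\<lambda>j. G j x))"
proof (induction rule: mpoly.induct)
  case (mpoly_const d c)
  show ?case by (rule mpoly.mpoly_const)
next
  case (mpoly_var i d)
  show ?case by (rule mpoly_mono[OF G[OF mpoly_var(1)]]) (use mpoly_var in simp)
next
  case (mpoly_add d f g)
  from mpoly_add.IH show ?case by (rule mpoly.mpoly_add)
next
  case (mpoly_mult d f e g l)
  show ?case
    by (rule mpoly.mpoly_mult[OF mpoly_mult.IH]) (use mpoly_mult.hyps in \<open>simp add: add_mult_distrib[symmetric]\<close>)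
qed

text \<open>The restriction to the line is a nonzero polynomial in one variable and has finitely
  many zeros, so every point can be moved off the zero set of \<open>q\<close> by an arbitrarily
  small shift towards \<open>y1\<close>.\<close>

lemma mpoly_nonzero_line:
  assumes q: "mpoly N d q" and nz: "q y1 \<noteq> 0"
  shows "\<forall>\<^sub>F t in at_right (0::real). q (\<lambda>i. y i + of_real t * (y1 i - y i)) \<noteq> 0"
proof -
  obtain p where p: "\<And>t. q (\<lambda>i. y i + t * (y1 i - y i)) = poly p t"
    using mpoly_line[OF q, of y "\<lambda>i. y1 i - y i"] by blast
  have "p \<noteq> 0" using p[of 1] nz by auto
  then have "finite {t. poly p t = 0}" by (rule poly_roots_finite)
  then have "finite (complex_of_real -` {t. poly p t = 0})"
    by (rule finite_vimageI) (auto intro: injI)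
  then have "\<forall>\<^sub>F t in at (0::real). t \<notin> complex_of_real -` {t. poly p t = 0}"
    using islimpt_finite islimpt_iff_eventually by blast
  then have "\<forall>\<^sub>F t in at_right (0::real). t \<notin> complex_of_real -` {t. poly p t = 0}"
    by (simp add: eventually_at_split)
  then show ?thesis by eventually_elim (simp add: p)
qed

lemma mpoly_lipschitz:
  assumes f: "mpoly N d f" and r: "r \<ge> 1"
  obtains L where "L \<ge> 0" "\<And>x h s. (\<And>i. i < N \<Longrightarrow> norm (x i) \<le> r) \<Longrightarrow> (\<And>i. i < N \<Longrightarrow> norm (h i) \<le> s) \<Longrightarrow> 0 \<le> s \<Longrightarrow> s \<le> 1 \<Longrightarrow>
     norm (f (\<lambda>i. x i + h i) - f x) \<le> L * s"
proof -
  obtain g where g: "\<And>j. mpoly N (d - 1) (g j)" "has_grad N f g" using mpoly_has_grad[OF f] by blast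
  obtain K where K: "K \<ge> 0" "\<And>x h s. (\<And>i. i < N \<Longrightarrow> norm (x i) \<le> r) \<Longrightarrow> (\<And>i. i < N \<Longrightarrow> norm (h i) \<le> s) \<Longrightarrow> 0 \<le> s \<Longrightarrow> s \<le> 1 \<Longrightarrow>
     norm (f (\<lambda>i. x i + h i) - f x - (\<Sum>j<N. h j * g j x)) \<le> K * s\<^sup>2" using has_gradD[OF g(2) r] by blast
  have "\<exists>B\<ge>0. \<forall>x. (\<forall>i<N. norm (x i) \<le> r) \<longrightarrow> norm (g j x) \<le> B" for j
  proof -
    obtain B where "B \<ge> 0" "\<forall>x r. 1 \<le> r \<longrightarrow> (\<forall>i<N. norm (x i) \<le> r) \<longrightarrow> norm (g j x) \<le> B * r ^ (d - 1)"
      using mpoly_bound[OF g(1)] by blast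
    then show ?thesis using r by (intro exI[of _ "B * r ^ (d - 1)"]) auto
  qed
  then obtain B where B: "\<And>j. B j \<ge> 0" "\<And>j x. (\<forall>i<N. norm (x i) \<le> r) \<Longrightarrow> norm (g j x) \<le> B j" by metis
  show thesis
  proof (rule that[of "K + (\<Sum>j<N. B j)"])
    show "0 \<le> K + (\<Sum>j<N. B j)" using K B by (intro add_nonneg_nonneg sum_nonneg) auto
    fix x h :: "nat \<Rightarrow> complex" and s :: real
    assume a: "\<And>i. i < N \<Longrightarrow> norm (x i) \<le> r" "\<And>i. i < N \<Longrightarrow> norm (h i) \<le> s" "0 \<le> s" "s \<le> 1"
    have "norm (\<Sum>j<N. h j * g j x) \<le> (\<Sum>j<N. s * B j)"
      by (intro order_trans[OF norm_sum] sum_mono) (use a B in \<open>auto simp: norm_mult intro!: mult_mono\<close>)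
    moreover have "K * s\<^sup>2 \<le> K * s" using a K by (intro mult_left_mono) (auto simp: power2_eq_square mult_left_le)
    moreover have "norm (f (\<lambda>i. x i + h i) - f x - (\<Sum>j<N. h j * g j x)) \<le> K * s\<^sup>2"
      using a by (intro K(2))
    ultimately show "norm (f (\<lambda>i. x i + h i) - f x) \<le> (K + (\<Sum>j<N. B j)) * s"
      using norm_triangle_ineq[of "f (\<lambda>i. x i + h i) - f x - (\<Sum>j<N. h j * g j x)" "\<Sum>j<N. h j * g j x"]
      by (simp add: algebra_simps sum_distrib_left[symmetric])
  qed
qed

lemma has_grad_var_power:
  assumes "i < N"
  shows "has_grad N (\<lambda>x. x i ^ k) (\<lambda>j x. if j = i then of_nat k * x i ^ (k - 1) else 0)"
proof (induction k)
  case 0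
  show ?case using has_grad_const[of N 1] by (simp cong: if_cong)
next
  case (Suc k)
  have "has_grad N (\<lambda>x. x i * x i ^ k) (\<lambda>j x. (if j = i then 1 else 0) * x i ^ k + x i * (if j = i then of_nat k * x i ^ (k - 1) else 0))"
  proof (rule has_grad_mult[OF has_grad_var[OF assms] Suc])
    show "mpoly N 1 (\<lambda>x. x i)" using assms by (rule mpoly_var) simp
    show "mpoly N k (\<lambda>x. x i ^ k)" using assms by (rule mpoly_var_power)
    show "mpoly N 0 (\<lambda>x. if j = i then 1 else 0)" for j :: nat by (rule mpoly_const)
    show "mpoly N (k - 1) (\<lambda>x. if j = i then of_nat k * x i ^ (k - 1) else 0)" for j
      using mpoly_scale[OF mpoly_var_power[OF assms, of "k - 1"]] mpoly_const[of N "k - 1" 0] by (cases "j = i") auto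
  qed
  moreover have "(if j = i then 1 else 0) * x i ^ k + x i * (if j = i then of_nat k * x i ^ (k - 1) else 0)
     = (if j = i then of_nat (Suc k) * x i ^ (Suc k - 1) else 0)" for j and x :: "nat \<Rightarrow> complex"
    by (cases k) (auto simp: algebra_simps)
  ultimately show ?case by simp
qed

lemma has_grad_scale:
  assumes "has_grad N f g" "mpoly N d f" "\<And>j. mpoly N e (g j)"
  shows "has_grad N (\<lambda>x. c * f x) (\<lambda>j x. c * g j x)"
  using has_grad_mult[OF has_grad_const[of N c] assms(1) mpoly_const[of N 0] assms(2) mpoly_const[of N 0] assms(3)] by simp

lemma has_grad_sum:
  assumes "\<And>a. a \<in> A \<Longrightarrow> has_grad N (f a) (g a)"
  shows "has_grad N (\<lambda>x. \<Sum>a\<in>A. f a x) (\<lambda>j x. \<Sum>a\<in>A. g a j x)"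
  using assms
proof (induction A rule: infinite_finite_induct)
  case (insert a A)
  then show ?case using has_grad_add[of N "f a" "g a" "\<lambda>x. \<Sum>a\<in>A. f a x" "\<lambda>j x. \<Sum>a\<in>A. g a j x"] by simp
qed (simp_all add: has_grad_const)

lemma has_grad_cong:
  assumes "has_grad N f g" "\<And>j x. j < N \<Longrightarrow> g j x = g' j x"
  shows "has_grad N f g'"
proof -
  have "(\<Sum>j<N. h j * g j x) = (\<Sum>j<N. h j * g' j x)" for x h using assms(2) by (intro sum.cong) auto
  then show ?thesis using assms(1) unfolding has_grad_def by simp
qed

text \<open>Only the first \<open>N\<close> coordinates are controlled, so compactness is obtained
  one coordinate at a time by passing to further subsequences.\<close>

lemma coordinatewise_subseq:
  fixes X :: "nat \<Rightarrow> nat \<Rightarrow> complex"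
  assumes "\<And>k i. i < N \<Longrightarrow> norm (X k i) \<le> R"
  shows "\<exists>r x. strict_mono (r :: nat \<Rightarrow> nat) \<and> (\<forall>i<N. (\<lambda>k. X (r k) i) \<longlonglongrightarrow> x i)"
  using assms
proof (induction N)
  case 0
  show ?case by (rule exI[of _ id]) (simp add: strict_mono_def)
next
  case (Suc N)
  then obtain r x where r: "strict_mono (r :: nat \<Rightarrow> nat)" "\<And>i. i < N \<Longrightarrow> (\<lambda>k. X (r k) i) \<longlonglongrightarrow> x i" by force
  have "bounded (range (\<lambda>k. X (r k) N))" unfolding bounded_iff using Suc.prems by blast
  then obtain s l where s: "strict_mono (s :: nat \<Rightarrow> nat)" "((\<lambda>k. X (r k) N) \<circ> s) \<longlonglongrightarrow> l"
    using bounded_imp_convergent_subsequence by blast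
  have "(\<lambda>k. X ((r \<circ> s) k) i) \<longlonglongrightarrow> (x(N := l)) i" if "i < Suc N" for i
  proof (cases "i = N")
    case False
    then show ?thesis using LIMSEQ_subseq_LIMSEQ[OF r(2) s(1), of i] that by (simp add: o_def)
  qed (use s(2) in \<open>simp add: o_def\<close>)
  moreover have "strict_mono (r \<circ> s)" using r(1) s(1) by (rule strict_mono_o)
  ultimately show ?case by blast
qed

section \<open>Critical values of perturbed polynomials\<close>

text \<open>\<open>\<delta>\<close> is the size of the perturbation, and \<open>P\<close> is the
  amount by which the degree of its gradient exceeds the degree bound \<open>e\<close> of
  \<open>g\<close>. The inequality for \<open>R\<close> is what confines the points with gradient at
  most \<open>1\<close> to the polydisc of radius \<open>R\<close>.\<close>

locale grad_system =
  fixes N d e P :: nat and f :: "(nat \<Rightarrow> complex) \<Rightarrow> complex" and g :: "nat \<Rightarrow> (nat \<Rightarrow> complex) \<Rightarrow> complex"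
    and \<delta> C R :: real
  assumes e: "1 \<le> e" and P: "1 \<le> P" and f: "mpoly N d f" and g: "\<And>j. mpoly N e (g j)"
    and fg: "has_grad N f g" and \<delta>: "0 < \<delta>" and C: "0 \<le> C"
    and growth: "\<And>x \<rho> j. j < N \<Longrightarrow> 1 \<le> \<rho> \<Longrightarrow> (\<And>i. i < N \<Longrightarrow> norm (x i) \<le> \<rho>) \<Longrightarrow> norm (g j x) \<le> C * \<rho> ^ e"
    and R: "1 \<le> R" "C + 1 \<le> \<delta> * R ^ P"
begin

text \<open>The perturbation \<open>\<delta> * (\<Sum>i<N. x i ^ (e + P + 1))\<close> makes the leading terms of the gradient \<open>G\<close> pure powers, so
  that all its fibres are finite; \<open>v\<close> is minus the Legendre transform of the perturbed function \<open>ft\<close>.\<close>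
definition G :: "nat \<Rightarrow> (nat \<Rightarrow> complex) \<Rightarrow> complex" where
  "G j x = g j x + of_real \<delta> * (of_nat (e + P + 1) * x j ^ (e + P))"

definition ft :: "(nat \<Rightarrow> complex) \<Rightarrow> complex" where
  "ft x = f x + of_real \<delta> * (\<Sum>i<N. x i ^ (e + P + 1))"

definition v :: "(nat \<Rightarrow> complex) \<Rightarrow> complex" where
  "v x = ft x - (\<Sum>j<N. G j x * x j)"

lemma mpoly_G: "j < N \<Longrightarrow> mpoly N (e + P) (G j)"
  unfolding G_def[abs_def]
  by (intro mpoly_add mpoly_scale mpoly_var_power) (auto intro: mpoly_mono[OF g])

lemma mpoly_ft: "mpoly N (d + e + P + 1) ft"
  unfolding ft_def[abs_def]
proof (intro mpoly_add mpoly_scale mpoly_sum)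
  show "mpoly N (d + e + P + 1) f" by (rule mpoly_mono[OF f]) simp
  show "mpoly N (d + e + P + 1) (\<lambda>x. x i ^ (e + P + 1))" if "i \<in> {..<N}" for i
    by (rule mpoly_mono[OF mpoly_var_power]) (use that in auto)
qed

lemma mpoly_v: "mpoly N (d + e + P + 1) v"
  unfolding v_def[abs_def]
proof (intro mpoly_diff mpoly_ft mpoly_sum)
  show "mpoly N (d + e + P + 1) (\<lambda>x. G j x * x j)" if "j \<in> {..<N}" for j
    using that by (intro mpoly_mult[OF mpoly_G mpoly_var[where d = 1]]) auto
qed

lemma has_grad_ft: "has_grad N ft G"
proof -
  define h where "h = (\<lambda>(a::nat) j (x :: nat \<Rightarrow> complex). if j = a then of_nat (e + P + 1) * x a ^ (e + P + 1 - 1) else 0)"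
  have "has_grad N (\<lambda>x. \<Sum>i<N. x i ^ (e + P + 1)) (\<lambda>j x. \<Sum>a<N. h a j x)"
    unfolding h_def by (intro has_grad_sum has_grad_var_power) simp
  then have "has_grad N (\<lambda>x. of_real \<delta> * (\<Sum>i<N. x i ^ (e + P + 1))) (\<lambda>j x. of_real \<delta> * (\<Sum>a<N. h a j x))"
  proof (rule has_grad_scale)
    show "mpoly N (e + P + 1) (\<lambda>x. \<Sum>i<N. x i ^ (e + P + 1))" by (intro mpoly_sum mpoly_var_power) simp
    have "mpoly N (e + P) (h a j)" if "a < N" for a j
      using mpoly_scale[OF mpoly_var_power[OF that], of "e + P"] mpoly_const[of N "e + P" 0]
      unfolding h_def by (cases "j = a") auto
    then show "mpoly N (e + P) (\<lambda>x. \<Sum>a<N. h a j x)" for j by (intro mpoly_sum) simp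
  qed
  from has_grad_add[OF fg this]
  show ?thesis unfolding ft_def[abs_def]
    by (rule has_grad_cong) (simp add: G_def h_def)
qed

text \<open>At a coordinate of maximal modulus \<open>\<rho>\<close> the pure power has size at
  least \<open>\<delta> * \<rho> ^ (e + P)\<close>, and \<open>g\<close> can cancel at most
  \<open>C * \<rho> ^ e\<close> of it; the choice of \<open>R\<close> then bounds
  \<open>\<rho>\<close>.\<close>

lemma fibre_bound:
  assumes "\<And>j. j < N \<Longrightarrow> norm (G j x) \<le> 1" "i < N"
  shows "norm (x i) \<le> R"
proof -
  define \<rho> where "\<rho> = Max ((\<lambda>i. norm (x i)) ` {..<N})"
  have ne: "(\<lambda>i. norm (x i)) ` {..<N} \<noteq> {}" using assms(2) by auto
  have \<rho>: "norm (x j) \<le> \<rho>" if "j < N" for j unfolding \<rho>_def using that by (intro Max_ge) auto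
  have "\<rho> \<in> (\<lambda>i. norm (x i)) ` {..<N}" unfolding \<rho>_def using ne by (intro Max_in) auto
  then obtain j where j: "j < N" "norm (x j) = \<rho>" by auto
  have "\<rho> \<le> R"
  proof (cases "\<rho> \<le> 1")
    case False
    then have r1: "1 \<le> \<rho>" by simp
    define c :: real where "c = real (e + P + 1)"
    have c1: "1 \<le> c" unfolding c_def by simp
    have gj: "norm (g j x) \<le> C * \<rho> ^ e" by (rule growth[OF j(1) r1]) (rule \<rho>)
    have "\<delta> * (1 * \<rho> ^ (e + P)) \<le> \<delta> * (c * \<rho> ^ (e + P))"
      using \<delta> c1 r1 by (intro mult_left_mono mult_right_mono) auto
    also have "\<dots> = norm (of_real \<delta> * (of_nat (e + P + 1) * x j ^ (e + P)))"
      unfolding norm_mult norm_power norm_of_nat j(2) c_def using \<delta> by simp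
    also have "\<dots> = norm (G j x - g j x)" by (simp add: G_def)
    also have "\<dots> \<le> 1 + C * \<rho> ^ e"
      using assms(1)[OF j(1)] gj norm_triangle_ineq4[of "G j x" "g j x"] by simp
    also have "\<dots> \<le> (C + 1) * \<rho> ^ e" using r1 by (simp add: algebra_simps one_le_power)
    finally have "\<rho> ^ e * (\<delta> * \<rho> ^ P) \<le> \<rho> ^ e * (C + 1)" by (simp add: power_add algebra_simps)
    moreover have "0 < \<rho> ^ e" using r1 by (intro zero_less_power) linarith
    ultimately have "\<delta> * \<rho> ^ P \<le> C + 1" by (simp only: mult_le_cancel_left_pos)
    also have "\<dots> \<le> \<delta> * R ^ P" by (rule R)
    finally have "\<rho> ^ P \<le> R ^ P" using \<delta> by simp
    then show ?thesis using R P power_mono_iff[of \<rho> R P] r1 by simp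
  qed (use R in simp)
  then show ?thesis using \<rho>[OF assms(2)] by simp
qed

section \<open>The Hessian and local inversion of the gradient\<close>

definition hg :: "nat \<Rightarrow> nat \<Rightarrow> (nat \<Rightarrow> complex) \<Rightarrow> complex" where
  "hg = (SOME h. \<forall>i. (\<forall>j. mpoly N (e - 1) (h i j)) \<and> has_grad N (g i) (h i))"

lemma hg: "mpoly N (e - 1) (hg i j)" "has_grad N (g i) (hg i)"
proof -
  have "\<forall>i. \<exists>h. (\<forall>j. mpoly N (e - 1) (h j)) \<and> has_grad N (g i) h"
    using mpoly_has_grad[OF g] by blast
  from choice[OF this] have ex: "\<exists>h. \<forall>i. (\<forall>j. mpoly N (e - 1) (h i j)) \<and> has_grad N (g i) (h i)" .
  from someI_ex[OF ex] show "mpoly N (e - 1) (hg i j)" "has_grad N (g i) (hg i)"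
    unfolding hg_def by blast+
qed

text \<open>The Hessian of \<open>ft\<close>, in the form of the Jacobian matrix of
  \<open>G\<close>.\<close>

definition H :: "nat \<Rightarrow> nat \<Rightarrow> (nat \<Rightarrow> complex) \<Rightarrow> complex" where
  "H i j x = hg i j x + of_real \<delta> * (of_nat (e + P + 1) * (if j = i then of_nat (e + P) * x i ^ (e + P - 1) else 0))"

lemma mpoly_H: "i < N \<Longrightarrow> mpoly N (e + P - 1) (H i j)"
proof -
  assume i: "i < N"
  have "mpoly N (e + P - 1) (\<lambda>x. if j = i then of_nat (e + P) * x i ^ (e + P - 1) else 0)"
    using mpoly_scale[OF mpoly_var_power[OF i, of "e + P - 1"]] mpoly_const[of N "e + P - 1" 0] by (cases "j = i") auto
  then show ?thesis unfolding H_def[abs_def]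
    by (intro mpoly_add mpoly_scale mpoly_mono[OF hg(1)]) auto
qed

lemma has_grad_G: "i < N \<Longrightarrow> has_grad N (G i) (H i)"
proof -
  assume i: "i < N"
  have m: "mpoly N (e + P - 1) (\<lambda>x. if j = i then of_nat (e + P) * x i ^ (e + P - 1) else 0)" for j
    using mpoly_scale[OF mpoly_var_power[OF i, of "e + P - 1"]] mpoly_const[of N "e + P - 1" 0] by (cases "j = i") auto
  have 1: "has_grad N (\<lambda>x. of_nat (e + P + 1) * x i ^ (e + P))
    (\<lambda>j x. of_nat (e + P + 1) * (if j = i then of_nat (e + P) * x i ^ (e + P - 1) else 0))"
    by (rule has_grad_scale[OF has_grad_var_power[OF i] mpoly_var_power[OF i] m])
  have 2: "has_grad N (\<lambda>x. of_real \<delta> * (of_nat (e + P + 1) * x i ^ (e + P)))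
    (\<lambda>j x. of_real \<delta> * (of_nat (e + P + 1) * (if j = i then of_nat (e + P) * x i ^ (e + P - 1) else 0)))"
    by (rule has_grad_scale[OF 1 mpoly_scale[OF mpoly_var_power[OF i]] mpoly_scale[OF m]])
  from has_grad_add[OF hg(2) 2] show ?thesis unfolding G_def[abs_def] H_def[abs_def] .
qed

text \<open>The Hessian determinant; its zero set is the ramification locus of the gradient map
  \<open>G\<close>.\<close>

definition w :: "(nat \<Rightarrow> complex) \<Rightarrow> complex" where
  "w x = det (mat N N (\<lambda>(i, j). H i j x))"

lemma mpoly_w: "\<exists>D. mpoly N D w"
proof -
  have "w x = (\<Sum>p\<in>{p. p permutes {0..<N}}. signof p * (\<Prod>i\<in>{0..<N}. H i (p i) x))" for x
    unfolding w_def det_def by (auto intro!: sum.cong prod.cong simp: permutes_in_image)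
  moreover have "mpoly N (\<Sum>i\<in>{0..<N}. e + P - 1) (\<lambda>x. \<Sum>p\<in>{p. p permutes {0..<N}}. signof p * (\<Prod>i\<in>{0..<N}. H i (p i) x))"
    by (intro mpoly_sum mpoly_scale mpoly_prod mpoly_H) auto
  ultimately show ?thesis by (intro exI[of _ "\<Sum>i\<in>{0..<N}. e + P - 1"]) presburger
qed

text \<open>Far out, at a point with equal coordinates, the Hessian is diagonally dominant: the
  diagonal of the perturbation grows with exponent \<open>e + P - 1\<close>, the entries
  \<open>hg i j\<close> only with exponent \<open>e - 1\<close>.\<close>

lemma w_nonzero: "\<exists>x. w x \<noteq> 0"
proof -
  have "\<exists>B\<ge>0. \<forall>x r. 1 \<le> r \<longrightarrow> (\<forall>i<N. norm (x i) \<le> r) \<longrightarrow> norm (hg i j x) \<le> B * r ^ (e - 1)" for i j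
    using mpoly_bound[OF hg(1)] .
  then have "\<forall>i j. \<exists>B. B\<ge>0 \<and> (\<forall>x r. 1 \<le> r \<longrightarrow> (\<forall>i<N. norm (x i) \<le> r) \<longrightarrow> norm (hg i j x) \<le> B * r ^ (e - 1))" by blast
  then obtain B where B: "\<And>i j. B i j \<ge> 0" "\<And>i j x r. 1 \<le> r \<Longrightarrow> (\<forall>i<N. norm (x i) \<le> r) \<Longrightarrow> norm (hg i j x) \<le> B i j * r ^ (e - 1)"
    by metis
  define K where "K = (\<Sum>i<N. \<Sum>j<N. B i j)"
  have K0: "K \<ge> 0" unfolding K_def using B by (intro sum_nonneg) auto
  \<comment> \<open>Large enough for \<open>\<delta> * \<rho>\<close> to exceed the sum of all
    growth constants of the second derivatives.\<close>
  define \<rho> where "\<rho> = K / \<delta> + 1"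
  have \<rho>: "1 \<le> \<rho>" "K < \<delta> * \<rho>" unfolding \<rho>_def using K0 \<delta> by (auto simp: field_simps)
  define x where "x = (\<lambda>i::nat. complex_of_real \<rho>)"
  have xb: "\<forall>i<N. norm (x i) \<le> \<rho>" unfolding x_def using \<rho> by simp
  have "w x \<noteq> 0"
  proof
    assume "w x = 0"
    then obtain u where u: "u \<in> carrier_vec N" "u \<noteq> 0\<^sub>v N" "mat N N (\<lambda>(i, j). H i j x) *\<^sub>v u = 0\<^sub>v N"
      unfolding w_def using det_0_iff_vec_prod_zero_field[of "mat N N (\<lambda>(i, j). H i j x)" N] by auto
    obtain i0 where i0: "i0 < N" "u $ i0 \<noteq> 0" using u(1,2) by (metis carrier_vecD eq_vecI index_zero_vec(1) index_zero_vec(2))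
    \<comment> \<open>Dominance is contradicted in the row belonging to the largest entry of a null
      vector.\<close>
    define m where "m = Max ((\<lambda>i. norm (u $ i)) ` {..<N})"
    have mge: "norm (u $ j) \<le> m" if "j < N" for j unfolding m_def using that by (intro Max_ge) auto
    have "m \<in> (\<lambda>i. norm (u $ i)) ` {..<N}" unfolding m_def using i0 by (intro Max_in) auto
    then obtain i where i: "i < N" "norm (u $ i) = m" by auto
    have m0: "m > 0" using mge[OF i0(1)] i0(2) by (meson less_le_trans zero_less_norm_iff)
    have "0 = (mat N N (\<lambda>(i, j). H i j x) *\<^sub>v u) $ i" using u(3) i(1) by simp
    also have "\<dots> = (\<Sum>j<N. H i j x * u $ j)"
      using i(1) u(1) by (simp add: scalar_prod_def lessThan_atLeast0)
    also have "\<dots> = (\<Sum>j<N. hg i j x * u $ j) + (\<Sum>j<N. of_real \<delta> * (of_nat (e + P + 1) * (if j = i then of_nat (e + P) * x i ^ (e + P - 1) else 0)) * u $ j)"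
      unfolding H_def by (simp add: algebra_simps sum.distrib)
    also have "(\<Sum>j<N. of_real \<delta> * (of_nat (e + P + 1) * (if j = i then of_nat (e + P) * x i ^ (e + P - 1) else 0)) * u $ j)
      = (\<Sum>j<N. if j = i then of_real \<delta> * (of_nat (e + P + 1) * (of_nat (e + P) * x i ^ (e + P - 1))) * u $ i else 0)"
      by (intro sum.cong) auto
    also have "\<dots> = of_real \<delta> * (of_nat (e + P + 1) * (of_nat (e + P) * x i ^ (e + P - 1))) * u $ i"
      using i by simp
    finally have "of_real \<delta> * (of_nat (e + P + 1) * (of_nat (e + P) * x i ^ (e + P - 1))) * u $ i = - (\<Sum>j<N. hg i j x * u $ j)"
      by (simp add: eq_neg_iff_add_eq_0 add.commute)
    then have "norm (of_real \<delta> * (of_nat (e + P + 1) * (of_nat (e + P) * x i ^ (e + P - 1))) * u $ i) = norm (\<Sum>j<N. hg i j x * u $ j)"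
      by (simp only: norm_minus_cancel)
    also have "\<dots> \<le> (\<Sum>j<N. B i j * \<rho> ^ (e - 1) * m)"
      using B(2)[OF \<rho>(1) xb] mge B(1) \<rho>(1)
      by (intro order_trans[OF norm_sum] sum_mono) (auto simp: norm_mult intro!: mult_mono)
    also have "\<dots> = (\<Sum>j<N. B i j) * (\<rho> ^ (e - 1) * m)" by (simp add: sum_distrib_right mult.assoc)
    also have "\<dots> \<le> K * (\<rho> ^ (e - 1) * m)"
      unfolding K_def using i(1) B(1) m0 \<rho> by (intro mult_right_mono member_le_sum[of i "{..<N}" "\<lambda>i. \<Sum>j<N. B i j"]) (auto intro!: sum_nonneg)
    also have "\<dots> < \<delta> * \<rho> * (\<rho> ^ (e - 1) * m)"
      using \<rho> m0 by (intro mult_strict_right_mono) auto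
    also have "\<dots> = \<delta> * \<rho> ^ e * m" using e by (cases e) auto
    also have "\<dots> \<le> \<delta> * \<rho> ^ (e + P - 1) * m"
      using \<delta> m0 \<rho> P by (intro mult_right_mono mult_left_mono power_increasing) auto
    also have "\<dots> \<le> (\<delta> * (real (e + P + 1) * (real (e + P) * \<rho> ^ (e + P - 1)))) * m"
    proof -
      have "1 * (1 * \<rho> ^ (e + P - 1)) \<le> real (e + P + 1) * (real (e + P) * \<rho> ^ (e + P - 1))"
        using e \<rho> by (intro mult_mono) auto
      then show ?thesis using \<delta> m0 by (intro mult_right_mono mult_left_mono) auto
    qed
    also have "\<dots> = norm (of_real \<delta> * (of_nat (e + P + 1) * (of_nat (e + P) * x i ^ (e + P - 1))) * u $ i)"
      unfolding norm_mult norm_power norm_of_nat i(2) x_def using \<delta> \<rho> by simp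
    finally show False by simp
  qed
  then show ?thesis by blast
qed

lemma w_inverse:
  assumes "w x \<noteq> 0"
  obtains b where "\<And>i z. i < N \<Longrightarrow> (\<Sum>j<N. H i j x * (\<Sum>k<N. b j k * z k)) = z i"
proof -
  let ?A = "mat N N (\<lambda>(i, j). H i j x)"
  have A: "?A \<in> carrier_mat N N" by simp
  from det_non_zero_imp_unit[OF A, of "undefined"] assms
  have "?A \<in> Units (ring_mat TYPE(complex) N undefined)" unfolding w_def by simp
  then obtain B where B: "B \<in> carrier_mat N N" "?A * B = 1\<^sub>m N"
    unfolding Units_def ring_mat_def by auto
  show thesis
  proof (rule that[of "\<lambda>j k. B $$ (j, k)"])
    fix i and z :: "nat \<Rightarrow> complex" assume i: "i < N"
    have d: "(\<Sum>j<N. H i j x * B $$ (j, k)) = (if i = k then 1 else 0)" if k: "k < N" for k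
    proof -
      have "(?A * B) $$ (i, k) = (\<Sum>j<N. H i j x * B $$ (j, k))"
        using i k B(1) by (simp add: scalar_prod_def lessThan_atLeast0)
      then show ?thesis using B(2) i k by simp
    qed
    have "(\<Sum>j<N. H i j x * (\<Sum>k<N. B $$ (j, k) * z k)) = (\<Sum>j<N. \<Sum>k<N. H i j x * B $$ (j, k) * z k)"
      by (simp add: sum_distrib_left mult.assoc)
    also have "\<dots> = (\<Sum>k<N. (\<Sum>j<N. H i j x * B $$ (j, k)) * z k)"
      by (subst sum.swap) (simp add: sum_distrib_right)
    also have "\<dots> = (\<Sum>k<N. if i = k then z k else 0)"
      by (intro sum.cong refl) (simp add: d)
    also have "\<dots> = z i" using i by simp
    finally show "(\<Sum>j<N. H i j x * (\<Sum>k<N. B $$ (j, k) * z k)) = z i" .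
  qed
qed

lemma G_taylor:
  assumes r: "r \<ge> 1"
  obtains K where "K \<ge> 1" "\<And>i x h s. i < N \<Longrightarrow> (\<And>i. i < N \<Longrightarrow> norm (x i) \<le> r) \<Longrightarrow> (\<And>i. i < N \<Longrightarrow> norm (h i) \<le> s) \<Longrightarrow> 0 \<le> s \<Longrightarrow> s \<le> 1 \<Longrightarrow>
     norm (G i (\<lambda>i. x i + h i) - G i x - (\<Sum>j<N. h j * H i j x)) \<le> K * s\<^sup>2"
proof -
  have "\<exists>K. K \<ge> 0 \<and> (\<forall>x h s. (\<forall>i<N. norm (x i) \<le> r) \<longrightarrow> (\<forall>i<N. norm (h i) \<le> s) \<longrightarrow> 0 \<le> s \<longrightarrow> s \<le> 1 \<longrightarrow>
     norm (G i (\<lambda>i. x i + h i) - G i x - (\<Sum>j<N. h j * H i j x)) \<le> K * s\<^sup>2)" if "i < N" for i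
    using has_grad_G[OF that] r unfolding has_grad_def by blast
  then have "\<forall>i\<in>{..<N}. \<exists>K. K \<ge> 0 \<and> (\<forall>x h s. (\<forall>i<N. norm (x i) \<le> r) \<longrightarrow> (\<forall>i<N. norm (h i) \<le> s) \<longrightarrow> 0 \<le> s \<longrightarrow> s \<le> 1 \<longrightarrow>
     norm (G i (\<lambda>i. x i + h i) - G i x - (\<Sum>j<N. h j * H i j x)) \<le> K * s\<^sup>2)" by blast
  from bchoice[OF this] obtain K where K: "\<And>i. i < N \<Longrightarrow> K i \<ge> 0" "\<And>i x h s. i < N \<Longrightarrow> (\<forall>i<N. norm (x i) \<le> r) \<Longrightarrow> (\<forall>i<N. norm (h i) \<le> s) \<Longrightarrow> 0 \<le> s \<Longrightarrow> s \<le> 1 \<Longrightarrow>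
     norm (G i (\<lambda>i. x i + h i) - G i x - (\<Sum>j<N. h j * H i j x)) \<le> K i * s\<^sup>2" by blast
  show thesis
  proof (rule that[of "1 + (\<Sum>i<N. K i)"])
    have "0 \<le> (\<Sum>i<N. K i)" using K(1) by (intro sum_nonneg) simp
    then show "1 \<le> 1 + (\<Sum>i<N. K i)" by simp
    fix i and x h :: "nat \<Rightarrow> complex" and s :: real assume a: "i < N" "(\<And>i. i < N \<Longrightarrow> norm (x i) \<le> r)" "(\<And>i. i < N \<Longrightarrow> norm (h i) \<le> s)" "0 \<le> s" "s \<le> 1"
    have "K i \<le> (\<Sum>i<N. K i)" using K(1) a(1) by (intro member_le_sum) auto
    then have "K i * s\<^sup>2 \<le> (1 + (\<Sum>i<N. K i)) * s\<^sup>2" by (intro mult_right_mono) auto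
    moreover have "norm (G i (\<lambda>i. x i + h i) - G i x - (\<Sum>j<N. h j * H i j x)) \<le> K i * s\<^sup>2"
      using a by (intro K(2)) auto
    ultimately show "norm (G i (\<lambda>i. x i + h i) - G i x - (\<Sum>j<N. h j * H i j x)) \<le> (1 + (\<Sum>i<N. K i)) * s\<^sup>2" by linarith
  qed
qed

lemma H_lipschitz:
  assumes r: "r \<ge> 1"
  obtains L where "L \<ge> 1" "\<And>i x h s. i < N \<Longrightarrow> (\<And>i. i < N \<Longrightarrow> norm (x i) \<le> r) \<Longrightarrow> (\<And>i. i < N \<Longrightarrow> norm (h i) \<le> s) \<Longrightarrow> 0 \<le> s \<Longrightarrow> s \<le> 1 \<Longrightarrow>
     (\<Sum>j<N. norm (H i j (\<lambda>i. x i + h i) - H i j x)) \<le> L * s"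
proof -
  have "\<exists>L. L \<ge> 0 \<and> (\<forall>x h s. (\<forall>i<N. norm (x i) \<le> r) \<longrightarrow> (\<forall>i<N. norm (h i) \<le> s) \<longrightarrow> 0 \<le> s \<longrightarrow> s \<le> 1 \<longrightarrow>
     norm (H i j (\<lambda>i. x i + h i) - H i j x) \<le> L * s)" if i: "i < N" for i j
  proof -
    obtain L where L: "L \<ge> 0" "\<And>x h s. (\<And>i. i < N \<Longrightarrow> norm (x i) \<le> r) \<Longrightarrow> (\<And>i. i < N \<Longrightarrow> norm (h i) \<le> s) \<Longrightarrow> 0 \<le> s \<Longrightarrow> s \<le> 1 \<Longrightarrow>
     norm (H i j (\<lambda>i. x i + h i) - H i j x) \<le> L * s" using mpoly_lipschitz[OF mpoly_H[OF i] r] by blast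
    show ?thesis by (rule exI[of _ L]) (use L in simp)
  qed
  then have "\<forall>z\<in>{..<N}\<times>{..<N}. \<exists>L. L \<ge> 0 \<and> (\<forall>x h s. (\<forall>i<N. norm (x i) \<le> r) \<longrightarrow> (\<forall>i<N. norm (h i) \<le> s) \<longrightarrow> 0 \<le> s \<longrightarrow> s \<le> 1 \<longrightarrow>
     norm (H (fst z) (snd z) (\<lambda>i. x i + h i) - H (fst z) (snd z) x) \<le> L * s)" by auto
  from bchoice[OF this] obtain L where L0: "\<forall>z\<in>{..<N}\<times>{..<N}. L z \<ge> 0 \<and> (\<forall>x h s. (\<forall>i<N. norm (x i) \<le> r) \<longrightarrow> (\<forall>i<N. norm (h i) \<le> s) \<longrightarrow> 0 \<le> s \<longrightarrow> s \<le> 1 \<longrightarrow>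
     norm (H (fst z) (snd z) (\<lambda>i. x i + h i) - H (fst z) (snd z) x) \<le> L z * s)" by blast
  have L: "\<And>i j. i < N \<Longrightarrow> j < N \<Longrightarrow> L (i, j) \<ge> 0" "\<And>i j x h s. i < N \<Longrightarrow> j < N \<Longrightarrow> (\<forall>i<N. norm (x i) \<le> r) \<Longrightarrow> (\<forall>i<N. norm (h i) \<le> s) \<Longrightarrow> 0 \<le> s \<Longrightarrow> s \<le> 1 \<Longrightarrow>
     norm (H i j (\<lambda>i. x i + h i) - H i j x) \<le> L (i, j) * s"
    using bspec[OF L0, of "(_, _)"] by simp_all
  show thesis
  proof (rule that[of "1 + (\<Sum>i<N. \<Sum>j<N. L (i, j))"])
    have nn: "0 \<le> (\<Sum>j<N. L (i, j))" if "i < N" for i using L(1) that by (intro sum_nonneg) auto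
    then have "0 \<le> (\<Sum>i<N. \<Sum>j<N. L (i, j))" by (intro sum_nonneg[of "{..<N}" "\<lambda>i. \<Sum>j<N. L (i, j)"]) simp
    then show "1 \<le> 1 + (\<Sum>i<N. \<Sum>j<N. L (i, j))" by simp
    fix i and x h :: "nat \<Rightarrow> complex" and s :: real assume a: "i < N" "(\<And>i. i < N \<Longrightarrow> norm (x i) \<le> r)" "(\<And>i. i < N \<Longrightarrow> norm (h i) \<le> s)" "0 \<le> s" "s \<le> 1"
    have "(\<Sum>j<N. norm (H i j (\<lambda>i. x i + h i) - H i j x)) \<le> (\<Sum>j<N. L (i, j) * s)"
      using a by (intro sum_mono L(2)) auto
    also have "\<dots> = (\<Sum>j<N. L (i, j)) * s" by (simp add: sum_distrib_right)
    also have "\<dots> \<le> (1 + (\<Sum>i<N. \<Sum>j<N. L (i, j))) * s"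
    proof (intro mult_right_mono a)
      have "(\<Sum>j<N. L (i, j)) \<le> (\<Sum>i<N. \<Sum>j<N. L (i, j))"
        using nn a(1) by (intro member_le_sum[of i "{..<N}" "\<lambda>i. \<Sum>j<N. L (i, j)"]) auto
      then show "(\<Sum>j<N. L (i, j)) \<le> 1 + (\<Sum>i<N. \<Sum>j<N. L (i, j))" by simp
    qed
    finally show "(\<Sum>j<N. norm (H i j (\<lambda>i. x i + h i) - H i j x)) \<le> (1 + (\<Sum>i<N. \<Sum>j<N. L (i, j))) * s" .
  qed
qed

text \<open>Newton's method with the derivative frozen at \<open>x\<close>.\<close>
lemma local_solve:
  assumes "w x \<noteq> 0"
  shows "\<exists>\<eta> c. 0 < \<eta> \<and> 0 \<le> c \<and> (\<forall>a t. (\<forall>j<N. norm (a j - G j x) \<le> t) \<longrightarrow> 0 \<le> t \<longrightarrow> t \<le> \<eta> \<longrightarrow>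
    (\<exists>x'. (\<forall>j<N. G j x' = a j) \<and> (\<forall>j<N. norm (x' j - x j) \<le> c * t)))"
proof -
  obtain b where b: "\<And>i z. i < N \<Longrightarrow> (\<Sum>j<N. H i j x * (\<Sum>k<N. b j k * z k)) = z i"
    using w_inverse[OF assms] by blast
  define r where "r = 2 + (\<Sum>i<N. norm (x i))"
  have r: "r \<ge> 1" unfolding r_def by (simp add: add_increasing2 sum_nonneg)
  have xr: "norm (x i) \<le> r - 1" if "i < N" for i
    unfolding r_def using member_le_sum[of i "{..<N}" "\<lambda>i. norm (x i)"] that by auto
  define \<beta> where "\<beta> = 1 + (\<Sum>i<N. \<Sum>j<N. norm (b i j))"
  have \<beta>1: "\<beta> \<ge> 1" unfolding \<beta>_def by (simp add: sum_nonneg)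
  have \<beta>: "norm (\<Sum>k<N. b j k * z k) \<le> \<beta> * t" if "j < N" "\<And>k. k < N \<Longrightarrow> norm (z k) \<le> t" "0 \<le> t" for j z t
  proof -
    have "norm (\<Sum>k<N. b j k * z k) \<le> (\<Sum>k<N. norm (b j k) * t)"
      by (intro order_trans[OF norm_sum] sum_mono) (use that in \<open>auto simp: norm_mult intro!: mult_left_mono\<close>)
    also have "\<dots> = (\<Sum>k<N. norm (b j k)) * t" by (simp add: sum_distrib_right)
    also have "\<dots> \<le> \<beta> * t"
    proof (intro mult_right_mono that)
      have "(\<Sum>k<N. norm (b j k)) \<le> (\<Sum>i<N. \<Sum>j<N. norm (b i j))"
        using that(1) by (intro member_le_sum[of j "{..<N}" "\<lambda>i. \<Sum>k<N. norm (b i k)"]) (auto intro!: sum_nonneg)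
      then show "(\<Sum>k<N. norm (b j k)) \<le> \<beta>" unfolding \<beta>_def by simp
    qed
    finally show ?thesis .
  qed
  obtain K where K: "K \<ge> 1" "\<And>i x h s. i < N \<Longrightarrow> (\<And>i. i < N \<Longrightarrow> norm (x i) \<le> r) \<Longrightarrow> (\<And>i. i < N \<Longrightarrow> norm (h i) \<le> s) \<Longrightarrow> 0 \<le> s \<Longrightarrow> s \<le> 1 \<Longrightarrow>
     norm (G i (\<lambda>i. x i + h i) - G i x - (\<Sum>j<N. h j * H i j x)) \<le> K * s\<^sup>2"
    using G_taylor[OF r] by blast
  obtain L where L: "L \<ge> 1" "\<And>i x h s. i < N \<Longrightarrow> (\<And>i. i < N \<Longrightarrow> norm (x i) \<le> r) \<Longrightarrow> (\<And>i. i < N \<Longrightarrow> norm (h i) \<le> s) \<Longrightarrow> 0 \<le> s \<Longrightarrow> s \<le> 1 \<Longrightarrow>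
     (\<Sum>j<N. norm (H i j (\<lambda>i. x i + h i) - H i j x)) \<le> L * s"
    using H_lipschitz[OF r] by blast
  \<comment> \<open>Within this distance of \<open>x\<close> the variation of the Jacobian matrix
    contributes at most \<open>t / 4\<close> to the new error.\<close>
  define s0 where "s0 = 1 / (4 * L * \<beta>)"
  have s0: "0 < s0" "s0 \<le> 1" "L * \<beta> * s0 = 1/4"
  proof -
    have "1 * 1 \<le> L * \<beta>" using L(1) \<beta>1 by (intro mult_mono) auto
    then show "0 < s0" "s0 \<le> 1" "L * \<beta> * s0 = 1/4" unfolding s0_def by (auto simp: field_simps)
  qed
  \<comment> \<open>The first bound keeps all iterates within \<open>s0\<close> of \<open>x\<close>;
    the second makes the quadratic remainder at most \<open>t / 4\<close>, so that each step halves
    the error.\<close>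
  define \<eta> where "\<eta> = min (s0 / (2 * \<beta>)) (1 / (4 * K * \<beta>\<^sup>2))"
  have \<eta>0: "\<eta> > 0" unfolding \<eta>_def using s0 K(1) \<beta>1 by auto
  have \<eta>1: "2 * \<beta> * \<eta> \<le> s0"
  proof -
    have "\<eta> \<le> s0 / (2 * \<beta>)" unfolding \<eta>_def by simp
    then show ?thesis using \<beta>1 by (simp add: field_simps)
  qed
  have \<eta>2: "K * \<beta>\<^sup>2 * \<eta> \<le> 1/4"
  proof -
    have "\<eta> \<le> 1 / (4 * K * \<beta>\<^sup>2)" unfolding \<eta>_def by simp
    moreover have "0 < K * \<beta>\<^sup>2" using K(1) \<beta>1 by simp
    ultimately show ?thesis by (simp add: field_simps)
  qed
  have step: "norm (z i + G i y - G i (\<lambda>i. y i + (\<Sum>k<N. b i k * z k))) \<le> t / 2"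
    if i: "i < N" and y: "\<And>j. j < N \<Longrightarrow> norm (y j - x j) \<le> s0" and z: "\<And>j. j < N \<Longrightarrow> norm (z j) \<le> t" and t: "0 \<le> t" "t \<le> \<eta>"
    for i y z t
  proof -
    define h where "h = (\<lambda>i. \<Sum>k<N. b i k * z k)"
    have h: "norm (h j) \<le> \<beta> * t" if "j < N" for j unfolding h_def using \<beta>[OF that z t(1)] .
    have bt: "\<beta> * t \<le> 1"
    proof -
      have "\<beta> * t \<le> \<beta> * \<eta>" using t \<beta>1 by (intro mult_left_mono) auto
      moreover have "\<beta> * \<eta> \<ge> 0" using \<beta>1 \<eta>0 by simp
      ultimately show ?thesis using \<eta>1 s0(2) by linarith
    qed
    have bt0: "0 \<le> \<beta> * t" using \<beta>1 t by simp
    have yr: "norm (y j) \<le> r" if "j < N" for j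
    proof -
      have "norm (y j) \<le> norm (y j - x j) + norm (x j)" using norm_triangle_ineq[of "y j - x j" "x j"] by simp
      then show ?thesis using y[OF that] xr[OF that] s0 by simp
    qed
    have A: "norm (G i (\<lambda>i. y i + h i) - G i y - (\<Sum>j<N. h j * H i j y)) \<le> K * (\<beta> * t)\<^sup>2"
      by (rule K(2)[OF i yr h bt0 bt])
    have xr': "norm (x j) \<le> r" if "j < N" for j using xr[OF that] by simp
    have "(\<Sum>j<N. norm (H i j (\<lambda>i. x i + (y i - x i)) - H i j x)) \<le> L * s0"
      by (rule L(2)[OF i xr' y]) (use s0 in auto)
    then have LL: "(\<Sum>j<N. norm (H i j y - H i j x)) \<le> L * s0" by simp
    have "norm (\<Sum>j<N. h j * (H i j y - H i j x)) \<le> (\<Sum>j<N. (\<beta> * t) * norm (H i j y - H i j x))"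
      by (intro order_trans[OF norm_sum] sum_mono) (use h in \<open>auto simp: norm_mult intro!: mult_right_mono\<close>)
    also have "\<dots> = (\<beta> * t) * (\<Sum>j<N. norm (H i j y - H i j x))" by (simp add: sum_distrib_left)
    also have "\<dots> \<le> (\<beta> * t) * (L * s0)" using LL bt0 by (intro mult_left_mono)
    also have "\<dots> = t / 4" using s0(3) by (simp add: algebra_simps)
    finally have Bd: "norm (\<Sum>j<N. h j * (H i j y - H i j x)) \<le> t / 4" .
    have zi: "(\<Sum>j<N. h j * H i j x) = z i" using b[OF i, of z] unfolding h_def by (simp add: mult.commute)
    have eq: "z i + G i y - G i (\<lambda>i. y i + h i)
      = - (G i (\<lambda>i. y i + h i) - G i y - (\<Sum>j<N. h j * H i j y)) - (\<Sum>j<N. h j * (H i j y - H i j x))"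
      using zi by (simp add: algebra_simps sum_subtractf)
    have "K * (\<beta> * t)\<^sup>2 = (K * \<beta>\<^sup>2 * t) * t" by (simp add: power2_eq_square)
    also have "\<dots> \<le> (K * \<beta>\<^sup>2 * \<eta>) * t" using t K(1) by (intro mult_right_mono mult_left_mono) auto
    also have "\<dots> \<le> (1/4) * t" using \<eta>2 t by (intro mult_right_mono)
    finally have A': "K * (\<beta> * t)\<^sup>2 \<le> t / 4" by simp
    have "norm (z i + G i y - G i (\<lambda>i. y i + h i)) \<le> t / 4 + t / 4"
      unfolding eq using norm_triangle_ineq4[of "- (G i (\<lambda>i. y i + h i) - G i y - (\<Sum>j<N. h j * H i j y))" "\<Sum>j<N. h j * (H i j y - H i j x)"]
        A A' Bd by (simp only: norm_minus_cancel)
    then show ?thesis by (simp add: h_def)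
  qed
  show ?thesis
  proof (rule exI[of _ \<eta>], rule exI[of _ "2 * \<beta>"], intro conjI allI impI)
    show "0 < \<eta>" by (rule \<eta>0)
    show "0 \<le> 2 * \<beta>" using \<beta>1 by simp
    fix a :: "nat \<Rightarrow> complex" and t :: real
    assume a: "\<forall>j<N. norm (a j - G j x) \<le> t" and t: "0 \<le> t" "t \<le> \<eta>"
    define y where "y = rec_nat x (\<lambda>_ y i. y i + (\<Sum>k<N. b i k * (a k - G k y)))"
    have y0: "y 0 = x" and yS: "y (Suc k) = (\<lambda>i. y k i + (\<Sum>l<N. b i l * (a l - G l (y k))))" for k
      unfolding y_def by simp_all
    \<comment> \<open>As errors halve, the displacements form a geometric series of total length
      \<open>2 * \<beta> * t\<close>.\<close>
    have inv: "(\<forall>j<N. norm (a j - G j (y k)) \<le> t / 2 ^ k) \<and> (\<forall>j<N. norm (y k j - x j) \<le> 2 * \<beta> * t * (1 - 1 / 2 ^ k))" for k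
    proof (induction k)
      case 0
      then show ?case using a by (simp add: y0)
    next
      case (Suc k)
      have tk: "0 \<le> t / 2 ^ k" "t / 2 ^ k \<le> \<eta>"
      proof -
        show "0 \<le> t / 2 ^ k" using t by simp
        have "t / 2 ^ k \<le> t / 1" using t by (intro divide_left_mono) auto
        then show "t / 2 ^ k \<le> \<eta>" using t by simp
      qed
      have near: "norm (y k j - x j) \<le> s0" if "j < N" for j
      proof -
        have "norm (y k j - x j) \<le> 2 * \<beta> * t * (1 - 1 / 2 ^ k)" using Suc that by blast
        also have "\<dots> \<le> 2 * \<beta> * t * 1" using \<beta>1 t by (intro mult_left_mono) auto
        also have "\<dots> \<le> 2 * \<beta> * \<eta>" using \<beta>1 t by simp
        finally show ?thesis using \<eta>1 by simp
      qed
      have "norm (a j - G j (y (Suc k))) \<le> t / 2 ^ Suc k" if "j < N" for j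
      proof -
        have "norm (a j - G j (y k) + G j (y k) - G j (\<lambda>i. y k i + (\<Sum>l<N. b i l * (a l - G l (y k))))) \<le> t / 2 ^ k / 2"
          by (rule step[OF that _ _ tk]) (use near Suc in blast)+
        then show ?thesis unfolding yS by simp
      qed
      moreover have "norm (y (Suc k) j - x j) \<le> 2 * \<beta> * t * (1 - 1 / 2 ^ Suc k)" if "j < N" for j
      proof -
        have "norm (\<Sum>l<N. b j l * (a l - G l (y k))) \<le> \<beta> * (t / 2 ^ k)"
          using Suc by (intro \<beta>[OF that _ tk(1)]) auto
        moreover have "norm (y k j - x j) \<le> 2 * \<beta> * t * (1 - 1 / 2 ^ k)" using Suc that by blast
        moreover have "y (Suc k) j - x j = (y k j - x j) + (\<Sum>l<N. b j l * (a l - G l (y k)))"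
          unfolding yS by simp
        ultimately have "norm (y (Suc k) j - x j) \<le> 2 * \<beta> * t * (1 - 1 / 2 ^ k) + \<beta> * (t / 2 ^ k)"
          using norm_triangle_ineq[of "y k j - x j" "\<Sum>l<N. b j l * (a l - G l (y k))"] by (simp only:)
        also have "\<dots> = 2 * \<beta> * t * (1 - 1 / 2 ^ Suc k)" by (simp add: field_simps)
        finally show ?thesis .
      qed
      ultimately show ?case by blast
    qed
    have "\<exists>X. (\<lambda>k. y k i) \<longlonglongrightarrow> X" if i: "i < N" for i
    proof -
      have nb: "norm (y (Suc k) i - y k i) \<le> (\<beta> * t) * (1/2) ^ k" for k
      proof -
        have "norm (\<Sum>l<N. b i l * (a l - G l (y k))) \<le> \<beta> * (t / 2 ^ k)"
          using inv[of k] t by (intro \<beta>[OF i]) auto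
        then show ?thesis unfolding yS by (simp add: power_divide)
      qed
      have sm: "summable (\<lambda>k. (\<beta> * t) * (1/2::real) ^ k)" by (intro summable_mult summable_geometric) simp
      have "summable (\<lambda>k. y (Suc k) i - y k i)" by (rule summable_comparison_test'[OF sm nb])
      then have "(\<lambda>n. \<Sum>k<n. y (Suc k) i - y k i) \<longlonglongrightarrow> (\<Sum>k. y (Suc k) i - y k i)" by (rule summable_LIMSEQ)
      then have "(\<lambda>n. y n i - y 0 i) \<longlonglongrightarrow> (\<Sum>k. y (Suc k) i - y k i)"
        using sum_lessThan_telescope[of "\<lambda>k. y k i"] by simp
      then have "(\<lambda>n. (y n i - y 0 i) + y 0 i) \<longlonglongrightarrow> (\<Sum>k. y (Suc k) i - y k i) + y 0 i" by (intro tendsto_add tendsto_const)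
      then show ?thesis by auto
    qed
    then obtain X where X: "\<And>i. i < N \<Longrightarrow> (\<lambda>k. y k i) \<longlonglongrightarrow> X i" by metis
    show "\<exists>x'. (\<forall>j<N. G j x' = a j) \<and> (\<forall>j<N. norm (x' j - x j) \<le> 2 * \<beta> * t)"
    proof (intro exI[of _ X] conjI allI impI)
      fix j assume j: "j < N"
      have "(\<lambda>k. G j (y k)) \<longlonglongrightarrow> G j X" by (rule mpoly_tendsto[OF mpoly_G[OF j]]) (rule X)
      moreover have "(\<lambda>k. G j (y k)) \<longlonglongrightarrow> a j"
      proof -
        have "(\<lambda>k. t * (1/2) ^ k) \<longlonglongrightarrow> t * 0" by (intro tendsto_mult tendsto_const LIMSEQ_realpow_zero) auto
        then have z: "(\<lambda>k. t * (1/2) ^ k) \<longlonglongrightarrow> 0" by simp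
        have "norm (a j - G j (y k)) \<le> t * (1/2) ^ k" for k using inv[of k] j by (simp add: power_divide)
        then have "(\<lambda>k. a j - G j (y k)) \<longlonglongrightarrow> 0"
          by (intro Lim_null_comparison[OF _ z] always_eventually) auto
        then have "(\<lambda>k. a j - (a j - G j (y k))) \<longlonglongrightarrow> a j - 0" by (intro tendsto_diff tendsto_const)
        then show ?thesis by simp
      qed
      ultimately show "G j X = a j" by (rule LIMSEQ_unique)
      have "(\<lambda>k. norm (y k j - x j)) \<longlonglongrightarrow> norm (X j - x j)" by (intro tendsto_intros X j)
      moreover have "norm (y k j - x j) \<le> 2 * \<beta> * t" for k
      proof -
        have "norm (y k j - x j) \<le> 2 * \<beta> * t * (1 - 1 / 2 ^ k)" using inv[of k] j by blast
        also have "\<dots> \<le> 2 * \<beta> * t * 1" using \<beta>1 t by (intro mult_left_mono) auto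
        finally show ?thesis by simp
      qed
      ultimately show "norm (X j - x j) \<le> 2 * \<beta> * t" by (intro Lim_bounded) auto
    qed
  qed
qed

end

section \<open>Lifting arcs through the gradient map\<close>

lemma mpoly_finite_zeros_line:
  assumes "mpoly N d q" "q x \<noteq> 0"
  shows "finite {t. q (\<lambda>i. x i + t * h i) = 0}"
proof -
  obtain p where p: "\<And>t. q (\<lambda>i. x i + t * h i) = poly p t" using mpoly_line[OF assms(1), of x h] by blast
  have "p \<noteq> 0" using p[of 0] assms(2) by auto
  then show ?thesis unfolding p by (rule poly_roots_finite)
qed

text \<open>The arcs belonging to different \<open>\<eta>\<close> meet only at their ends, so each
  point of \<open>Z\<close> excludes at most one value of \<open>\<eta>\<close>.\<close>

lemma avoiding_arc:
  assumes "finite Z" "0 \<notin> Z" "1 \<notin> Z"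
  obtains \<eta> where "0 < \<eta>" "\<eta> \<le> (1::real)" "\<And>\<tau>. 0 \<le> \<tau> \<Longrightarrow> \<tau> \<le> 1 \<Longrightarrow> Complex \<tau> (\<eta> * (\<tau> * (1 - \<tau>))) \<notin> Z"
proof -
  define B where "B = (\<lambda>z. Im z / (Re z * (1 - Re z))) ` Z"
  have "finite B" unfolding B_def using assms(1) by simp
  moreover have "infinite {0<..1::real}" by (simp add: infinite_Ioc)
  ultimately have "\<not> {0<..1} \<subseteq> B" using finite_subset by blast
  then obtain \<eta> where "\<eta> \<in> {0<..1}" and \<eta>3: "\<eta> \<notin> B" by blast
  then have \<eta>: "0 < \<eta>" "\<eta> \<le> 1" "\<eta> \<notin> B" by auto
  have "Complex \<tau> (\<eta> * (\<tau> * (1 - \<tau>))) \<notin> Z" if "0 \<le> \<tau>" "\<tau> \<le> 1" for \<tau>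
  proof (cases "\<tau> = 0 \<or> \<tau> = 1")
    case True
    then show ?thesis using assms by (auto simp: zero_complex.code[symmetric] one_complex.code[symmetric])
  next
    case False
    then have nz: "\<tau> * (1 - \<tau>) \<noteq> 0" by simp
    show ?thesis
    proof
      assume "Complex \<tau> (\<eta> * (\<tau> * (1 - \<tau>))) \<in> Z"
      then have "Im (Complex \<tau> (\<eta> * (\<tau> * (1 - \<tau>)))) / (\<tau> * (1 - \<tau>)) \<in> B" unfolding B_def by force
      then show False using \<eta>(3) nz by simp
    qed
  qed
  then show thesis using that \<eta> by blast
qed

context grad_system begin

text \<open>The envelope theorem in finite form: the first-order change of \<open>ft\<close> cancels
  against part of the change of the pairing of \<open>G\<close> with the point. What remains is a
  Taylor remainder, quadratic in \<open>t\<close>, and the pairing of the change of gradient with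
  the new point, whose coordinates are at most \<open>R\<close>.\<close>

lemma v_step:
  assumes wx: "w x \<noteq> 0" and G1: "\<And>j. j < N \<Longrightarrow> norm (G j x) \<le> 1"
  shows "\<exists>\<eta>>0. \<forall>a t. 0 \<le> t \<longrightarrow> t \<le> \<eta> \<longrightarrow> (\<forall>j<N. norm (a j - G j x) \<le> t) \<longrightarrow> (\<forall>j<N. norm (a j) \<le> 1) \<longrightarrow>
    (\<exists>x'. (\<forall>j<N. G j x' = a j) \<and> norm (v x' - v x) \<le> (real N * R + 1) * t)"
proof -
  obtain \<eta> c where c0: "0 < \<eta> \<and> 0 \<le> c \<and> (\<forall>a t. (\<forall>j<N. norm (a j - G j x) \<le> t) \<longrightarrow> 0 \<le> t \<longrightarrow> t \<le> \<eta> \<longrightarrow>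
    (\<exists>x'. (\<forall>j<N. G j x' = a j) \<and> (\<forall>j<N. norm (x' j - x j) \<le> c * t)))"
    using local_solve[OF wx] by blast
  then have c: "0 < \<eta>" "0 \<le> c" by simp_all
  have c3: "\<exists>x'. (\<forall>j<N. G j x' = a j) \<and> (\<forall>j<N. norm (x' j - x j) \<le> c * t)"
    if "\<And>j. j < N \<Longrightarrow> norm (a j - G j x) \<le> t" "0 \<le> t" "t \<le> \<eta>" for a t
    using c0 that by simp
  obtain K where K: "K \<ge> 0" "\<And>x h s. (\<And>i. i < N \<Longrightarrow> norm (x i) \<le> R) \<Longrightarrow> (\<And>i. i < N \<Longrightarrow> norm (h i) \<le> s) \<Longrightarrow> 0 \<le> s \<Longrightarrow> s \<le> 1 \<Longrightarrow>
     norm (ft (\<lambda>i. x i + h i) - ft x - (\<Sum>j<N. h j * G j x)) \<le> K * s\<^sup>2"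
    using has_gradD[OF has_grad_ft R(1)] by blast
  \<comment> \<open>Besides solvability, the bounds make the displacement \<open>c * t\<close> at
    most \<open>1\<close> and the quadratic remainder at most \<open>t\<close>.\<close>
  define \<eta>' where "\<eta>' = min \<eta> (min (1 / (c + 1)) (1 / (K * c\<^sup>2 + 1)))"
  have \<eta>': "\<eta>' > 0" unfolding \<eta>'_def using c K by (auto intro!: add_nonneg_pos)
  show ?thesis
  proof (intro exI[of _ \<eta>'] conjI allI impI \<eta>')
    fix a :: "nat \<Rightarrow> complex" and t :: real
    assume t: "0 \<le> t" "t \<le> \<eta>'" and a: "\<forall>j<N. norm (a j - G j x) \<le> t" and a1: "\<forall>j<N. norm (a j) \<le> 1"
    have "t \<le> \<eta>" using t unfolding \<eta>'_def by simp
    then obtain x' where x': "\<And>j. j < N \<Longrightarrow> G j x' = a j" "\<And>j. j < N \<Longrightarrow> norm (x' j - x j) \<le> c * t"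
      using c3[of a t] a t by blast
    have ct: "c * t \<le> 1"
    proof -
      have "t \<le> 1 / (c + 1)" using t unfolding \<eta>'_def by simp
      then have "t * (c + 1) \<le> 1" using c by (simp add: field_simps)
      then show ?thesis using t by (simp add: algebra_simps)
    qed
    have Kt: "K * c\<^sup>2 * t \<le> 1"
    proof -
      have "t \<le> 1 / (K * c\<^sup>2 + 1)" using t unfolding \<eta>'_def by simp
      moreover have "0 < K * c\<^sup>2 + 1" using K by (intro add_nonneg_pos) auto
      ultimately have "t * (K * c\<^sup>2 + 1) \<le> 1" by (simp add: field_simps)
      then show ?thesis using t by (simp add: algebra_simps)
    qed
    have xR: "norm (x i) \<le> R" if "i < N" for i by (rule fibre_bound[OF G1 that])
    have x'R: "norm (x' i) \<le> R" if "i < N" for i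
      by (rule fibre_bound[OF _ that]) (use x'(1) a1 in simp)
    have "norm (ft (\<lambda>i. x i + (x' i - x i)) - ft x - (\<Sum>j<N. (x' j - x j) * G j x)) \<le> K * (c * t)\<^sup>2"
      by (rule K(2)[OF xR x'(2)]) (use c t ct in auto)
    then have 1: "norm (ft x' - ft x - (\<Sum>j<N. (x' j - x j) * G j x)) \<le> K * c\<^sup>2 * t * t"
      by (simp add: power2_eq_square algebra_simps)
    have "K * c\<^sup>2 * t * t \<le> 1 * t" using Kt t by (intro mult_right_mono)
    moreover have 2: "norm (\<Sum>j<N. (a j - G j x) * x' j) \<le> real N * (t * R)"
    proof -
      have "norm (\<Sum>j<N. (a j - G j x) * x' j) \<le> (\<Sum>j<N. t * R)"
        by (intro order_trans[OF norm_sum] sum_mono) (use a x'R t in \<open>auto simp: norm_mult intro!: mult_mono\<close>)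
      then show ?thesis by simp
    qed
    moreover have eq: "v x' - v x = (ft x' - ft x - (\<Sum>j<N. (x' j - x j) * G j x)) - (\<Sum>j<N. (a j - G j x) * x' j)"
    proof -
      have "(\<Sum>j<N. G j x' * x' j) = (\<Sum>j<N. a j * x' j)" by (intro sum.cong) (auto simp: x'(1))
      moreover have "(\<Sum>j<N. (x' j - x j) * G j x) + (\<Sum>j<N. (a j - G j x) * x' j) = (\<Sum>j<N. a j * x' j) - (\<Sum>j<N. G j x * x j)"
        by (simp add: sum.distrib[symmetric] sum_subtractf[symmetric] algebra_simps)
      ultimately show ?thesis unfolding v_def by (simp add: algebra_simps)
    qed
    ultimately have "norm (v x' - v x) \<le> (real N * R + 1) * t"
      unfolding eq using 1 norm_triangle_ineq4[of "ft x' - ft x - (\<Sum>j<N. (x' j - x j) * G j x)" "\<Sum>j<N. (a j - G j x) * x' j"]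
      by (simp add: algebra_simps)
    then show "\<exists>x'. (\<forall>j<N. G j x' = a j) \<and> norm (v x' - v x) \<le> (real N * R + 1) * t" using x'(1) by blast
  qed
qed

text \<open>By the envelope theorem the derivative of the critical value with respect to a linear perturbation
  is minus the critical point, which is bounded by \<open>R\<close>.\<close>
lemma continuation:
  assumes arc: "\<And>s t j. 0 \<le> s \<Longrightarrow> s \<le> 1 \<Longrightarrow> 0 \<le> t \<Longrightarrow> t \<le> 1 \<Longrightarrow> j < N \<Longrightarrow> norm (a s j - a t j) \<le> \<theta> * \<bar>s - t\<bar>"
    and \<theta>: "0 \<le> \<theta>" and a1: "\<And>t j. 0 \<le> t \<Longrightarrow> t \<le> 1 \<Longrightarrow> j < N \<Longrightarrow> norm (a t j) \<le> 1"
    and good: "\<And>t x. 0 \<le> t \<Longrightarrow> t \<le> 1 \<Longrightarrow> (\<And>j. j < N \<Longrightarrow> G j x = a t j) \<Longrightarrow> w x \<noteq> 0"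
    and x0: "\<And>j. j < N \<Longrightarrow> G j x0 = a 0 j"
  shows "\<exists>x. (\<forall>j<N. G j x = a 1 j) \<and> norm (v x - v x0) \<le> (real N * R + 1) * \<theta>"
proof -
  define \<kappa> where "\<kappa> = (real N * R + 1) * \<theta>"
  \<comment> \<open>Continuity method: \<open>T\<close> contains \<open>0\<close>, it is closed
    because all the fibres lie in a fixed polydisc, and by \<open>v_step\<close> it reaches beyond
    each of its points below \<open>1\<close>. Hence its supremum belongs to it and equals
    \<open>1\<close>.\<close>
  define T where "T = {t\<in>{0..1}. \<exists>x. (\<forall>j<N. G j x = a t j) \<and> norm (v x - v x0) \<le> \<kappa> * t}"
  have T0: "0 \<in> T" unfolding T_def using x0 by force
  have bdd: "bdd_above T" unfolding T_def bdd_above_def by (rule exI[of _ 1]) auto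
  have "closed T" unfolding closed_sequential_limits
  proof (intro allI impI, elim conjE)
    fix s t assume s: "\<forall>n. s n \<in> T" and lim: "s \<longlonglongrightarrow> t"
    have s01: "0 \<le> s n" "s n \<le> 1" for n using s by (auto simp: T_def)
    have t01: "0 \<le> t" "t \<le> 1"
      using s01 lim by (auto intro: Lim_bounded2 Lim_bounded)
    have "\<forall>n. \<exists>x. (\<forall>j<N. G j x = a (s n) j) \<and> norm (v x - v x0) \<le> \<kappa> * s n" using s by (auto simp: T_def)
    from choice[OF this] obtain X where X: "\<And>n j. j < N \<Longrightarrow> G j (X n) = a (s n) j" "\<And>n. norm (v (X n) - v x0) \<le> \<kappa> * s n" by blast
    have XR: "norm (X n i) \<le> R" if "i < N" for n i
      by (rule fibre_bound[OF _ that]) (use X(1) a1 s01 in simp)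
    have "\<exists>r x. strict_mono (r :: nat \<Rightarrow> nat) \<and> (\<forall>i<N. (\<lambda>k. X (r k) i) \<longlonglongrightarrow> x i)"
      by (rule coordinatewise_subseq) (rule XR)
    then obtain r x where r: "strict_mono (r :: nat \<Rightarrow> nat)"
      "\<And>i. i < N \<Longrightarrow> (\<lambda>k. X (r k) i) \<longlonglongrightarrow> x i" by blast
    have sr: "(\<lambda>k. s (r k)) \<longlonglongrightarrow> t" using LIMSEQ_subseq_LIMSEQ[OF lim r(1)] by (simp add: o_def)
    have "G j x = a t j" if j: "j < N" for j
    proof -
      have "(\<lambda>k. G j (X (r k))) \<longlonglongrightarrow> G j x" by (rule mpoly_tendsto[OF mpoly_G[OF j] r(2)])
      moreover have "(\<lambda>k. G j (X (r k))) \<longlonglongrightarrow> a t j"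
      proof -
        have z: "(\<lambda>k. \<theta> * \<bar>s (r k) - t\<bar>) \<longlonglongrightarrow> 0"
          using tendsto_mult[OF tendsto_const[of \<theta>] tendsto_rabs[OF tendsto_diff[OF sr tendsto_const[of t]]]] by simp
        have nb: "norm (a (s (r k)) j - a t j) \<le> \<theta> * \<bar>s (r k) - t\<bar>" for k using arc s01 t01 j by simp
        have "(\<lambda>k. a (s (r k)) j - a t j) \<longlonglongrightarrow> 0"
          by (rule Lim_null_comparison[OF always_eventually z]) (use nb in simp)
        then have "(\<lambda>k. (a (s (r k)) j - a t j) + a t j) \<longlonglongrightarrow> 0 + a t j" by (intro tendsto_add tendsto_const)
        then show ?thesis by (simp add: X(1)[OF j])
      qed
      ultimately show ?thesis by (rule LIMSEQ_unique)
    qed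
    moreover have "norm (v x - v x0) \<le> \<kappa> * t"
    proof -
      have 1: "(\<lambda>k. norm (v (X (r k)) - v x0)) \<longlonglongrightarrow> norm (v x - v x0)"
        by (intro tendsto_norm tendsto_diff tendsto_const mpoly_tendsto[OF mpoly_v r(2)])
      have 2: "(\<lambda>k. \<kappa> * s (r k)) \<longlonglongrightarrow> \<kappa> * t" by (intro tendsto_mult tendsto_const sr)
      show ?thesis by (rule LIMSEQ_le[OF 1 2]) (use X(2) in blast)
    qed
    ultimately show "t \<in> T" unfolding T_def using t01 by auto
  qed
  then have ST: "Sup T \<in> T" using T0 bdd closed_contains_Sup[of T] by blast
  have "Sup T = 1"
  proof (rule ccontr)
    assume ne: "Sup T \<noteq> 1"
    define t where "t = Sup T"
    from ST obtain x where t01: "0 \<le> t" "t \<le> 1" and x: "\<And>j. j < N \<Longrightarrow> G j x = a t j" "norm (v x - v x0) \<le> \<kappa> * t"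
      unfolding t_def T_def by auto
    have t1: "t < 1" using t01 ne unfolding t_def by simp
    have "w x \<noteq> 0" by (rule good[OF t01 x(1)])
    moreover have "norm (G j x) \<le> 1" if "j < N" for j using x(1) a1[OF t01] that by simp
    ultimately obtain \<eta> where \<eta>: "\<eta> > 0" "\<forall>b u. 0 \<le> u \<longrightarrow> u \<le> \<eta> \<longrightarrow> (\<forall>j<N. norm (b j - G j x) \<le> u) \<longrightarrow> (\<forall>j<N. norm (b j) \<le> 1) \<longrightarrow>
      (\<exists>x'. (\<forall>j<N. G j x' = b j) \<and> norm (v x' - v x) \<le> (real N * R + 1) * u)" using v_step by blast
    define \<Delta> where "\<Delta> = min (1 - t) (\<eta> / (\<theta> + 1))"
    have \<Delta>: "0 < \<Delta>" "t + \<Delta> \<le> 1" unfolding \<Delta>_def using t1 \<eta>(1) \<theta> by auto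
    have u: "\<theta> * \<Delta> \<le> \<eta>"
    proof -
      have "\<Delta> \<le> \<eta> / (\<theta> + 1)" unfolding \<Delta>_def by simp
      then have "\<Delta> * (\<theta> + 1) \<le> \<eta>" using \<theta> by (simp add: field_simps)
      then show ?thesis using \<Delta>(1) by (simp add: algebra_simps)
    qed
    have u0: "0 \<le> \<theta> * \<Delta>" using \<theta> \<Delta> by simp
    have "\<forall>j<N. norm (a (t + \<Delta>) j - G j x) \<le> \<theta> * \<Delta>"
      using arc[of "t + \<Delta>" t] t01 \<Delta> x(1) by simp
    moreover have "\<forall>j<N. norm (a (t + \<Delta>) j) \<le> 1" using a1 t01 \<Delta> by simp
    ultimately obtain x' where x': "\<forall>j<N. G j x' = a (t + \<Delta>) j" "norm (v x' - v x) \<le> (real N * R + 1) * (\<theta> * \<Delta>)"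
      using \<eta>(2) u u0 by blast
    have "norm (v x' - v x0) \<le> norm (v x' - v x) + norm (v x - v x0)"
      using norm_triangle_ineq[of "v x' - v x" "v x - v x0"] by simp
    also have "\<dots> \<le> \<kappa> * (t + \<Delta>)" using x'(2) x(2) by (simp add: \<kappa>_def algebra_simps)
    finally have "t + \<Delta> \<in> T" unfolding T_def using x'(1) t01 \<Delta> by auto
    then have "t + \<Delta> \<le> t" unfolding t_def by (rule cSup_upper[OF _ bdd])
    then show False using \<Delta> by simp
  qed
  then show ?thesis using ST unfolding T_def \<kappa>_def by auto
qed

text \<open>The equation for the gradient expresses \<open>x i ^ (e + P)\<close> by a polynomial of
  degree at most \<open>e\<close>, and \<open>P \<ge> 1\<close> makes this a reduced system. Fixing
  the coordinates from \<open>N\<close> on at zero turns the fibre into a finite set of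
  functions.\<close>

lemma fibre_card:
  defines "F \<equiv> \<lambda>a. {x. (\<forall>i\<ge>N. x i = 0) \<and> (\<forall>j<N. G j x = a j)}"
  shows "finite (F a) \<and> card (F a) \<le> (e + P) ^ N"
proof -
  define h where "h = (\<lambda>i x. inverse (of_real \<delta> * of_nat (e + P + 1)) * (a i - g i x))"
  have nz: "complex_of_real \<delta> * of_nat (e + P + 1) \<noteq> 0" using \<delta> by (metis of_real_eq_0_iff mult_eq_0_iff of_nat_eq_0_iff less_irrefl add_is_0 one_neq_zero)
  have sub: "card F' \<le> (e + P) ^ N" if F': "F' \<subseteq> F a" "finite F'" for F'
  proof (rule reduced_fibre_card)
    show "1 \<le> e + P" using e by simp
    show "mpoly N (e + P - 1) (h i)" if "i < N" for i unfolding h_def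
      using P by (intro mpoly_scale mpoly_diff mpoly_const mpoly_mono[OF g]) simp
    show "finite F'" by fact
    show "x i = 0" if "x \<in> F'" "i \<ge> N" for x i using that F' unfolding F_def by auto
    fix x i assume "x \<in> F'" "i < N"
    then have "G i x = a i" using F' unfolding F_def by auto
    then have "a i - g i x = (of_real \<delta> * of_nat (e + P + 1)) * x i ^ (e + P)"
      unfolding G_def by (simp add: algebra_simps)
    then show "x i ^ (e + P) = h i x" unfolding h_def using nz by (simp del: of_nat_add add: field_simps)
  qed
  have "finite (F a)"
  proof (rule ccontr)
    assume "infinite (F a)"
    then obtain F' where "F' \<subseteq> F a" "finite F'" "card F' = (e + P) ^ N + 1"
      using infinite_arbitrarily_large by blast
    then show False using sub[of F'] by simp
  qed
  then show ?thesis using sub[of "F a"] by simp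
qed

text \<open>The last clause says that \<open>q\<close> composed with \<open>G\<close> is not
  identically zero, which is more than \<open>q\<close> being nonzero. It holds because the image of
  \<open>G\<close> contains a neighbourhood of its value at a regular point \<open>x1\<close>, while
  the segment from that value towards \<open>a1\<close> leaves the zero set of \<open>q\<close> at
  once.\<close>

lemma eliminant:
  "\<exists>D q a1 xd. mpoly N D q \<and> q a1 \<noteq> 0 \<and> (\<forall>x. w x = 0 \<longrightarrow> q (\<lambda>j. G j x) = 0) \<and> q (\<lambda>j. G j xd) \<noteq> 0"
proof -
  obtain x1 where x1: "w x1 \<noteq> 0" using w_nonzero by blast
  obtain E where E: "mpoly N E w" using mpoly_w by blast
  have "\<exists>d q. mpoly N d q \<and> (\<exists>a. q a \<noteq> 0) \<and> (\<forall>x. w x = 0 \<longrightarrow> q (\<lambda>j. G j x) = 0)"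
    by (rule mpoly_eliminate[OF E _ x1]) (rule mpoly_G)
  then obtain D q a1 where q: "mpoly N D q" "q a1 \<noteq> 0" "\<And>x. w x = 0 \<Longrightarrow> q (\<lambda>j. G j x) = 0" by blast
  obtain \<eta> c where c0: "0 < \<eta> \<and> 0 \<le> c \<and> (\<forall>a t. (\<forall>j<N. norm (a j - G j x1) \<le> t) \<longrightarrow> 0 \<le> t \<longrightarrow> t \<le> \<eta> \<longrightarrow>
    (\<exists>x'. (\<forall>j<N. G j x' = a j) \<and> (\<forall>j<N. norm (x' j - x1 j) \<le> c * t)))"
    using local_solve[OF x1] by blast
  then have c: "0 < \<eta>" "0 \<le> c" by simp_all
  have c3: "\<exists>x'. (\<forall>j<N. G j x' = a j) \<and> (\<forall>j<N. norm (x' j - x1 j) \<le> c * t)"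
    if "\<And>j. j < N \<Longrightarrow> norm (a j - G j x1) \<le> t" "0 \<le> t" "t \<le> \<eta>" for a t
    using c0 that by simp
  define y where "y = (\<lambda>j. G j x1)"
  have 1: "\<forall>\<^sub>F t in at_right (0::real). q (\<lambda>i. y i + of_real t * (a1 i - y i)) \<noteq> 0"
    by (rule mpoly_nonzero_line[OF q(1,2)])
  have 2: "\<forall>\<^sub>F t in at_right (0::real). \<forall>i\<in>{..<N}. norm (of_real t * (a1 i - y i)) < \<eta>"
  proof (rule eventually_ball_finite, rule finite_lessThan, rule ballI)
    fix i
    have "((\<lambda>t. norm (of_real t * (a1 i - y i))) \<longlongrightarrow> norm (of_real 0 * (a1 i - y i))) (at_right (0::real))"
      by (intro tendsto_intros)
    then have "((\<lambda>t. norm (of_real t * (a1 i - y i))) \<longlongrightarrow> 0) (at_right (0::real))" by simp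
    then show "\<forall>\<^sub>F t in at_right (0::real). norm (of_real t * (a1 i - y i)) < \<eta>"
      using c(1) by (rule order_tendstoD)
  qed
  from eventually_happens'[OF _ eventually_conj[OF 1 2]]
  obtain t where t: "q (\<lambda>i. y i + of_real t * (a1 i - y i)) \<noteq> 0" "\<And>i. i < N \<Longrightarrow> norm (of_real t * (a1 i - y i)) < \<eta>"
    by (auto simp: trivial_limit_at_right_real)
  have "\<exists>x'. (\<forall>j<N. G j x' = y j + of_real t * (a1 j - y j)) \<and> (\<forall>j<N. norm (x' j - x1 j) \<le> c * \<eta>)"
    by (rule c3) (use t(2) c(1) in \<open>auto simp: y_def intro: less_imp_le\<close>)
  then obtain xd where xd: "\<And>j. j < N \<Longrightarrow> G j xd = y j + of_real t * (a1 j - y j)" by blast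
  have "q (\<lambda>j. G j xd) = q (\<lambda>i. y i + of_real t * (a1 i - y i))"
    by (rule mpoly_cong[OF q(1)]) (rule xd)
  then have "q (\<lambda>j. G j xd) \<noteq> 0" using t(1) by simp
  then show ?thesis using q by blast
qed

text \<open>A small gradient value \<open>as\<close> off the branch hypersurface is fixed once, and
  its fibre supplies all the values in \<open>S\<close>. A near-critical \<open>x0\<close> is
  shifted slightly to lie over the complement of the hypersurface and then carried along an arc of
  gradients to the fibre of \<open>as\<close>. The bound \<open>1/8\<close> keeps the gradients on
  the arc, of size at most \<open>8 * \<epsilon>\<close>, in the unit polydisc.\<close>

lemma near_critical_values:
  assumes \<epsilon>: "0 < \<epsilon>" "\<epsilon> \<le> 1/8"
  shows "\<exists>S. finite S \<and> card S \<le> (e + P) ^ N \<and>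
    (\<forall>x0. (\<forall>j<N. norm (G j x0) \<le> \<epsilon>) \<longrightarrow> (\<exists>\<sigma>\<in>S. norm (ft x0 - \<sigma>) \<le> 9 * (real N + 1) * (R + 1) * \<epsilon>))"
proof -
  obtain D q a1 xd where q: "mpoly N D q" "q a1 \<noteq> 0" "\<And>x. w x = 0 \<Longrightarrow> q (\<lambda>j. G j x) = 0" and xd: "q (\<lambda>j. G j xd) \<noteq> 0"
    using eliminant by blast
  have qG: "mpoly N (D * (e + P)) (\<lambda>x. q (\<lambda>j. G j x))" by (rule mpoly_comp[OF mpoly_G q(1)])
  have 1: "\<forall>\<^sub>F t in at_right (0::real). q (\<lambda>i. 0 + of_real t * (a1 i - 0)) \<noteq> 0"
    by (rule mpoly_nonzero_line[OF q(1,2)])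
  have 2: "\<forall>\<^sub>F t in at_right (0::real). \<forall>i\<in>{..<N}. norm (of_real t * a1 i) < \<epsilon>"
  proof (rule eventually_ball_finite, rule finite_lessThan, rule ballI)
    fix i
    have "((\<lambda>t. norm (of_real t * a1 i)) \<longlongrightarrow> norm (of_real 0 * a1 i)) (at_right (0::real))"
      by (intro tendsto_intros)
    then have "((\<lambda>t. norm (of_real t * a1 i)) \<longlongrightarrow> 0) (at_right (0::real))" by simp
    then show "\<forall>\<^sub>F t in at_right (0::real). norm (of_real t * a1 i) < \<epsilon>"
      using \<epsilon>(1) by (rule order_tendstoD)
  qed
  from eventually_happens'[OF _ eventually_conj[OF 1 2]]
  obtain t0 where t0: "q (\<lambda>i. 0 + of_real t0 * (a1 i - 0)) \<noteq> 0" "\<And>i. i < N \<Longrightarrow> norm (of_real t0 * a1 i) < \<epsilon>"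
    by (auto simp: trivial_limit_at_right_real)
  \<comment> \<open>A point on the segment from \<open>0\<close> to \<open>a1\<close>, close to
    \<open>0\<close> and off the zero set of \<open>q\<close>.\<close>
  define as where "as = (\<lambda>i. of_real t0 * a1 i)"
  have as: "q as \<noteq> 0" "\<And>i. i < N \<Longrightarrow> norm (as i) \<le> \<epsilon>" using t0 by (auto simp: as_def less_imp_le)
  define F where "F = {x. (\<forall>i\<ge>N. x i = 0) \<and> (\<forall>j<N. G j x = as j)}"
  have F: "finite F" "card F \<le> (e + P) ^ N" using fibre_card[of as] unfolding F_def by auto
  show ?thesis
  proof (rule exI[of _ "v ` F"], intro conjI allI impI)
    show "finite (v ` F)" using F by simp
    show "card (v ` F) \<le> (e + P) ^ N" using F card_image_le[of F v] by linarith
    fix x0 assume x0: "\<forall>j<N. norm (G j x0) \<le> \<epsilon>"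
    \<comment> \<open>The gradient at \<open>x0\<close> itself may lie on the hypersurface; for
      small positive \<open>t\<close> the gradient at \<open>L t\<close> does not.\<close>
    define L where "L = (\<lambda>t::real. \<lambda>i. x0 i + of_real t * (xd i - x0 i))"
    have Lt: "((\<lambda>t. L t i) \<longlongrightarrow> x0 i) (at_right 0)" for i
    proof -
      have "((\<lambda>t. L t i) \<longlongrightarrow> x0 i + of_real 0 * (xd i - x0 i)) (at_right 0)"
        unfolding L_def by (intro tendsto_intros)
      then show ?thesis by simp
    qed
    have mt: "((\<lambda>t. f (L t)) \<longlongrightarrow> f x0) (at_right 0)" if "mpoly N k f" for f k
      by (rule mpoly_tendsto[OF that]) (rule Lt)
    have A: "\<forall>\<^sub>F t in at_right (0::real). q (\<lambda>j. G j (L t)) \<noteq> 0"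
      using mpoly_nonzero_line[OF qG, of xd x0] xd unfolding L_def by simp
    have B: "\<forall>\<^sub>F t in at_right (0::real). \<forall>i\<in>{..<N}. norm (G i (L t)) < 2 * \<epsilon>"
    proof (rule eventually_ball_finite, rule finite_lessThan, rule ballI)
      fix i assume i: "i \<in> {..<N}"
      have "((\<lambda>t. norm (G i (L t))) \<longlongrightarrow> norm (G i x0)) (at_right (0::real))"
        using mt[OF mpoly_G] i by (intro tendsto_norm) simp
      moreover have "norm (G i x0) < 2 * \<epsilon>" using x0[rule_format, of i] i \<epsilon> by simp
      ultimately show "\<forall>\<^sub>F t in at_right (0::real). norm (G i (L t)) < 2 * \<epsilon>" by (rule order_tendstoD)
    qed
    have C: "\<forall>\<^sub>F t in at_right (0::real). norm (ft (L t) - ft x0) < \<epsilon>"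
    proof -
      have "((\<lambda>t. norm (ft (L t) - ft x0)) \<longlongrightarrow> norm (ft x0 - ft x0)) (at_right (0::real))"
        by (intro tendsto_norm tendsto_diff tendsto_const mt[OF mpoly_ft])
      then show ?thesis by (rule order_tendstoD(2)) (use \<epsilon> in simp)
    qed
    from eventually_happens'[OF _ eventually_conj[OF A eventually_conj[OF B C]]]
    obtain t where t: "q (\<lambda>j. G j (L t)) \<noteq> 0" "\<And>i. i < N \<Longrightarrow> norm (G i (L t)) < 2 * \<epsilon>" "norm (ft (L t) - ft x0) < \<epsilon>"
      by (auto simp: trivial_limit_at_right_real)
    define x where "x = L t"
    define b where "b = (\<lambda>j. as j - G j x)"
    have bb: "norm (b j) \<le> 3 * \<epsilon>" if "j < N" for j
      unfolding b_def x_def using norm_triangle_ineq4[of "as j" "G j (L t)"] t(2)[OF that] as(2)[OF that] by simp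
    \<comment> \<open>The parameters at which the complex line through the gradient at
      \<open>x\<close> and \<open>as\<close> meets the hypersurface; neither of these two points
      lies on it.\<close>
    define Z where "Z = {s. q (\<lambda>i. G i x + s * b i) = 0}"
    have "finite Z" unfolding Z_def by (rule mpoly_finite_zeros_line[OF q(1)]) (use t(1) in \<open>simp add: x_def\<close>)
    moreover have "0 \<notin> Z" unfolding Z_def using t(1) by (simp add: x_def)
    moreover have "1 \<notin> Z" unfolding Z_def using as(1) by (simp add: b_def)
    ultimately obtain \<eta> where \<eta>: "0 < \<eta>" "\<eta> \<le> (1::real)" "\<And>\<tau>. 0 \<le> \<tau> \<Longrightarrow> \<tau> \<le> 1 \<Longrightarrow> Complex \<tau> (\<eta> * (\<tau> * (1 - \<tau>))) \<notin> Z"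
      using avoiding_arc[of Z] by metis
    define T where "T = (\<lambda>\<tau>. Complex \<tau> (\<eta> * (\<tau> * (1 - \<tau>))))"
    have TL: "norm (T s - T u) \<le> 2 * \<bar>s - u\<bar>" if "0 \<le> s" "s \<le> 1" "0 \<le> u" "u \<le> 1" for s u
    proof -
      have "norm (T s - T u) \<le> \<bar>Re (T s - T u)\<bar> + \<bar>Im (T s - T u)\<bar>" by (rule cmod_le)
      also have "Im (T s - T u) = \<eta> * ((s - u) * (1 - s - u))" by (simp add: T_def algebra_simps)
      also have "\<bar>\<eta> * ((s - u) * (1 - s - u))\<bar> \<le> 1 * (\<bar>s - u\<bar> * 1)"
        unfolding abs_mult using \<eta> that by (intro mult_mono) auto
      finally show ?thesis by (simp add: T_def)
    qed
    \<comment> \<open>The arc parameter has Lipschitz constant \<open>2\<close> and the displacement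
      \<open>b\<close> is at most \<open>3 * \<epsilon>\<close>; hence the constant
      \<open>6 * \<epsilon>\<close> below.\<close>
    define a where "a = (\<lambda>\<tau> j. G j x + T \<tau> * b j)"
    have T0: "T 0 = 0" "T 1 = 1" unfolding T_def by (auto simp: zero_complex.code one_complex.code)
    have "\<exists>y. (\<forall>j<N. G j y = a 1 j) \<and> norm (v y - v x) \<le> (real N * R + 1) * (6 * \<epsilon>)"
    proof (rule continuation[where a = a and \<theta> = "6 * \<epsilon>"])
      fix s u j assume *: "0 \<le> s" "s \<le> (1::real)" "0 \<le> u" "u \<le> (1::real)" "j < N"
      have "a s j - a u j = (T s - T u) * b j" by (simp add: a_def algebra_simps)
      then have "norm (a s j - a u j) = norm (T s - T u) * norm (b j)" by (simp add: norm_mult)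
      also have "\<dots> \<le> (2 * \<bar>s - u\<bar>) * (3 * \<epsilon>)" using TL[OF *(1-4)] bb[OF *(5)] by (intro mult_mono) auto
      finally show "norm (a s j - a u j) \<le> 6 * \<epsilon> * \<bar>s - u\<bar>" by (simp add: algebra_simps)
    next
      show "0 \<le> 6 * \<epsilon>" using \<epsilon> by simp
    next
      fix s j assume *: "0 \<le> s" "s \<le> (1::real)" "j < N"
      have "norm (T s) \<le> 2" using TL[of s 0] * T0 by simp
      then have "norm (T s * b j) \<le> 2 * (3 * \<epsilon>)" unfolding norm_mult using bb[OF *(3)] by (intro mult_mono) auto
      then have "norm (a s j) \<le> 2 * \<epsilon> + 6 * \<epsilon>"
        unfolding a_def using t(2)[OF *(3)] by (intro norm_triangle_le) (simp add: x_def)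
      then show "norm (a s j) \<le> 1" using \<epsilon> by simp
    next
      fix s y assume *: "0 \<le> s" "s \<le> (1::real)" "\<And>j. j < N \<Longrightarrow> G j y = a s j"
      have "q (\<lambda>j. G j y) = q (a s)" by (rule mpoly_cong[OF q(1)]) (rule *(3))
      moreover have "q (a s) \<noteq> 0" using \<eta>(3)[OF *(1,2)] unfolding Z_def a_def T_def by simp
      ultimately show "w y \<noteq> 0" using q(3) by auto
    next
      show "G j x = a 0 j" if "j < N" for j by (simp add: a_def T0)
    qed
    then obtain y where y: "\<And>j. j < N \<Longrightarrow> G j y = as j" "norm (v y - v x) \<le> (real N * R + 1) * (6 * \<epsilon>)"
      by (auto simp: a_def T0 b_def)
    \<comment> \<open>Only the first \<open>N\<close> coordinates matter; the others are cleared to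
      land in the normalised fibre \<open>F\<close>.\<close>
    define y' where "y' = (\<lambda>i. if i < N then y i else 0)"
    have "G j y' = as j" if "j < N" for j
      using mpoly_cong[OF mpoly_G[OF that], of y' y] y(1)[OF that] by (simp add: y'_def)
    then have "y' \<in> F" unfolding F_def y'_def by simp
    moreover have vy: "v y' = v y" by (rule mpoly_cong[OF mpoly_v]) (simp add: y'_def)
    moreover have "norm (ft x0 - v y) \<le> 9 * (real N + 1) * (R + 1) * \<epsilon>"
    proof -
      have xR: "norm (x i) \<le> R" if "i < N" for i
      proof (rule fibre_bound[OF _ that])
        show "norm (G j x) \<le> 1" if "j < N" for j using t(2)[OF that] \<epsilon> by (simp add: x_def)
      qed
      have "norm (\<Sum>j<N. G j x * x j) \<le> (\<Sum>j<N. (2 * \<epsilon>) * R)"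
        by (intro order_trans[OF norm_sum] sum_mono) (use xR t(2) \<epsilon> in \<open>auto simp: norm_mult x_def less_imp_le intro!: mult_mono\<close>)
      then have A1: "norm (ft x - v x) \<le> real N * (2 * \<epsilon> * R)" by (simp add: v_def)
      have A2: "norm (ft x0 - ft x) \<le> \<epsilon>" using t(3) by (simp add: x_def norm_minus_commute)
      have "ft x0 - v y = (ft x0 - ft x) + ((ft x - v x) + (v x - v y))" by simp
      then have "norm (ft x0 - v y) \<le> norm (ft x0 - ft x) + (norm (ft x - v x) + norm (v x - v y))"
        by (metis norm_triangle_mono order_refl norm_triangle_ineq)
      \<comment> \<open>The contributions are the shift of the base point, the difference between
        \<open>ft\<close> and \<open>v\<close> at \<open>x\<close>, and the variation of
        \<open>v\<close> along the arc.\<close>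
      also have "\<dots> \<le> \<epsilon> + (real N * (2 * \<epsilon> * R) + (real N * R + 1) * (6 * \<epsilon>))"
        using A1 A2 y(2) by (simp add: norm_minus_commute)
      also have "\<dots> = (7 + 8 * (real N * R)) * \<epsilon>" by (simp add: algebra_simps)
      also have "\<dots> \<le> (9 * (real N + 1) * (R + 1)) * \<epsilon>"
      proof (rule mult_right_mono)
        have "0 \<le> real N * R" using R by simp
        then show "7 + 8 * (real N * R) \<le> 9 * (real N + 1) * (R + 1)" using R by (simp add: algebra_simps)
      qed (use \<epsilon> in simp)
      finally show ?thesis .
    qed
    ultimately show "\<exists>\<sigma>\<in>v ` F. norm (ft x0 - \<sigma>) \<le> 9 * (real N + 1) * (R + 1) * \<epsilon>" by (metis imageI)
  qed
qed

end

section \<open>Near-critical values of polynomial maps\<close>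

no_notation scalar_prod (infix \<open>\<bullet>\<close> 70)

text \<open>A list over \<open>{..N}\<close> encodes a monomial, the letter \<open>N\<close> standing for the factor \<open>1\<close>, so that the lists of
  length \<open>d\<close> give all monomials of degree at most \<open>d\<close>.\<close>
definition ev :: "nat \<Rightarrow> (nat \<Rightarrow> 'a) \<Rightarrow> nat \<Rightarrow> 'a::comm_ring_1" where
  "ev N x i = (if i < N then x i else 1)"

definition lmon :: "nat \<Rightarrow> (nat \<Rightarrow> 'a) \<Rightarrow> nat list \<Rightarrow> 'a::comm_ring_1" where
  "lmon N x I = prod_list (map (ev N x) I)"

text \<open>The formal partial derivative by the product rule; the guard \<open>i < N\<close>
  excludes the letter that stands for \<open>1\<close>.\<close>

fun dlmon :: "nat \<Rightarrow> nat \<Rightarrow> (nat \<Rightarrow> 'a) \<Rightarrow> nat list \<Rightarrow> 'a::comm_ring_1" where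
  "dlmon N j x [] = 0"
| "dlmon N j x (i # I) = (if i = j \<and> i < N then lmon N x I else 0) + ev N x i * dlmon N j x I"

definition lists_n :: "nat \<Rightarrow> nat \<Rightarrow> nat list set" where
  "lists_n N d = {I. set I \<subseteq> {..N} \<and> length I = d}"

lemma finite_lists_n: "finite (lists_n N d)"
  unfolding lists_n_def by (rule finite_lists_length_eq) simp

lemma card_lists_n: "card (lists_n N d) = (N + 1) ^ d"
  unfolding lists_n_def by (subst card_lists_length_eq) auto

lemma lmon_Nil [simp]: "lmon N x [] = 1"
  and lmon_Cons: "lmon N x (i # I) = ev N x i * lmon N x I"
  by (simp_all add: lmon_def)

lemma lmon_append: "lmon N x (I @ J) = lmon N x I * lmon N x J"
  by (simp add: lmon_def)

lemma ev_of_real: "ev N (\<lambda>i. complex_of_real (x i)) i = of_real (ev N x i)"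
  by (simp add: ev_def)

lemma lmon_of_real: "lmon N (\<lambda>i. complex_of_real (x i)) I = of_real (lmon N x I)"
  by (induction I) (simp_all add: lmon_Cons ev_of_real)

lemma dlmon_of_real: "dlmon N j (\<lambda>i. complex_of_real (x i)) I = of_real (dlmon N j x I)"
  by (induction I) (simp_all add: lmon_of_real ev_of_real)

lemma lmon_cong: "(\<And>i. i < N \<Longrightarrow> x i = y i) \<Longrightarrow> lmon N x I = lmon N y I"
  unfolding lmon_def ev_def by (metis (no_types, lifting) map_eq_conv)

lemma dlmon_cong: "(\<And>i. i < N \<Longrightarrow> x i = y i) \<Longrightarrow> dlmon N j x I = dlmon N j y I"
  by (induction I) (simp_all add: ev_def lmon_cong[of N x y])

lemma norm_lmon:
  fixes x :: "nat \<Rightarrow> 'a::real_normed_field"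
  assumes "1 \<le> \<rho>" "\<And>i. i < N \<Longrightarrow> norm (x i) \<le> \<rho>"
  shows "norm (lmon N x I) \<le> \<rho> ^ length I"
proof (induction I)
  case (Cons i I)
  have "norm (ev N x i) \<le> \<rho>" using assms by (simp add: ev_def)
  then show ?case unfolding lmon_Cons norm_mult using Cons assms(1) by (simp add: mult_mono)
qed simp

lemma norm_dlmon:
  fixes x :: "nat \<Rightarrow> 'a::real_normed_field"
  assumes "1 \<le> \<rho>" "\<And>i. i < N \<Longrightarrow> norm (x i) \<le> \<rho>"
  shows "norm (dlmon N j x I) \<le> real (length I) * \<rho> ^ length I"
proof (induction I)
  case (Cons i I)
  have e: "norm (ev N x i) \<le> \<rho>" using assms by (simp add: ev_def)
  have "norm (if i = j \<and> i < N then lmon N x I else 0) \<le> \<rho> ^ length I"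
    using norm_lmon[of \<rho> N x I] assms by auto
  also have "\<dots> \<le> \<rho> ^ length (i # I)" using assms(1) by (intro power_increasing) auto
  finally have 1: "norm (if i = j \<and> i < N then lmon N x I else 0) \<le> \<rho> ^ length (i # I)" .
  have "norm (ev N x i * dlmon N j x I) \<le> \<rho> * (real (length I) * \<rho> ^ length I)"
    unfolding norm_mult using e Cons assms(1) by (intro mult_mono) auto
  then have 2: "norm (ev N x i * dlmon N j x I) \<le> real (length I) * \<rho> ^ length (i # I)" by (simp add: algebra_simps)
  have "norm (dlmon N j x (i # I)) \<le> norm (if i = j \<and> i < N then lmon N x I else 0) + norm (ev N x i * dlmon N j x I)"
    unfolding dlmon.simps by (rule norm_triangle_ineq)
  also have "\<dots> \<le> \<rho> ^ length (i # I) + real (length I) * \<rho> ^ length (i # I)" using 1 2 by (rule add_mono)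
  also have "\<dots> = real (length (i # I)) * \<rho> ^ length (i # I)" by (simp add: algebra_simps)
  finally show ?case .
qed simp

lemma mpoly_ev: "N \<le> N' \<Longrightarrow> mpoly N' 1 (\<lambda>x. ev N x i)"
  by (cases "i < N") (auto simp: ev_def intro: mpoly_const mpoly_var)

lemma mpoly_lmon: "N \<le> N' \<Longrightarrow> mpoly N' (length I) (\<lambda>x. lmon N x I)"
proof (induction I)
  case Nil
  then show ?case using mpoly_const[of N' 0 1] by simp
next
  case (Cons i I)
  then show ?case unfolding lmon_Cons using mpoly_mult[OF mpoly_ev[of N N' i], of "length I" "\<lambda>x. lmon N x I" "length (i # I)"] by simp
qed

lemma mpoly_dlmon: "N \<le> N' \<Longrightarrow> mpoly N' (length I) (\<lambda>x. dlmon N j x I)"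
proof (induction I)
  case Nil
  then show ?case using mpoly_const[of N' 0 0] by simp
next
  case (Cons i I)
  have 1: "mpoly N' (length (i # I)) (\<lambda>x. if i = j \<and> i < N then lmon N x I else 0)"
  proof (cases "i = j \<and> i < N")
    case True
    then show ?thesis using mpoly_mono[OF mpoly_lmon[OF Cons.prems, of I], of "length (i # I)"] by simp
  next
    case False
    then show ?thesis using mpoly_const[of N' "length (i # I)" 0] by (simp only: if_False)
  qed
  have 2: "mpoly N' (length (i # I)) (\<lambda>x. ev N x i * dlmon N j x I)"
    by (rule mpoly_mult[OF mpoly_ev[OF Cons.prems] Cons.IH[OF Cons.prems]]) simp
  show ?case unfolding dlmon.simps by (rule mpoly_add[OF 1 2])
qed

lemma has_grad_ev: "N \<le> N' \<Longrightarrow> has_grad N' (\<lambda>x. ev N x i) (\<lambda>j x. if i = j \<and> i < N then 1 else 0)"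
proof (cases "i < N")
  case True
  assume "N \<le> N'"
  then have "has_grad N' (\<lambda>x. x i) (\<lambda>j x. if j = i then 1 else 0)" using True by (intro has_grad_var) simp
  then have "has_grad N' (\<lambda>x. x i) (\<lambda>j x. if i = j \<and> i < N then 1 else 0)" by (rule has_grad_cong) (use True in auto)
  then show ?thesis using True by (simp add: ev_def)
next
  case False
  then show ?thesis using has_grad_const[of N' 1] by (simp add: ev_def)
qed

lemma has_grad_lmon: "N \<le> N' \<Longrightarrow> has_grad N' (\<lambda>x. lmon N x I) (\<lambda>j x. dlmon N j x I)"
proof (induction I)
  case Nil
  then show ?case using has_grad_const[of N' 1] by simp
next
  case (Cons i I)
  have m: "mpoly N' 0 (\<lambda>x. if i = j \<and> i < N then 1 else 0)" for j by (rule mpoly_const)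
  from has_grad_mult[OF has_grad_ev[OF Cons.prems] Cons.IH[OF Cons.prems] mpoly_ev[OF Cons.prems] mpoly_lmon[OF Cons.prems] m mpoly_dlmon[OF Cons.prems]]
  have "has_grad N' (\<lambda>x. ev N x i * lmon N x I) (\<lambda>j x. (if i = j \<and> i < N then 1 else 0) * lmon N x I + ev N x i * dlmon N j x I)" .
  then have "has_grad N' (\<lambda>x. ev N x i * lmon N x I) (\<lambda>j x. dlmon N j x (i # I))" by (rule has_grad_cong) simp
  then show ?case by (simp add: lmon_Cons)
qed

definition lpoly :: "nat \<Rightarrow> nat \<Rightarrow> (nat list \<Rightarrow> real) \<Rightarrow> (nat \<Rightarrow> complex) \<Rightarrow> complex" where
  "lpoly N d c x = (\<Sum>I\<in>lists_n N d. of_real (c I) * lmon N x I)"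

definition dlpoly :: "nat \<Rightarrow> nat \<Rightarrow> (nat list \<Rightarrow> real) \<Rightarrow> nat \<Rightarrow> (nat \<Rightarrow> complex) \<Rightarrow> complex" where
  "dlpoly N d c j x = (\<Sum>I\<in>lists_n N d. of_real (c I) * dlmon N j x I)"

lemma mpoly_lpoly: "N \<le> N' \<Longrightarrow> mpoly N' d (lpoly N d c)"
  unfolding lpoly_def[abs_def]
proof (intro mpoly_sum mpoly_scale)
  fix I assume "N \<le> N'" "I \<in> lists_n N d"
  then show "mpoly N' d (\<lambda>x. lmon N x I)" using mpoly_lmon[of N N' I] by (simp add: lists_n_def)
qed

lemma mpoly_dlpoly: "N \<le> N' \<Longrightarrow> mpoly N' d (dlpoly N d c j)"
  unfolding dlpoly_def[abs_def]
proof (intro mpoly_sum mpoly_scale)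
  fix I assume "N \<le> N'" "I \<in> lists_n N d"
  then show "mpoly N' d (\<lambda>x. dlmon N j x I)" using mpoly_dlmon[of N N' I j] by (simp add: lists_n_def)
qed

lemma has_grad_lpoly: "N \<le> N' \<Longrightarrow> has_grad N' (lpoly N d c) (dlpoly N d c)"
  unfolding lpoly_def[abs_def] dlpoly_def[abs_def]
  by (intro has_grad_sum has_grad_scale[OF has_grad_lmon mpoly_lmon mpoly_dlmon])

text \<open>In the application \<open>d\<close> is fixed by the step of the group while
  \<open>N\<close> grows, so uniformly bounded coefficients give values that grow only polynomially
  in \<open>N\<close>.\<close>

lemma norm_lpoly:
  assumes "\<And>I. I \<in> lists_n N d \<Longrightarrow> \<bar>c I\<bar> \<le> C" "1 \<le> \<rho>" "\<And>i. i < N \<Longrightarrow> norm (x i) \<le> \<rho>"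
  shows "norm (lpoly N d c x) \<le> C * (real N + 1) ^ d * \<rho> ^ d"
proof -
  have "norm (lpoly N d c x) \<le> (\<Sum>I\<in>lists_n N d. C * \<rho> ^ d)"
    unfolding lpoly_def
  proof (intro order_trans[OF norm_sum] sum_mono)
    fix I assume I: "I \<in> lists_n N d"
    then have "norm (lmon N x I) \<le> \<rho> ^ d" using norm_lmon[of \<rho> N x I] assms(2,3) by (simp add: lists_n_def)
    then show "norm (of_real (c I) * lmon N x I) \<le> C * \<rho> ^ d"
      unfolding norm_mult norm_of_real using assms(1)[OF I] by (intro mult_mono) (auto intro: order_trans[OF abs_ge_zero])
  qed
  then show ?thesis by (simp add: card_lists_n algebra_simps)
qed

lemma norm_dlpoly:
  assumes "\<And>I. I \<in> lists_n N d \<Longrightarrow> \<bar>c I\<bar> \<le> C" "1 \<le> \<rho>" "\<And>i. i < N \<Longrightarrow> norm (x i) \<le> \<rho>"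
  shows "norm (dlpoly N d c j x) \<le> C * (real N + 1) ^ d * real d * \<rho> ^ d"
proof -
  have "norm (dlpoly N d c j x) \<le> (\<Sum>I\<in>lists_n N d. C * (real d * \<rho> ^ d))"
    unfolding dlpoly_def
  proof (intro order_trans[OF norm_sum] sum_mono)
    fix I assume I: "I \<in> lists_n N d"
    then have "norm (dlmon N j x I) \<le> real d * \<rho> ^ d" using norm_dlmon[of \<rho> N x j I] assms(2,3) by (simp add: lists_n_def)
    then show "norm (of_real (c I) * dlmon N j x I) \<le> C * (real d * \<rho> ^ d)"
      unfolding norm_mult norm_of_real using assms(1)[OF I] by (intro mult_mono) (auto intro: order_trans[OF abs_ge_zero])
  qed
  then show ?thesis by (simp add: card_lists_n algebra_simps)
qed

text \<open>A near-critical point \<open>x\<close> of the vector-valued map \<open>(F\<^sub>k)\<close> with normalised covector \<open>(1, -\<mu>)\<close> whose remaining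
  coordinates are close to \<open>y\<close> is a near-critical point \<open>(x, \<mu>)\<close> of the scalar function \<open>F0 - (\<Sum>k. \<mu>\<^sub>k (F\<^sub>k - y\<^sub>k))\<close>.\<close>
lemma near_critical_lagrange:
  fixes c0 :: "nat list \<Rightarrow> real" and c :: "nat \<Rightarrow> nat list \<Rightarrow> real" and y :: "nat \<Rightarrow> real" and K :: "nat set"
  assumes K: "K \<subseteq> {..<m}" and d: "1 \<le> d" and P: "1 \<le> P"
    and c0: "\<And>I. I \<in> lists_n N d \<Longrightarrow> \<bar>c0 I\<bar> \<le> C" and c: "\<And>k I. k \<in> K \<Longrightarrow> I \<in> lists_n N d \<Longrightarrow> \<bar>c k I\<bar> \<le> C"
    and y: "\<And>k. k \<in> K \<Longrightarrow> \<bar>y k\<bar> \<le> Y" and Y: "0 \<le> Y" and C: "0 \<le> C"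
    and M: "1 \<le> M" and \<epsilon>: "0 < \<epsilon>" and R: "1 \<le> R"
    and RP: "(1 + 2 * real m) * (C * (real N + 1) ^ d * real d + Y) + 1 \<le> \<epsilon> * R ^ P"
    and small: "\<epsilon> * (1 + real (d + P + 2) * M ^ (d + P + 1)) \<le> 1/8"
  shows "\<exists>S. finite S \<and> card S \<le> (d + P + 1) ^ (N + m) \<and>
    (\<forall>x \<mu>. (\<forall>i<N. \<bar>x i\<bar> \<le> M) \<longrightarrow> (\<forall>k\<in>K. \<bar>\<mu> k\<bar> \<le> 1) \<longrightarrow>
      (\<forall>j<N. norm (dlpoly N d c0 j (\<lambda>i. of_real (x i)) - (\<Sum>k\<in>K. of_real (\<mu> k) * dlpoly N d (c k) j (\<lambda>i. of_real (x i)))) \<le> \<epsilon>) \<longrightarrow>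
      (\<forall>k\<in>K. norm (lpoly N d (c k) (\<lambda>i. of_real (x i)) - of_real (y k)) \<le> \<epsilon>) \<longrightarrow>
      (\<exists>\<sigma>\<in>S. norm (lpoly N d c0 (\<lambda>i. of_real (x i)) - \<sigma>) \<le>
         (9 * (real (N + m) + 1) * (R + 1) * (1 + real (d + P + 2) * M ^ (d + P + 1)) + real (N + m) * M ^ (d + P + 2) + real m) * \<epsilon>))"
proof -
  define N' where "N' = N + m"
  have NN: "N \<le> N'" by (simp add: N'_def)
  have kN: "N + k < N'" if "k \<in> K" for k using K that by (auto simp: N'_def)
  have fK: "finite K" using K finite_subset by blast
  have cK: "real (card K) \<le> real m" using card_mono[OF _ K] by simp
  \<comment> \<open>The Lagrange function; coordinate \<open>N + k\<close> is the multiplier of the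
    constraint \<open>k\<close>. Coordinates with \<open>k\<close> outside \<open>K\<close> are
    dummies that keep the number of variables equal to \<open>N + m\<close>.\<close>
  define f where "f = (\<lambda>x. lpoly N d c0 x - (\<Sum>k\<in>K. x (N + k) * (lpoly N d (c k) x - of_real (y k))))"
  \<comment> \<open>Left in the shape that the product rule produces, so that it matches
    \<open>has_grad_mult\<close> literally.\<close>
  define g where "g = (\<lambda>j x. dlpoly N d c0 j x + (- (\<Sum>k\<in>K. (if j = N + k then 1 else 0) * (lpoly N d (c k) x + (- of_real (y k)))
      + x (N + k) * (dlpoly N d (c k) j x + 0))))"
  have mf: "mpoly N' (d + 1) f" unfolding f_def
  proof (intro mpoly_diff mpoly_sum)
    show "mpoly N' (d + 1) (lpoly N d c0)" by (rule mpoly_mono[OF mpoly_lpoly[OF NN]]) simp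
    show "mpoly N' (d + 1) (\<lambda>x. x (N + k) * (lpoly N d (c k) x - complex_of_real (y k)))" if k: "k \<in> K" for k
      by (rule mpoly_mult[OF mpoly_var[OF kN[OF k], of 1] mpoly_diff[OF mpoly_lpoly[OF NN] mpoly_const]]) auto
  qed
  have mg: "mpoly N' (d + 1) (g j)" for j unfolding g_def
  proof (intro mpoly_add mpoly_uminus mpoly_sum)
    show "mpoly N' (d + 1) (dlpoly N d c0 j)" by (rule mpoly_mono[OF mpoly_dlpoly[OF NN]]) simp
    show "mpoly N' (d + 1) (\<lambda>x. (if j = N + k then 1 else 0) * (lpoly N d (c k) x + (- complex_of_real (y k))))" for k
      by (rule mpoly_scale, rule mpoly_mono[of _ d], rule mpoly_add[OF mpoly_lpoly[OF NN] mpoly_const]) simp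
    show "mpoly N' (d + 1) (\<lambda>x. x (N + k) * (dlpoly N d (c k) j x + 0))" if k: "k \<in> K" for k
      by (rule mpoly_mult[OF mpoly_var[OF kN[OF k], of 1] mpoly_add[OF mpoly_dlpoly[OF NN] mpoly_const]]) auto
  qed
  have fg: "has_grad N' f g"
  proof -
    have a: "has_grad N' (\<lambda>x. x (N + k) * (lpoly N d (c k) x + (- of_real (y k))))
       (\<lambda>j x. (if j = N + k then 1 else 0) * (lpoly N d (c k) x + (- of_real (y k))) + x (N + k) * (dlpoly N d (c k) j x + 0))" if k: "k \<in> K" for k
    proof (rule has_grad_mult)
      show "has_grad N' (\<lambda>x. x (N + k)) (\<lambda>j x. if j = N + k then 1 else 0)" by (rule has_grad_var[OF kN[OF k]])
      show "has_grad N' (\<lambda>x. lpoly N d (c k) x + (- of_real (y k))) (\<lambda>j x. dlpoly N d (c k) j x + 0)"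
        by (rule has_grad_add[OF has_grad_lpoly[OF NN] has_grad_const])
      show "mpoly N' 1 (\<lambda>x. x (N + k))" using kN[OF k] by (rule mpoly_var) simp
      show "mpoly N' d (\<lambda>x. lpoly N d (c k) x + (- of_real (y k)))"
        by (rule mpoly_add[OF mpoly_lpoly[OF NN] mpoly_const])
      show "mpoly N' 0 (\<lambda>x. if j = N + k then 1 else 0)" for j by (rule mpoly_const)
      show "mpoly N' d (\<lambda>x. dlpoly N d (c k) j x + 0)" for j
        by (rule mpoly_add[OF mpoly_dlpoly[OF NN] mpoly_const])
    qed
    define s where "s = (\<lambda>x. \<Sum>k\<in>K. x (N + k) * (lpoly N d (c k) x + (- of_real (y k))))"
    define s' where "s' = (\<lambda>j x. \<Sum>k\<in>K. (if j = N + k then 1 else 0) * (lpoly N d (c k) x + (- of_real (y k))) + x (N + k) * (dlpoly N d (c k) j x + 0))"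
    have "has_grad N' s s'" unfolding s_def s'_def by (rule has_grad_sum) (rule a)
    moreover have "mpoly N' (d + 1) s" unfolding s_def
    proof (rule mpoly_sum)
      show "mpoly N' (d + 1) (\<lambda>x. x (N + k) * (lpoly N d (c k) x + - complex_of_real (y k)))" if k: "k \<in> K" for k
        by (rule mpoly_mult[OF mpoly_var[OF kN[OF k], of 1] mpoly_add[OF mpoly_lpoly[OF NN] mpoly_const]]) auto
    qed
    moreover have "mpoly N' (d + 1) (s' j)" for j unfolding s'_def
    proof (intro mpoly_sum mpoly_add)
      show "mpoly N' (d + 1) (\<lambda>x. (if j = N + k then 1 else 0) * (lpoly N d (c k) x + (- complex_of_real (y k))))" for k
        by (rule mpoly_scale, rule mpoly_mono[of _ d], rule mpoly_add[OF mpoly_lpoly[OF NN] mpoly_const]) simp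
      show "mpoly N' (d + 1) (\<lambda>x. x (N + k) * (dlpoly N d (c k) j x + 0))" if k: "k \<in> K" for k
        by (rule mpoly_mult[OF mpoly_var[OF kN[OF k], of 1] mpoly_add[OF mpoly_dlpoly[OF NN] mpoly_const]]) auto
    qed
    ultimately have "has_grad N' (\<lambda>x. (-1) * s x) (\<lambda>j x. (-1) * s' j x)" by (rule has_grad_scale)
    from has_grad_add[OF has_grad_lpoly[OF NN] this]
    have h: "has_grad N' (\<lambda>x. lpoly N d c0 x + (-1) * s x) (\<lambda>j x. dlpoly N d c0 j x + (-1) * s' j x)" .
    have e1: "(\<lambda>x. lpoly N d c0 x + (-1) * s x) = f" unfolding f_def s_def by (rule ext) simp
    have e2: "(\<lambda>j x. dlpoly N d c0 j x + (-1) * s' j x) = g" unfolding g_def s'_def by (intro ext) simp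
    show ?thesis using h unfolding e1 e2 .
  qed
  define C1 where "C1 = C * (real N + 1) ^ d * real d"
  have C10: "0 \<le> C1" unfolding C1_def using C by simp
  \<comment> \<open>Each of the at most \<open>m\<close> constraints contributes two terms of size
    \<open>C1 + Y\<close>, one from differentiating the multiplier and one from differentiating the
    constraint.\<close>
  define Cg where "Cg = (1 + 2 * real m) * (C1 + Y)"
  have Cle: "C * (real N + 1) ^ d \<le> C1"
  proof -
    have "C * (real N + 1) ^ d * 1 \<le> C1" unfolding C1_def using C d by (intro mult_left_mono) auto
    then show ?thesis by simp
  qed
  have growth: "norm (g j x) \<le> Cg * \<rho> ^ (d + 1)" if \<rho>: "1 \<le> \<rho>" and x: "\<And>i. i < N' \<Longrightarrow> norm (x i) \<le> \<rho>" for j x \<rho>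
  proof -
    have xN: "\<And>i. i < N \<Longrightarrow> norm (x i) \<le> \<rho>" using x NN by simp
    have p1: "\<rho> ^ d \<le> \<rho> ^ (d + 1)" "1 \<le> \<rho> ^ (d + 1)" using \<rho> by (simp_all only: power_increasing one_le_power)
    have dl: "norm (dlpoly N d c0 j x) \<le> C1 * \<rho> ^ (d + 1)"
    proof -
      have "norm (dlpoly N d c0 j x) \<le> C1 * \<rho> ^ d" unfolding C1_def by (rule norm_dlpoly[OF c0 \<rho> xN])
      also have "\<dots> \<le> C1 * \<rho> ^ (d + 1)" using p1(1) C10 by (rule mult_left_mono)
      finally show ?thesis .
    qed
    have tk: "norm ((if j = N + k then 1 else 0) * (lpoly N d (c k) x + (- of_real (y k))) + x (N + k) * (dlpoly N d (c k) j x + 0))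
      \<le> 2 * (C1 + Y) * \<rho> ^ (d + 1)" if k: "k \<in> K" for k
    proof -
      have l1: "norm (lpoly N d (c k) x) \<le> C * (real N + 1) ^ d * \<rho> ^ d" by (rule norm_lpoly[OF c[OF k] \<rho> xN])
      also have "\<dots> \<le> C1 * \<rho> ^ (d + 1)" using Cle p1 C10 \<rho> C by (intro mult_mono) auto
      finally have l: "norm (lpoly N d (c k) x) \<le> C1 * \<rho> ^ (d + 1)" .
      have "\<bar>y k\<bar> \<le> Y * 1" using y[OF k] by simp
      also have "\<dots> \<le> Y * \<rho> ^ (d + 1)" using Y p1 by (intro mult_left_mono)
      finally have "norm (lpoly N d (c k) x + (- of_real (y k))) \<le> C1 * \<rho> ^ (d + 1) + Y * \<rho> ^ (d + 1)"
        using l norm_triangle_ineq4[of "lpoly N d (c k) x" "of_real (y k)"] by simp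
      then have A: "norm ((if j = N + k then 1 else 0) * (lpoly N d (c k) x + (- of_real (y k)))) \<le> (C1 + Y) * \<rho> ^ (d + 1)"
        using C10 Y \<rho> by (auto simp: algebra_simps)
      have "norm (x (N + k)) \<le> \<rho>" using x kN[OF k] by blast
      moreover have "norm (dlpoly N d (c k) j x) \<le> C1 * \<rho> ^ d"
        unfolding C1_def by (rule norm_dlpoly[OF c[OF k] \<rho> xN])
      ultimately have "norm (x (N + k) * (dlpoly N d (c k) j x + 0)) \<le> \<rho> * (C1 * \<rho> ^ d)"
        unfolding norm_mult using \<rho> by (intro mult_mono) auto
      also have "\<dots> \<le> (C1 + Y) * \<rho> ^ (d + 1)" using Y \<rho> by (simp add: algebra_simps)
      finally have B: "norm (x (N + k) * (dlpoly N d (c k) j x + 0)) \<le> (C1 + Y) * \<rho> ^ (d + 1)" .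
      show ?thesis by (rule order_trans[OF norm_triangle_ineq]) (use add_mono[OF A B] in \<open>simp only: mult_2 distrib_right\<close>)
    qed
    have "norm (\<Sum>k\<in>K. (if j = N + k then 1 else 0) * (lpoly N d (c k) x + (- of_real (y k))) + x (N + k) * (dlpoly N d (c k) j x + 0))
      \<le> real (card K) * (2 * (C1 + Y) * \<rho> ^ (d + 1))"
      by (rule sum_norm_bound) (rule tk)
    also have "\<dots> \<le> real m * (2 * (C1 + Y) * \<rho> ^ (d + 1))"
      using cK C10 Y \<rho> by (intro mult_right_mono) auto
    finally have "norm (g j x) \<le> C1 * \<rho> ^ (d + 1) + real m * (2 * (C1 + Y) * \<rho> ^ (d + 1))"
      unfolding g_def using dl by (intro order_trans[OF norm_triangle_ineq] add_mono) (simp_all only: norm_minus_cancel)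
    also have "\<dots> \<le> Cg * \<rho> ^ (d + 1)" unfolding Cg_def using Y \<rho> by (simp add: algebra_simps)
    finally show ?thesis .
  qed
  interpret gs: grad_system N' "d + 1" "d + 1" P f g \<epsilon> Cg R
  proof
    show "1 \<le> d + 1" by simp
    show "1 \<le> P" by (rule P)
    show "mpoly N' (d + 1) f" by (rule mf)
    show "mpoly N' (d + 1) (g j)" for j by (rule mg)
    show "has_grad N' f g" by (rule fg)
    show "0 < \<epsilon>" by (rule \<epsilon>)
    show "0 \<le> Cg" unfolding Cg_def using C10 Y by simp
    show "norm (g j x) \<le> Cg * \<rho> ^ (d + 1)" if "1 \<le> \<rho>" "\<And>i. i < N' \<Longrightarrow> norm (x i) \<le> \<rho>" for x \<rho> j
      by (rule growth[OF that])
    show "1 \<le> R" by (rule R)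
    show "Cg + 1 \<le> \<epsilon> * R ^ P" using RP unfolding Cg_def C1_def .
  qed
  \<comment> \<open>The perturbation is given the size \<open>\<epsilon>\<close> as well; on the
    polydisc of radius \<open>M\<close> it enlarges the gradient by the second summand.\<close>
  define \<epsilon>' where "\<epsilon>' = \<epsilon> * (1 + real (d + P + 2) * M ^ (d + P + 1))"
  have \<epsilon>': "0 < \<epsilon>'" "\<epsilon>' \<le> 1/8" using small \<epsilon> M unfolding \<epsilon>'_def by (auto intro!: mult_pos_pos add_pos_nonneg)
  obtain S where S: "finite S" "card S \<le> (d + 1 + P) ^ N'"
    "\<forall>x0. (\<forall>j<N'. norm (gs.G j x0) \<le> \<epsilon>') \<longrightarrow> (\<exists>\<sigma>\<in>S. norm (gs.ft x0 - \<sigma>) \<le> 9 * (real N' + 1) * (R + 1) * \<epsilon>')"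
    using gs.near_critical_values[OF \<epsilon>'] by blast
  show ?thesis
  proof (rule exI[of _ S], intro conjI allI impI)
    show "finite S" by (rule S)
    show "card S \<le> (d + P + 1) ^ (N + m)" using S(2) by (simp add: N'_def add_ac)
    fix x \<mu> :: "nat \<Rightarrow> real"
    assume x: "\<forall>i<N. \<bar>x i\<bar> \<le> M" and \<mu>: "\<forall>k\<in>K. \<bar>\<mu> k\<bar> \<le> 1"
      and cr: "\<forall>j<N. norm (dlpoly N d c0 j (\<lambda>i. of_real (x i)) - (\<Sum>k\<in>K. of_real (\<mu> k) * dlpoly N d (c k) j (\<lambda>i. of_real (x i)))) \<le> \<epsilon>"
      and cl: "\<forall>k\<in>K. norm (lpoly N d (c k) (\<lambda>i. of_real (x i)) - of_real (y k)) \<le> \<epsilon>"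
    define z where "z = (\<lambda>i. if i < N then complex_of_real (x i) else if i - N \<in> K then of_real (\<mu> (i - N)) else 0)"
    have zN: "z i = of_real (x i)" if "i < N" for i using that by (simp add: z_def)
    have zk: "z (N + k) = of_real (\<mu> k)" if "k \<in> K" for k using that by (simp add: z_def)
    have zM: "norm (z i) \<le> M" for i
    proof -
      have "\<bar>\<mu> k\<bar> \<le> M" if "k \<in> K" for k using \<mu> M that by force
      then show ?thesis unfolding z_def using x M by auto
    qed
    have lp: "lpoly N d c z = lpoly N d c (\<lambda>i. of_real (x i))" for c
      unfolding lpoly_def by (intro sum.cong refl) (simp add: lmon_cong[of N z "\<lambda>i. of_real (x i)"] zN)
    have dlp: "dlpoly N d c j z = dlpoly N d c j (\<lambda>i. of_real (x i))" for c j
      unfolding dlpoly_def by (intro sum.cong refl) (simp add: dlmon_cong[of N z "\<lambda>i. of_real (x i)"] zN)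
    have dl0: "dlpoly N d c j z = 0" if "j \<ge> N" for c j
    proof -
      have "dlmon N j z I = 0" for I using that by (induction I) auto
      then show ?thesis by (simp add: dlpoly_def)
    qed
    \<comment> \<open>In the first \<open>N\<close> coordinates this is the near-critical equation,
      in the multipliers the constraint; in the dummy coordinates the derivative vanishes.\<close>
    have gz: "norm (g j z) \<le> \<epsilon>" if j: "j < N'" for j
    proof (cases "j < N")
      case True
      then have "g j z = dlpoly N d c0 j z - (\<Sum>k\<in>K. z (N + k) * dlpoly N d (c k) j z)"
        unfolding g_def by simp
      also have "\<dots> = dlpoly N d c0 j (\<lambda>i. of_real (x i)) - (\<Sum>k\<in>K. of_real (\<mu> k) * dlpoly N d (c k) j (\<lambda>i. of_real (x i)))"
        by (simp add: dlp zk cong: sum.cong)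
      finally show ?thesis using cr True by simp
    next
      case False
      then have "g j z = - (\<Sum>k\<in>K. (if j = N + k then 1 else 0) * (lpoly N d (c k) z - of_real (y k)))"
        unfolding g_def by (simp add: dl0)
      also have "(\<Sum>k\<in>K. (if j = N + k then 1 else 0) * (lpoly N d (c k) z - of_real (y k)))
        = (\<Sum>k\<in>K. if k = j - N then lpoly N d (c k) z - of_real (y k) else 0)"
        using False by (intro sum.cong) auto
      also have "\<dots> = (if j - N \<in> K then lpoly N d (c (j - N)) z - of_real (y (j - N)) else 0)"
        using fK by simp
      finally show ?thesis using cl \<epsilon> by (auto simp: lp)
    qed
    have Gz: "norm (gs.G j z) \<le> \<epsilon>'" if j: "j < N'" for j
    proof -
      have "norm (gs.G j z) \<le> norm (g j z) + norm (of_real \<epsilon> * (of_nat (d + 1 + P + 1) * z j ^ (d + 1 + P)))"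
        unfolding gs.G_def by (rule norm_triangle_ineq)
      also have "norm (of_real \<epsilon> * (of_nat (d + 1 + P + 1) * z j ^ (d + 1 + P))) = \<epsilon> * (real (d + 1 + P + 1) * norm (z j) ^ (d + 1 + P))"
        unfolding norm_mult norm_power norm_of_nat using \<epsilon> by simp
      also have "\<dots> \<le> \<epsilon> * (real (d + 1 + P + 1) * M ^ (d + 1 + P))"
        using \<epsilon> zM by (intro mult_left_mono power_mono) auto
      finally show ?thesis using gz[OF j] unfolding \<epsilon>'_def by (simp add: algebra_simps)
    qed
    then obtain \<sigma> where \<sigma>: "\<sigma> \<in> S" "norm (gs.ft z - \<sigma>) \<le> 9 * (real N' + 1) * (R + 1) * \<epsilon>'" using S(3) by blast
    have 1: "norm (lpoly N d c0 z - f z) \<le> real m * \<epsilon>"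
    proof -
      have "lpoly N d c0 z - f z = (\<Sum>k\<in>K. z (N + k) * (lpoly N d (c k) z - of_real (y k)))" by (simp add: f_def)
      also have "norm \<dots> \<le> real (card K) * \<epsilon>"
      proof (rule sum_norm_bound)
        fix k assume k: "k \<in> K"
        have "norm (z (N + k)) * norm (lpoly N d (c k) z - of_real (y k)) \<le> 1 * \<epsilon>"
          using k \<mu> cl by (intro mult_mono) (auto simp: zk lp)
        then show "norm (z (N + k) * (lpoly N d (c k) z - of_real (y k))) \<le> \<epsilon>" by (simp add: norm_mult)
      qed
      also have "\<dots> \<le> real m * \<epsilon>" using cK \<epsilon> by (intro mult_right_mono) auto
      finally show ?thesis .
    qed
    have 2: "norm (f z - gs.ft z) \<le> real N' * M ^ (d + P + 2) * \<epsilon>"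
    proof -
      have "norm (\<Sum>i<N'. z i ^ (d + 1 + P + 1)) \<le> real (card {..<N'}) * M ^ (d + 1 + P + 1)"
        by (rule sum_norm_bound) (unfold norm_power, rule power_mono[OF zM norm_ge_zero])
      then have "\<epsilon> * norm (\<Sum>i<N'. z i ^ (d + 1 + P + 1)) \<le> \<epsilon> * (real N' * M ^ (d + 1 + P + 1))"
        using \<epsilon> by (intro mult_left_mono) auto
      moreover have "norm (f z - gs.ft z) = \<epsilon> * norm (\<Sum>i<N'. z i ^ (d + 1 + P + 1))"
        unfolding gs.ft_def using \<epsilon> by (simp add: norm_mult)
      ultimately show ?thesis by (simp add: algebra_simps)
    qed
    have "lpoly N d c0 z - \<sigma> = (lpoly N d c0 z - f z) + ((f z - gs.ft z) + (gs.ft z - \<sigma>))" by simp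
    then have "norm (lpoly N d c0 z - \<sigma>) \<le> norm (lpoly N d c0 z - f z) + (norm (f z - gs.ft z) + norm (gs.ft z - \<sigma>))"
      by (metis norm_triangle_mono order_refl norm_triangle_ineq)
    \<comment> \<open>Errors from the constraints, from the perturbation, and from the covering of
      near-critical values.\<close>
    also have "\<dots> \<le> real m * \<epsilon> + (real N' * M ^ (d + P + 2) * \<epsilon> + 9 * (real N' + 1) * (R + 1) * \<epsilon>')"
      using 1 2 \<sigma>(2) by (intro add_mono)
    also have "\<dots> = (9 * (real (N + m) + 1) * (R + 1) * (1 + real (d + P + 2) * M ^ (d + P + 1)) + real (N + m) * M ^ (d + P + 2) + real m) * \<epsilon>"
      unfolding \<epsilon>'_def N'_def by (simp add: algebra_simps)
    finally show "\<exists>\<sigma>\<in>S. norm (lpoly N d c0 (\<lambda>i. of_real (x i)) - \<sigma>) \<le>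
         (9 * (real (N + m) + 1) * (R + 1) * (1 + real (d + P + 2) * M ^ (d + P + 1)) + real (N + m) * M ^ (d + P + 2) + real m) * \<epsilon>"
      using \<sigma>(1) unfolding lp by blast
  qed
qed

section \<open>Covering the near-critical values of a vector-valued polynomial\<close>

definition lmap :: "nat \<Rightarrow> nat \<Rightarrow> (nat list \<Rightarrow> 'g::real_vector) \<Rightarrow> (nat \<Rightarrow> real) \<Rightarrow> 'g" where
  "lmap N d c x = (\<Sum>I\<in>lists_n N d. lmon N x I *\<^sub>R c I)"

definition dlmap :: "nat \<Rightarrow> nat \<Rightarrow> (nat list \<Rightarrow> 'g::real_vector) \<Rightarrow> nat \<Rightarrow> (nat \<Rightarrow> real) \<Rightarrow> 'g" where
  "dlmap N d c j x = (\<Sum>I\<in>lists_n N d. dlmon N j x I *\<^sub>R c I)"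

lemma lpoly_component:
  "lpoly N d (\<lambda>I. c I \<bullet> b) (\<lambda>i. of_real (x i)) = of_real (lmap N d c x \<bullet> b)"
  unfolding lpoly_def lmap_def by (simp add: inner_sum_left lmon_of_real mult.commute)

lemma dlpoly_component:
  "dlpoly N d (\<lambda>I. c I \<bullet> b) j (\<lambda>i. of_real (x i)) = of_real (dlmap N d c j x \<bullet> b)"
  unfolding dlpoly_def dlmap_def by (simp add: inner_sum_left dlmon_of_real mult.commute)

text \<open>The constant of \<open>near_critical_lagrange\<close>. Its factor \<open>R + 1\<close>
  is the one that grows as \<open>\<epsilon>\<close> shrinks.\<close>

definition cover_const :: "nat \<Rightarrow> nat \<Rightarrow> nat \<Rightarrow> nat \<Rightarrow> real \<Rightarrow> real \<Rightarrow> real" where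
  "cover_const N m d P M R = 9 * (real (N + m) + 1) * (R + 1) * (1 + real (d + P + 2) * M ^ (d + P + 1)) + real (N + m) * M ^ (d + P + 2) + real m"

text \<open>\<open>near_critical_lagrange\<close> is applied once for every dominant direction
  \<open>b0\<close> of the covector and every grid point for the other \<open>m - 1\<close>
  coordinates. The grid costs the power \<open>m - 1\<close> of \<open>1 / \<epsilon>\<close>; the
  remaining coordinate costs only the number of critical values.\<close>

lemma near_critical_cover:
  fixes c :: "nat list \<Rightarrow> 'g::euclidean_space"
  defines "m \<equiv> DIM('g)"
  assumes d: "1 \<le> d" and P: "1 \<le> P"
    and c: "\<And>I. I \<in> lists_n N d \<Longrightarrow> norm (c I) \<le> C"
    and Y: "0 \<le> Y" and C: "0 \<le> C" and M: "1 \<le> M" and \<epsilon>: "0 < \<epsilon>" and R: "1 \<le> R"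
    and RP: "(1 + 2 * real m) * (C * (real N + 1) ^ d * real d + Y) + 1 \<le> \<epsilon> * R ^ P"
    and small: "\<epsilon> * (1 + real (d + P + 2) * M ^ (d + P + 1)) \<le> 1/8"
    and Z: "\<epsilon> * real Z \<le> Y"
  shows "\<exists>Q. finite Q \<and> card Q \<le> m * ((2 * Z + 1) ^ (m - 1) * (d + P + 1) ^ (N + m)) \<and>
    (\<forall>x l b0. b0 \<in> Basis \<longrightarrow> l \<bullet> b0 = 1 \<longrightarrow> (\<forall>b\<in>Basis. \<bar>l \<bullet> b\<bar> \<le> 1) \<longrightarrow> (\<forall>i<N. \<bar>x i\<bar> \<le> M) \<longrightarrow>
      (\<forall>j<N. \<bar>l \<bullet> dlmap N d c j x\<bar> \<le> \<epsilon>) \<longrightarrow> (\<forall>b\<in>Basis. \<bar>lmap N d c x \<bullet> b\<bar> \<le> \<epsilon> * real Z) \<longrightarrow>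
      (\<exists>q\<in>Q. dist (lmap N d c x) q \<le> (real m + cover_const N m d P M R) * \<epsilon>))"
proof -
  \<comment> \<open>Basis vectors are numbered because the multipliers occupy numbered
    variables.\<close>
  obtain \<beta> where \<beta>: "bij_betw \<beta> {0..<m} (Basis :: 'g set)"
    using ex_bij_betw_nat_finite[of "Basis :: 'g set"] by (auto simp: m_def)
  define K where "K = (\<lambda>b0::'g. {k\<in>{..<m}. \<beta> k \<noteq> b0})"
  have \<beta>B: "\<beta> k \<in> Basis" if "k < m" for k using bij_betw_apply[OF \<beta>] that by simp
  have bK: "bij_betw \<beta> (K b0) (Basis - {b0})" for b0
  proof (rule bij_betw_imageI)
    show "inj_on \<beta> (K b0)" by (rule inj_on_subset[OF bij_betw_imp_inj_on[OF \<beta>]]) (auto simp: K_def)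
    have "\<beta> ` {0..<m} = Basis" using \<beta> by (rule bij_betw_imp_surj_on)
    moreover have "\<beta> ` K b0 = \<beta> ` {0..<m} - {b0}" unfolding K_def by auto
    ultimately show "\<beta> ` K b0 = Basis - {b0}" by simp
  qed
  have cb: "\<bar>c I \<bullet> b\<bar> \<le> C" if "I \<in> lists_n N d" "b \<in> Basis" for I b
    using Basis_le_norm[OF that(2), of "c I"] c[OF that(1)] by linarith
  \<comment> \<open>Grid points in the coordinates other than \<open>b0\<close>, as extensional
    functions so that there are finitely many.\<close>
  define PE where "PE = (\<lambda>b0::'g. (Basis - {b0}) \<rightarrow>\<^sub>E {- int Z .. int Z})"
  have PE: "finite (PE b0)" "b0 \<in> Basis \<Longrightarrow> card (PE b0) = (2 * Z + 1) ^ (m - 1)" for b0 :: 'g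
  proof -
    show "finite (PE b0)" unfolding PE_def by (intro finite_PiE) auto
    assume b0: "b0 \<in> Basis"
    have "card (PE b0) = (\<Prod>b\<in>Basis - {b0}. card {- int Z .. int Z})" unfolding PE_def by (rule card_PiE) simp
    also have "\<dots> = (2 * Z + 1) ^ (m - 1)" using b0 by (simp add: m_def nat_add_distrib nat_mult_distrib)
    finally show "card (PE b0) = (2 * Z + 1) ^ (m - 1)" .
  qed
  define good where "good = (\<lambda>b0 (\<kappa> :: 'g \<Rightarrow> int) S. finite S \<and> card S \<le> (d + P + 1) ^ (N + m) \<and>
    (\<forall>x \<mu>. (\<forall>i<N. \<bar>x i\<bar> \<le> M) \<longrightarrow> (\<forall>k\<in>K b0. \<bar>\<mu> k\<bar> \<le> 1) \<longrightarrow>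
      (\<forall>j<N. norm (dlpoly N d (\<lambda>I. c I \<bullet> b0) j (\<lambda>i. of_real (x i)) - (\<Sum>k\<in>K b0. of_real (\<mu> k) * dlpoly N d (\<lambda>I. c I \<bullet> \<beta> k) j (\<lambda>i. of_real (x i)))) \<le> \<epsilon>) \<longrightarrow>
      (\<forall>k\<in>K b0. norm (lpoly N d (\<lambda>I. c I \<bullet> \<beta> k) (\<lambda>i. of_real (x i)) - of_real (\<epsilon> * \<kappa> (\<beta> k))) \<le> \<epsilon>) \<longrightarrow>
      (\<exists>\<sigma>\<in>S. norm (lpoly N d (\<lambda>I. c I \<bullet> b0) (\<lambda>i. of_real (x i)) - \<sigma>) \<le> cover_const N m d P M R * \<epsilon>)))"
  have ex: "\<exists>S. good b0 \<kappa> S" if b0: "b0 \<in> Basis" and \<kappa>: "\<kappa> \<in> PE b0" for b0 \<kappa>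
    unfolding good_def cover_const_def
  proof (rule near_critical_lagrange)
    show "K b0 \<subseteq> {..<m}" by (auto simp: K_def)
    show "\<bar>c I \<bullet> b0\<bar> \<le> C" if "I \<in> lists_n N d" for I using cb that b0 by blast
    show "\<bar>c I \<bullet> \<beta> k\<bar> \<le> C" if "I \<in> lists_n N d" "k \<in> K b0" for k I using cb that \<beta>B by (auto simp: K_def)
    show "\<bar>\<epsilon> * \<kappa> (\<beta> k)\<bar> \<le> Y" if k: "k \<in> K b0" for k
    proof -
      have "\<beta> k \<in> Basis - {b0}" using bij_betw_apply[OF bK k] .
      then have "\<kappa> (\<beta> k) \<in> {- int Z .. int Z}" using \<kappa> unfolding PE_def by blast
      then have "\<bar>real_of_int (\<kappa> (\<beta> k))\<bar> \<le> real Z" by (simp add: abs_le_iff)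
      then have "\<epsilon> * \<bar>real_of_int (\<kappa> (\<beta> k))\<bar> \<le> \<epsilon> * real Z" using \<epsilon> by (intro mult_left_mono) auto
      then have "\<epsilon> * \<bar>real_of_int (\<kappa> (\<beta> k))\<bar> \<le> Y" using Z by linarith
      then show ?thesis using \<epsilon> by (simp add: abs_mult)
    qed
  qed (use assms in auto)
  then obtain S where S: "\<And>b0 \<kappa>. b0 \<in> Basis \<Longrightarrow> \<kappa> \<in> PE b0 \<Longrightarrow> good b0 \<kappa> (S b0 \<kappa>)" by metis
  \<comment> \<open>The critical values of the complexification may be complex; dropping the
    imaginary part of \<open>\<sigma>\<close> does not increase its distance to a real
    number.\<close>
  define ctr where "ctr = (\<lambda>b0 (\<kappa> :: 'g \<Rightarrow> int) \<sigma>. (\<Sum>b\<in>Basis - {b0}. (\<epsilon> * \<kappa> b) *\<^sub>R b) + Re \<sigma> *\<^sub>R b0)"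
  define Q where "Q = (\<Union>b0\<in>Basis. \<Union>\<kappa>\<in>PE b0. ctr b0 \<kappa> ` S b0 \<kappa>)"
  have Sf: "finite (S b0 \<kappa>)" "card (S b0 \<kappa>) \<le> (d + P + 1) ^ (N + m)" if "b0 \<in> Basis" "\<kappa> \<in> PE b0" for b0 \<kappa>
    using S[OF that] by (auto simp: good_def)
  have "finite Q" unfolding Q_def using Sf PE by (intro finite_UN_I finite_imageI) auto
  moreover have "card Q \<le> m * ((2 * Z + 1) ^ (m - 1) * (d + P + 1) ^ (N + m))"
  proof -
    have 1: "card (\<Union>\<kappa>\<in>PE b0. ctr b0 \<kappa> ` S b0 \<kappa>) \<le> (2 * Z + 1) ^ (m - 1) * (d + P + 1) ^ (N + m)" if b0: "b0 \<in> Basis" for b0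
    proof -
      have "card (\<Union>\<kappa>\<in>PE b0. ctr b0 \<kappa> ` S b0 \<kappa>) \<le> (\<Sum>\<kappa>\<in>PE b0. card (ctr b0 \<kappa> ` S b0 \<kappa>))"
        by (rule card_UN_le[OF PE(1)])
      also have "\<dots> \<le> (\<Sum>\<kappa>\<in>PE b0. (d + P + 1) ^ (N + m))"
        by (intro sum_mono order_trans[OF card_image_le[OF Sf(1)[OF b0]] Sf(2)[OF b0]])
      also have "\<dots> = (2 * Z + 1) ^ (m - 1) * (d + P + 1) ^ (N + m)" using PE(2)[OF b0] by simp
      finally show ?thesis .
    qed
    have "card Q \<le> (\<Sum>b0\<in>Basis. card (\<Union>\<kappa>\<in>PE b0. ctr b0 \<kappa> ` S b0 \<kappa>))"
      unfolding Q_def by (rule card_UN_le) simp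
    also have "\<dots> \<le> (\<Sum>b0\<in>(Basis::'g set). (2 * Z + 1) ^ (m - 1) * (d + P + 1) ^ (N + m))"
      by (rule sum_mono) (rule 1)
    finally show ?thesis by (simp add: m_def)
  qed
  moreover have "\<exists>q\<in>Q. dist (lmap N d c x) q \<le> (real m + cover_const N m d P M R) * \<epsilon>"
    if b0: "b0 \<in> Basis" and l: "l \<bullet> b0 = 1" "\<forall>b\<in>Basis. \<bar>l \<bullet> b\<bar> \<le> 1" and x: "\<forall>i<N. \<bar>x i\<bar> \<le> M"
      and cr: "\<forall>j<N. \<bar>l \<bullet> dlmap N d c j x\<bar> \<le> \<epsilon>" and bd: "\<forall>b\<in>Basis. \<bar>lmap N d c x \<bullet> b\<bar> \<le> \<epsilon> * real Z" for x l b0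
  proof -
    define F where "F = lmap N d c x"
    define \<kappa> where "\<kappa> = restrict (\<lambda>b. \<lfloor>F \<bullet> b / \<epsilon>\<rfloor>) (Basis - {b0})"
    have \<kappa>b: "\<bar>F \<bullet> b - \<epsilon> * \<kappa> b\<bar> \<le> \<epsilon>" if "b \<in> Basis - {b0}" for b
    proof -
      have "0 \<le> F \<bullet> b / \<epsilon> - \<lfloor>F \<bullet> b / \<epsilon>\<rfloor>" "F \<bullet> b / \<epsilon> - \<lfloor>F \<bullet> b / \<epsilon>\<rfloor> \<le> 1" by linarith+
      then have "\<bar>F \<bullet> b / \<epsilon> - \<kappa> b\<bar> \<le> 1" using that by (simp add: \<kappa>_def)
      then have "\<epsilon> * \<bar>F \<bullet> b / \<epsilon> - \<kappa> b\<bar> \<le> \<epsilon> * 1" using \<epsilon> by (intro mult_left_mono) auto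
      moreover have "\<epsilon> * \<bar>F \<bullet> b / \<epsilon> - \<kappa> b\<bar> = \<bar>F \<bullet> b - \<epsilon> * \<kappa> b\<bar>"
      proof -
        have "F \<bullet> b - \<epsilon> * \<kappa> b = \<epsilon> * (F \<bullet> b / \<epsilon> - \<kappa> b)" using \<epsilon> by (simp add: right_diff_distrib)
        then show ?thesis using \<epsilon> by (simp only: abs_mult)
      qed
      ultimately show ?thesis by simp
    qed
    have \<kappa>: "\<kappa> \<in> PE b0" unfolding PE_def
    proof (rule PiE_I)
      fix b assume b: "b \<in> Basis - {b0}"
      have "\<bar>F \<bullet> b\<bar> \<le> \<epsilon> * real Z" using bd b by (simp add: F_def)
      then have "F \<bullet> b / \<epsilon> \<le> real Z" "- real Z \<le> F \<bullet> b / \<epsilon>" using \<epsilon> by (auto simp: field_simps abs_le_iff)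
      then have "\<lfloor>F \<bullet> b / \<epsilon>\<rfloor> \<le> int Z" "- int Z \<le> \<lfloor>F \<bullet> b / \<epsilon>\<rfloor>" by linarith+
      then show "\<kappa> b \<in> {- int Z .. int Z}" using b by (simp add: \<kappa>_def)
    next
      fix b assume "b \<notin> Basis - {b0}"
      then show "\<kappa> b = undefined" unfolding \<kappa>_def restrict_def by (rule if_not_P)
    qed
    have sumK: "(\<Sum>k\<in>K b0. h (\<beta> k)) = (\<Sum>b\<in>Basis - {b0}. h b)" for h :: "'g \<Rightarrow> complex"
      by (rule sum.reindex_bij_betw[OF bK])
    \<comment> \<open>The Lagrange function subtracts the constraints, so the multipliers are the
      components of the covector with the opposite sign.\<close>
    have 1: "\<forall>k\<in>K b0. \<bar>- (l \<bullet> \<beta> k)\<bar> \<le> 1" using l(2) \<beta>B by (auto simp: K_def)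
    have 2: "\<forall>j<N. norm (dlpoly N d (\<lambda>I. c I \<bullet> b0) j (\<lambda>i. of_real (x i)) - (\<Sum>k\<in>K b0. of_real (- (l \<bullet> \<beta> k)) * dlpoly N d (\<lambda>I. c I \<bullet> \<beta> k) j (\<lambda>i. of_real (x i)))) \<le> \<epsilon>"
    proof (intro allI impI)
      fix j assume j: "j < N"
      have "dlpoly N d (\<lambda>I. c I \<bullet> b0) j (\<lambda>i. of_real (x i)) - (\<Sum>k\<in>K b0. of_real (- (l \<bullet> \<beta> k)) * dlpoly N d (\<lambda>I. c I \<bullet> \<beta> k) j (\<lambda>i. of_real (x i)))
        = of_real (dlmap N d c j x \<bullet> b0) + (\<Sum>b\<in>Basis - {b0}. of_real ((l \<bullet> b) * (dlmap N d c j x \<bullet> b)))"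
        unfolding dlpoly_component using sumK[of "\<lambda>b. of_real ((l \<bullet> b) * (dlmap N d c j x \<bullet> b))"] by (simp add: sum_negf)
      also have "\<dots> = of_real (\<Sum>b\<in>Basis. (l \<bullet> b) * (dlmap N d c j x \<bullet> b))"
        using b0 l(1) by (simp add: sum.remove[of Basis b0])
      also have "\<dots> = of_real (l \<bullet> dlmap N d c j x)" by (simp only: euclidean_inner[of l "dlmap N d c j x"])
      finally show "norm (dlpoly N d (\<lambda>I. c I \<bullet> b0) j (\<lambda>i. of_real (x i)) - (\<Sum>k\<in>K b0. of_real (- (l \<bullet> \<beta> k)) * dlpoly N d (\<lambda>I. c I \<bullet> \<beta> k) j (\<lambda>i. of_real (x i)))) \<le> \<epsilon>"
        using cr j by simp
    qed
    have 3: "\<forall>k\<in>K b0. norm (lpoly N d (\<lambda>I. c I \<bullet> \<beta> k) (\<lambda>i. of_real (x i)) - of_real (\<epsilon> * \<kappa> (\<beta> k))) \<le> \<epsilon>"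
    proof
      fix k assume k: "k \<in> K b0"
      have "\<beta> k \<in> Basis - {b0}" using bij_betw_apply[OF bK k] .
      from \<kappa>b[OF this] show "norm (lpoly N d (\<lambda>I. c I \<bullet> \<beta> k) (\<lambda>i. of_real (x i)) - of_real (\<epsilon> * \<kappa> (\<beta> k))) \<le> \<epsilon>"
        unfolding lpoly_component F_def by (simp only: of_real_diff[symmetric] norm_of_real)
    qed
    obtain \<sigma> where \<sigma>: "\<sigma> \<in> S b0 \<kappa>" "norm (lpoly N d (\<lambda>I. c I \<bullet> b0) (\<lambda>i. of_real (x i)) - \<sigma>) \<le> cover_const N m d P M R * \<epsilon>"
    proof -
      have "\<exists>\<sigma>\<in>S b0 \<kappa>. norm (lpoly N d (\<lambda>I. c I \<bullet> b0) (\<lambda>i. of_real (x i)) - \<sigma>) \<le> cover_const N m d P M R * \<epsilon>"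
        by (rule S[OF b0 \<kappa>, unfolded good_def, THEN conjunct2, THEN conjunct2, THEN spec[of _ x], THEN spec[of _ "\<lambda>k. - (l \<bullet> \<beta> k)"],
            THEN mp, OF x, THEN mp, OF 1, THEN mp, OF 2, THEN mp, OF 3])
      then show ?thesis using that by blast
    qed
    have "\<bar>F \<bullet> b0 - Re \<sigma>\<bar> = \<bar>Re (of_real (F \<bullet> b0) - \<sigma>)\<bar>" by simp
    also have "\<dots> \<le> norm (of_real (F \<bullet> b0) - \<sigma>)" by (rule abs_Re_le_cmod)
    also have "\<dots> \<le> cover_const N m d P M R * \<epsilon>" using \<sigma>(2) unfolding lpoly_component F_def .
    finally have F0: "\<bar>F \<bullet> b0 - Re \<sigma>\<bar> \<le> cover_const N m d P M R * \<epsilon>" .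
    have "F = (\<Sum>b\<in>Basis. (F \<bullet> b) *\<^sub>R b)" by (rule euclidean_representation[symmetric])
    also have "\<dots> = (F \<bullet> b0) *\<^sub>R b0 + (\<Sum>b\<in>Basis - {b0}. (F \<bullet> b) *\<^sub>R b)"
      by (rule sum.remove[OF finite_Basis b0])
    finally have Fe: "F = (F \<bullet> b0) *\<^sub>R b0 + (\<Sum>b\<in>Basis - {b0}. (F \<bullet> b) *\<^sub>R b)" .
    have "F - ctr b0 \<kappa> \<sigma> = (F \<bullet> b0 - Re \<sigma>) *\<^sub>R b0 + (\<Sum>b\<in>Basis - {b0}. (F \<bullet> b - \<epsilon> * \<kappa> b) *\<^sub>R b)"
      unfolding ctr_def by (subst Fe) (simp only: scaleR_diff_left sum_subtractf algebra_simps)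
    then have "dist F (ctr b0 \<kappa> \<sigma>) \<le> \<bar>F \<bullet> b0 - Re \<sigma>\<bar> + norm (\<Sum>b\<in>Basis - {b0}. (F \<bullet> b - \<epsilon> * \<kappa> b) *\<^sub>R b)"
      using norm_triangle_ineq[of "(F \<bullet> b0 - Re \<sigma>) *\<^sub>R b0"] b0 by (simp add: dist_norm)
    also have "norm (\<Sum>b\<in>Basis - {b0}. (F \<bullet> b - \<epsilon> * \<kappa> b) *\<^sub>R b) \<le> real (card (Basis - {b0})) * \<epsilon>"
      by (rule sum_norm_bound) (use \<kappa>b in simp)
    also have "\<dots> \<le> real m * \<epsilon>" using \<epsilon> unfolding m_def by (intro mult_right_mono) (auto intro!: card_mono)
    finally have "dist F (ctr b0 \<kappa> \<sigma>) \<le> (real m + cover_const N m d P M R) * \<epsilon>" using F0 by (simp add: algebra_simps)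
    moreover have "ctr b0 \<kappa> \<sigma> \<in> Q" unfolding Q_def using b0 \<kappa> \<sigma> by blast
    ultimately show ?thesis unfolding F_def by blast
  qed
  ultimately show ?thesis by (intro exI[of _ Q] conjI allI impI) blast+
qed

section \<open>Smooth functions\<close>

abbreviation dd :: "('a::real_normed_vector \<Rightarrow> 'b::real_normed_vector) \<Rightarrow> 'a \<Rightarrow> 'a \<Rightarrow> 'b" where
  "dd f x \<equiv> frechet_derivative f (at x)"

lemma smooth_differentiable: "smooth_fun f \<Longrightarrow> f differentiable (at x)"
  by (erule smooth_fun.cases) blast

lemma smooth_has_derivative: "smooth_fun f \<Longrightarrow> (f has_derivative dd f x) (at x)"
  using smooth_differentiable frechet_derivative_works by blast

lemma smooth_partial: "smooth_fun f \<Longrightarrow> i \<in> Basis \<Longrightarrow> smooth_fun (\<lambda>x. dd f x i)"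
  by (erule smooth_fun.cases) blast

lemma smooth_continuous: "smooth_fun f \<Longrightarrow> continuous_on UNIV f"
  by (simp add: continuous_on_eq_continuous_at differentiable_imp_continuous_within smooth_differentiable)

lemma linear_dd: "smooth_fun f \<Longrightarrow> linear (dd f x)"
  using smooth_has_derivative has_derivative_linear by blast

text \<open>The coinduction invariant has to allow all finite linear combinations of smooth
  functions, because differentiation changes the summands.\<close>

lemma smooth_lincomb:
  fixes F :: "nat \<Rightarrow> 'a::euclidean_space \<Rightarrow> 'b::real_normed_vector"
  assumes "\<And>k. k < n \<Longrightarrow> smooth_fun (F k)"
  shows "smooth_fun (\<lambda>x. \<Sum>k<n. c k *\<^sub>R F k x)"
proof -
  define R where "R = (\<lambda>g::'a \<Rightarrow> 'b. \<exists>(n::nat) c (F :: nat \<Rightarrow> 'a \<Rightarrow> 'b). (\<forall>k<n. smooth_fun (F k)) \<and> g = (\<lambda>x. \<Sum>k<n. c k *\<^sub>R F k x))"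
  have "R (\<lambda>x. \<Sum>k<n. c k *\<^sub>R F k x)" unfolding R_def
    by (rule exI[of _ n], rule exI[of _ c], rule exI[of _ F]) (simp add: assms)
  then show ?thesis
  proof (rule smooth_fun.coinduct[of R])
    fix g assume "R g"
    then obtain n :: nat and c and F :: "nat \<Rightarrow> 'a \<Rightarrow> 'b" where F: "\<And>k. k < n \<Longrightarrow> smooth_fun (F k)" and g: "g = (\<lambda>x. \<Sum>k<n. c k *\<^sub>R F k x)"
      unfolding R_def by (elim exE conjE) (rule that, auto)
    have der: "(g has_derivative (\<lambda>v. \<Sum>k<n. c k *\<^sub>R dd (F k) x v)) (at x)" for x
      unfolding g by (intro has_derivative_sum has_derivative_scaleR_right smooth_has_derivative F) simp
    have e: "dd g x = (\<lambda>v. \<Sum>k<n. c k *\<^sub>R dd (F k) x v)" for x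
      using frechet_derivative_at[OF der] by simp
    have "R (\<lambda>x. dd g x i)" if "i \<in> Basis" for i
      unfolding R_def e
      by (rule exI[of _ n], rule exI[of _ c], rule exI[of _ "\<lambda>k x. dd (F k) x i"]) (simp add: smooth_partial[OF F that])
    then show "\<exists>f. g = f \<and> (\<forall>x. f differentiable at x) \<and> (\<forall>i\<in>Basis. R (\<lambda>x. dd f x i) \<or> smooth_fun (\<lambda>x. dd f x i))"
      using der differentiable_def by blast
  qed
qed

lemma smooth_directional:
  fixes f :: "'a::euclidean_space \<Rightarrow> 'b::real_normed_vector"
  assumes "smooth_fun f"
  shows "smooth_fun (\<lambda>x. dd f x a)"
proof -
  obtain \<beta> where \<beta>: "bij_betw \<beta> {0..<DIM('a)} (Basis :: 'a set)"
    using ex_bij_betw_nat_finite[of "Basis :: 'a set"] by auto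
  have "dd f x a = (\<Sum>k<DIM('a). (a \<bullet> \<beta> k) *\<^sub>R dd f x (\<beta> k))" for x
  proof -
    interpret linear "dd f x" by (rule linear_dd[OF assms])
    have "dd f x a = dd f x (\<Sum>i\<in>Basis. (a \<bullet> i) *\<^sub>R i)" by (simp only: euclidean_representation)
    also have "\<dots> = (\<Sum>i\<in>Basis. (a \<bullet> i) *\<^sub>R dd f x i)" by (simp add: sum scaleR)
    also have "\<dots> = (\<Sum>k<DIM('a). (a \<bullet> \<beta> k) *\<^sub>R dd f x (\<beta> k))"
      using sum.reindex_bij_betw[OF \<beta>, of "\<lambda>i. (a \<bullet> i) *\<^sub>R dd f x i"] by (simp add: lessThan_atLeast0)
    finally show ?thesis .
  qed
  moreover have "smooth_fun (\<lambda>x. \<Sum>k<DIM('a). (a \<bullet> \<beta> k) *\<^sub>R dd f x (\<beta> k))"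
    by (intro smooth_lincomb smooth_partial assms bij_betw_apply[OF \<beta>]) simp
  ultimately show ?thesis by simp
qed

text \<open>Coinduction over all slices: a partial derivative of a slice is the slice of a
  directional derivative of \<open>f\<close>.\<close>

lemma smooth_slice:
  fixes f :: "'a::euclidean_space \<times> 'a \<Rightarrow> 'b::real_normed_vector"
  assumes "smooth_fun f"
  shows "smooth_fun (\<lambda>x. f (x, 0))"
proof -
  define R where "R = (\<lambda>g. \<exists>f :: 'a \<times> 'a \<Rightarrow> 'b. smooth_fun f \<and> g = (\<lambda>x. f (x, 0)))"
  have "R (\<lambda>x. f (x, 0))" unfolding R_def using assms by blast
  then show ?thesis
  proof (rule smooth_fun.coinduct[of R])
    fix g assume "R g"
    then obtain f :: "'a \<times> 'a \<Rightarrow> 'b" where f: "smooth_fun f" and g: "g = (\<lambda>x. f (x, 0))"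
      unfolding R_def by blast
    have der: "(g has_derivative (\<lambda>v. dd f (x, 0) (v, 0))) (at x)" for x
    proof -
      have "((\<lambda>x. (x, 0)) has_derivative (\<lambda>v. (v, 0))) (at x)" by (intro derivative_intros)
      from has_derivative_compose[OF this smooth_has_derivative[OF f]] show ?thesis unfolding g .
    qed
    have e: "dd g x = (\<lambda>v. dd f (x, 0) (v, 0))" for x
      using frechet_derivative_at[OF der] by simp
    have "R (\<lambda>x. dd g x i)" if "i \<in> Basis" for i
      unfolding R_def e using smooth_directional[OF f, of "(i, 0)"] by blast
    then show "\<exists>f. g = f \<and> (\<forall>x. f differentiable at x) \<and> (\<forall>i\<in>Basis. R (\<lambda>x. dd f x i) \<or> smooth_fun (\<lambda>x. dd f x i))"
      using der differentiable_def by blast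
  qed
qed

text \<open>Schwarz's theorem through the mixed second difference \<open>Q\<close>, which is
  symmetric in the two directions. Two mean value steps express it by either mixed derivative at a
  nearby point, and continuity gives the limit.\<close>

lemma symmetric_second_derivative_real:
  fixes f :: "'a::euclidean_space \<Rightarrow> real"
  assumes f: "smooth_fun f"
  shows "dd (\<lambda>x. dd f x a) x b = dd (\<lambda>x. dd f x b) x a"
proof -
  define Q where "Q = (\<lambda>h. f (x + h *\<^sub>R a + h *\<^sub>R b) - f (x + h *\<^sub>R a) - f (x + h *\<^sub>R b) + f x)"
  have MV: "\<exists>\<xi> \<zeta>. 0 < \<xi> \<and> \<xi> < h \<and> 0 < \<zeta> \<and> \<zeta> < h \<and>
      f (x + h *\<^sub>R a + h *\<^sub>R b) - f (x + h *\<^sub>R a) - f (x + h *\<^sub>R b) + f x = h * h * dd (\<lambda>x. dd f x a) (x + \<xi> *\<^sub>R a + \<zeta> *\<^sub>R b) b"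
    if h: "0 < h" for a b h
  proof -
    define g where "g = (\<lambda>s. f (x + s *\<^sub>R a + h *\<^sub>R b) - f (x + s *\<^sub>R a))"
    have picard_degree: "(g has_real_derivative (dd f (x + s *\<^sub>R a + h *\<^sub>R b) a - dd f (x + s *\<^sub>R a) a)) (at s)" for s
    proof -
      have d1: "((\<lambda>s. x + s *\<^sub>R a + h *\<^sub>R b) has_derivative (\<lambda>t. t *\<^sub>R a)) (at s)"
       and d2: "((\<lambda>s. x + s *\<^sub>R a) has_derivative (\<lambda>t. t *\<^sub>R a)) (at s)"
        by (auto intro!: derivative_eq_intros)
      have "(g has_derivative (\<lambda>t. dd f (x + s *\<^sub>R a + h *\<^sub>R b) (t *\<^sub>R a) - dd f (x + s *\<^sub>R a) (t *\<^sub>R a))) (at s)"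
        unfolding g_def by (intro has_derivative_diff has_derivative_compose[OF d1 smooth_has_derivative[OF f]] has_derivative_compose[OF d2 smooth_has_derivative[OF f]])
      then show ?thesis unfolding has_field_derivative_def
        by (rule has_derivative_eq_rhs) (simp add: linear_scale[OF linear_dd[OF f]] fun_eq_iff algebra_simps)
    qed
    obtain \<xi> where \<xi>: "0 < \<xi>" "\<xi> < h" "g h - g 0 = (h - 0) * (dd f (x + \<xi> *\<^sub>R a + h *\<^sub>R b) a - dd f (x + \<xi> *\<^sub>R a) a)"
      using MVT2[OF h, of g "\<lambda>s. dd f (x + s *\<^sub>R a + h *\<^sub>R b) a - dd f (x + s *\<^sub>R a) a"] picard_degree by blast
    define k where "k = (\<lambda>s. dd f (x + \<xi> *\<^sub>R a + s *\<^sub>R b) a)"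
    have dk: "(k has_real_derivative (dd (\<lambda>x. dd f x a) (x + \<xi> *\<^sub>R a + s *\<^sub>R b) b)) (at s)" for s
    proof -
      have d1: "((\<lambda>s. x + \<xi> *\<^sub>R a + s *\<^sub>R b) has_derivative (\<lambda>t. t *\<^sub>R b)) (at s)"
        by (auto intro!: derivative_eq_intros)
      have "(k has_derivative (\<lambda>t. dd (\<lambda>x. dd f x a) (x + \<xi> *\<^sub>R a + s *\<^sub>R b) (t *\<^sub>R b))) (at s)"
        unfolding k_def by (rule has_derivative_compose[OF d1 smooth_has_derivative[OF smooth_directional[OF f]]])
      then show ?thesis unfolding has_field_derivative_def
        by (rule has_derivative_eq_rhs) (simp add: linear_scale[OF linear_dd[OF smooth_directional[OF f]]] fun_eq_iff algebra_simps)
    qed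
    obtain \<zeta> where \<zeta>: "0 < \<zeta>" "\<zeta> < h" "k h - k 0 = (h - 0) * dd (\<lambda>x. dd f x a) (x + \<xi> *\<^sub>R a + \<zeta> *\<^sub>R b) b"
      using MVT2[OF h, of k "\<lambda>s. dd (\<lambda>x. dd f x a) (x + \<xi> *\<^sub>R a + s *\<^sub>R b) b"] dk by blast
    have "f (x + h *\<^sub>R a + h *\<^sub>R b) - f (x + h *\<^sub>R a) - f (x + h *\<^sub>R b) + f x = g h - g 0" by (simp add: g_def)
    also have "\<dots> = h * (k h - k 0)" using \<xi>(3) by (simp add: k_def)
    also have "\<dots> = h * h * dd (\<lambda>x. dd f x a) (x + \<xi> *\<^sub>R a + \<zeta> *\<^sub>R b) b" using \<zeta>(3) by simp
    finally show ?thesis using \<xi> \<zeta> by blast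
  qed
  \<comment> \<open>Stated for arbitrary directions and any \<open>Q\<close> of this form, so that
    it applies again with the directions exchanged.\<close>
  have lim: "(\<lambda>n. Q (1 / Suc n) / (1 / Suc n * (1 / Suc n))) \<longlonglongrightarrow> dd (\<lambda>x. dd f x a) x b"
    if Q: "\<And>h. Q h = f (x + h *\<^sub>R a + h *\<^sub>R b) - f (x + h *\<^sub>R a) - f (x + h *\<^sub>R b) + f x" for a b Q
  proof -
    have "\<forall>n. \<exists>z. 0 < fst z \<and> fst z < 1 / Suc n \<and> 0 < snd z \<and> snd z < 1 / Suc n \<and>
       Q (1 / Suc n) = (1 / Suc n) * (1 / Suc n) * dd (\<lambda>x. dd f x a) (x + fst z *\<^sub>R a + snd z *\<^sub>R b) b"
      using MV[of "1 / Suc n" a b for n] unfolding Q by simp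
    from choice[OF this] obtain z where z: "\<And>n. 0 < fst (z n)" "\<And>n. fst (z n) < 1 / Suc n" "\<And>n. 0 < snd (z n)" "\<And>n. snd (z n) < 1 / Suc n"
       "\<And>n. Q (1 / Suc n) = (1 / Suc n) * (1 / Suc n) * dd (\<lambda>x. dd f x a) (x + fst (z n) *\<^sub>R a + snd (z n) *\<^sub>R b) b" by blast
    have l0: "(\<lambda>n. 1 / real (Suc n)) \<longlonglongrightarrow> 0" by (rule LIMSEQ_Suc[OF lim_1_over_n])
    have z1: "(\<lambda>n. fst (z n)) \<longlonglongrightarrow> 0" by (rule tendsto_sandwich[OF _ _ tendsto_const l0]) (auto intro!: always_eventually less_imp_le z(1,2) simp del: of_nat_Suc)
    have z2: "(\<lambda>n. snd (z n)) \<longlonglongrightarrow> 0" by (rule tendsto_sandwich[OF _ _ tendsto_const l0]) (auto intro!: always_eventually less_imp_le z(3,4) simp del: of_nat_Suc)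
    have "(\<lambda>n. x + fst (z n) *\<^sub>R a + snd (z n) *\<^sub>R b) \<longlonglongrightarrow> x + 0 *\<^sub>R a + 0 *\<^sub>R b" by (intro tendsto_intros z1 z2)
    then have lx: "(\<lambda>n. x + fst (z n) *\<^sub>R a + snd (z n) *\<^sub>R b) \<longlonglongrightarrow> x" by simp
    have "isCont (\<lambda>y. dd (\<lambda>x. dd f x a) y b) x"
      using smooth_continuous[OF smooth_directional[OF smooth_directional[OF f]]] by (simp add: continuous_on_eq_continuous_at)
    from isCont_tendsto_compose[OF this lx]
    have "(\<lambda>n. dd (\<lambda>x. dd f x a) (x + fst (z n) *\<^sub>R a + snd (z n) *\<^sub>R b) b) \<longlonglongrightarrow> dd (\<lambda>x. dd f x a) x b" .
    then show ?thesis unfolding z(5) by simp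
  qed
  have "(\<lambda>n. Q (1 / Suc n) / (1 / Suc n * (1 / Suc n))) \<longlonglongrightarrow> dd (\<lambda>x. dd f x a) x b"
    by (rule lim) (simp add: Q_def)
  moreover have "(\<lambda>n. Q (1 / Suc n) / (1 / Suc n * (1 / Suc n))) \<longlonglongrightarrow> dd (\<lambda>x. dd f x b) x a"
    by (rule lim) (simp add: Q_def algebra_simps)
  ultimately show ?thesis by (rule LIMSEQ_unique)
qed

lemma smooth_inner:
  fixes f :: "'a::euclidean_space \<Rightarrow> 'b::euclidean_space"
  assumes "smooth_fun f"
  shows "smooth_fun (\<lambda>x. f x \<bullet> c)" and "dd (\<lambda>x. f x \<bullet> c) x = (\<lambda>v. dd f x v \<bullet> c)"
proof -
  have der: "((\<lambda>x. f x \<bullet> c) has_derivative (\<lambda>v. dd f x v \<bullet> c)) (at x)" if "smooth_fun f" for f :: "'a \<Rightarrow> 'b" and x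
    by (intro has_derivative_inner_left smooth_has_derivative that)
  have e: "dd (\<lambda>x. f x \<bullet> c) x = (\<lambda>v. dd f x v \<bullet> c)" if "smooth_fun f" for f :: "'a \<Rightarrow> 'b" and x
    using frechet_derivative_at[OF der[OF that]] by simp
  show "dd (\<lambda>x. f x \<bullet> c) x = (\<lambda>v. dd f x v \<bullet> c)" by (rule e[OF assms])
  define R where "R = (\<lambda>g. \<exists>f :: 'a \<Rightarrow> 'b. smooth_fun f \<and> g = (\<lambda>x. f x \<bullet> c))"
  have "R (\<lambda>x. f x \<bullet> c)" unfolding R_def using assms by blast
  then show "smooth_fun (\<lambda>x. f x \<bullet> c)"
  proof (rule smooth_fun.coinduct[of R])
    fix g assume "R g"
    then obtain f :: "'a \<Rightarrow> 'b" where f: "smooth_fun f" and g: "g = (\<lambda>x. f x \<bullet> c)"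
      unfolding R_def by blast
    have "R (\<lambda>x. dd g x i)" if "i \<in> Basis" for i
      unfolding R_def g e[OF f] using smooth_directional[OF f, of i] by blast
    then show "\<exists>f. g = f \<and> (\<forall>x. f differentiable at x) \<and> (\<forall>i\<in>Basis. R (\<lambda>x. dd f x i) \<or> smooth_fun (\<lambda>x. dd f x i))"
      using der[OF f] differentiable_def unfolding g by blast
  qed
qed

lemma symmetric_second_derivative:
  fixes f :: "'a::euclidean_space \<Rightarrow> 'b::euclidean_space"
  assumes f: "smooth_fun f"
  shows "dd (\<lambda>x. dd f x a) x b = dd (\<lambda>x. dd f x b) x a"
proof (rule euclidean_eqI)
  fix c :: 'b
  have "dd (\<lambda>x. dd f x a) x b \<bullet> c = dd (\<lambda>x. dd (\<lambda>x. f x \<bullet> c) x a) x b" for a b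
    by (simp add: smooth_inner(2)[OF f] smooth_inner(2)[OF smooth_directional[OF f]])
  then show "dd (\<lambda>x. dd f x a) x b \<bullet> c = dd (\<lambda>x. dd f x b) x a \<bullet> c"
    using symmetric_second_derivative_real[OF smooth_inner(1)[OF f]] by metis
qed

text \<open>Gronwall's argument: the squared norm of \<open>\<psi>\<close>, damped by
  \<open>exp (- (2 * K) * t)\<close>, is nonincreasing and starts at zero.\<close>

lemma linear_ode_zero:
  fixes \<psi> :: "real \<Rightarrow> 'a::real_inner"
  assumes d: "\<And>t. 0 \<le> t \<Longrightarrow> t \<le> 1 \<Longrightarrow> (\<psi> has_vector_derivative D t) (at t)"
    and D: "\<And>t. 0 \<le> t \<Longrightarrow> t \<le> 1 \<Longrightarrow> norm (D t) \<le> K * norm (\<psi> t)" and z: "\<psi> 0 = 0"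
  shows "\<psi> 1 = 0"
proof -
  define \<phi> where "\<phi> = (\<lambda>t. exp (- (2 * K) * t) * (\<psi> t \<bullet> \<psi> t))"
  have "\<phi> 1 \<le> \<phi> 0"
  proof (rule DERIV_nonpos_imp_nonincreasing[where f = \<phi> and a = 0 and b = 1])
    show "(0::real) \<le> 1" by simp
    fix t :: real assume t: "0 \<le> t" "t \<le> 1"
    have "((\<lambda>t. \<psi> t \<bullet> \<psi> t) has_real_derivative (2 * (\<psi> t \<bullet> D t))) (at t)"
    proof -
      have "(\<psi> has_derivative (\<lambda>h. h *\<^sub>R D t)) (at t)" using d[OF t] by (simp add: has_vector_derivative_def)
      from has_derivative_inner[OF this this]
      show ?thesis unfolding has_field_derivative_def
        by (rule has_derivative_eq_rhs) (simp add: fun_eq_iff inner_commute algebra_simps)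
    qed
    note dq = this
    have de: "((\<lambda>t. exp (- (2 * K) * t)) has_real_derivative (exp (- (2 * K) * t) * (- (2 * K)))) (at t)"
      by (auto intro!: derivative_eq_intros)
    have dp: "(\<phi> has_real_derivative (exp (- (2 * K) * t) * (- (2 * K)) * (\<psi> t \<bullet> \<psi> t) + 2 * (\<psi> t \<bullet> D t) * exp (- (2 * K) * t))) (at t)"
      unfolding \<phi>_def by (rule DERIV_mult[OF de dq])
    have "\<psi> t \<bullet> D t \<le> norm (\<psi> t) * norm (D t)" by (rule norm_cauchy_schwarz)
    also have "\<dots> \<le> norm (\<psi> t) * (K * norm (\<psi> t))" by (intro mult_left_mono D t norm_ge_zero)
    also have "\<dots> = K * (\<psi> t \<bullet> \<psi> t)" by (simp add: power2_norm_eq_inner[symmetric] power2_eq_square)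
    finally have "2 * (\<psi> t \<bullet> D t) - 2 * K * (\<psi> t \<bullet> \<psi> t) \<le> 0" by simp
    then have "exp (- (2 * K) * t) * (2 * (\<psi> t \<bullet> D t) - 2 * K * (\<psi> t \<bullet> \<psi> t)) \<le> 0"
      by (intro mult_nonneg_nonpos) auto
    then have le: "exp (- (2 * K) * t) * (- (2 * K)) * (\<psi> t \<bullet> \<psi> t) + 2 * (\<psi> t \<bullet> D t) * exp (- (2 * K) * t) \<le> 0"
      by (simp add: algebra_simps)
    show "\<exists>y. (\<phi> has_real_derivative y) (at t) \<and> y \<le> 0" by (rule exI, rule conjI[OF dp le])
  qed
  then have "exp (- (2 * K)) * (\<psi> 1 \<bullet> \<psi> 1) \<le> 0" using z by (simp add: \<phi>_def)
  then have "\<psi> 1 \<bullet> \<psi> 1 \<le> 0" by (simp add: mult_le_0_iff del: inner_eq_zero_iff)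
  moreover have "0 \<le> \<psi> 1 \<bullet> \<psi> 1" by (rule inner_ge_zero)
  ultimately have "\<psi> 1 \<bullet> \<psi> 1 = 0" by linarith
  then show ?thesis by simp
qed

section \<open>Left-invariant vector fields on a Carnot group\<close>

locale carnot =
  fixes gmul :: "'g::euclidean_space \<Rightarrow> 'g \<Rightarrow> 'g" and s :: nat and Vs :: "nat \<Rightarrow> 'g set" and Xmap :: "'k::euclidean_space \<Rightarrow> 'g"
  assumes cg: "carnot_group gmul s Vs Xmap"
begin

lemmas carnot_conj = cg[unfolded carnot_group_def]

lemma step_pos: "1 \<le> s"
  and assoc: "gmul (gmul x y) z = gmul x (gmul y z)"
  and unit: "gmul 0 x = x" "gmul x 0 = x"
  and smooth_gmul: "smooth_fun (\<lambda>p. gmul (fst p) (snd p))"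
  and one_param: "gmul (a *\<^sub>R v) (b *\<^sub>R v) = (a + b) *\<^sub>R v"
  and span_layers: "span (\<Union>i\<in>{1..s}. Vs i) = UNIV"
  and layer_Suc: "i \<in> {1..<s} \<Longrightarrow> span {lie_br gmul v w | v w. v \<in> Vs 1 \<and> w \<in> Vs i} = Vs (Suc i)"
  and layer_last: "v \<in> Vs 1 \<Longrightarrow> w \<in> Vs s \<Longrightarrow> lie_br gmul v w = 0"
  and linear_Xmap: "linear Xmap"
  subgoal by (rule carnot_conj[THEN conjunct1])
  subgoal by (rule carnot_conj[THEN conjunct2, THEN conjunct1, rule_format])
  subgoal by (rule carnot_conj[THEN conjunct2, THEN conjunct2, THEN conjunct1, rule_format, THEN conjunct1])
  subgoal by (rule carnot_conj[THEN conjunct2, THEN conjunct2, THEN conjunct1, rule_format, THEN conjunct2])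
  subgoal by (rule carnot_conj[THEN conjunct2, THEN conjunct2, THEN conjunct2, THEN conjunct2, THEN conjunct1])
  subgoal by (rule carnot_conj[THEN conjunct2, THEN conjunct2, THEN conjunct2, THEN conjunct2, THEN conjunct2, THEN conjunct1, rule_format])
  subgoal by (rule carnot_conj[THEN conjunct2, THEN conjunct2, THEN conjunct2, THEN conjunct2, THEN conjunct2, THEN conjunct2, THEN conjunct2, THEN conjunct2, THEN conjunct1])
  subgoal by (rule carnot_conj[THEN conjunct2, THEN conjunct2, THEN conjunct2, THEN conjunct2, THEN conjunct2, THEN conjunct2, THEN conjunct2, THEN conjunct2, THEN conjunct2, THEN conjunct1, rule_format])
  subgoal by (rule carnot_conj[THEN conjunct2, THEN conjunct2, THEN conjunct2, THEN conjunct2, THEN conjunct2, THEN conjunct2, THEN conjunct2, THEN conjunct2, THEN conjunct2, THEN conjunct2, THEN conjunct1, rule_format])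
  subgoal by (rule carnot_conj[THEN conjunct2, THEN conjunct2, THEN conjunct2, THEN conjunct2, THEN conjunct2, THEN conjunct2, THEN conjunct2, THEN conjunct2, THEN conjunct2, THEN conjunct2, THEN conjunct2, THEN conjunct1])
  done

abbreviation X :: "'g \<Rightarrow> 'g \<Rightarrow> 'g" where "X \<equiv> linv_field gmul"
abbreviation br :: "'g \<Rightarrow> 'g \<Rightarrow> 'g" where "br \<equiv> lie_br gmul"

text \<open>Uncurried, so that smoothness on the product space and the symmetry of its second
  derivatives apply.\<close>

definition mm :: "'g \<times> 'g \<Rightarrow> 'g" where "mm p = gmul (fst p) (snd p)"

lemma smooth_mm: "smooth_fun mm"
  using smooth_gmul unfolding mm_def[abs_def] .

lemma gmul_right_derivative: "(gmul x has_derivative (\<lambda>w. dd mm (x, y) (0, w))) (at y)"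
proof -
  have "((\<lambda>y. (x, y)) has_derivative (\<lambda>w. (0, w))) (at y)" by (intro derivative_intros)
  from has_derivative_compose[OF this smooth_has_derivative[OF smooth_mm]]
  show ?thesis by (simp add: mm_def)
qed

lemma X_eq: "X w x = dd mm (x, 0) (0, w)"
  unfolding linv_field_def by (rule fun_cong[OF frechet_derivative_at[OF gmul_right_derivative[of x 0]], symmetric])

lemma linear_X: "linear (\<lambda>w. X w x)"
proof -
  interpret l: linear "dd mm (x, 0)" by (rule linear_dd[OF smooth_mm])
  show ?thesis unfolding X_eq
  proof (rule linearI)
    show "dd mm (x, 0) (0, a + b) = dd mm (x, 0) (0, a) + dd mm (x, 0) (0, b)" for a b
      using l.add[of "(0, a)" "(0, b)"] by simp
    show "dd mm (x, 0) (0, c *\<^sub>R a) = c *\<^sub>R dd mm (x, 0) (0, a)" for c a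
      using l.scale[of c "(0, a)"] by simp
  qed
qed

lemmas X_add = linear_add[OF linear_X] and X_diff = linear_diff[OF linear_X]
  and X_scale = linear_scale[OF linear_X] and X_zero = linear_0[OF linear_X]

lemma smooth_X: "smooth_fun (X w)"
proof -
  have "X w = (\<lambda>x. dd mm (x, 0) (0, w))" by (rule ext) (rule X_eq)
  then show ?thesis using smooth_slice[OF smooth_directional[OF smooth_mm, of "(0, w)"]] by simp
qed

lemma X_at_0: "X w 0 = w"
proof -
  have "(gmul 0 has_derivative (\<lambda>w. w)) (at 0)" unfolding unit(1)[abs_def] by (rule has_derivative_ident)
  from fun_cong[OF frechet_derivative_at[OF this], of w] show ?thesis unfolding linv_field_def by (rule sym)
qed

text \<open>Differentiate \<open>one_param\<close> in \<open>b\<close> at \<open>0\<close>: in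
  exponential coordinates a left-invariant field is constant along its own line through the
  identity.\<close>

lemma X_along: "X v (t *\<^sub>R v) = v"
proof -
  have d: "((\<lambda>b::real. b *\<^sub>R v) has_derivative (\<lambda>b. b *\<^sub>R v)) (at 0)" by (auto intro!: derivative_eq_intros)
  have "(gmul (t *\<^sub>R v) has_derivative (\<lambda>w. X w (t *\<^sub>R v))) (at (0 *\<^sub>R v))"
    unfolding X_eq using gmul_right_derivative[of "t *\<^sub>R v" 0] by simp
  from has_derivative_compose[OF d this]
  have 1: "((\<lambda>b. gmul (t *\<^sub>R v) (b *\<^sub>R v)) has_derivative (\<lambda>b. X (b *\<^sub>R v) (t *\<^sub>R v))) (at 0)" .
  have 2: "((\<lambda>b. gmul (t *\<^sub>R v) (b *\<^sub>R v)) has_derivative (\<lambda>b. b *\<^sub>R v)) (at 0)"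
    unfolding one_param by (auto intro!: derivative_eq_intros simp: scaleR_add_left)
  from fun_cong[OF has_derivative_unique[OF 1 2], of 1] show ?thesis by simp
qed

text \<open>Differentiate associativity in the last factor at the identity.\<close>

lemma left_invariance: "dd mm (x, y) (0, X w y) = X w (gmul x y)"
proof -
  have d1: "(gmul y has_derivative (\<lambda>w. X w y)) (at 0)" unfolding X_eq by (rule gmul_right_derivative)
  have d2: "(gmul x has_derivative (\<lambda>w. dd mm (x, y) (0, w))) (at (gmul y 0))"
    unfolding unit(2) by (rule gmul_right_derivative)
  from has_derivative_compose[OF d1 d2]
  have 1: "((\<lambda>z. gmul x (gmul y z)) has_derivative (\<lambda>w. dd mm (x, y) (0, X w y))) (at 0)" .
  have 2: "((\<lambda>z. gmul x (gmul y z)) has_derivative (\<lambda>w. X w (gmul x y))) (at 0)"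
    unfolding assoc[symmetric] X_eq by (rule gmul_right_derivative)
  from fun_cong[OF has_derivative_unique[OF 1 2], of w] show ?thesis .
qed

lemma lie_br_eq: "br v w = dd (X w) 0 v - dd (X v) 0 w"
  by (simp add: lie_br_def)

lemma linear_expand:
  assumes "linear (L :: 'g \<Rightarrow> 'z::real_vector)"
  shows "L a = (\<Sum>i\<in>Basis. (a \<bullet> i) *\<^sub>R L i)"
proof -
  have "L a = L (\<Sum>i\<in>Basis. (a \<bullet> i) *\<^sub>R i)" by (simp only: euclidean_representation)
  also have "\<dots> = (\<Sum>i\<in>Basis. (a \<bullet> i) *\<^sub>R L i)" by (simp add: linear_sum[OF assms] linear_scale[OF assms])
  finally show ?thesis .
qed

lemma dd_X_linear_field: "linear (\<lambda>w. dd (X w) x v)"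
proof (rule linearI)
  fix a b
  have e: "X (a + b) = (\<lambda>x. X a x + X b x)" by (rule ext) (rule X_add)
  have "(X (a + b) has_derivative (\<lambda>v. dd (X a) x v + dd (X b) x v)) (at x)"
    unfolding e by (intro has_derivative_add smooth_has_derivative smooth_X)
  from fun_cong[OF frechet_derivative_at[OF this], of v]
  show "dd (X (a + b)) x v = dd (X a) x v + dd (X b) x v" by (rule sym)
next
  fix c a
  have e: "X (c *\<^sub>R a) = (\<lambda>x. c *\<^sub>R X a x)" by (rule ext) (rule X_scale)
  have "(X (c *\<^sub>R a) has_derivative (\<lambda>v. c *\<^sub>R dd (X a) x v)) (at x)"
    unfolding e by (intro has_derivative_scaleR_right smooth_has_derivative smooth_X)
  from fun_cong[OF frechet_derivative_at[OF this], of v]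
  show "dd (X (c *\<^sub>R a)) x v = c *\<^sub>R dd (X a) x v" by (rule sym)
qed

lemma br_linear_left: "linear (\<lambda>v. br v w)"
  unfolding lie_br_eq
  by (intro linear_compose_sub linear_dd smooth_X dd_X_linear_field)

lemma br_linear_right: "linear (br v)"
  unfolding lie_br_eq[abs_def]
  by (intro linear_compose_sub linear_dd smooth_X dd_X_linear_field)

lemma br_antisym: "br v w = - br w v"
  by (simp add: lie_br_eq)

text \<open>The Maurer--Cartan relation, by differentiating left invariance.\<close>
lemma field_bracket: "dd (X w) x (X v x) - dd (X v) x (X w x) = X (br v w) x"
proof -
  \<comment> \<open>The second summand is a second derivative of the multiplication, symmetric in
    \<open>v\<close> and \<open>w\<close>, and drops out of the commutator.\<close>
  have key: "dd (X w) x (X v x) = X (dd (X w) 0 v) x + dd (\<lambda>p. dd mm p (0, w)) (x, 0) (0, v)" for v w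
  proof -
    have d1: "(gmul x has_derivative (\<lambda>v. X v x)) (at 0)" unfolding X_eq by (rule gmul_right_derivative)
    have d2: "(X w has_derivative dd (X w) x) (at (gmul x 0))" unfolding unit(2) by (rule smooth_has_derivative[OF smooth_X])
    from has_derivative_compose[OF d1 d2]
    have 1: "((\<lambda>y. X w (gmul x y)) has_derivative (\<lambda>v. dd (X w) x (X v x))) (at 0)" .
    have ex: "dd mm p (0, a) = (\<Sum>i\<in>Basis. (a \<bullet> i) *\<^sub>R dd mm p (0, i))" for p a
    proof (rule linear_expand)
      interpret l: linear "dd mm p" by (rule linear_dd[OF smooth_mm])
      show "linear (\<lambda>a. dd mm p (0, a))"
      proof (rule linearI)
        show "dd mm p (0, a + b) = dd mm p (0, a) + dd mm p (0, b)" for a b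
          using l.add[of "(0, a)" "(0, b)"] by simp
        show "dd mm p (0, c *\<^sub>R a) = c *\<^sub>R dd mm p (0, a)" for c a
          using l.scale[of c "(0, a)"] by simp
      qed
    qed
    have dp: "((\<lambda>y. (x, y)) has_derivative (\<lambda>v. (0, v))) (at 0)" by (intro derivative_intros)
    have dW: "((\<lambda>y. dd mm (x, y) (0, i)) has_derivative (\<lambda>v. dd (\<lambda>p. dd mm p (0, i)) (x, 0) (0, v))) (at 0)" for i
      by (rule has_derivative_compose[OF dp smooth_has_derivative[OF smooth_directional[OF smooth_mm]]])
    have "((\<lambda>y. \<Sum>i\<in>Basis. (X w y \<bullet> i) *\<^sub>R dd mm (x, y) (0, i)) has_derivative
      (\<lambda>v. \<Sum>i\<in>Basis. (X w 0 \<bullet> i) *\<^sub>R dd (\<lambda>p. dd mm p (0, i)) (x, 0) (0, v) + (dd (X w) 0 v \<bullet> i) *\<^sub>R dd mm (x, 0) (0, i))) (at 0)"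
      by (intro has_derivative_sum has_derivative_scaleR has_derivative_inner_left smooth_has_derivative[OF smooth_X] dW)
    moreover have "(\<lambda>y. \<Sum>i\<in>Basis. (X w y \<bullet> i) *\<^sub>R dd mm (x, y) (0, i)) = (\<lambda>y. X w (gmul x y))"
      unfolding left_invariance[symmetric] ex[symmetric] ..
    ultimately have 2: "((\<lambda>y. X w (gmul x y)) has_derivative
      (\<lambda>v. \<Sum>i\<in>Basis. (X w 0 \<bullet> i) *\<^sub>R dd (\<lambda>p. dd mm p (0, i)) (x, 0) (0, v) + (dd (X w) 0 v \<bullet> i) *\<^sub>R dd mm (x, 0) (0, i))) (at 0)" by simp
    from fun_cong[OF has_derivative_unique[OF 1 2], of v]
    have "dd (X w) x (X v x) = (\<Sum>i\<in>Basis. (w \<bullet> i) *\<^sub>R dd (\<lambda>p. dd mm p (0, i)) (x, 0) (0, v) + (dd (X w) 0 v \<bullet> i) *\<^sub>R dd mm (x, 0) (0, i))"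
      unfolding X_at_0 .
    also have "\<dots> = (\<Sum>i\<in>Basis. (w \<bullet> i) *\<^sub>R dd (\<lambda>p. dd mm p (0, i)) (x, 0) (0, v)) + X (dd (X w) 0 v) x"
      unfolding sum.distrib ex[symmetric] X_eq ..
    also have "(\<Sum>i\<in>Basis. (w \<bullet> i) *\<^sub>R dd (\<lambda>p. dd mm p (0, i)) (x, 0) (0, v)) = dd (\<lambda>p. dd mm p (0, w)) (x, 0) (0, v)"
    proof -
      have "((\<lambda>p. \<Sum>i\<in>Basis. (w \<bullet> i) *\<^sub>R dd mm p (0, i)) has_derivative (\<lambda>u. \<Sum>i\<in>Basis. (w \<bullet> i) *\<^sub>R dd (\<lambda>p. dd mm p (0, i)) (x, 0) u)) (at (x, 0))"
        by (intro has_derivative_sum has_derivative_scaleR_right smooth_has_derivative smooth_directional smooth_mm)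
      then have "((\<lambda>p. dd mm p (0, w)) has_derivative (\<lambda>u. \<Sum>i\<in>Basis. (w \<bullet> i) *\<^sub>R dd (\<lambda>p. dd mm p (0, i)) (x, 0) u)) (at (x, 0))"
        unfolding ex[symmetric] .
      from fun_cong[OF frechet_derivative_at[OF this], of "(0, v)"] show ?thesis .
    qed
    finally show ?thesis by (simp add: add.commute)
  qed
  have "dd (\<lambda>p. dd mm p (0, w)) (x, 0) (0, v) = dd (\<lambda>p. dd mm p (0, v)) (x, 0) (0, w)"
    by (rule symmetric_second_derivative[OF smooth_mm])
  then show ?thesis unfolding key[of w v] key[of v w] lie_br_eq X_diff by simp
qed

text \<open>Differentiating \<open>field_bracket\<close> at the identity expresses double brackets
  by the first derivatives \<open>\<Gamma>\<close> and the second derivatives \<open>S\<close> of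
  the fields there. The second derivatives are symmetric in their last two arguments and
  cancel.\<close>

lemma jacobi: "br (br p q) y = br p (br q y) - br q (br p y)"
proof -
  define \<Gamma> where "\<Gamma> = (\<lambda>w v. dd (X w) 0 v)"
  define S where "S = (\<lambda>w v u. dd (\<lambda>x. dd (X w) x v) 0 u)"
  have S: "S w v u = S w u v" for w v u unfolding S_def by (rule symmetric_second_derivative[OF smooth_X])
  have lin\<Gamma>: "linear (\<Gamma> w)" for w unfolding \<Gamma>_def by (rule linear_dd[OF smooth_X])
  have d: "((\<lambda>x. dd (X w) x (X v x)) has_derivative (\<lambda>u. \<Gamma> w (\<Gamma> v u) + S w v u)) (at 0)" for v w
  proof -
    have ex: "dd (X w) x a = (\<Sum>i\<in>Basis. (a \<bullet> i) *\<^sub>R dd (X w) x i)" for x a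
      by (rule linear_expand[OF linear_dd[OF smooth_X]])
    have 1: "((\<lambda>x. \<Sum>i\<in>Basis. (X v x \<bullet> i) *\<^sub>R dd (X w) x i) has_derivative
       (\<lambda>u. \<Sum>i\<in>Basis. (X v 0 \<bullet> i) *\<^sub>R dd (\<lambda>x. dd (X w) x i) 0 u + (dd (X v) 0 u \<bullet> i) *\<^sub>R dd (X w) 0 i)) (at 0)"
      by (intro has_derivative_sum has_derivative_scaleR has_derivative_inner_left smooth_has_derivative smooth_directional smooth_X)
    have sv: "(\<Sum>i\<in>Basis. (v \<bullet> i) *\<^sub>R dd (\<lambda>x. dd (X w) x i) 0 u) = S w v u" for u
    proof -
      have "((\<lambda>x. \<Sum>i\<in>Basis. (v \<bullet> i) *\<^sub>R dd (X w) x i) has_derivative (\<lambda>u. \<Sum>i\<in>Basis. (v \<bullet> i) *\<^sub>R dd (\<lambda>x. dd (X w) x i) 0 u)) (at 0)"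
        by (intro has_derivative_sum has_derivative_scaleR_right smooth_has_derivative smooth_directional smooth_X)
      then have "((\<lambda>x. dd (X w) x v) has_derivative (\<lambda>u. \<Sum>i\<in>Basis. (v \<bullet> i) *\<^sub>R dd (\<lambda>x. dd (X w) x i) 0 u)) (at 0)"
        unfolding ex[of _ v, symmetric] .
      from fun_cong[OF frechet_derivative_at[OF this], of u] show ?thesis unfolding S_def .
    qed
    have "(\<lambda>u. \<Sum>i\<in>Basis. (X v 0 \<bullet> i) *\<^sub>R dd (\<lambda>x. dd (X w) x i) 0 u + (dd (X v) 0 u \<bullet> i) *\<^sub>R dd (X w) 0 i)
      = (\<lambda>u. \<Gamma> w (\<Gamma> v u) + S w v u)"
      unfolding sum.distrib X_at_0 sv ex[symmetric] by (simp add: \<Gamma>_def add.commute)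
    moreover have "(\<lambda>x. \<Sum>i\<in>Basis. (X v x \<bullet> i) *\<^sub>R dd (X w) x i) = (\<lambda>x. dd (X w) x (X v x))"
      unfolding ex[symmetric] ..
    ultimately show ?thesis using 1 by simp
  qed
  have e: "\<Gamma> w (\<Gamma> v u) + S w v u - (\<Gamma> v (\<Gamma> w u) + S v w u) = \<Gamma> (br v w) u" for u v w
  proof -
    have "((\<lambda>x. dd (X w) x (X v x) - dd (X v) x (X w x)) has_derivative
      (\<lambda>u. \<Gamma> w (\<Gamma> v u) + S w v u - (\<Gamma> v (\<Gamma> w u) + S v w u))) (at 0)" by (intro has_derivative_diff d)
    then have 1: "((\<lambda>x. X (br v w) x) has_derivative (\<lambda>u. \<Gamma> w (\<Gamma> v u) + S w v u - (\<Gamma> v (\<Gamma> w u) + S v w u))) (at 0)"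
      unfolding field_bracket .
    from fun_cong[OF has_derivative_unique[OF 1 smooth_has_derivative[OF smooth_X]], of u] show ?thesis unfolding \<Gamma>_def .
  qed
  have b: "br v w = \<Gamma> w v - \<Gamma> v w" for v w by (simp add: lie_br_eq \<Gamma>_def)
  have bb: "br u (br v w) = \<Gamma> w (\<Gamma> v u) + S w v u - (\<Gamma> v (\<Gamma> w u) + S v w u) - (\<Gamma> u (\<Gamma> w v) - \<Gamma> u (\<Gamma> v w))" for u v w
  proof -
    have "\<Gamma> u (br v w) = \<Gamma> u (\<Gamma> w v) - \<Gamma> u (\<Gamma> v w)" unfolding b[of v w] by (rule linear_diff[OF lin\<Gamma>])
    then show ?thesis unfolding b[of u "br v w"] e[of w v u] by (simp only:)
  qed
  have "br (br p q) y = - br y (br p q)" by (rule br_antisym)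
  then show ?thesis unfolding bb using S[of q p y] S[of p q y] S[of y q p] by (simp add: algebra_simps)
qed

end

section \<open>The filtration by layers and nilpotency\<close>

lemma span_linear_into:
  assumes "linear f" "subspace S" "\<And>x. x \<in> B \<Longrightarrow> f x \<in> S" "x \<in> span B"
  shows "f x \<in> S"
proof -
  have "f x \<in> f ` span B" using assms(4) by blast
  also have "f ` span B = span (f ` B)" by (rule linear_span_image[OF assms(1), symmetric])
  also have "\<dots> \<subseteq> S" using assms(2,3) by (intro span_minimal) auto
  finally show ?thesis .
qed

context carnot begin

text \<open>The descending filtration of the Lie algebra. It is \<open>{0}\<close> at
  \<open>Suc s\<close>, so any operation that gains one step each time is exact after
  \<open>s\<close> repetitions.\<close>

definition layers_from :: "nat \<Rightarrow> 'g set" where "layers_from i = span (\<Union>j\<in>{i..s}. Vs j)"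

lemma subspace_layers_from: "subspace (layers_from i)"
  unfolding layers_from_def by (rule subspace_span)

lemma layers_from_mono: "i \<le> j \<Longrightarrow> layers_from j \<subseteq> layers_from i"
  unfolding layers_from_def by (intro span_mono UN_mono) auto

lemma layers_from_1: "layers_from 1 = UNIV"
  unfolding layers_from_def by (rule span_layers)

lemma layers_from_last: "layers_from (Suc s) = {0}"
  by (simp add: layers_from_def)

lemma layer_in_layers_from: "v \<in> Vs j \<Longrightarrow> i \<le> j \<Longrightarrow> j \<le> s \<Longrightarrow> v \<in> layers_from i"
  unfolding layers_from_def by (intro span_base) auto

lemma br_Vs1: "v \<in> Vs 1 \<Longrightarrow> y \<in> layers_from b \<Longrightarrow> 1 \<le> b \<Longrightarrow> br v y \<in> layers_from (Suc b)"
proof (rule span_linear_into[OF br_linear_right subspace_layers_from])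
  assume v: "v \<in> Vs 1" and b: "1 \<le> b"
  fix w assume "w \<in> (\<Union>j\<in>{b..s}. Vs j)"
  then obtain j where j: "b \<le> j" "j \<le> s" "w \<in> Vs j" by auto
  show "br v w \<in> layers_from (Suc b)"
  proof (cases "j = s")
    case True
    then have "br v w = 0" using layer_last[OF v] j by simp
    then show ?thesis using subspace_0[OF subspace_layers_from] by simp
  next
    case False
    then have js: "j \<in> {1..<s}" using j b by auto
    have "br v w \<in> span {lie_br gmul v w | v w. v \<in> Vs 1 \<and> w \<in> Vs j}" using v j(3) by (intro span_base) blast
    then have "br v w \<in> Vs (Suc j)" unfolding layer_Suc[OF js] .
    then show ?thesis using j js by (intro layer_in_layers_from[of _ "Suc j"]) auto
  qed
qed (simp add: layers_from_def)

text \<open>Induction on \<open>a\<close>. The layer \<open>Suc a\<close> is spanned by brackets of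
  the first layer with the layer \<open>a\<close>, and the Jacobi identity reduces a bracket with
  such an element to successive brackets with its two constituents.\<close>

lemma br_layer:
  assumes "1 \<le> a" "a \<le> s" "p \<in> Vs a" "y \<in> layers_from b" "1 \<le> b"
  shows "br p y \<in> layers_from (a + b)"
  using assms
proof (induction a arbitrary: p y b rule: nat_induct_at_least)
  case base
  then show ?case using br_Vs1 by simp
next
  case (Suc a)
  have as: "a \<in> {1..<s}" using Suc by auto
  have "p \<in> span {lie_br gmul v w | v w. v \<in> Vs 1 \<and> w \<in> Vs a}" using Suc.prems(2) unfolding layer_Suc[OF as] .
  then show ?case
  proof (rule span_linear_into[OF br_linear_left subspace_layers_from, rotated])
    fix x assume "x \<in> {lie_br gmul v w | v w. v \<in> Vs 1 \<and> w \<in> Vs a}"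
    then obtain v w where x: "x = br v w" "v \<in> Vs 1" "w \<in> Vs a" by blast
    have "br w y \<in> layers_from (a + b)" using Suc.IH[OF _ x(3) Suc.prems(3,4)] as by simp
    then have 1: "br v (br w y) \<in> layers_from (Suc (a + b))" using br_Vs1[OF x(2)] Suc.prems(4) by simp
    have "br v y \<in> layers_from (Suc b)" by (rule br_Vs1[OF x(2) Suc.prems(3,4)])
    then have "br w (br v y) \<in> layers_from (a + Suc b)" using Suc.IH[of w "br v y" "Suc b"] x(3) as by simp
    then show "br x y \<in> layers_from (Suc a + b)" unfolding x(1) jacobi using 1 subspace_diff[OF subspace_layers_from] by simp
  qed
qed

text \<open>Only one step is gained because \<open>x\<close> is arbitrary and may have a component
  in the first layer.\<close>

lemma br_layers_from: "y \<in> layers_from i \<Longrightarrow> 1 \<le> i \<Longrightarrow> br x y \<in> layers_from (Suc i)"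
proof -
  assume y: "y \<in> layers_from i" and i: "1 \<le> i"
  have "x \<in> span (\<Union>j\<in>{1..s}. Vs j)" unfolding span_layers by simp
  then show ?thesis
  proof (rule span_linear_into[OF br_linear_left subspace_layers_from, rotated])
    fix p assume "p \<in> (\<Union>j\<in>{1..s}. Vs j)"
    then obtain j where j: "1 \<le> j" "j \<le> s" "p \<in> Vs j" by auto
    show "br p y \<in> layers_from (Suc i)" using br_layer[OF j y i] layers_from_mono[of "Suc i" "j + i"] j by auto
  qed
qed

lemma br_layers_from_left: "x \<in> layers_from i \<Longrightarrow> 1 \<le> i \<Longrightarrow> br x y \<in> layers_from (Suc i)"
  using br_layers_from[of x i y] br_antisym[of x y] subspace_neg[OF subspace_layers_from] by metis

lemma br_pow_layers_from: "y \<in> layers_from i \<Longrightarrow> 1 \<le> i \<Longrightarrow> (br x ^^ k) y \<in> layers_from (i + k)"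
proof (induction k)
  case (Suc k)
  then show ?case using br_layers_from[of "(br x ^^ k) y" "i + k" x] by simp
qed simp

lemma br_pow_s: "(br x ^^ s) y = 0"
  using br_pow_layers_from[where y = y and i = 1 and x = x and k = s] layers_from_1 layers_from_last by simp

lemma linear_br_pow: "linear (br x ^^ k)"
proof (induction k)
  case 0
  then show ?case by (simp add: linear_ident)
next
  case (Suc k)
  then show ?case using linear_compose[OF Suc br_linear_right[of x]] by (simp add: o_def)
qed

section \<open>Left-invariant fields in exponential coordinates\<close>

lemma X_moving:
  assumes a: "(a has_vector_derivative a') (at t)" and c: "(c has_vector_derivative c') (at t)"
  shows "((\<lambda>t. X (a t) (c t)) has_vector_derivative (X a' (c t) + dd (X (a t)) (c t) c')) (at t)"
proof -
  have ex: "X z y = (\<Sum>i\<in>Basis. (z \<bullet> i) *\<^sub>R X i y)" for z y by (rule linear_expand[OF linear_X])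
  have ex2: "dd (X z) y u = (\<Sum>i\<in>Basis. (z \<bullet> i) *\<^sub>R dd (X i) y u)" for z y u by (rule linear_expand[OF dd_X_linear_field])
  have a1: "(a has_derivative (\<lambda>h. h *\<^sub>R a')) (at t)" using a by (simp add: has_vector_derivative_def)
  have c1: "(c has_derivative (\<lambda>h. h *\<^sub>R c')) (at t)" using c by (simp add: has_vector_derivative_def)
  have "((\<lambda>t. \<Sum>i\<in>Basis. (a t \<bullet> i) *\<^sub>R X i (c t)) has_derivative
     (\<lambda>h. \<Sum>i\<in>Basis. (a t \<bullet> i) *\<^sub>R dd (X i) (c t) (h *\<^sub>R c') + ((h *\<^sub>R a') \<bullet> i) *\<^sub>R X i (c t))) (at t)"
    by (intro has_derivative_sum has_derivative_scaleR has_derivative_inner_left a1 has_derivative_compose[OF c1 smooth_has_derivative[OF smooth_X]])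
  then have "((\<lambda>t. X (a t) (c t)) has_derivative (\<lambda>h. dd (X (a t)) (c t) (h *\<^sub>R c') + X (h *\<^sub>R a') (c t))) (at t)"
    unfolding sum.distrib ex[symmetric] ex2[symmetric] .
  then show ?thesis unfolding has_vector_derivative_def
    by (rule has_derivative_eq_rhs)
      (simp add: fun_eq_iff linear_scale[OF linear_dd[OF smooth_X]] X_scale scaleR_add_right add.commute)
qed

text \<open>Differentiate \<open>X_along\<close> along the family
  \<open>x + \<tau> *\<^sub>R y\<close> at \<open>\<tau> = 0\<close>.\<close>

lemma dd_X_along: "dd (X x) (t *\<^sub>R x) (t *\<^sub>R y) = y - X y (t *\<^sub>R x)"
proof -
  have a: "((\<lambda>\<tau>. x + \<tau> *\<^sub>R y) has_vector_derivative y) (at 0)"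
    by (auto intro!: derivative_eq_intros)
  have c: "((\<lambda>\<tau>. t *\<^sub>R (x + \<tau> *\<^sub>R y)) has_vector_derivative t *\<^sub>R y) (at 0)"
    by (auto intro!: derivative_eq_intros)
  from X_moving[OF a c] have "((\<lambda>\<tau>. x + \<tau> *\<^sub>R y) has_vector_derivative (X y (t *\<^sub>R x) + dd (X x) (t *\<^sub>R x) (t *\<^sub>R y))) (at 0)"
    unfolding X_along by simp
  from vector_derivative_unique_at[OF this a] show ?thesis by (simp add: eq_diff_eq add.commute)
qed

definition Em :: "'g \<Rightarrow> 'g \<Rightarrow> 'g" where
  "Em x y = (\<Sum>k<s. ((-1) ^ k / fact (Suc k)) *\<^sub>R (br x ^^ k) y)"

text \<open>In exponential coordinates the left Maurer--Cartan form is \<open>(1 - exp (- ad x)) / ad x\<close>.\<close>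
lemma X_Em: "X (Em x y) x = y"
proof -
  \<comment> \<open>The solution of the linear equation with right-hand side
    \<open>y - br x (\<theta> t)\<close> starting at \<open>0\<close>; its series stops by
    nilpotency, and its value at \<open>1\<close> is \<open>Em x y\<close>.\<close>
  define \<theta> where "\<theta> = (\<lambda>t::real. \<Sum>k<s. ((-1) ^ k * t ^ Suc k / fact (Suc k)) *\<^sub>R (br x ^^ k) y)"
  define \<theta>' where "\<theta>' = (\<lambda>t::real. \<Sum>k<s. ((-1) ^ k * t ^ k / fact k) *\<^sub>R (br x ^^ k) y)"
  have d\<theta>: "(\<theta> has_vector_derivative \<theta>' t) (at t)" for t
  proof -
    have "((\<lambda>t. ((-1) ^ k * t ^ Suc k / fact (Suc k))) has_real_derivative ((-1) ^ k * t ^ k / fact k)) (at t)" for k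
    proof -
      have "((\<lambda>t. ((-1) ^ k * t ^ Suc k / fact (Suc k))) has_real_derivative ((-1) ^ k * (real (Suc k) * t ^ k) / fact (Suc k))) (at t)"
        using DERIV_cdivide[OF DERIV_cmult[OF DERIV_pow[of "Suc k" t], of "(-1) ^ k"], of "fact (Suc k)"] by (simp del: of_nat_Suc fact_Suc)
      moreover have "(-1) ^ k * (real (Suc k) * t ^ k) / fact (Suc k) = (-1) ^ k * t ^ k / fact k"
        by (simp add: field_simps del: of_nat_Suc)
      ultimately show ?thesis by simp
    qed
    then have "((\<lambda>t. ((-1) ^ k * t ^ Suc k / fact (Suc k)) *\<^sub>R (br x ^^ k) y) has_vector_derivative ((-1) ^ k * t ^ k / fact k) *\<^sub>R (br x ^^ k) y) (at t)" for k
      by (rule has_vector_derivative_scaleR[OF _ has_vector_derivative_const, THEN has_vector_derivative_eq_rhs]) simp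
    then show ?thesis unfolding \<theta>_def \<theta>'_def by (intro has_vector_derivative_sum)
  qed
  have \<theta>': "\<theta>' t = y - br x (\<theta> t)" for t
  proof -
    define q where "q = (\<lambda>k. ((-1) ^ k * t ^ k / fact k) *\<^sub>R (br x ^^ k) y)"
    have "br x (\<theta> t) = (\<Sum>k<s. ((-1) ^ k * t ^ Suc k / fact (Suc k)) *\<^sub>R (br x ^^ Suc k) y)"
      unfolding \<theta>_def by (simp only: linear_sum[OF br_linear_right] linear_scale[OF br_linear_right] funpow.simps o_apply)
    also have "\<dots> = - (\<Sum>k<s. q (Suc k))"
      unfolding q_def sum_negf[symmetric] by (intro sum.cong refl) (simp del: funpow.simps fact_Suc)
    finally have "y - br x (\<theta> t) = q 0 + (\<Sum>k<s. q (Suc k))" by (simp add: q_def)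
    also have "\<dots> = (\<Sum>k<Suc s. q k)" by (rule sum.lessThan_Suc_shift[symmetric])
    also have "\<dots> = \<theta>' t" by (simp add: q_def \<theta>'_def br_pow_s)
    finally show ?thesis by simp
  qed
  \<comment> \<open>The claim is \<open>\<psi> 1 = 0\<close>. By the bracket relation and
    \<open>dd_X_along\<close> the inhomogeneous terms cancel, so \<open>\<psi>\<close> solves a
    homogeneous linear equation with initial value zero.\<close>
  define \<psi> where "\<psi> = (\<lambda>t. X (\<theta> t) (t *\<^sub>R x) - t *\<^sub>R y)"
  have d\<psi>: "(\<psi> has_vector_derivative dd (X x) (t *\<^sub>R x) (\<psi> t)) (at t)" for t
  proof -
    have c: "((\<lambda>t. t *\<^sub>R x) has_vector_derivative x) (at t)" and cy: "((\<lambda>t. t *\<^sub>R y) has_vector_derivative y) (at t)"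
      by (auto intro!: derivative_eq_intros)
    have "(\<psi> has_vector_derivative (X (\<theta>' t) (t *\<^sub>R x) + dd (X (\<theta> t)) (t *\<^sub>R x) x - y)) (at t)"
      unfolding \<psi>_def by (intro has_vector_derivative_diff X_moving[OF d\<theta> c] cy)
    moreover have "X (\<theta>' t) (t *\<^sub>R x) + dd (X (\<theta> t)) (t *\<^sub>R x) x - y = dd (X x) (t *\<^sub>R x) (\<psi> t)"
    proof -
      have 1: "dd (X (\<theta> t)) (t *\<^sub>R x) x = dd (X x) (t *\<^sub>R x) (X (\<theta> t) (t *\<^sub>R x)) + X (br x (\<theta> t)) (t *\<^sub>R x)"
        using field_bracket[of "\<theta> t" "t *\<^sub>R x" x] unfolding X_along by (simp add: algebra_simps)
      have 2: "X (\<theta>' t) (t *\<^sub>R x) = X y (t *\<^sub>R x) - X (br x (\<theta> t)) (t *\<^sub>R x)" unfolding \<theta>' by (rule X_diff)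
      have 3: "dd (X x) (t *\<^sub>R x) (\<psi> t) = dd (X x) (t *\<^sub>R x) (X (\<theta> t) (t *\<^sub>R x)) - (y - X y (t *\<^sub>R x))"
        unfolding \<psi>_def dd_X_along[symmetric] by (rule linear_diff[OF linear_dd[OF smooth_X]])
      show ?thesis unfolding 1 2 3 by simp
    qed
    ultimately show ?thesis by simp
  qed
  have "\<exists>B. \<forall>t\<in>{0..1}. norm (dd (X x) (t *\<^sub>R x) i) \<le> B" for i
  proof -
    have "continuous_on {0..1} (\<lambda>t. dd (X x) (t *\<^sub>R x) i)"
      by (rule continuous_on_compose2[OF smooth_continuous[OF smooth_directional[OF smooth_X]]]) (auto intro!: continuous_intros)
    then have "bounded ((\<lambda>t. dd (X x) (t *\<^sub>R x) i) ` {0..1})"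
      by (intro compact_imp_bounded compact_continuous_image) auto
    then show ?thesis unfolding bounded_iff by auto
  qed
  then obtain B where B: "\<And>i t. t \<in> {0..1} \<Longrightarrow> norm (dd (X x) (t *\<^sub>R x) i) \<le> B i" by metis
  have bd: "norm (dd (X x) (t *\<^sub>R x) z) \<le> (\<Sum>i\<in>Basis. B i) * norm z" if t: "0 \<le> t" "t \<le> 1" for t z
  proof -
    have "dd (X x) (t *\<^sub>R x) z = (\<Sum>i\<in>Basis. (z \<bullet> i) *\<^sub>R dd (X x) (t *\<^sub>R x) i)"
      by (rule linear_expand[OF linear_dd[OF smooth_X]])
    also have "norm \<dots> \<le> (\<Sum>i\<in>Basis. norm z * B i)"
      by (intro order_trans[OF norm_sum] sum_mono) (use B t Basis_le_norm in \<open>auto intro!: mult_mono\<close>)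
    finally show ?thesis by (simp add: sum_distrib_left mult.commute)
  qed
  have "\<psi> 1 = 0"
  proof (rule linear_ode_zero[OF d\<psi> bd])
    show "\<psi> 0 = 0" by (simp add: \<psi>_def \<theta>_def X_zero)
  qed auto
  then show ?thesis by (simp add: \<psi>_def \<theta>_def Em_def)
qed

text \<open>The defect of \<open>Em x\<close> from the identity. The sum starts at \<open>1\<close>,
  so every term contains a bracket and \<open>Nm x\<close> is nilpotent.\<close>

definition Nm :: "'g \<Rightarrow> 'g \<Rightarrow> 'g" where
  "Nm x y = - (\<Sum>k\<in>{1..<s}. ((-1) ^ k / fact (Suc k)) *\<^sub>R (br x ^^ k) y)"

lemma Em_Nm: "Em x y = y - Nm x y"
proof -
  have "{..<s} = insert 0 {1..<s}" using step_pos by auto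
  then show ?thesis unfolding Em_def Nm_def by simp
qed

lemma linear_Nm: "linear (Nm x)"
  unfolding Nm_def[abs_def]
  by (intro linear_compose_neg linear_compose_sum ballI linear_compose_scale_right linear_br_pow)

text \<open>Every term of \<open>Nm\<close> contains a bracket with \<open>x\<close>, so a
  perturbation lying in \<open>layers_from i\<close> is moved one step further down the
  filtration.\<close>

lemma Nm_diff_layers_from:
  assumes "x - x' \<in> layers_from i" "y - y' \<in> layers_from i" "1 \<le> i"
  shows "Nm x y - Nm x' y' \<in> layers_from (Suc i)"
proof -
  have b: "br x y - br x' y' \<in> layers_from (Suc i)" if "y - y' \<in> layers_from i" for y y'
  proof -
    have "br x y - br x' y' = br (x - x') y + br x' (y - y')"
      by (simp add: linear_diff[OF br_linear_left] linear_diff[OF br_linear_right])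
    then show ?thesis using br_layers_from_left[OF assms(1,3)] br_layers_from[OF that assms(3)] subspace_add[OF subspace_layers_from] by metis
  qed
  have p: "(br x ^^ Suc k) y - (br x' ^^ Suc k) y' \<in> layers_from (Suc i)" for k
  proof (induction k)
    case 0
    then show ?case using b[OF assms(2)] by simp
  next
    case (Suc k)
    then have "(br x ^^ Suc k) y - (br x' ^^ Suc k) y' \<in> layers_from i" using layers_from_mono[of i "Suc i"] by auto
    from b[OF this] show ?case by simp
  qed
  have "Nm x y - Nm x' y' = (\<Sum>k\<in>{1..<s}. - ((-1) ^ k / fact (Suc k)) *\<^sub>R ((br x ^^ k) y - (br x' ^^ k) y'))"
    unfolding Nm_def by (simp add: scaleR_diff_right sum_subtractf sum_negf)
  also have "\<dots> \<in> layers_from (Suc i)"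
  proof (intro subspace_sum[OF subspace_layers_from] subspace_scale[OF subspace_layers_from])
    fix k assume "k \<in> {1..<s}"
    then obtain l where "k = Suc l" by (cases k) auto
    then show "(br x ^^ k) y - (br x' ^^ k) y' \<in> layers_from (Suc i)" using p by simp
  qed
  finally show ?thesis .
qed

lemma Nm_layers_from: "y \<in> layers_from i \<Longrightarrow> 1 \<le> i \<Longrightarrow> Nm x y \<in> layers_from (Suc i)"
  using Nm_diff_layers_from[of x x i y 0] linear_0[OF linear_Nm] subspace_0[OF subspace_layers_from] by simp

lemma Nm_pow_s: "(Nm x ^^ s) y = 0"
proof -
  have "(Nm x ^^ k) y \<in> layers_from (Suc k)" for k
  proof (induction k)
    case 0
    then show ?case using layers_from_1 by simp
  next
    case (Suc k)
    then show ?case using Nm_layers_from[of "(Nm x ^^ k) y" "Suc k"] by simp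
  qed
  then show ?thesis using layers_from_last by blast
qed

text \<open>The finite Neumann series for the inverse of \<open>Em x\<close>. In particular the
  fields are polynomial in the base point.\<close>

lemma X_formula: "X v x = (\<Sum>j<s. (Nm x ^^ j) v)"
proof -
  define u where "u = (\<Sum>j<s. (Nm x ^^ j) v)"
  have "Nm x u = (\<Sum>j<s. (Nm x ^^ Suc j) v)"
    unfolding u_def by (simp add: linear_sum[OF linear_Nm])
  moreover have "v + (\<Sum>j<s. (Nm x ^^ Suc j) v) = (\<Sum>j<Suc s. (Nm x ^^ j) v)"
    unfolding sum.lessThan_Suc_shift by simp
  moreover have "(\<Sum>j<Suc s. (Nm x ^^ j) v) = u" by (simp add: u_def Nm_pow_s)
  ultimately have "v = Em x u" unfolding Em_Nm by (simp add: algebra_simps)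
  then show ?thesis using X_Em[of x u] by (simp add: u_def)
qed

text \<open>With respect to the filtration the fields contract differences of base points; this gain
  of one step makes the Picard iteration terminate.\<close>

lemma X_diff_layers_from:
  assumes "x - x' \<in> layers_from i" "1 \<le> i"
  shows "X v x - X v x' \<in> layers_from (Suc i)"
proof -
  have "(Nm x ^^ j) v - (Nm x' ^^ j) v \<in> layers_from (Suc i)" for j
  proof (induction j)
    case 0
    then show ?case using subspace_0[OF subspace_layers_from] by simp
  next
    case (Suc j)
    then have "(Nm x ^^ j) v - (Nm x' ^^ j) v \<in> layers_from i" using layers_from_mono[of i "Suc i"] by auto
    from Nm_diff_layers_from[OF assms(1) this assms(2)] show ?case by simp
  qed
  then show ?thesis unfolding X_formula sum_subtractf[symmetric] by (intro subspace_sum[OF subspace_layers_from])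
qed

end

section \<open>The endpoint map as a polynomial\<close>

lemma L2D: "u \<in> L2 \<Longrightarrow> u \<in> borel_measurable (lebesgue_on {0..1})"
    "u \<in> L2 \<Longrightarrow> (\<lambda>t. (norm (u t))\<^sup>2) integrable_on {0..1}"
    "u \<in> L2 \<Longrightarrow> integral {0..1} (\<lambda>t. (norm (u t))\<^sup>2) = (L2norm u)\<^sup>2"
proof -
  show "u \<in> L2 \<Longrightarrow> u \<in> borel_measurable (lebesgue_on {0..1})" by (simp add: L2_def)
  assume "u \<in> L2"
  then have i: "integrable (lebesgue_on {0..1}) (\<lambda>t. (norm (u t))\<^sup>2)" by (simp add: L2_def)
  then show "(\<lambda>t. (norm (u t))\<^sup>2) integrable_on {0..1}" by (intro integrable_on_lebesgue_on) auto
  have "integral {0..1} (\<lambda>t. (norm (u t))\<^sup>2) = integral\<^sup>L (lebesgue_on {0..1}) (\<lambda>t. (norm (u t))\<^sup>2)"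
    using i by (intro lebesgue_integral_eq_integral[symmetric]) auto
  then show "integral {0..1} (\<lambda>t. (norm (u t))\<^sup>2) = (L2norm u)\<^sup>2" by (simp add: L2norm_def)
qed

lemma L2_scale: "u \<in> L2 \<Longrightarrow> (\<lambda>t. c *\<^sub>R u t) \<in> L2"
  by (auto simp: L2_def power_mult_distrib intro!: borel_measurable_scaleR)

lemma L2norm_scale: "L2norm (\<lambda>t. c *\<^sub>R u t) = \<bar>c\<bar> * L2norm u"
  by (simp add: L2norm_def power_mult_distrib real_sqrt_mult)

lemma L2norm_nonneg: "0 \<le> L2norm u"
  by (simp add: L2norm_def integral_nonneg_AE)

lemma L2_add:
  assumes "u \<in> L2" "v \<in> L2"
  shows "(\<lambda>t. u t + v t) \<in> L2"
proof -
  have m: "(\<lambda>t. u t + v t) \<in> borel_measurable (lebesgue_on {0..1})"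
    using L2D(1)[OF assms(1)] L2D(1)[OF assms(2)] by (rule borel_measurable_add)
  have "integrable (lebesgue_on {0..1}) (\<lambda>t. (norm (u t + v t))\<^sup>2)"
  proof (rule Bochner_Integration.integrable_bound)
    show "integrable (lebesgue_on {0..1}) (\<lambda>t. 2 * (norm (u t))\<^sup>2 + 2 * (norm (v t))\<^sup>2)"
      using assms by (auto simp: L2_def)
    show "(\<lambda>t. (norm (u t + v t))\<^sup>2) \<in> borel_measurable (lebesgue_on {0..1})" using m by measurable
    have "(norm (u t + v t))\<^sup>2 \<le> 2 * (norm (u t))\<^sup>2 + 2 * (norm (v t))\<^sup>2" for t
    proof -
      have "(norm (u t + v t))\<^sup>2 \<le> (norm (u t) + norm (v t))\<^sup>2" by (intro power_mono norm_triangle_ineq) auto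
      also have "\<dots> \<le> 2 * (norm (u t))\<^sup>2 + 2 * (norm (v t))\<^sup>2"
        using zero_le_power2[of "norm (u t) - norm (v t)"] by (simp add: power2_eq_square algebra_simps)
      finally show ?thesis .
    qed
    then show "AE t in lebesgue_on {0..1}. norm ((norm (u t + v t))\<^sup>2) \<le> norm (2 * (norm (u t))\<^sup>2 + 2 * (norm (v t))\<^sup>2)"
      by simp
  qed
  then show ?thesis using m by (simp add: L2_def)
qed

lemma L2_zero: "(\<lambda>t. 0) \<in> L2"
  by (simp add: L2_def)

lemma L2_sum: "(\<And>j. j \<in> A \<Longrightarrow> e j \<in> L2) \<Longrightarrow> (\<lambda>t. \<Sum>j\<in>A. x j *\<^sub>R e j t) \<in> L2"
  by (induction A rule: infinite_finite_induct) (simp_all add: L2_zero L2_add L2_scale)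

text \<open>The weight is dominated by \<open>(1 + (norm (u \<tau>))\<^sup>2) / 2\<close>, whose
  integral is at most \<open>1\<close> for a control in the unit ball. Integration against such a
  control therefore does not enlarge a bound \<open>C\<close>.\<close>

lemma L2_integrand:
  fixes u :: "real \<Rightarrow> 'k::euclidean_space" and c :: "real \<Rightarrow> 'z::euclidean_space"
  assumes u: "u \<in> L2" and c: "continuous_on {0..1} c" and b: "norm b \<le> 1"
  shows "(\<lambda>\<tau>. (u \<tau> \<bullet> b) *\<^sub>R c \<tau>) integrable_on {0..1}"
    and "L2norm u \<le> 1 \<Longrightarrow> (\<And>t. t \<in> {0..1} \<Longrightarrow> norm (c t) \<le> C) \<Longrightarrow> t \<in> {0..1} \<Longrightarrow> norm (integral {0..t} (\<lambda>\<tau>. (u \<tau> \<bullet> b) *\<^sub>R c \<tau>)) \<le> C"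
proof -
  have mc: "c \<in> borel_measurable (lebesgue_on {0..1})"
    using c by (intro continuous_imp_measurable_on_sets_lebesgue) auto
  have m: "(\<lambda>\<tau>. (u \<tau> \<bullet> b) *\<^sub>R c \<tau>) \<in> borel_measurable (lebesgue_on {0..1})"
    using L2D(1)[OF u] mc by measurable
  have ub: "\<bar>u \<tau> \<bullet> b\<bar> \<le> (1 + (norm (u \<tau>))\<^sup>2) / 2" for \<tau>
  proof -
    have "\<bar>u \<tau> \<bullet> b\<bar> \<le> norm (u \<tau>) * norm b" by (rule Cauchy_Schwarz_ineq2)
    also have "\<dots> \<le> norm (u \<tau>) * 1" using b by (intro mult_left_mono) auto
    also have "\<dots> \<le> (1 + (norm (u \<tau>))\<^sup>2) / 2"
      using zero_le_power2[of "norm (u \<tau>) - 1"] by (simp add: power2_eq_square algebra_simps)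
    finally show ?thesis .
  qed
  have gi: "(\<lambda>\<tau>. (1 + (norm (u \<tau>))\<^sup>2) / 2 * D) integrable_on {0..1}" for D :: real
    using L2D(2)[OF u] by (intro integrable_on_mult_left integrable_on_divide integrable_add) auto
  have int: "(\<lambda>\<tau>. (u \<tau> \<bullet> b) *\<^sub>R c \<tau>) integrable_on {0..1}"
    and bound: "t \<in> {0..1} \<Longrightarrow> norm (integral {0..t} (\<lambda>\<tau>. (u \<tau> \<bullet> b) *\<^sub>R c \<tau>)) \<le> integral {0..1} (\<lambda>\<tau>. (1 + (norm (u \<tau>))\<^sup>2) / 2 * D)"
    if D: "\<And>t. t \<in> {0..1} \<Longrightarrow> norm (c t) \<le> D" for D
  proof -
    have nb: "norm ((u \<tau> \<bullet> b) *\<^sub>R c \<tau>) \<le> (1 + (norm (u \<tau>))\<^sup>2) / 2 * D" if "\<tau> \<in> {0..1}" for \<tau>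
      unfolding norm_scaleR using ub D[OF that] by (intro mult_mono) auto
    show i1: "(\<lambda>\<tau>. (u \<tau> \<bullet> b) *\<^sub>R c \<tau>) integrable_on {0..1}"
      by (rule measurable_bounded_by_integrable_imp_integrable[OF m gi]) (use nb in auto)
    assume t: "t \<in> {0..1}"
    have D0: "0 \<le> D" by (rule order_trans[OF norm_ge_zero D[of 0]]) simp
    have "norm (integral {0..t} (\<lambda>\<tau>. (u \<tau> \<bullet> b) *\<^sub>R c \<tau>)) \<le> integral {0..t} (\<lambda>\<tau>. (1 + (norm (u \<tau>))\<^sup>2) / 2 * D)"
    proof (rule integral_norm_bound_integral)
      show "(\<lambda>\<tau>. (u \<tau> \<bullet> b) *\<^sub>R c \<tau>) integrable_on {0..t}" using i1 by (rule integrable_on_subinterval) (use t in auto)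
      show "(\<lambda>\<tau>. (1 + (norm (u \<tau>))\<^sup>2) / 2 * D) integrable_on {0..t}" using gi by (rule integrable_on_subinterval) (use t in auto)
    qed (use nb t in auto)
    also have "\<dots> \<le> integral {0..1} (\<lambda>\<tau>. (1 + (norm (u \<tau>))\<^sup>2) / 2 * D)"
    proof (rule integral_subset_le)
      show "(\<lambda>\<tau>. (1 + (norm (u \<tau>))\<^sup>2) / 2 * D) integrable_on {0..t}" using gi by (rule integrable_on_subinterval) (use t in auto)
    qed (use t gi D0 in auto)
    finally show "norm (integral {0..t} (\<lambda>\<tau>. (u \<tau> \<bullet> b) *\<^sub>R c \<tau>)) \<le> integral {0..1} (\<lambda>\<tau>. (1 + (norm (u \<tau>))\<^sup>2) / 2 * D)" .
  qed
  have "\<exists>D. \<forall>t\<in>{0..1}. norm (c t) \<le> D"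
    using compact_imp_bounded[OF compact_continuous_image[OF c]] unfolding bounded_iff by auto
  then obtain D where D: "\<And>t. t \<in> {0..1} \<Longrightarrow> norm (c t) \<le> D" by blast
  show "(\<lambda>\<tau>. (u \<tau> \<bullet> b) *\<^sub>R c \<tau>) integrable_on {0..1}" by (rule int[OF D])
  assume n1: "L2norm u \<le> 1" and C: "\<And>t. t \<in> {0..1} \<Longrightarrow> norm (c t) \<le> C" and t: "t \<in> {0..1}"
  have C0: "0 \<le> C" by (rule order_trans[OF norm_ge_zero C[of 0]]) simp
  have "integral {0..1} (\<lambda>\<tau>. (1 + (norm (u \<tau>))\<^sup>2) / 2 * C) = (1 + (L2norm u)\<^sup>2) / 2 * C"
  proof -
    have "integral {0..1} (\<lambda>\<tau>. 1 + (norm (u \<tau>))\<^sup>2) = integral {0..1} (\<lambda>\<tau>::real. 1::real) + integral {0..1} (\<lambda>\<tau>. (norm (u \<tau>))\<^sup>2)"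
      by (rule integral_add) (use L2D(2)[OF u] in auto)
    then show ?thesis using L2D(3)[OF u] by simp
  qed
  also have "\<dots> \<le> (1 + 1) / 2 * C"
    using n1 C0 L2norm_nonneg[of u] by (intro mult_right_mono divide_right_mono add_left_mono) (auto simp: power_le_one)
  finally show "norm (integral {0..t} (\<lambda>\<tau>. (u \<tau> \<bullet> b) *\<^sub>R c \<tau>)) \<le> C" using bound[OF C t] by simp
qed

text \<open>\<open>unif_poly d \<Phi>\<close>: along every finite-dimensional subspace spanned by controls in the unit ball, \<open>\<Phi> u t\<close> is
  a polynomial of degree at most \<open>d\<close> whose coefficients are bounded uniformly in the subspace.\<close>
definition unif_poly_rep :: "nat \<Rightarrow> nat \<Rightarrow> (nat \<Rightarrow> real \<Rightarrow> 'k::euclidean_space) \<Rightarrow> ((real \<Rightarrow> 'k) \<Rightarrow> real \<Rightarrow> 'z::euclidean_space) \<Rightarrow> real \<Rightarrow> (nat list \<Rightarrow> real \<Rightarrow> 'z) \<Rightarrow> bool" where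
  "unif_poly_rep N d e \<Phi> C c \<longleftrightarrow> (\<forall>I\<in>lists_n N d. continuous_on {0..1} (c I) \<and> (\<forall>t\<in>{0..1}. norm (c I t) \<le> C)) \<and>
     (\<forall>x. \<forall>t\<in>{0..1}. \<Phi> (\<lambda>\<tau>. \<Sum>j<N. x j *\<^sub>R e j \<tau>) t = (\<Sum>I\<in>lists_n N d. lmon N x I *\<^sub>R c I t))"

definition unif_poly :: "nat \<Rightarrow> ((real \<Rightarrow> 'k::euclidean_space) \<Rightarrow> real \<Rightarrow> 'z::euclidean_space) \<Rightarrow> bool" where
  "unif_poly d \<Phi> \<longleftrightarrow> (\<exists>C\<ge>0. \<forall>N e. (\<forall>j<N. e j \<in> L2 \<and> L2norm (e j) \<le> 1) \<longrightarrow> (\<exists>c. unif_poly_rep N d e \<Phi> C c))"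

lemma unif_poly_repD:
  assumes "unif_poly_rep N d e \<Phi> C c"
  shows "I \<in> lists_n N d \<Longrightarrow> continuous_on {0..1} (c I)" "I \<in> lists_n N d \<Longrightarrow> t \<in> {0..1} \<Longrightarrow> norm (c I t) \<le> C"
    "t \<in> {0..1} \<Longrightarrow> \<Phi> (\<lambda>\<tau>. \<Sum>j<N. x j *\<^sub>R e j \<tau>) t = (\<Sum>I\<in>lists_n N d. lmon N x I *\<^sub>R c I t)"
  using assms unfolding unif_poly_rep_def by simp_all

lemma lists_n_0: "lists_n N 0 = {[]}"
  by (auto simp: lists_n_def)

lemma sum_lists_n_Suc: "(\<Sum>I\<in>lists_n N (Suc d). f I) = (\<Sum>i\<le>N. \<Sum>I\<in>lists_n N d. f (i # I))"
proof -
  have e: "lists_n N (Suc d) = (\<lambda>(i, I). i # I) ` ({..N} \<times> lists_n N d)"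
  proof (intro equalityI subsetI)
    fix J assume "J \<in> lists_n N (Suc d)"
    then obtain i I where "J = i # I" "i \<le> N" "I \<in> lists_n N d" by (cases J) (auto simp: lists_n_def)
    then show "J \<in> (\<lambda>(i, I). i # I) ` ({..N} \<times> lists_n N d)" by force
  qed (auto simp: lists_n_def)
  have "inj_on (\<lambda>(i, I). i # I) ({..N} \<times> lists_n N d)" by (auto simp: inj_on_def)
  from sum.reindex[OF this, of f] show ?thesis unfolding e sum.cartesian_product by (simp add: case_prod_beta o_def)
qed

lemma sum_lists_n_append: "(\<Sum>K\<in>lists_n N (d + e). f K) = (\<Sum>I\<in>lists_n N d. \<Sum>J\<in>lists_n N e. f (I @ J))"
proof (induction d arbitrary: f)
  case 0
  then show ?case by (simp add: lists_n_0)
next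
  case (Suc d)
  have "(\<Sum>K\<in>lists_n N (Suc d + e). f K) = (\<Sum>i\<le>N. \<Sum>K\<in>lists_n N (d + e). f (i # K))"
    using sum_lists_n_Suc[of f N "d + e"] by simp
  also have "\<dots> = (\<Sum>i\<le>N. \<Sum>I\<in>lists_n N d. \<Sum>J\<in>lists_n N e. f (i # I @ J))" by (simp add: Suc)
  also have "\<dots> = (\<Sum>I\<in>lists_n N (Suc d). \<Sum>J\<in>lists_n N e. f (I @ J))"
    by (simp add: sum_lists_n_Suc)
  finally show ?case .
qed

lemma unif_poly_I:
  assumes "0 \<le> C" "\<And>N e. \<forall>j<N. e j \<in> L2 \<and> L2norm (e j) \<le> 1 \<Longrightarrow> unif_poly_rep N d e \<Phi> C (c N e)"
  shows "unif_poly d \<Phi>"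
  unfolding unif_poly_def using assms by blast

text \<open>Coefficients are selected for all families at once, so that derived coefficients can be
  written down by a formula.\<close>

lemma unif_poly_E:
  assumes "unif_poly d \<Phi>"
  shows "\<exists>C c. 0 \<le> C \<and> (\<forall>N e. (\<forall>j<N. e j \<in> L2 \<and> L2norm (e j) \<le> 1) \<longrightarrow> unif_poly_rep N d e \<Phi> C (c N e))"
proof -
  obtain C where C: "0 \<le> C" "\<forall>N e. (\<forall>j<N. e j \<in> L2 \<and> L2norm (e j) \<le> 1) \<longrightarrow> (\<exists>c. unif_poly_rep N d e \<Phi> C c)"
    using assms unfolding unif_poly_def by blast
  then have "\<forall>N e. (\<forall>j<N. e j \<in> L2 \<and> L2norm (e j) \<le> 1) \<longrightarrow> unif_poly_rep N d e \<Phi> C (SOME c. unif_poly_rep N d e \<Phi> C c)"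
    by (simp add: someI_ex)
  then show ?thesis using C(1) by (intro exI[of _ C] exI[of _ "\<lambda>N e. SOME c. unif_poly_rep N d e \<Phi> C c"]) simp
qed

lemma unif_poly_const: "unif_poly 0 (\<lambda>u t. z)"
  by (rule unif_poly_I[where C = "norm z" and c = "\<lambda>_ _ _ _. z"]) (auto simp: unif_poly_rep_def lists_n_0)

text \<open>The formal degree is raised by prefixing the letter \<open>N\<close>, that is, a factor
  \<open>1\<close>.\<close>

lemma unif_poly_Suc:
  assumes "unif_poly d \<Phi>"
  shows "unif_poly (Suc d) \<Phi>"
proof -
  obtain C c where C: "0 \<le> C" and r: "\<And>N e. \<forall>j<N. e j \<in> L2 \<and> L2norm (e j) \<le> 1 \<Longrightarrow> unif_poly_rep N d e \<Phi> C (c N e)"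
    using unif_poly_E[OF assms] by blast
  show ?thesis
  proof (rule unif_poly_I[OF C, where c = "\<lambda>N e I t. if hd I = N then c N e (tl I) t else 0"])
    fix N and e :: "nat \<Rightarrow> real \<Rightarrow> 'a" assume e: "\<forall>j<N. e j \<in> L2 \<and> L2norm (e j) \<le> 1"
    note c = unif_poly_repD[OF r[OF e]]
    show "unif_poly_rep N (Suc d) e \<Phi> C (\<lambda>I t. if hd I = N then c N e (tl I) t else 0)"
      unfolding unif_poly_rep_def
    proof (intro conjI ballI allI)
      fix I assume "I \<in> lists_n N (Suc d)"
      then have tl: "tl I \<in> lists_n N d" by (cases I) (auto simp: lists_n_def)
      show "continuous_on {0..1} (\<lambda>t. if hd I = N then c N e (tl I) t else 0)" using c(1)[OF tl] by (cases "hd I = N") auto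
      show "norm (if hd I = N then c N e (tl I) t else 0) \<le> C" if "t \<in> {0..1}" for t using c(2)[OF tl that] C by auto
    next
      fix x and t :: real assume t: "t \<in> {0..1}"
      have "(\<Sum>I\<in>lists_n N (Suc d). lmon N x I *\<^sub>R (if hd I = N then c N e (tl I) t else 0))
        = (\<Sum>i\<le>N. if i = N then (\<Sum>I\<in>lists_n N d. lmon N x I *\<^sub>R c N e I t) else 0)"
        unfolding sum_lists_n_Suc by (intro sum.cong refl) (auto simp: lmon_Cons ev_def)
      then show "\<Phi> (\<lambda>\<tau>. \<Sum>j<N. x j *\<^sub>R e j \<tau>) t = (\<Sum>I\<in>lists_n N (Suc d). lmon N x I *\<^sub>R (if hd I = N then c N e (tl I) t else 0))"
        unfolding c(3)[OF t] by simp
    qed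
  qed
qed

lemma unif_poly_mono: "unif_poly d \<Phi> \<Longrightarrow> d \<le> d' \<Longrightarrow> unif_poly d' \<Phi>"
proof (induction d')
  case (Suc n)
  then show ?case by (cases "d = Suc n") (auto intro: unif_poly_Suc)
qed simp

lemma unif_poly_add:
  assumes "unif_poly d \<Phi>" "unif_poly d \<Psi>"
  shows "unif_poly d (\<lambda>u t. \<Phi> u t + \<Psi> u t)"
proof -
  obtain C c where C: "0 \<le> C" and r: "\<And>N e. \<forall>j<N. e j \<in> L2 \<and> L2norm (e j) \<le> 1 \<Longrightarrow> unif_poly_rep N d e \<Phi> C (c N e)"
    using unif_poly_E[OF assms(1)] by blast
  obtain D c' where D: "0 \<le> D" and r': "\<And>N e. \<forall>j<N. e j \<in> L2 \<and> L2norm (e j) \<le> 1 \<Longrightarrow> unif_poly_rep N d e \<Psi> D (c' N e)"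
    using unif_poly_E[OF assms(2)] by blast
  show ?thesis
  proof (rule unif_poly_I[where C = "C + D" and c = "\<lambda>N e I t. c N e I t + c' N e I t"])
    show "0 \<le> C + D" using C D by simp
    fix N and e :: "nat \<Rightarrow> real \<Rightarrow> 'a" assume e: "\<forall>j<N. e j \<in> L2 \<and> L2norm (e j) \<le> 1"
    note c = unif_poly_repD[OF r[OF e]] and c' = unif_poly_repD[OF r'[OF e]]
    show "unif_poly_rep N d e (\<lambda>u t. \<Phi> u t + \<Psi> u t) (C + D) (\<lambda>I t. c N e I t + c' N e I t)"
      unfolding unif_poly_rep_def
    proof (intro conjI ballI allI)
      fix I assume I: "I \<in> lists_n N d"
      show "continuous_on {0..1} (\<lambda>t. c N e I t + c' N e I t)" using c(1) c'(1) I by (intro continuous_on_add) auto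
      show "norm (c N e I t + c' N e I t) \<le> C + D" if "t \<in> {0..1}" for t
        using c(2) c'(2) I that by (intro norm_triangle_le add_mono) auto
    qed (use c(3) c'(3) in \<open>simp add: scaleR_add_right sum.distrib\<close>)
  qed
qed

text \<open>Coefficients of a product are indexed by concatenated lists. Since equal monomials are
  not collected, each coefficient comes from a single pair and its bound is free of
  \<open>N\<close>.\<close>

lemma unif_poly_bilinear:
  assumes B: "bounded_bilinear B" and "unif_poly d \<Phi>" "unif_poly d' \<Psi>"
  shows "unif_poly (d + d') (\<lambda>u t. B (\<Phi> u t) (\<Psi> u t))"
proof -
  interpret bounded_bilinear B by fact
  obtain K where K: "0 \<le> K" "\<And>a b. norm (B a b) \<le> norm a * norm b * K" using nonneg_bounded by blast
  obtain C c where C: "0 \<le> C" and r: "\<And>N e. \<forall>j<N. e j \<in> L2 \<and> L2norm (e j) \<le> 1 \<Longrightarrow> unif_poly_rep N d e \<Phi> C (c N e)"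
    using unif_poly_E[OF assms(2)] by blast
  obtain D c' where D: "0 \<le> D" and r': "\<And>N e. \<forall>j<N. e j \<in> L2 \<and> L2norm (e j) \<le> 1 \<Longrightarrow> unif_poly_rep N d' e \<Psi> D (c' N e)"
    using unif_poly_E[OF assms(3)] by blast
  show ?thesis
  proof (rule unif_poly_I[where C = "C * D * K" and c = "\<lambda>N e L t. B (c N e (take d L) t) (c' N e (drop d L) t)"])
    show "0 \<le> C * D * K" using C D K by simp
    fix N and e :: "nat \<Rightarrow> real \<Rightarrow> 'd" assume e: "\<forall>j<N. e j \<in> L2 \<and> L2norm (e j) \<le> 1"
    note c = unif_poly_repD[OF r[OF e]] and c' = unif_poly_repD[OF r'[OF e]]
    define b where "b = (\<lambda>L t. B (c N e (take d L) t) (c' N e (drop d L) t))"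
    show "unif_poly_rep N (d + d') e (\<lambda>u t. B (\<Phi> u t) (\<Psi> u t)) (C * D * K) (\<lambda>L t. B (c N e (take d L) t) (c' N e (drop d L) t))"
      unfolding unif_poly_rep_def b_def[symmetric]
    proof (intro conjI ballI allI)
      fix I assume I: "I \<in> lists_n N (d + d')"
      have sp: "take d I \<in> lists_n N d" "drop d I \<in> lists_n N d'"
        using I set_take_subset[of d I] set_drop_subset[of d I] by (auto simp: lists_n_def)
      show "continuous_on {0..1} (b I)" unfolding b_def using c(1) c'(1) sp by (intro continuous_on) auto
      fix t :: real assume t: "t \<in> {0..1}"
      have "norm (b I t) \<le> norm (c N e (take d I) t) * norm (c' N e (drop d I) t) * K" unfolding b_def by (rule K(2))
      also have "\<dots> \<le> C * D * K" using c(2) c'(2) sp t K(1) C by (intro mult_right_mono mult_mono) auto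
      finally show "norm (b I t) \<le> C * D * K" .
    next
      fix x and t :: real assume t: "t \<in> {0..1}"
      have "B (\<Phi> (\<lambda>\<tau>. \<Sum>j<N. x j *\<^sub>R e j \<tau>) t) (\<Psi> (\<lambda>\<tau>. \<Sum>j<N. x j *\<^sub>R e j \<tau>) t)
        = (\<Sum>I\<in>lists_n N d. \<Sum>J\<in>lists_n N d'. lmon N x I *\<^sub>R lmon N x J *\<^sub>R B (c N e I t) (c' N e J t))"
        unfolding c(3)[OF t] c'(3)[OF t] sum_left sum_right scaleR_left scaleR_right scaleR_sum_right
        by (subst sum.swap, intro sum.cong refl) (simp add: mult.commute)
      also have "\<dots> = (\<Sum>I\<in>lists_n N d. \<Sum>J\<in>lists_n N d'. lmon N x (I @ J) *\<^sub>R b (I @ J) t)"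
        by (intro sum.cong refl) (simp add: lmon_append b_def lists_n_def)
      also have "\<dots> = (\<Sum>I\<in>lists_n N (d + d'). lmon N x I *\<^sub>R b I t)"
        by (rule sum_lists_n_append[symmetric])
      finally show "B (\<Phi> (\<lambda>\<tau>. \<Sum>j<N. x j *\<^sub>R e j \<tau>) t) (\<Psi> (\<lambda>\<tau>. \<Sum>j<N. x j *\<^sub>R e j \<tau>) t) = (\<Sum>I\<in>lists_n N (d + d'). lmon N x I *\<^sub>R b I t)" .
    qed
  qed
qed

lemma unif_poly_scale: "unif_poly d \<Phi> \<Longrightarrow> unif_poly d (\<lambda>u t. a *\<^sub>R \<Phi> u t)"
  using unif_poly_bilinear[OF bounded_bilinear_scaleR unif_poly_const[of a], of d \<Phi>] by simp

lemma unif_poly_sum: "(\<And>i. i \<in> A \<Longrightarrow> unif_poly d (\<Phi> i)) \<Longrightarrow> unif_poly d (\<lambda>u t. \<Sum>i\<in>A. \<Phi> i u t)"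
proof (induction A rule: infinite_finite_induct)
  case (insert a A)
  then show ?case using unif_poly_add[of d "\<Phi> a" "\<lambda>u t. \<Sum>i\<in>A. \<Phi> i u t"] by simp
qed (simp_all add: unif_poly_mono[OF unif_poly_const])

text \<open>The new first letter records which member of the family appears as the weight; by
  \<open>L2_integrand\<close> the coefficient bound is unchanged.\<close>

lemma unif_poly_integral:
  fixes \<Psi> :: "(real \<Rightarrow> 'k::euclidean_space) \<Rightarrow> real \<Rightarrow> 'z::euclidean_space"
  assumes "unif_poly d \<Psi>" and b: "norm b \<le> 1"
  shows "unif_poly (Suc d) (\<lambda>u t. integral {0..t} (\<lambda>\<tau>. (u \<tau> \<bullet> b) *\<^sub>R \<Psi> u \<tau>))"
proof -
  obtain C c where C: "0 \<le> C" and r: "\<And>N e. \<forall>j<N. e j \<in> L2 \<and> L2norm (e j) \<le> 1 \<Longrightarrow> unif_poly_rep N d e \<Psi> C (c N e)"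
    using unif_poly_E[OF assms(1)] by blast
  define h where "h = (\<lambda>N e i I \<tau>. (e i \<tau> \<bullet> b) *\<^sub>R c N e I \<tau>)"
  show ?thesis
  proof (rule unif_poly_I[OF C, where c = "\<lambda>N e I t. if hd I < N then integral {0..t} (h N e (hd I) (tl I)) else 0"])
    fix N and e :: "nat \<Rightarrow> real \<Rightarrow> 'k" assume e: "\<forall>j<N. e j \<in> L2 \<and> L2norm (e j) \<le> 1"
    note c = unif_poly_repD[OF r[OF e]]
    have eL: "e j \<in> L2" "L2norm (e j) \<le> 1" if "j < N" for j using e that by auto
    have hi: "h N e i I integrable_on {0..1}" if "i < N" "I \<in> lists_n N d" for i I
      unfolding h_def by (rule L2_integrand(1)[OF eL(1)[OF that(1)] c(1)[OF that(2)] b])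
    define c' where "c' = (\<lambda>I t. if hd I < N then integral {0..t} (h N e (hd I) (tl I)) else 0)"
    show "unif_poly_rep N (Suc d) e (\<lambda>u t. integral {0..t} (\<lambda>\<tau>. (u \<tau> \<bullet> b) *\<^sub>R \<Psi> u \<tau>)) C
       (\<lambda>I t. if hd I < N then integral {0..t} (h N e (hd I) (tl I)) else 0)"
      unfolding unif_poly_rep_def c'_def[symmetric]
    proof (intro conjI ballI allI)
      fix I assume "I \<in> lists_n N (Suc d)"
      then have tl: "tl I \<in> lists_n N d" by (cases I) (auto simp: lists_n_def)
      show "continuous_on {0..1} (c' I)"
      proof (cases "hd I < N")
        case True
        then show ?thesis unfolding c'_def using indefinite_integral_continuous_1[OF hi[OF True tl]] by simp
      qed (simp add: c'_def)
      fix t :: real assume t: "t \<in> {0..1}"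
      show "norm (c' I t) \<le> C"
      proof (cases "hd I < N")
        case True
        have "norm (integral {0..t} (h N e (hd I) (tl I))) \<le> C"
          unfolding h_def by (rule L2_integrand(2)[OF eL(1)[OF True] c(1)[OF tl] b eL(2)[OF True] c(2)[OF tl] t])
        then show ?thesis using True by (simp add: c'_def)
      qed (simp add: c'_def C)
    next
      fix x and t :: real assume t: "t \<in> {0..1}"
      have hit: "h N e i I integrable_on {0..t}" if "i < N" "I \<in> lists_n N d" for i I
        using hi[OF that] by (rule integrable_on_subinterval) (use t in auto)
      have "((\<Sum>j<N. x j *\<^sub>R e j \<tau>) \<bullet> b) *\<^sub>R \<Psi> (\<lambda>\<tau>. \<Sum>j<N. x j *\<^sub>R e j \<tau>) \<tau>
        = (\<Sum>j<N. \<Sum>I\<in>lists_n N d. (x j * lmon N x I) *\<^sub>R h N e j I \<tau>)" if "\<tau> \<in> {0..t}" for \<tau>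
      proof -
        have \<tau>: "\<tau> \<in> {0..1}" using that t by auto
        show ?thesis unfolding c(3)[OF \<tau>] h_def inner_sum_left scaleR_sum_left scaleR_sum_right
          by (subst sum.swap, intro sum.cong refl) (simp add: mult_ac)
      qed
      then have "integral {0..t} (\<lambda>\<tau>. ((\<Sum>j<N. x j *\<^sub>R e j \<tau>) \<bullet> b) *\<^sub>R \<Psi> (\<lambda>\<tau>. \<Sum>j<N. x j *\<^sub>R e j \<tau>) \<tau>)
        = integral {0..t} (\<lambda>\<tau>. \<Sum>j<N. \<Sum>I\<in>lists_n N d. (x j * lmon N x I) *\<^sub>R h N e j I \<tau>)"
        by (rule integral_cong)
      also have "\<dots> = (\<Sum>j<N. integral {0..t} (\<lambda>\<tau>. \<Sum>I\<in>lists_n N d. (x j * lmon N x I) *\<^sub>R h N e j I \<tau>))"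
        by (intro integral_sum integrable_sum integrable_cmul hit finite_lists_n) auto
      also have "\<dots> = (\<Sum>j<N. \<Sum>I\<in>lists_n N d. integral {0..t} (\<lambda>\<tau>. (x j * lmon N x I) *\<^sub>R h N e j I \<tau>))"
        by (rule sum.cong[OF refl], intro integral_sum integrable_cmul hit finite_lists_n) auto
      also have "\<dots> = (\<Sum>j<N. \<Sum>I\<in>lists_n N d. lmon N x (j # I) *\<^sub>R c' (j # I) t)"
        by (intro sum.cong refl) (simp add: c'_def lmon_Cons ev_def)
      also have "\<dots> = (\<Sum>I\<in>lists_n N (Suc d). lmon N x I *\<^sub>R c' I t)"
        unfolding sum_lists_n_Suc lessThan_Suc_atMost[symmetric] by (simp add: c'_def)
      finally show "integral {0..t} (\<lambda>\<tau>. ((\<Sum>j<N. x j *\<^sub>R e j \<tau>) \<bullet> b) *\<^sub>R \<Psi> (\<lambda>\<tau>. \<Sum>j<N. x j *\<^sub>R e j \<tau>) \<tau>) = (\<Sum>I\<in>lists_n N (Suc d). lmon N x I *\<^sub>R c' I t)" .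
    qed
  qed
qed

text \<open>A single control, scaled into the unit ball, is a family with one member.\<close>

lemma unif_poly_continuous:
  assumes "unif_poly d \<Phi>" "u \<in> L2"
  shows "continuous_on {0..1} (\<Phi> u)"
proof -
  define a where "a = max 1 (L2norm u)"
  define e where "e = (\<lambda>j::nat. \<lambda>t. (1 / a) *\<^sub>R u t)"
  have a: "a \<ge> 1" "L2norm u \<le> a" by (auto simp: a_def)
  have e: "\<forall>j<1. e j \<in> L2 \<and> L2norm (e j) \<le> 1"
    unfolding e_def using L2_scale[OF assms(2)] a by (auto simp: L2norm_scale)
  obtain C c where r: "\<And>N e. \<forall>j<N. e j \<in> L2 \<and> L2norm (e j) \<le> 1 \<Longrightarrow> unif_poly_rep N d e \<Phi> C (c N e)"
    using unif_poly_E[OF assms(1)] by blast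
  note c = unif_poly_repD[OF r[OF e]]
  have "(\<lambda>\<tau>. \<Sum>j<1::nat. a *\<^sub>R e j \<tau>) = u" using a by (simp add: e_def)
  then have "\<Phi> u t = (\<Sum>I\<in>lists_n 1 d. lmon 1 (\<lambda>_. a) I *\<^sub>R c 1 e I t)" if "t \<in> {0..1}" for t
    using c(3)[OF that, of "\<lambda>_. a"] by simp
  moreover have "continuous_on {0..1} (\<lambda>t. \<Sum>I\<in>lists_n 1 d. lmon 1 (\<lambda>_. a) I *\<^sub>R c 1 e I t)"
    using c(1) by (intro continuous_on_sum continuous_on_scaleR continuous_on_const) auto
  ultimately show ?thesis by (intro continuous_on_eq[of _ "\<lambda>t. \<Sum>I\<in>lists_n 1 d. lmon 1 (\<lambda>_. a) I *\<^sub>R c 1 e I t" "\<Phi> u"]) simp_all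
qed

text \<open>The component \<open>q\<close> of the integral orthogonal to \<open>S\<close> is paired
  with the integrand, which is orthogonal to it; hence \<open>q\<close> vanishes.\<close>

lemma has_integral_in_subspace:
  fixes f :: "real \<Rightarrow> 'a::euclidean_space"
  assumes S: "subspace S" and f: "(f has_integral I) A" and fS: "\<And>x. x \<in> A \<Longrightarrow> f x \<in> S"
  shows "I \<in> S"
proof -
  obtain p q where pq: "p \<in> span S" "\<And>w. w \<in> span S \<Longrightarrow> real_inner_class.orthogonal q w" "I = p + q"
    using orthogonal_subspace_decomp_exists[of S I] by metis
  have pS: "p \<in> S" using pq(1) S by (simp add: span_eq_iff[THEN iffD2])
  have "((\<lambda>x. f x \<bullet> q) has_integral (I \<bullet> q)) A"
    using has_integral_linear[OF f bounded_linear_inner_left[of q]] by (simp add: o_def)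
  moreover have "((\<lambda>x. f x \<bullet> q) has_integral 0) A"
  proof (rule has_integral_is_0)
    fix x assume "x \<in> A"
    then show "f x \<bullet> q = 0" using pq(2)[OF span_base[OF fS]] by (simp add: real_inner_class.orthogonal_def inner_commute)
  qed
  ultimately have "I \<bullet> q = 0" by (rule has_integral_unique)
  moreover have "p \<bullet> q = 0" using pq(2)[OF pq(1)] by (simp add: real_inner_class.orthogonal_def inner_commute)
  ultimately have "q \<bullet> q = 0" unfolding pq(3) by (simp add: inner_add_left)
  then show ?thesis using pS pq(3) by simp
qed

text \<open>Evaluating a field multiplies the degree by at most \<open>s * s\<close>, and
  integration against the control adds one.\<close>

fun picard_degree :: "nat \<Rightarrow> nat \<Rightarrow> nat" where
  "picard_degree s 0 = 0"
| "picard_degree s (Suc i) = Suc (s * s * picard_degree s i)"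

section \<open>Picard iteration for the control equation\<close>

context carnot begin

lemma bounded_bilinear_br: "bounded_bilinear br"
  unfolding bilinear_conv_bounded_bilinear[symmetric] bilinear_def
  using br_linear_left br_linear_right by blast

lemma unif_poly_Nm:
  assumes "unif_poly d \<Phi>" "unif_poly e \<Psi>"
  shows "unif_poly (s * d + e) (\<lambda>u t. Nm (\<Phi> u t) (\<Psi> u t))"
proof -
  have p: "unif_poly (k * d + e) (\<lambda>u t. (br (\<Phi> u t) ^^ k) (\<Psi> u t))" for k
  proof (induction k)
    case 0
    then show ?case using assms(2) by simp
  next
    case (Suc k)
    from unif_poly_bilinear[OF bounded_bilinear_br assms(1) Suc] show ?case by (simp add: add.assoc)
  qed
  have "unif_poly (s * d + e) (\<lambda>u t. \<Sum>k\<in>{1..<s}. (- ((-1) ^ k / fact (Suc k))) *\<^sub>R (br (\<Phi> u t) ^^ k) (\<Psi> u t))"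
  proof (intro unif_poly_sum unif_poly_scale)
    fix k assume "k \<in> {1..<s}"
    then show "unif_poly (s * d + e) (\<lambda>u t. (br (\<Phi> u t) ^^ k) (\<Psi> u t))"
      by (intro unif_poly_mono[OF p]) (simp add: mult_right_mono)
  qed
  then show ?thesis unfolding Nm_def by (simp add: sum_negf)
qed

lemma unif_poly_X:
  assumes "unif_poly d \<Phi>"
  shows "unif_poly (s * s * d) (\<lambda>u t. X v (\<Phi> u t))"
proof -
  have p: "unif_poly (j * (s * d)) (\<lambda>u t. (Nm (\<Phi> u t) ^^ j) v)" for j
  proof (induction j)
    case 0
    then show ?case using unif_poly_const by simp
  next
    case (Suc j)
    from unif_poly_Nm[OF assms Suc] show ?case by simp
  qed
  show ?thesis unfolding X_formula
  proof (intro unif_poly_sum)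
    fix j assume "j \<in> {..<s}"
    then show "unif_poly (s * s * d) (\<lambda>u t. (Nm (\<Phi> u t) ^^ j) v)"
      by (intro unif_poly_mono[OF p]) (simp add: mult_right_mono)
  qed
qed

text \<open>Split into components of the control, since \<open>unif_poly_integral\<close> handles
  scalar weights; linearity of the fields recombines them.\<close>

definition picard_step :: "(real \<Rightarrow> 'k) \<Rightarrow> (real \<Rightarrow> 'g) \<Rightarrow> real \<Rightarrow> 'g" where
  "picard_step u \<gamma> t = (\<Sum>b\<in>Basis. integral {0..t} (\<lambda>\<tau>. (u \<tau> \<bullet> b) *\<^sub>R X (Xmap b) (\<gamma> \<tau>)))"

primrec picard :: "nat \<Rightarrow> (real \<Rightarrow> 'k) \<Rightarrow> real \<Rightarrow> 'g" where
  "picard 0 u = (\<lambda>t. 0)"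
| "picard (Suc i) u = picard_step u (picard i u)"

lemma unif_poly_picard: "unif_poly (picard_degree s i) (picard i)"
proof (induction i)
  case 0
  have "picard 0 = (\<lambda>u t. 0)" by (rule ext) simp
  then show ?case using unif_poly_const[of 0] by simp
next
  case (Suc i)
  have "unif_poly (picard_degree s (Suc i)) (\<lambda>u t. \<Sum>b\<in>Basis. integral {0..t} (\<lambda>\<tau>. (u \<tau> \<bullet> b) *\<^sub>R X (Xmap b) (picard i u \<tau>)))"
    unfolding picard_degree.simps by (intro unif_poly_sum unif_poly_integral unif_poly_X Suc) simp
  moreover have "picard (Suc i) = (\<lambda>u t. \<Sum>b\<in>Basis. integral {0..t} (\<lambda>\<tau>. (u \<tau> \<bullet> b) *\<^sub>R X (Xmap b) (picard i u \<tau>)))"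
    by (intro ext) (simp add: picard_step_def)
  ultimately show ?case by simp
qed

lemma continuous_picard: "u \<in> L2 \<Longrightarrow> continuous_on {0..1} (picard i u)"
  by (rule unif_poly_continuous[OF unif_poly_picard])

lemma picard_step_has_integral:
  assumes u: "u \<in> L2" and \<gamma>: "continuous_on {0..1} \<gamma>" and t: "t \<in> {0..1}"
  shows "((\<lambda>\<tau>. X (Xmap (u \<tau>)) (\<gamma> \<tau>)) has_integral picard_step u \<gamma> t) {0..t}"
proof -
  have e: "X (Xmap a) y = (\<Sum>b\<in>Basis. (a \<bullet> b) *\<^sub>R X (Xmap b) y)" for a y
  proof -
    have l: "linear (\<lambda>a. X (Xmap a) y)" using linear_compose[OF linear_Xmap linear_X[of y]] by (simp add: o_def)
    have "X (Xmap a) y = X (Xmap (\<Sum>b\<in>Basis. (a \<bullet> b) *\<^sub>R b)) y" by (simp only: euclidean_representation)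
    also have "\<dots> = (\<Sum>b\<in>Basis. (a \<bullet> b) *\<^sub>R X (Xmap b) y)" by (simp add: linear_sum[OF l] linear_scale[OF l])
    finally show ?thesis .
  qed
  have c: "continuous_on {0..1} (\<lambda>\<tau>. X w (\<gamma> \<tau>))" for w
    by (rule continuous_on_compose2[OF smooth_continuous[OF smooth_X] \<gamma>]) simp
  have "((\<lambda>\<tau>. \<Sum>b\<in>Basis. (u \<tau> \<bullet> b) *\<^sub>R X (Xmap b) (\<gamma> \<tau>)) has_integral picard_step u \<gamma> t) {0..t}"
    unfolding picard_step_def
  proof (intro has_integral_sum integrable_integral finite_Basis)
    fix b :: 'k assume b: "b \<in> Basis"
    have "(\<lambda>\<tau>. (u \<tau> \<bullet> b) *\<^sub>R X (Xmap b) (\<gamma> \<tau>)) integrable_on {0..1}"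
      by (rule L2_integrand(1)[OF u c]) (use b in simp)
    then show "(\<lambda>\<tau>. (u \<tau> \<bullet> b) *\<^sub>R X (Xmap b) (\<gamma> \<tau>)) integrable_on {0..t}"
      by (rule integrable_on_subinterval) (use t in auto)
  qed
  then show ?thesis unfolding e[symmetric] .
qed

lemma picard_step_diff_layers_from:
  assumes u: "u \<in> L2" and "continuous_on {0..1} \<gamma>" "continuous_on {0..1} \<gamma>'"
    and d: "\<And>t. t \<in> {0..1} \<Longrightarrow> \<gamma> t - \<gamma>' t \<in> layers_from i" "1 \<le> i" and t: "t \<in> {0..1}"
  shows "picard_step u \<gamma> t - picard_step u \<gamma>' t \<in> layers_from (Suc i)"
proof (rule has_integral_in_subspace[OF subspace_layers_from])
  show "((\<lambda>\<tau>. X (Xmap (u \<tau>)) (\<gamma> \<tau>) - X (Xmap (u \<tau>)) (\<gamma>' \<tau>)) has_integral (picard_step u \<gamma> t - picard_step u \<gamma>' t)) {0..t}"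
    by (intro has_integral_diff picard_step_has_integral assms)
  show "X (Xmap (u \<tau>)) (\<gamma> \<tau>) - X (Xmap (u \<tau>)) (\<gamma>' \<tau>) \<in> layers_from (Suc i)" if "\<tau> \<in> {0..t}" for \<tau>
    by (rule X_diff_layers_from[OF d]) (use that t in auto)
qed

text \<open>Successive iterates, and likewise an iterate and any solution, agree modulo
  \<open>layers_from (Suc i)\<close> after \<open>i\<close> steps, because the Picard map gains one
  step of the filtration. For \<open>i = s\<close> nothing is left, which yields both existence and
  uniqueness of the solution and so determines the definite description in
  \<open>End_map\<close>.\<close>

lemma End_map_eq:
  assumes u: "u \<in> L2"
  shows "End_map gmul Xmap u = picard s u 1"
proof -
  have step: "picard (Suc i) u t - picard i u t \<in> layers_from (Suc i)" if "t \<in> {0..1}" for i t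
    using that
  proof (induction i arbitrary: t)
    case 0
    then show ?case using layers_from_1 by simp
  next
    case (Suc i)
    show ?case unfolding picard.simps(2)[of "Suc i"] picard.simps(2)[of i]
      by (rule picard_step_diff_layers_from[OF u _ continuous_picard[OF u] _ _ Suc.prems]) (use Suc.IH continuous_picard[OF u, of "Suc i"] in auto)
  qed
  have fixp: "picard_step u (picard s u) t = picard s u t" if "t \<in> {0..1}" for t
    using step[OF that, of s] layers_from_last by simp
  have sol: "((\<lambda>\<tau>. X (Xmap (u \<tau>)) (picard s u \<tau>)) has_integral picard s u t) {0..t}" if "t \<in> {0..1}" for t
    using picard_step_has_integral[OF u continuous_picard[OF u] that, of s] fixp[OF that] by simp
  have uniq: "\<gamma> 1 = picard s u 1"
    if \<gamma>: "continuous_on {0..1} \<gamma>" "\<forall>t\<in>{0..1}. ((\<lambda>\<tau>. X (Xmap (u \<tau>)) (\<gamma> \<tau>)) has_integral \<gamma> t) {0..t}" for \<gamma>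
  proof -
    have eq: "\<gamma> t = picard_step u \<gamma> t" if "t \<in> {0..1}" for t
      using has_integral_unique[OF \<gamma>(2)[rule_format, OF that] picard_step_has_integral[OF u \<gamma>(1) that]] .
    have "\<gamma> t - picard i u t \<in> layers_from (Suc i)" if "t \<in> {0..1}" for i t
      using that
    proof (induction i arbitrary: t)
      case 0
      then show ?case using layers_from_1 by simp
    next
      case (Suc i)
      have "picard_step u \<gamma> t - picard_step u (picard i u) t \<in> layers_from (Suc (Suc i))"
        by (rule picard_step_diff_layers_from[OF u \<gamma>(1) continuous_picard[OF u] Suc.IH _ Suc.prems]) auto
      then show ?case using eq[OF Suc.prems] by simp
    qed
    from this[of 1 s] show ?thesis using layers_from_last by simp
  qed
  show ?thesis unfolding End_map_def
  proof (rule the_equality)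
    show "\<exists>\<gamma>. continuous_on {0..1} \<gamma> \<and> (\<forall>t\<in>{0..1}. ((\<lambda>\<tau>. X (Xmap (u \<tau>)) (\<gamma> \<tau>)) has_integral \<gamma> t) {0..t}) \<and> picard s u 1 = \<gamma> 1"
      using sol continuous_picard[OF u] by (intro exI[of _ "picard s u"]) simp
    fix y assume "\<exists>\<gamma>. continuous_on {0..1} \<gamma> \<and> (\<forall>t\<in>{0..1}. ((\<lambda>\<tau>. X (Xmap (u \<tau>)) (\<gamma> \<tau>)) has_integral \<gamma> t) {0..t}) \<and> y = \<gamma> 1"
    then show "y = picard s u 1" using uniq by metis
  qed
qed

text \<open>The bound \<open>C\<close> is chosen before \<open>N\<close> and before the family of
  controls; the covering argument depends on this uniformity.\<close>

lemma End_poly: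
  "\<exists>C\<ge>0. \<forall>N e. (\<forall>j<N. e j \<in> L2 \<and> L2norm (e j) \<le> 1) \<longrightarrow>
     (\<exists>c. (\<forall>I\<in>lists_n N (picard_degree s s). norm (c I) \<le> C) \<and> (\<forall>x. End_map gmul Xmap (\<lambda>\<tau>. \<Sum>j<N. x j *\<^sub>R e j \<tau>) = lmap N (picard_degree s s) c x))"
proof -
  obtain C c where C: "0 \<le> C" and r: "\<And>N e. \<forall>j<N. e j \<in> L2 \<and> L2norm (e j) \<le> 1 \<Longrightarrow> unif_poly_rep N (picard_degree s s) e (picard s) C (c N e)"
    using unif_poly_E[OF unif_poly_picard[of s]] by blast
  show ?thesis
  proof (intro exI[of _ C] conjI allI impI C)
    fix N and e :: "nat \<Rightarrow> real \<Rightarrow> 'k" assume e: "\<forall>j<N. e j \<in> L2 \<and> L2norm (e j) \<le> 1"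
    note c = unif_poly_repD[OF r[OF e]]
    have "End_map gmul Xmap (\<lambda>\<tau>. \<Sum>j<N. x j *\<^sub>R e j \<tau>) = lmap N (picard_degree s s) (\<lambda>I. c N e I 1) x" for x
      using End_map_eq[OF L2_sum[of "{..<N}" e x]] e c(3)[of 1 x] by (simp add: lmap_def)
    then show "\<exists>c. (\<forall>I\<in>lists_n N (picard_degree s s). norm (c I) \<le> C) \<and> (\<forall>x. End_map gmul Xmap (\<lambda>\<tau>. \<Sum>j<N. x j *\<^sub>R e j \<tau>) = lmap N (picard_degree s s) c x)"
      using c(2)[of _ 1] by (intro exI[of _ "\<lambda>I. c N e I 1"]) simp
  qed
qed

end

lemma picard_degree_pos: "1 \<le> s \<Longrightarrow> 1 \<le> picard_degree s s"
  by (cases s) auto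

section \<open>Thin sets\<close>

text \<open>All balls have the same radius, as the covering argument produces them at a single
  scale. Countable unions are formed only afterwards, for null sets and for Hausdorff
  measure.\<close>

definition thin :: "real \<Rightarrow> 'a::euclidean_space set \<Rightarrow> bool" where
  "thin s A \<longleftrightarrow> (\<forall>\<epsilon>>0. \<forall>\<delta>>0. \<exists>Q \<rho>. finite Q \<and> 0 < \<rho> \<and> \<rho> \<le> \<delta> \<and> A \<subseteq> (\<Union>q\<in>Q. cball q \<rho>) \<and> real (card Q) * \<rho> powr s \<le> \<epsilon>)"

lemma thinD:
  assumes "thin s A" "0 < \<epsilon>" "0 < \<delta>"
  shows "\<exists>Q \<rho>. finite Q \<and> 0 < \<rho> \<and> \<rho> \<le> \<delta> \<and> A \<subseteq> (\<Union>q\<in>Q. cball q \<rho>) \<and> real (card Q) * \<rho> powr s \<le> \<epsilon>"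
  using assms(1)[unfolded thin_def, rule_format, OF assms(2,3)] .

lemma thin_negligible:
  fixes A :: "'a::euclidean_space set"
  assumes "thin (real DIM('a)) A"
  shows "negligible A"
  unfolding negligible_outer_le
proof (intro allI impI)
  fix e :: real assume e: "0 < e"
  \<comment> \<open>The balls will be enclosed in cubes of side \<open>2 * \<rho>\<close>, hence the
    division by \<open>2 ^ DIM('a)\<close>.\<close>
  obtain Q \<rho> where Q: "finite Q" "0 < \<rho>" "A \<subseteq> (\<Union>q\<in>Q. cball q \<rho>)" "real (card Q) * \<rho> powr real DIM('a) \<le> e / 2 ^ DIM('a)"
    using thinD[OF assms, of "e / 2 ^ DIM('a)" 1] e by auto
  define b where "b = (\<lambda>q::'a. cbox (q - \<rho> *\<^sub>R One) (q + \<rho> *\<^sub>R One))"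
  have cb: "cball q \<rho> \<subseteq> b q" for q
  proof
    fix x assume x: "x \<in> cball q \<rho>"
    have "q \<bullet> i - \<rho> \<le> x \<bullet> i \<and> x \<bullet> i \<le> q \<bullet> i + \<rho>" if "i \<in> Basis" for i
    proof -
      have "\<bar>(q - x) \<bullet> i\<bar> \<le> norm (q - x)" by (rule Basis_le_norm[OF that])
      also have "\<dots> \<le> \<rho>" using x by (simp add: dist_norm)
      finally show ?thesis by (simp add: inner_diff_left abs_le_iff)
    qed
    then show "x \<in> b q" unfolding b_def mem_box by (simp add: inner_diff_left inner_add_left)
  qed
  have mb: "measure lebesgue (b q) = (2 * \<rho>) ^ DIM('a)" for q
  proof -
    have "measure lebesgue (b q) = (\<Prod>i\<in>Basis. (q + \<rho> *\<^sub>R One) \<bullet> i - (q - \<rho> *\<^sub>R One) \<bullet> i)"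
      unfolding b_def using Q(2) by (simp add: measure_completion measure_lborel_cbox_eq inner_diff_left inner_add_left)
    also have "\<dots> = (\<Prod>i\<in>(Basis::'a set). 2 * \<rho>)"
      by (intro prod.cong) (auto simp: inner_diff_left inner_add_left)
    finally show ?thesis by simp
  qed
  show "\<exists>T. A \<subseteq> T \<and> T \<in> lmeasurable \<and> measure lebesgue T \<le> e"
  proof (intro exI[of _ "\<Union>q\<in>Q. b q"] conjI)
    show "A \<subseteq> (\<Union>q\<in>Q. b q)" using Q(3) cb by blast
    show "(\<Union>q\<in>Q. b q) \<in> lmeasurable" using Q(1) by (intro fmeasurable.finite_UN) (auto simp: b_def)
    have "measure lebesgue (\<Union>q\<in>Q. b q) \<le> (\<Sum>q\<in>Q. measure lebesgue (b q))"
      by (intro measure_UNION_le Q(1)) (auto simp: b_def)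
    also have "\<dots> = 2 ^ DIM('a) * (real (card Q) * \<rho> powr real DIM('a))"
      using Q(2) by (simp add: mb powr_realpow power_mult_distrib)
    also have "\<dots> \<le> 2 ^ DIM('a) * (e / 2 ^ DIM('a))" using Q(4) by (intro mult_left_mono) auto
    finally show "measure lebesgue (\<Union>q\<in>Q. b q) \<le> e" by simp
  qed
qed

lemma thin_cover:
  fixes A :: "'a::euclidean_space set"
  assumes A: "thin s A" and e: "0 < \<epsilon>" and d: "0 < \<delta>" and s: "0 < s"
  shows "\<exists>C :: nat \<Rightarrow> 'a set. A \<subseteq> (\<Union>i. C i) \<and> (\<forall>i. bounded (C i) \<and> diameter (C i) \<le> \<delta>) \<and>
    (\<Sum>i. ennreal (if C i = {} then 0 else diameter (C i) powr s)) \<le> ennreal \<epsilon>"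
proof -
  \<comment> \<open>The pieces will be balls of radius \<open>\<rho>\<close> and diameter
    \<open>2 * \<rho>\<close>; this accounts for the factor \<open>2 powr s\<close> and for the
    halved \<open>\<delta>\<close>.\<close>
  have e': "0 < \<epsilon> / 2 powr s" using e by simp
  have d': "0 < \<delta> / 2" using d by simp
  obtain Q \<rho> where Q: "finite Q" "0 < \<rho>" "\<rho> \<le> \<delta> / 2" "A \<subseteq> (\<Union>q\<in>Q. cball q \<rho>)" "real (card Q) * \<rho> powr s \<le> \<epsilon> / 2 powr s"
    using thinD[OF A e' d'] by blast
  obtain f where f: "bij_betw f {0..<card Q} Q" using ex_bij_betw_nat_finite[OF Q(1)] by blast
  define C where "C = (\<lambda>i. if i < card Q then cball (f i) \<rho> else {})"
  have dC: "diameter (cball (f i) \<rho>) = 2 * \<rho>" for i using Q(2) by simp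
  have "A \<subseteq> (\<Union>i. C i)"
  proof
    fix x assume "x \<in> A"
    then obtain q where q: "q \<in> Q" "x \<in> cball q \<rho>" using Q(4) by blast
    then obtain i where "i < card Q" "q = f i" using bij_betw_imp_surj_on[OF f] by (metis atLeastLessThan_iff imageE)
    then show "x \<in> (\<Union>i. C i)" using q by (auto simp: C_def)
  qed
  moreover have "bounded (C i) \<and> diameter (C i) \<le> \<delta>" for i
    using Q(2,3) d unfolding C_def by (cases "i < card Q") auto
  moreover have "(\<Sum>i. ennreal (if C i = {} then 0 else diameter (C i) powr s)) \<le> ennreal \<epsilon>"
  proof -
    have "(\<Sum>i. ennreal (if C i = {} then 0 else diameter (C i) powr s)) = (\<Sum>i<card Q. ennreal (if C i = {} then 0 else diameter (C i) powr s))"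
      by (rule suminf_finite) (auto simp: C_def)
    also have "\<dots> = (\<Sum>i<card Q. ennreal ((2 * \<rho>) powr s))"
      using Q(2) by (intro sum.cong refl) (simp add: C_def)
    also have "\<dots> = ennreal (real (card Q) * (2 * \<rho>) powr s)"
      by (simp add: ennreal_mult' ennreal_of_nat_eq_real_of_nat)
    also have "\<dots> \<le> ennreal \<epsilon>"
    proof (rule ennreal_leI)
      have "real (card Q) * (2 * \<rho>) powr s = 2 powr s * (real (card Q) * \<rho> powr s)"
        using Q(2) by (simp add: powr_mult)
      also have "\<dots> \<le> 2 powr s * (\<epsilon> / 2 powr s)" using Q(5) by (intro mult_left_mono) auto
      finally show "real (card Q) * (2 * \<rho>) powr s \<le> \<epsilon>" by simp
    qed
    finally show ?thesis .
  qed
  ultimately show ?thesis by (intro exI[of _ C]) blast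
qed

section \<open>Hausdorff measure and dimension\<close>

lemma thin_UN_hausdorff:
  fixes A :: "nat \<Rightarrow> 'a::euclidean_space set"
  assumes A: "\<And>M. thin s (A M)" and s: "0 < s"
  shows "hausdorff_measure s (\<Union>M. A M) = 0"
proof -
  have "hausdorff_pre s \<delta> (\<Union>M. A M) \<le> 0 + ennreal \<epsilon>" if d: "0 < \<delta>" and e: "0 < \<epsilon>" for \<delta> \<epsilon>
  proof -
    \<comment> \<open>The set \<open>A M\<close> receives the share
      \<open>\<epsilon> / 2 ^ Suc M\<close> of the budget; a pairing of the natural numbers then
      merges the covers into a single sequence.\<close>
    have "\<forall>M. \<exists>C :: nat \<Rightarrow> 'a set. A M \<subseteq> (\<Union>i. C i) \<and> (\<forall>i. bounded (C i) \<and> diameter (C i) \<le> \<delta>) \<and>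
      (\<Sum>i. ennreal (if C i = {} then 0 else diameter (C i) powr s)) \<le> ennreal (\<epsilon> * (1/2) ^ Suc M)"
      using thin_cover[OF A _ d s] e by simp
    from choice[OF this] obtain C :: "nat \<Rightarrow> nat \<Rightarrow> 'a set" where C: "\<And>M. A M \<subseteq> (\<Union>i. C M i)" "\<And>M i. bounded (C M i) \<and> diameter (C M i) \<le> \<delta>"
      "\<And>M. (\<Sum>i. ennreal (if C M i = {} then 0 else diameter (C M i) powr s)) \<le> ennreal (\<epsilon> * (1/2) ^ Suc M)" by blast
    define D where "D = (\<lambda>i. C (fst (prod_decode i)) (snd (prod_decode i)))"
    define h where "h = (\<lambda>z. ennreal (if C (fst z) (snd z) = {} then 0 else diameter (C (fst z) (snd z)) powr s))"
    have "(\<Union>M. A M) \<subseteq> (\<Union>i. D i)"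
    proof
      fix x assume "x \<in> (\<Union>M. A M)"
      then obtain M i where "x \<in> C M i" using C(1) by blast
      then have "x \<in> D (prod_encode (M, i))" by (simp add: D_def)
      then show "x \<in> (\<Union>i. D i)" by blast
    qed
    moreover have "\<forall>i. bounded (D i) \<and> diameter (D i) \<le> \<delta>" using C(2) by (simp add: D_def)
    ultimately have "hausdorff_pre s \<delta> (\<Union>M. A M) \<le> (\<Sum>i. ennreal (if D i = {} then 0 else diameter (D i) powr s))"
      unfolding hausdorff_pre_def by (intro INF_lower) simp
    also have "\<dots> = (\<Sum>i. h (prod_decode i))" unfolding h_def D_def ..
    also have "\<dots> = (\<Sum>M. \<Sum>i. h (M, i))" by (rule suminf_ennreal_2dimen) simp
    also have "\<dots> \<le> (\<Sum>M. ennreal (\<epsilon> * (1/2) ^ Suc M))"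
      using C(3) by (intro suminf_le) (auto simp: h_def cong: if_cong)
    also have "\<dots> = ennreal (\<Sum>M. \<epsilon> * (1/2) ^ Suc M)"
      using e by (intro suminf_ennreal2) (auto intro!: summable_mult summable_geometric simp: summable_Suc_iff)
    also have "(\<Sum>M. \<epsilon> * (1/2) ^ Suc M) = \<epsilon>"
      using sums_mult[OF power_half_series, of \<epsilon>] by (simp add: sums_iff)
    finally show ?thesis by simp
  qed
  note pre = this
  have "hausdorff_pre s \<delta> (\<Union>M. A M) \<le> 0" if d: "0 < \<delta>" for \<delta>
    by (rule ennreal_le_epsilon) (rule pre[OF d])
  then have "hausdorff_measure s (\<Union>M. A M) \<le> 0"
    unfolding hausdorff_measure_def by (intro SUP_least) simp
  then show ?thesis by simp
qed

lemma hausdorff_measure_mono: "A \<subseteq> B \<Longrightarrow> hausdorff_measure s A \<le> hausdorff_measure s B"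
proof -
  assume AB: "A \<subseteq> B"
  have "hausdorff_pre s \<delta> A \<le> hausdorff_pre s \<delta> B" for \<delta>
    unfolding hausdorff_pre_def by (rule INF_superset_mono) (use AB in auto)
  then show ?thesis unfolding hausdorff_measure_def by (rule SUP_mono')
qed

text \<open>The dimension is an infimum of real numbers, so the set of admissible exponents of
  \<open>B\<close> must be nonempty; \<open>s\<close> is one of them.\<close>

lemma hausdorff_dim_mono:
  assumes "A \<subseteq> B" "0 < s" "hausdorff_measure s B = 0"
  shows "hausdorff_dim A \<le> hausdorff_dim B"
  unfolding hausdorff_dim_def
proof (rule cInf_superset_mono)
  show "{d. 0 < d \<and> hausdorff_measure d B = 0} \<noteq> {}" using assms by blast
  show "bdd_below {d. 0 < d \<and> hausdorff_measure d A = 0}" by (rule bdd_belowI[of _ 0]) auto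
  show "{d. 0 < d \<and> hausdorff_measure d B = 0} \<subseteq> {d. 0 < d \<and> hausdorff_measure d A = 0}"
  proof
    fix d assume "d \<in> {d. 0 < d \<and> hausdorff_measure d B = 0}"
    then show "d \<in> {d. 0 < d \<and> hausdorff_measure d A = 0}"
      using hausdorff_measure_mono[OF assms(1), of d] by simp
  qed
qed

lemma hausdorff_dim_le:
  assumes "0 \<le> d" "\<And>\<tau>. 0 < \<tau> \<Longrightarrow> \<tau> \<le> 1 \<Longrightarrow> hausdorff_measure (d + \<tau>) A = 0"
  shows "hausdorff_dim A \<le> d"
proof (rule field_le_epsilon)
  fix e :: real assume e: "0 < e"
  define \<tau> where "\<tau> = min e 1"
  have \<tau>: "0 < \<tau>" "\<tau> \<le> 1" "\<tau> \<le> e" using e by (auto simp: \<tau>_def)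
  have "hausdorff_dim A \<le> d + \<tau>" unfolding hausdorff_dim_def
    using assms \<tau> by (intro cInf_lower bdd_belowI[of _ 0]) auto
  then show "hausdorff_dim A \<le> d + e" using \<tau> by simp
qed

section \<open>Taylor approximation of piecewise analytic controls\<close>

lemma AE_lebesgue_on: "S \<in> sets lebesgue \<Longrightarrow> (AE t in lebesgue_on S. P t) \<longleftrightarrow> (AE t in lebesgue. t \<in> S \<longrightarrow> P t)"
  by (simp add: AE_restrict_space_iff)

lemma piece_lebesgue: "piece l a \<in> sets lebesgue"
  by (simp add: piece_def)

lemma L2_bounded:
  fixes v :: "real \<Rightarrow> 'k::euclidean_space"
  assumes m: "v \<in> borel_measurable (lebesgue_on {0..1})" and K: "AE t in lebesgue_on {0..1}. norm (v t) \<le> K" and K0: "0 \<le> K"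
  shows "v \<in> L2" "L2norm v \<le> K"
proof -
  have ci: "integrable (lebesgue_on {0..1::real}) (\<lambda>t. K\<^sup>2)"
    by (rule finite_measure.integrable_const[OF finite_measure_lebesgue_on]) simp
  have b: "AE t in lebesgue_on {0..1}. (norm (v t))\<^sup>2 \<le> K\<^sup>2"
    using K by eventually_elim (simp add: power_mono)
  have m2: "(\<lambda>t. (norm (v t))\<^sup>2) \<in> borel_measurable (lebesgue_on {0..1})" using m by measurable
  have i: "integrable (lebesgue_on {0..1}) (\<lambda>t. (norm (v t))\<^sup>2)"
    by (rule Bochner_Integration.integrable_bound[OF ci m2]) (use b in simp)
  then show "v \<in> L2" using m by (simp add: L2_def)
  have "integral\<^sup>L (lebesgue_on {0..1}) (\<lambda>t. (norm (v t))\<^sup>2) \<le> integral\<^sup>L (lebesgue_on {0..1::real}) (\<lambda>t. K\<^sup>2)"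
    by (rule integral_mono_AE[OF i ci b])
  also have "\<dots> = K\<^sup>2" by (simp add: measure_restrict_space)
  finally show "L2norm v \<le> K" unfolding L2norm_def using K0 by (simp add: real_le_lsqrt)
qed

text \<open>The centre of the piece, used as centre of expansion so that all its points are within
  half its length.\<close>

definition mid :: "nat \<Rightarrow> nat \<Rightarrow> real" where
  "mid l a = (real a - 1/2) / real l"

lemma mid_dist: "1 \<le> l \<Longrightarrow> t \<in> piece l a \<Longrightarrow> \<bar>t - mid l a\<bar> \<le> 1 / (2 * real l)"
  by (auto simp: piece_def mid_def field_simps abs_le_iff)

lemma mid_in_piece: "1 \<le> l \<Longrightarrow> mid l a \<in> piece l a"
  by (auto simp: piece_def mid_def field_simps)

text \<open>Distinct pieces share at most a node, and the nodes form a null set.\<close>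

lemma piece_Int: "1 \<le> l \<Longrightarrow> t \<in> piece l a \<Longrightarrow> t \<in> piece l a' \<Longrightarrow> t \<notin> (\<lambda>i. real i / real l) ` {..l} \<Longrightarrow> a \<in> {1..l} \<Longrightarrow> a' \<in> {1..l} \<Longrightarrow> a' = a"
proof (rule ccontr)
  assume l: "1 \<le> l" and t: "t \<in> piece l a" "t \<in> piece l a'" and n: "t \<notin> (\<lambda>i. real i / real l) ` {..l}" and a: "a \<in> {1..l}" "a' \<in> {1..l}" "a' \<noteq> a"
  have t': "real a - 1 \<le> real l * t" "real l * t \<le> real a" "real a' - 1 \<le> real l * t" "real l * t \<le> real a'"
    using t l by (auto simp: piece_def field_simps)
  have "real l * t = real a \<or> real l * t = real a'" using t' a(3) by linarith
  then have "t = real a / real l \<or> t = real a' / real l" using l by (auto simp: field_simps)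
  then show False using n a by auto
qed

lemma piece_cover:
  assumes l: "1 \<le> l" and t: "t \<in> {0..1}"
  shows "\<exists>a\<in>{1..l}. t \<in> piece l a"
proof (cases "t = 0")
  case True
  then show ?thesis using l by (intro bexI[of _ 1]) (auto simp: piece_def)
next
  case False
  \<comment> \<open>For positive \<open>t\<close> the ceiling is at least \<open>1\<close>; at
    \<open>t = 0\<close> it would be \<open>0\<close>, which is not the index of a piece.\<close>
  define a where "a = nat \<lceil>real l * t\<rceil>"
  have p: "0 < real l * t" "real l * t \<le> real l" using False l t by (auto simp: mult_le_cancel_left1)
  have a: "real a = of_int \<lceil>real l * t\<rceil>" using p unfolding a_def by simp
  have "real a - 1 \<le> real l * t" "real l * t \<le> real a" unfolding a by linarith+
  moreover have "a \<in> {1..l}" using p unfolding a_def by (auto simp: nat_le_iff le_nat_iff ceiling_le_iff)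
  ultimately show ?thesis using l by (intro bexI[of _ a]) (auto simp: piece_def field_simps)
qed

text \<open>The approximating controls. They are piecewise entire, hence belong to every class of
  controls considered, and they lie in the unit ball.\<close>

definition local_monomial :: "nat \<Rightarrow> nat \<Rightarrow> nat \<Rightarrow> 'k::euclidean_space \<Rightarrow> real \<Rightarrow> 'k" where
  "local_monomial l a k b t = (if t \<in> piece l a then (t - mid l a) ^ k else 0) *\<^sub>R b"

lemma AE_off_nodes: "AE t in lebesgue. t \<notin> (\<lambda>i. real i / real l) ` {..l}"
  by (intro AE_not_in) (simp add: negligible_iff_null_sets[symmetric] negligible_finite)

lemma local_monomial_entire:
  assumes l: "1 \<le> l" and a: "a \<in> {1..l}" and b: "b \<in> Basis"
  shows "local_monomial l a k b \<in> Cw_pw_entire l" "L2norm (local_monomial l a k b) \<le> 1"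
proof -
  have "(\<lambda>t. indicator (piece l a) t * (t - mid l a) ^ k) \<in> borel_measurable borel"
    by (intro borel_measurable_times borel_measurable_indicator) (auto simp: piece_def)
  then have "(\<lambda>t. (indicator (piece l a) t * (t - mid l a) ^ k) *\<^sub>R b) \<in> borel_measurable borel" by simp
  moreover have "local_monomial l a k b = (\<lambda>t. (indicator (piece l a) t * (t - mid l a) ^ k) *\<^sub>R b)"
    by (rule ext) (simp add: local_monomial_def)
  ultimately have m: "local_monomial l a k b \<in> borel_measurable (lebesgue_on {0..1})"
    by (simp add: measurable_completion measurable_restrict_space1)
  have n: "norm (local_monomial l a k b t) \<le> 1" for t
  proof (cases "t \<in> piece l a")
    case True
    have "\<bar>t - mid l a\<bar> \<le> 1 / (2 * real l)" by (rule mid_dist[OF l True])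
    also have "\<dots> \<le> 1" using l by simp
    finally show ?thesis using b by (simp add: local_monomial_def power_abs power_le_one)
  qed (simp add: local_monomial_def)
  have i: "local_monomial l a k b \<in> L2" by (rule L2_bounded[OF m, of 1]) (simp_all add: n)
  show "L2norm (local_monomial l a k b) \<le> 1" by (rule L2_bounded[OF m]) (simp_all add: n)
  have "analytic_entire (piece l a') (local_monomial l a k b)" if a': "a' \<in> {1..l}" for a'
    unfolding analytic_entire_def
  proof
    fix b' :: 'a assume b': "b' \<in> Basis"
    define F where "F = (\<lambda>z::complex. if a' = a then (z - of_real (mid l a)) ^ k * of_real (b \<bullet> b') else 0)"
    have "F holomorphic_on UNIV" unfolding F_def by (cases "a' = a") (auto intro!: holomorphic_intros)
    moreover have "AE t in lebesgue_on (piece l a'). F (complex_of_real t) = complex_of_real (local_monomial l a k b t \<bullet> b')"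
      unfolding AE_lebesgue_on[OF piece_lebesgue] using AE_off_nodes[of l]
    proof eventually_elim
      case (elim t)
      show ?case
      proof
        assume t: "t \<in> piece l a'"
        show "F (complex_of_real t) = complex_of_real (local_monomial l a k b t \<bullet> b')"
        proof (cases "t \<in> piece l a")
          case True
          then have "a' = a" using piece_Int[OF l True t elim a a'] by simp
          then show ?thesis using True by (simp add: F_def local_monomial_def)
        next
          case False
          then have "a' \<noteq> a" using t by auto
          then show ?thesis using False by (simp add: F_def local_monomial_def)
        qed
      qed
    qed
    ultimately show "\<exists>F. F holomorphic_on UNIV \<and> (AE t in lebesgue_on (piece l a'). F (complex_of_real t) = complex_of_real (local_monomial l a k b t \<bullet> b'))"
      by (intro exI[of _ F]) simp
  qed
  then show "local_monomial l a k b \<in> Cw_pw_entire l" using i by (simp add: Cw_pw_entire_def)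
qed

text \<open>The power series converges at distance \<open>r\<close> from the centre, so its
  coefficients multiplied by \<open>r ^ k\<close> are bounded, and at distance \<open>h\<close> the
  tail is geometric with ratio \<open>h / r \<le> 1/2\<close>. Real parts are taken because the
  controls are real.\<close>

lemma taylor_piece:
  assumes F: "F holomorphic_on ball (of_real c) \<rho>" and r: "1 \<le> r" "r < \<rho>" and h: "0 < h" "h \<le> 1/2"
  shows "\<exists>X M. 0 \<le> M \<and> (\<forall>k::nat. \<bar>X k\<bar> \<le> M) \<and> (\<forall>t n. \<bar>t - c\<bar> \<le> h \<longrightarrow> \<bar>Re (F (of_real t)) - (\<Sum>k<n. X k * (t - c) ^ k)\<bar> \<le> M * (h / r) ^ n)"
proof -
  define f where "f = (\<lambda>k. (deriv ^^ k) F (of_real c) / fact k)"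
  have ps: "(\<lambda>k. f k * (w - of_real c) ^ k) sums F w" if "w \<in> ball (of_real c) \<rho>" for w
    unfolding f_def by (rule holomorphic_power_series[OF F that])
  have "of_real c + of_real r \<in> ball (complex_of_real c) \<rho>" using r by (simp add: dist_norm)
  from sums_summable[OF ps[OF this]] have "summable (\<lambda>k. f k * of_real r ^ k)" by simp
  then have "Bseq (\<lambda>k. f k * of_real r ^ k)"
    by (intro convergent_imp_Bseq convergentI[of _ 0]) (rule summable_LIMSEQ_zero)
  then obtain M0 where M0: "0 < M0" "\<And>k. norm (f k * of_real r ^ k) \<le> M0" by (auto elim: BseqE)
  have fk: "norm (f k) * r ^ k \<le> M0" for k using M0(2)[of k] r by (simp add: norm_mult norm_power)
  have Xk: "\<bar>Re (f k)\<bar> * r ^ k \<le> M0" for k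
    by (rule order_trans[OF mult_right_mono[OF abs_Re_le_cmod] fk]) (use r in simp)
  define q where "q = h / r"
  have q: "0 < q" "q \<le> 1/2" using h r by (auto simp: q_def field_simps)
  \<comment> \<open>Twice \<open>M0\<close>, since summing the geometric tail costs the factor
    \<open>1 / (1 - q) \<le> 2\<close>.\<close>
  show ?thesis
  proof (rule exI[of _ "\<lambda>k. Re (f k)"], rule exI[of _ "2 * M0"], intro conjI allI impI)
    show "0 \<le> 2 * M0" using M0(1) by simp
    show "\<bar>Re (f k)\<bar> \<le> 2 * M0" for k
    proof -
      have "\<bar>Re (f k)\<bar> * 1 \<le> \<bar>Re (f k)\<bar> * r ^ k" using r by (intro mult_left_mono) auto
      then show ?thesis using Xk[of k] M0(1) by simp
    qed
    fix t :: real and n :: nat assume t: "\<bar>t - c\<bar> \<le> h"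
    have "of_real t \<in> ball (complex_of_real c) \<rho>"
      using t h r by (simp add: dist_norm norm_minus_commute flip: of_real_diff)
    from sums_Re[OF ps[OF this]] have s: "(\<lambda>k. Re (f k) * (t - c) ^ k) sums Re (F (of_real t))"
      by (simp flip: of_real_diff of_real_power)
    have b: "\<bar>Re (f k) * (t - c) ^ k\<bar> \<le> M0 * q ^ k" for k
    proof -
      have "\<bar>Re (f k) * (t - c) ^ k\<bar> \<le> \<bar>Re (f k)\<bar> * h ^ k"
        unfolding abs_mult power_abs using t by (intro mult_left_mono power_mono) auto
      also have "\<dots> = (\<bar>Re (f k)\<bar> * r ^ k) * q ^ k" using r by (simp add: q_def power_divide)
      also have "\<dots> \<le> M0 * q ^ k" using Xk q by (intro mult_right_mono) auto
      finally show ?thesis .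
    qed
    have g: "(\<lambda>k. M0 * q ^ (k + n)) sums (M0 * (q ^ n * (1 / (1 - q))))"
      using sums_mult[OF geometric_sums[of q], of "M0 * q ^ n"] q by (simp add: power_add mult_ac)
    have "(\<lambda>k. Re (f (k + n)) * (t - c) ^ (k + n)) sums (Re (F (of_real t)) - (\<Sum>k<n. Re (f k) * (t - c) ^ k))"
      by (rule sums_split_initial_segment[OF s])
    then have "Re (F (of_real t)) - (\<Sum>k<n. Re (f k) * (t - c) ^ k) = (\<Sum>k. Re (f (k + n)) * (t - c) ^ (k + n))"
      by (simp add: sums_iff)
    also have "\<bar>\<dots>\<bar> \<le> (\<Sum>k. M0 * q ^ (k + n))"
      unfolding real_norm_def[symmetric]
      by (rule norm_suminf_le) (use b sums_summable[OF g] in auto)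
    also have "\<dots> = M0 * q ^ n * (1 / (1 - q))" using g by (simp add: sums_iff)
    also have "\<dots> \<le> M0 * q ^ n * 2" using q M0(1) by (intro mult_left_mono) (auto simp: field_simps)
    finally show "\<bar>Re (F (of_real t)) - (\<Sum>k<n. Re (f k) * (t - c) ^ k)\<bar> \<le> 2 * M0 * (h / r) ^ n"
      by (simp add: q_def mult_ac)
  qed
qed

text \<open>A single natural number \<open>M\<close> bounds coefficients and errors on all pieces
  and for all \<open>n\<close>. It divides the controls into countably many classes on which the
  estimates are uniform.\<close>

definition taylor_bounds :: "nat \<Rightarrow> real \<Rightarrow> nat \<Rightarrow> (real \<Rightarrow> 'k::euclidean_space) \<Rightarrow> (nat \<Rightarrow> nat \<Rightarrow> 'k \<Rightarrow> real) \<Rightarrow> bool" where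
  "taylor_bounds l q M u X \<longleftrightarrow> (\<forall>a\<in>{1..l}. \<forall>b\<in>Basis. (\<forall>k. \<bar>X a k b\<bar> \<le> real M) \<and>
     (\<forall>n. AE t in lebesgue. t \<in> piece l a \<longrightarrow> \<bar>u t \<bullet> b - (\<Sum>k<n. X a k b * (t - mid l a) ^ k)\<bar> \<le> real M * q ^ n))"

lemma Cw_pw_taylor_bounds:
  fixes u :: "real \<Rightarrow> 'k::euclidean_space"
  assumes u: "u \<in> Cw_pw r l" and r: "1 \<le> r" and l: "1 \<le> l"
  shows "\<exists>M X. 1 \<le> M \<and> taylor_bounds l (1 / (2 * real l * r)) M u X"
proof -
  define q where "q = 1 / (2 * real l * r)"
  have q0: "0 \<le> q" using r by (simp add: q_def)
  have "\<exists>X M. 0 \<le> M \<and> (\<forall>k. \<bar>X k\<bar> \<le> M) \<and>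
     (\<forall>n. AE t in lebesgue. t \<in> piece l a \<longrightarrow> \<bar>u t \<bullet> b - (\<Sum>k<n. X k * (t - mid l a) ^ k)\<bar> \<le> M * q ^ n)"
    if ab: "a \<in> {1..l}" "b \<in> Basis" for a b
  proof -
    from u ab have "analytic_radius_gt (piece l a) r u" by (simp add: Cw_pw_def)
    then obtain \<rho> F where \<rho>: "r < \<rho>" and F: "F holomorphic_on {z. infdist z (complex_of_real ` piece l a) < \<rho>}"
      and FA: "AE t in lebesgue_on (piece l a). F (complex_of_real t) = complex_of_real (u t \<bullet> b)"
      unfolding analytic_radius_gt_def using ab(2) by blast
    have sub: "ball (complex_of_real (mid l a)) \<rho> \<subseteq> {z. infdist z (complex_of_real ` piece l a) < \<rho>}"
    proof
      fix z assume z: "z \<in> ball (complex_of_real (mid l a)) \<rho>"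
      have "infdist z (complex_of_real ` piece l a) \<le> dist z (of_real (mid l a))"
        by (rule infdist_le) (use mid_in_piece[OF l] in simp)
      then show "z \<in> {z. infdist z (complex_of_real ` piece l a) < \<rho>}" using z by (simp add: dist_commute)
    qed
    have h: "0 < 1 / (2 * real l)" "1 / (2 * real l) \<le> 1 / 2" using l by auto
    from taylor_piece[OF holomorphic_on_subset[OF F sub] r \<rho> h] obtain X M where XM: "0 \<le> M" "\<And>k. \<bar>X k\<bar> \<le> M"
      and XM2: "\<And>t n. \<bar>t - mid l a\<bar> \<le> 1 / (2 * real l) \<Longrightarrow> \<bar>Re (F (of_real t)) - (\<Sum>k<n. X k * (t - mid l a) ^ k)\<bar> \<le> M * (1 / (2 * real l) / r) ^ n"
      by blast
    have "AE t in lebesgue. t \<in> piece l a \<longrightarrow> \<bar>u t \<bullet> b - (\<Sum>k<n. X k * (t - mid l a) ^ k)\<bar> \<le> M * q ^ n" for n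
      using FA unfolding AE_lebesgue_on[OF piece_lebesgue]
    proof eventually_elim
      case (elim t)
      show ?case
      proof
        assume t: "t \<in> piece l a"
        have "Re (F (of_real t)) = u t \<bullet> b" using elim t by simp
        then show "\<bar>u t \<bullet> b - (\<Sum>k<n. X k * (t - mid l a) ^ k)\<bar> \<le> M * q ^ n"
          using XM2[OF mid_dist[OF l t], of n] by (simp add: q_def)
      qed
    qed
    then show ?thesis using XM by (intro exI[of _ X] exI[of _ M]) simp
  qed
  then have "\<forall>z\<in>{1..l} \<times> Basis. \<exists>XM. 0 \<le> snd XM \<and> (\<forall>k. \<bar>fst XM k\<bar> \<le> snd XM) \<and>
     (\<forall>n. AE t in lebesgue. t \<in> piece l (fst z) \<longrightarrow> \<bar>u t \<bullet> snd z - (\<Sum>k<n. fst XM k * (t - mid l (fst z)) ^ k)\<bar> \<le> snd XM * q ^ n)"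
    by auto
  from bchoice[OF this] obtain G where "\<forall>z\<in>{1..l} \<times> (Basis::'k set). 0 \<le> snd (G z) \<and> (\<forall>k. \<bar>fst (G z) k\<bar> \<le> snd (G z)) \<and>
     (\<forall>n. AE t in lebesgue. t \<in> piece l (fst z) \<longrightarrow> \<bar>u t \<bullet> snd z - (\<Sum>k<n. fst (G z) k * (t - mid l (fst z)) ^ k)\<bar> \<le> snd (G z) * q ^ n)" ..
  note G = bspec[OF this]
  define M where "M = Suc (nat \<lceil>\<Sum>z\<in>{1..l} \<times> (Basis::'k set). snd (G z)\<rceil>)"
  have GM: "snd (G z) \<le> real M" if z: "z \<in> {1..l} \<times> (Basis::'k set)" for z
  proof -
    have "snd (G z) \<le> (\<Sum>z\<in>{1..l} \<times> (Basis::'k set). snd (G z))"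
      by (rule member_le_sum[OF z]) (use G in auto)
    also have "\<dots> \<le> real M" unfolding M_def by linarith
    finally show ?thesis .
  qed
  have "taylor_bounds l q M u (\<lambda>a k b. fst (G (a, b)) k)"
    unfolding taylor_bounds_def
  proof (intro ballI conjI allI)
    fix a b assume "a \<in> {1..l}" "b \<in> (Basis::'k set)"
    then have z: "(a, b) \<in> {1..l} \<times> (Basis::'k set)" by simp
    note g = G[OF z] and m = GM[OF z]
    show "\<bar>fst (G (a, b)) k\<bar> \<le> real M" for k
    proof -
      have "\<bar>fst (G (a, b)) k\<bar> \<le> snd (G (a, b))" using g by simp
      then show ?thesis using m by linarith
    qed
    show "AE t in lebesgue. t \<in> piece l a \<longrightarrow> \<bar>u t \<bullet> b - (\<Sum>k<n. fst (G (a, b)) k * (t - mid l a) ^ k)\<bar> \<le> real M * q ^ n" for n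
    proof -
      have A: "AE t in lebesgue. t \<in> piece l a \<longrightarrow> \<bar>u t \<bullet> b - (\<Sum>k<n. fst (G (a, b)) k * (t - mid l a) ^ k)\<bar> \<le> snd (G (a, b)) * q ^ n"
        using g by simp
      have B: "snd (G (a, b)) * q ^ n \<le> real M * q ^ n" using m q0 by (intro mult_right_mono) auto
      from A show ?thesis by eventually_elim (use B in linarith)
    qed
  qed
  moreover have "1 \<le> M" by (simp add: M_def)
  ultimately show ?thesis unfolding q_def by blast
qed

text \<open>Away from the nodes exactly one piece contributes at each time; the factor
  \<open>DIM('k)\<close> comes from adding the errors of the components.\<close>

lemma taylor_bounds_approx:
  fixes u :: "real \<Rightarrow> 'k::euclidean_space"
  assumes u: "u \<in> L2" and T: "taylor_bounds l q M u X" and l: "1 \<le> l" and q: "0 \<le> q"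
  shows "L2norm (\<lambda>t. u t - (\<Sum>z\<in>{1..l} \<times> {..<n} \<times> Basis. (case z of (a, k, b) \<Rightarrow> X a k b) *\<^sub>R (case z of (a, k, b) \<Rightarrow> local_monomial l a k b t))) \<le> real DIM('k) * real M * q ^ n"
proof -
  define un where "un = (\<lambda>t. \<Sum>z\<in>{1..l} \<times> {..<n} \<times> Basis. (case z of (a, k, b) \<Rightarrow> X a k b) *\<^sub>R (case z of (a, k, b) \<Rightarrow> local_monomial l a k b t))"
  have "local_monomial l a k b \<in> L2" if "a \<in> {1..l}" "b \<in> (Basis::'k set)" for a k b
    using local_monomial_entire(1)[OF l that, of k] by (simp add: Cw_pw_entire_def)
  then have unL: "un \<in> L2" unfolding un_def
    by (intro L2_sum[where e = "\<lambda>z t. (case z of (a, k, b) \<Rightarrow> local_monomial l a k b t)"]) auto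
  have m: "(\<lambda>t. u t - un t) \<in> borel_measurable (lebesgue_on {0..1})"
    using L2D(1)[OF u] L2D(1)[OF unL] by (rule borel_measurable_diff)
  have "AE t in lebesgue. \<forall>a\<in>{1..l}. \<forall>b\<in>Basis. t \<in> piece l a \<longrightarrow> \<bar>u t \<bullet> b - (\<Sum>k<n. X a k b * (t - mid l a) ^ k)\<bar> \<le> real M * q ^ n"
    using T unfolding taylor_bounds_def by (intro AE_finite_allI) auto
  then have "AE t in lebesgue_on {0..1}. norm (u t - un t) \<le> real DIM('k) * real M * q ^ n"
    unfolding AE_lebesgue_on[OF lmeasurable_interval(1)[of 0 "1::real", THEN fmeasurableD, unfolded box_real]]
    using AE_off_nodes[of l]
  proof eventually_elim
    case (elim t)
    show ?case
    proof
      assume "t \<in> {0..1}"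
      then obtain a where a: "a \<in> {1..l}" "t \<in> piece l a" using piece_cover[OF l] by blast
      have un: "un t \<bullet> b = (\<Sum>k<n. X a k b * (t - mid l a) ^ k)" if b: "b \<in> Basis" for b
      proof -
        have "un t = (\<Sum>a'\<in>{1..l}. \<Sum>k<n. \<Sum>b'\<in>Basis. X a' k b' *\<^sub>R local_monomial l a' k b' t)"
          unfolding un_def by (simp add: sum.cartesian_product case_prod_beta)
        also have "\<dots> = (\<Sum>a'\<in>{1..l}. if a' = a then (\<Sum>k<n. \<Sum>b'\<in>Basis. X a k b' *\<^sub>R local_monomial l a k b' t) else 0)"
        proof (rule sum.cong[OF refl])
          fix a' assume a': "a' \<in> {1..l}"
          show "(\<Sum>k<n. \<Sum>b'\<in>Basis. X a' k b' *\<^sub>R local_monomial l a' k b' t) = (if a' = a then (\<Sum>k<n. \<Sum>b'\<in>Basis. X a k b' *\<^sub>R local_monomial l a k b' t) else 0)"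
          proof (cases "a' = a")
            case False
            then have "t \<notin> piece l a'" using piece_Int[OF l a(2) _ _ a(1) a'] elim by auto
            then show ?thesis using False by (simp add: local_monomial_def)
          qed simp
        qed
        also have "\<dots> = (\<Sum>k<n. \<Sum>b'\<in>Basis. X a k b' *\<^sub>R local_monomial l a k b' t)" using a(1) by simp
        finally have "un t \<bullet> b = (\<Sum>k<n. \<Sum>b'\<in>Basis. X a k b' * (t - mid l a) ^ k * (b' \<bullet> b))"
          using a(2) by (simp add: inner_sum_left local_monomial_def mult.assoc)
        also have "\<dots> = (\<Sum>k<n. X a k b * (t - mid l a) ^ k)"
          using b by (intro sum.cong refl) (simp add: inner_Basis if_distrib[of "\<lambda>x. _ * x"] cong: if_cong)
        finally show ?thesis .
      qed
      have "norm (u t - un t) \<le> (\<Sum>b\<in>Basis. \<bar>(u t - un t) \<bullet> b\<bar>)" by (rule norm_le_l1)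
      also have "\<dots> \<le> (\<Sum>b\<in>(Basis::'k set). real M * q ^ n)"
      proof (rule sum_mono)
        fix b :: 'k assume b: "b \<in> Basis"
        show "\<bar>(u t - un t) \<bullet> b\<bar> \<le> real M * q ^ n" using elim a b un[OF b] by (simp add: inner_diff_left)
      qed
      finally show "norm (u t - un t) \<le> real DIM('k) * real M * q ^ n" by simp
    qed
  qed
  from L2_bounded(2)[OF m this] q show ?thesis by (simp add: un_def)
qed

text \<open>The number of controls is linear in \<open>n\<close> while the error is of order
  \<open>q ^ n\<close>, and one family serves all controls. The covering argument rests on this
  proportion.\<close>

lemma control_basis:
  assumes l: "1 \<le> l"
  shows "\<exists>e :: nat \<Rightarrow> real \<Rightarrow> 'k::euclidean_space. (\<forall>j<n * (l * DIM('k)). e j \<in> Cw_pw_entire l \<and> L2norm (e j) \<le> 1) \<and>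
    (\<forall>q M u X. u \<in> L2 \<longrightarrow> 0 \<le> q \<longrightarrow> taylor_bounds l q M u X \<longrightarrow>
      (\<exists>x. (\<forall>j<n * (l * DIM('k)). \<bar>x j\<bar> \<le> real M) \<and>
        L2norm (\<lambda>t. u t - (\<Sum>j<n * (l * DIM('k)). x j *\<^sub>R e j t)) \<le> real DIM('k) * real M * q ^ n))"
    (is "\<exists>e. ?P e")
proof -
  define S where "S = {1..l} \<times> {..<n} \<times> (Basis::'k set)"
  have "card S = n * (l * DIM('k))" by (simp add: S_def card_cartesian_product)
  moreover have "finite S" by (simp add: S_def)
  ultimately obtain g where g: "bij_betw g {..<n * (l * DIM('k))} S"
    using ex_bij_betw_nat_finite[of S] by (auto simp: atLeast0LessThan)
  define e where "e = (\<lambda>j t. case g j of (a, k, b) \<Rightarrow> local_monomial l a k b t)"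
  have gS: "g j \<in> S" if "j < n * (l * DIM('k))" for j using bij_betwE[OF g] that by simp
  have e: "e j \<in> Cw_pw_entire l \<and> L2norm (e j) \<le> 1" if j: "j < n * (l * DIM('k))" for j
  proof -
    obtain a k b where z: "g j = (a, k, b)" by (cases "g j")
    then have "a \<in> {1..l}" "b \<in> Basis" using gS[OF j] by (auto simp: S_def)
    from local_monomial_entire[OF l this, of k] have "local_monomial l a k b \<in> Cw_pw_entire l \<and> L2norm (local_monomial l a k b) \<le> 1" by simp
    moreover have "e j = local_monomial l a k b" unfolding e_def z by (rule ext) simp
    ultimately show ?thesis by simp
  qed
  have ap: "\<exists>x. (\<forall>j<n * (l * DIM('k)). \<bar>x j\<bar> \<le> real M) \<and>
        L2norm (\<lambda>t. u t - (\<Sum>j<n * (l * DIM('k)). x j *\<^sub>R e j t)) \<le> real DIM('k) * real M * q ^ n"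
    if u: "u \<in> L2" and q: "0 \<le> q" and T: "taylor_bounds l q M u X" for q M X and u :: "real \<Rightarrow> 'k"
  proof (rule exI[of _ "\<lambda>j. case g j of (a, k, b) \<Rightarrow> X a k b"], intro conjI allI impI)
    fix j assume j: "j < n * (l * DIM('k))"
    obtain a k b where z: "g j = (a, k, b)" by (cases "g j")
    then have "a \<in> {1..l}" "b \<in> Basis" using gS[OF j] by (auto simp: S_def)
    then show "\<bar>case g j of (a, k, b) \<Rightarrow> X a k b\<bar> \<le> real M" using T unfolding z taylor_bounds_def by simp
  next
    have "(\<Sum>j<n * (l * DIM('k)). (case g j of (a, k, b) \<Rightarrow> X a k b) *\<^sub>R e j t) =
      (\<Sum>z\<in>S. (case z of (a, k, b) \<Rightarrow> X a k b) *\<^sub>R (case z of (a, k, b) \<Rightarrow> local_monomial l a k b t))" for t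
      unfolding e_def by (rule sum.reindex_bij_betw[OF g])
    then show "L2norm (\<lambda>t. u t - (\<Sum>j<n * (l * DIM('k)). (case g j of (a, k, b) \<Rightarrow> X a k b) *\<^sub>R e j t)) \<le> real DIM('k) * real M * q ^ n"
      using taylor_bounds_approx[OF u T l q, of n] by (simp add: S_def)
  qed
  show ?thesis
  proof (rule exI[of _ e], intro conjI allI impI)
    show "e j \<in> Cw_pw_entire l" "L2norm (e j) \<le> 1" if "j < n * (l * DIM('k))" for j using e[OF that] by simp_all
  qed (rule ap)
qed

section \<open>Critical values of the endpoint map\<close>

text \<open>Telescoping over the letters of the list, one factor of the monomial being changed at a
  time.\<close>

lemma lmon_diff:
  fixes x y :: "nat \<Rightarrow> real"
  assumes \<rho>: "1 \<le> \<rho>" and x: "\<And>i. i < N \<Longrightarrow> \<bar>x i\<bar> \<le> \<rho>" and y: "\<And>i. i < N \<Longrightarrow> \<bar>y i\<bar> \<le> \<rho>"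
    and d: "\<And>i. i < N \<Longrightarrow> \<bar>x i - y i\<bar> \<le> \<eta>" and \<eta>: "0 \<le> \<eta>"
  shows "\<bar>lmon N x I - lmon N y I\<bar> \<le> real (length I) * \<rho> ^ length I * \<eta>"
    and "\<bar>dlmon N j x I - dlmon N j y I\<bar> \<le> (real (length I))\<^sup>2 * \<rho> ^ length I * \<eta>"
proof -
  have ev: "\<bar>ev N x i\<bar> \<le> \<rho>" "\<bar>ev N y i\<bar> \<le> \<rho>" "\<bar>ev N x i - ev N y i\<bar> \<le> \<eta>" for i
    using x y d \<rho> \<eta> by (auto simp: ev_def)
  have split: "\<bar>a * b - a' * b'\<bar> \<le> \<bar>a\<bar> * \<bar>b - b'\<bar> + \<bar>a - a'\<bar> * \<bar>b'\<bar>" for a b a' b' :: real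
  proof -
    have "a * b - a' * b' = a * (b - b') + (a - a') * b'" by (simp add: algebra_simps)
    then show ?thesis unfolding abs_mult[symmetric] by (simp only: abs_triangle_ineq)
  qed
  have L: "\<bar>lmon N x I - lmon N y I\<bar> \<le> real (length I) * \<rho> ^ length I * \<eta>" for I
  proof (induction I)
    case (Cons i I)
    let ?n = "length I"
    have "\<bar>lmon N x (i # I) - lmon N y (i # I)\<bar> \<le> \<bar>ev N x i\<bar> * \<bar>lmon N x I - lmon N y I\<bar> + \<bar>ev N x i - ev N y i\<bar> * \<bar>lmon N y I\<bar>"
      unfolding lmon_Cons by (rule split)
    also have "\<dots> \<le> \<rho> * (real ?n * \<rho> ^ ?n * \<eta>) + \<eta> * \<rho> ^ ?n"
      using ev Cons norm_lmon[of \<rho> N y I] \<rho> y \<eta> by (intro add_mono mult_mono) auto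
    also have "\<dots> \<le> \<rho> * (real ?n * \<rho> ^ ?n * \<eta>) + \<eta> * (\<rho> * \<rho> ^ ?n)"
      using \<rho> \<eta> by (intro add_left_mono mult_left_mono) (auto simp: mult_le_cancel_right1)
    finally show ?case by (simp add: algebra_simps)
  qed simp
  show "\<bar>lmon N x I - lmon N y I\<bar> \<le> real (length I) * \<rho> ^ length I * \<eta>" by (rule L)
  show "\<bar>dlmon N j x I - dlmon N j y I\<bar> \<le> (real (length I))\<^sup>2 * \<rho> ^ length I * \<eta>"
  proof (induction I)
    case (Cons i I)
    let ?n = "length I"
    have "\<bar>dlmon N j x (i # I) - dlmon N j y (i # I)\<bar> \<le> \<bar>lmon N x I - lmon N y I\<bar> + \<bar>ev N x i * dlmon N j x I - ev N y i * dlmon N j y I\<bar>"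
      by auto
    also have "\<dots> \<le> real ?n * \<rho> ^ ?n * \<eta> + (\<bar>ev N x i\<bar> * \<bar>dlmon N j x I - dlmon N j y I\<bar> + \<bar>ev N x i - ev N y i\<bar> * \<bar>dlmon N j y I\<bar>)"
      by (intro add_mono L split)
    also have "\<dots> \<le> real ?n * \<rho> ^ ?n * \<eta> + (\<rho> * ((real ?n)\<^sup>2 * \<rho> ^ ?n * \<eta>) + \<eta> * (real ?n * \<rho> ^ ?n))"
      using ev Cons norm_dlmon[of \<rho> N y j I] \<rho> y \<eta> by (intro add_mono mult_mono) auto
    also have "\<dots> \<le> real ?n * (\<rho> * \<rho> ^ ?n) * \<eta> + (\<rho> * ((real ?n)\<^sup>2 * \<rho> ^ ?n * \<eta>) + \<eta> * (real ?n * (\<rho> * \<rho> ^ ?n)))"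
      using \<rho> \<eta> by (intro add_mono mult_left_mono mult_right_mono) (auto simp: mult_le_cancel_right1)
    also have "\<dots> = ((real ?n)\<^sup>2 + 2 * real ?n) * (\<rho> * \<rho> ^ ?n * \<eta>)" by (simp add: algebra_simps)
    also have "\<dots> \<le> (real (Suc ?n))\<^sup>2 * (\<rho> * \<rho> ^ ?n * \<eta>)"
      using \<rho> \<eta> by (intro mult_right_mono) (auto simp: power2_eq_square algebra_simps)
    finally show ?case by (simp add: mult.assoc)
  qed simp
qed

lemma norm_sum_lists_n:
  fixes c :: "nat list \<Rightarrow> 'g::real_normed_vector"
  assumes c: "\<And>I. I \<in> lists_n N d \<Longrightarrow> norm (c I) \<le> C" and f: "\<And>I. length I = d \<Longrightarrow> \<bar>f I\<bar> \<le> B"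
  shows "norm (\<Sum>I\<in>lists_n N d. f I *\<^sub>R c I) \<le> C * (real N + 1) ^ d * B"
proof -
  have "norm (\<Sum>I\<in>lists_n N d. f I *\<^sub>R c I) \<le> (\<Sum>I\<in>lists_n N d. B * C)"
  proof (rule sum_norm_le)
    fix I assume I: "I \<in> lists_n N d"
    then have l: "length I = d" by (simp add: lists_n_def)
    have "\<bar>f I\<bar> * norm (c I) \<le> B * C"
      using f[OF l] c[OF I] order_trans[OF abs_ge_zero f[OF l]] by (intro mult_mono) auto
    then show "norm (f I *\<^sub>R c I) \<le> B * C" by simp
  qed
  then show ?thesis by (simp add: card_lists_n algebra_simps)
qed

lemma norm_lmap:
  fixes c :: "nat list \<Rightarrow> 'g::real_normed_vector"
  assumes "\<And>I. I \<in> lists_n N d \<Longrightarrow> norm (c I) \<le> C" "1 \<le> \<rho>" "\<And>i. i < N \<Longrightarrow> \<bar>x i\<bar> \<le> \<rho>"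
  shows "norm (lmap N d c x) \<le> C * (real N + 1) ^ d * \<rho> ^ d"
  unfolding lmap_def
  by (rule norm_sum_lists_n[OF assms(1)]) (use norm_lmon[of \<rho> N x] assms in auto)

lemma lmap_diff:
  fixes c :: "nat list \<Rightarrow> 'g::real_normed_vector"
  assumes c: "\<And>I. I \<in> lists_n N d \<Longrightarrow> norm (c I) \<le> C"
    and \<rho>: "1 \<le> \<rho>" and x: "\<And>i. i < N \<Longrightarrow> \<bar>x i\<bar> \<le> \<rho>" and y: "\<And>i. i < N \<Longrightarrow> \<bar>y i\<bar> \<le> \<rho>"
    and d: "\<And>i. i < N \<Longrightarrow> \<bar>x i - y i\<bar> \<le> \<eta>" and \<eta>: "0 \<le> \<eta>"
  shows "norm (lmap N d c x - lmap N d c y) \<le> C * (real N + 1) ^ d * (real d * \<rho> ^ d * \<eta>)"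
    and "norm (dlmap N d c j x - dlmap N d c j y) \<le> C * (real N + 1) ^ d * ((real d)\<^sup>2 * \<rho> ^ d * \<eta>)"
proof -
  have "lmap N d c x - lmap N d c y = (\<Sum>I\<in>lists_n N d. (lmon N x I - lmon N y I) *\<^sub>R c I)"
    by (simp add: lmap_def scaleR_diff_left sum_subtractf)
  then show "norm (lmap N d c x - lmap N d c y) \<le> C * (real N + 1) ^ d * (real d * \<rho> ^ d * \<eta>)"
    using norm_sum_lists_n[of N d c C "\<lambda>I. lmon N x I - lmon N y I" "real d * \<rho> ^ d * \<eta>"] c lmon_diff(1)[of \<rho> N x y \<eta>] assms(2-) by auto
  have "dlmap N d c j x - dlmap N d c j y = (\<Sum>I\<in>lists_n N d. (dlmon N j x I - dlmon N j y I) *\<^sub>R c I)"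
    by (simp add: dlmap_def scaleR_diff_left sum_subtractf)
  then show "norm (dlmap N d c j x - dlmap N d c j y) \<le> C * (real N + 1) ^ d * ((real d)\<^sup>2 * \<rho> ^ d * \<eta>)"
    using norm_sum_lists_n[of N d c C "\<lambda>I. dlmon N j x I - dlmon N j y I" "(real d)\<^sup>2 * \<rho> ^ d * \<eta>"] c lmon_diff(2)[of \<rho> N x y \<eta> j] assms(2-) by auto
qed

text \<open>Identifies the formal \<open>dlmap\<close> with an actual derivative, so that it can be
  compared between different systems of coefficients and with the differential of the endpoint
  map.\<close>

lemma lmap_line_derivative:
  fixes c :: "nat list \<Rightarrow> 'g::real_normed_vector"
  assumes j: "j < N"
  shows "((\<lambda>t. lmap N d c (x(j := x j + t))) has_vector_derivative dlmap N d c j x) (at 0)"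
proof -
  have ev: "((\<lambda>t. ev N (x(j := x j + t)) i) has_real_derivative (if i = j \<and> i < N then 1 else 0)) (at 0)" for i
  proof (cases "i = j \<and> i < N")
    case True
    then show ?thesis by (auto simp: ev_def intro!: derivative_eq_intros)
  next
    case False
    then have "(\<lambda>t. ev N (x(j := x j + t)) i) = (\<lambda>t. ev N x i)" by (auto simp: ev_def)
    then show ?thesis using False by auto
  qed
  have mon: "((\<lambda>t. lmon N (x(j := x j + t)) I) has_real_derivative dlmon N j x I) (at 0)" for I
  proof (induction I)
    case (Cons i I)
    have "(if i = j \<and> i < N then 1 else 0) * lmon N (x(j := x j + 0)) I + dlmon N j x I * ev N (x(j := x j + 0)) i = dlmon N j x (i # I)"
      by (simp add: mult.commute)
    then show ?case unfolding lmon_Cons by (rule DERIV_cong[OF DERIV_mult[OF ev[of i] Cons]])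
  qed simp
  have "((\<lambda>t. lmon N (x(j := x j + t)) I *\<^sub>R c I) has_vector_derivative (dlmon N j x I *\<^sub>R c I)) (at 0)" for I
    using has_vector_derivative_scaleR[OF mon[of I] has_vector_derivative_const[of "c I"]] by simp
  then show ?thesis unfolding lmap_def dlmap_def by (intro has_vector_derivative_sum) auto
qed

lemma L2_diff: "u \<in> L2 \<Longrightarrow> v \<in> L2 \<Longrightarrow> (\<lambda>t. u t - v t) \<in> L2"
  using L2_add[OF _ L2_scale[of v "-1"], of u] by simp

context carnot begin

lemma End_deriv_line:
  assumes L: "has_End_deriv gmul Xmap u L" and v: "v \<in> L2"
  shows "((\<lambda>t. End_map gmul Xmap (\<lambda>\<tau>. u \<tau> + t *\<^sub>R v \<tau>)) has_vector_derivative L v) (at 0)"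
proof -
  define n where "n = L2norm v + 1"
  have n: "0 < n" "L2norm v < n" using L2norm_nonneg[of v] by (auto simp: n_def)
  have Ls: "L (\<lambda>\<tau>. t *\<^sub>R v \<tau>) = t *\<^sub>R L v" for t
    using L v unfolding has_End_deriv_def by simp
  have L4: "\<forall>\<epsilon>>0. \<exists>\<delta>>0. \<forall>v\<in>L2. L2norm v < \<delta> \<longrightarrow>
        norm (End_map gmul Xmap (\<lambda>t. u t + v t) - End_map gmul Xmap u - L v) \<le> \<epsilon> * L2norm v"
    using L unfolding has_End_deriv_def by simp
  show ?thesis unfolding has_vector_derivative_def has_derivative_at_alt
  proof (intro conjI allI impI)
    show "bounded_linear (\<lambda>t. t *\<^sub>R L v)" by (rule bounded_linear_scaleR_left)
    fix e :: real assume e: "0 < e"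
    then have "0 < e / n" using n by simp
    with L4 obtain \<delta> where \<delta>: "0 < \<delta>" and B: "\<forall>v\<in>L2. L2norm v < \<delta> \<longrightarrow>
        norm (End_map gmul Xmap (\<lambda>t. u t + v t) - End_map gmul Xmap u - L v) \<le> e / n * L2norm v" by blast
    show "\<exists>d>0. \<forall>y. norm (y - 0) < d \<longrightarrow> norm (End_map gmul Xmap (\<lambda>\<tau>. u \<tau> + y *\<^sub>R v \<tau>) -
        End_map gmul Xmap (\<lambda>\<tau>. u \<tau> + 0 *\<^sub>R v \<tau>) - (y - 0) *\<^sub>R L v) \<le> e * norm (y - 0)"
    proof (rule exI[of _ "\<delta> / n"], intro conjI allI impI)
      show "0 < \<delta> / n" using \<delta> n by simp
      fix y :: real assume y: "norm (y - 0) < \<delta> / n"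
      have "L2norm (\<lambda>\<tau>. y *\<^sub>R v \<tau>) = \<bar>y\<bar> * L2norm v" by (rule L2norm_scale)
      also have "\<dots> \<le> \<bar>y\<bar> * n" using n by (intro mult_left_mono) auto
      finally have yn: "L2norm (\<lambda>\<tau>. y *\<^sub>R v \<tau>) \<le> \<bar>y\<bar> * n" .
      also have "\<bar>y\<bar> * n < \<delta>" using y n by (simp add: field_simps)
      finally have "norm (End_map gmul Xmap (\<lambda>t. u t + y *\<^sub>R v t) - End_map gmul Xmap u - L (\<lambda>t. y *\<^sub>R v t)) \<le> e / n * L2norm (\<lambda>t. y *\<^sub>R v t)"
        using B[rule_format, OF L2_scale[OF v, of y]] by simp
      also have "\<dots> \<le> e / n * (\<bar>y\<bar> * n)" using e n by (intro mult_left_mono yn) auto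
      also have "\<dots> = e * \<bar>y\<bar>" using n by simp
      finally show "norm (End_map gmul Xmap (\<lambda>\<tau>. u \<tau> + y *\<^sub>R v \<tau>) -
        End_map gmul Xmap (\<lambda>\<tau>. u \<tau> + 0 *\<^sub>R v \<tau>) - (y - 0) *\<^sub>R L v) \<le> e * norm (y - 0)" by (simp add: Ls)
    qed
  qed
qed

text \<open>A covector annihilating the image of \<open>V\<close> exists because the rank is
  deficient; it is divided by its component of largest modulus. This determines \<open>b0\<close>
  and is the normalisation that \<open>near_critical_cover\<close> expects.\<close>

lemma Crit_covector:
  assumes "u \<in> Crit_End_on gmul Xmap V"
  shows "\<exists>L \<xi> b0. has_End_deriv gmul Xmap u L \<and> b0 \<in> Basis \<and> \<xi> \<bullet> b0 = 1 \<and> (\<forall>b\<in>Basis. \<bar>\<xi> \<bullet> b\<bar> \<le> 1) \<and> (\<forall>v\<in>V. \<xi> \<bullet> L v = 0)"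
proof -
  from assms obtain L where L: "has_End_deriv gmul Xmap u L" and dL: "dim (L ` V) \<le> DIM('g) - 1"
    unfolding Crit_End_on_def by blast
  have "dim (L ` V) < DIM('g)" by (rule le_less_trans[OF dL]) simp
  then obtain \<xi>0 where l0: "\<xi>0 \<noteq> 0" "\<And>y. y \<in> span (L ` V) \<Longrightarrow> real_inner_class.orthogonal \<xi>0 y"
    using orthogonal_to_subspace_exists by blast
  define B where "B = (\<lambda>b. \<bar>\<xi>0 \<bullet> b\<bar>) ` (Basis :: 'g set)"
  have B: "finite B" "B \<noteq> {}" by (simp_all add: B_def)
  obtain b0 where b0: "b0 \<in> Basis" "Max B = \<bar>\<xi>0 \<bullet> b0\<bar>" using Max_in[OF B] unfolding B_def by blast
  have mx: "\<bar>\<xi>0 \<bullet> b\<bar> \<le> \<bar>\<xi>0 \<bullet> b0\<bar>" if "b \<in> Basis" for b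
    using Max_ge[OF B(1), of "\<bar>\<xi>0 \<bullet> b\<bar>"] that unfolding b0(2) by (simp add: B_def)
  have nz: "\<xi>0 \<bullet> b0 \<noteq> 0"
  proof
    assume "\<xi>0 \<bullet> b0 = 0"
    then have "\<xi>0 \<bullet> b = 0" if "b \<in> Basis" for b using mx[OF that] by simp
    then show False using l0(1) euclidean_all_zero_iff[of \<xi>0] by blast
  qed
  define \<xi> where "\<xi> = (1 / (\<xi>0 \<bullet> b0)) *\<^sub>R \<xi>0"
  have "\<xi> \<bullet> b0 = 1" using nz by (simp add: \<xi>_def)
  moreover have "\<bar>\<xi> \<bullet> b\<bar> \<le> 1" if "b \<in> Basis" for b using mx[OF that] nz by (simp add: \<xi>_def abs_mult field_simps)
  moreover have "\<xi> \<bullet> L v = 0" if "v \<in> V" for v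
    using l0(2)[OF span_base, of "L v"] that by (simp add: \<xi>_def real_inner_class.orthogonal_def)
  ultimately show ?thesis using L b0(1) by blast
qed

text \<open>The normalised remainder of \<open>u\<close> is adjoined to the family \<open>e\<close>, so that the endpoint at \<open>u\<close> and at its
  approximation are values of one polynomial at points differing by \<open>\<eta>\<close> in the last coordinate.\<close>
lemma approx_critical:
  assumes C: "0 \<le> C"
    and EP: "\<And>N (e::nat \<Rightarrow> real \<Rightarrow> 'k). (\<forall>j<N. e j \<in> L2 \<and> L2norm (e j) \<le> 1) \<Longrightarrow>
     \<exists>c. (\<forall>I\<in>lists_n N d. norm (c I) \<le> C) \<and> (\<forall>x. End_map gmul Xmap (\<lambda>\<tau>. \<Sum>j<N. x j *\<^sub>R e j \<tau>) = lmap N d c x)"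
    and e: "\<And>j. j < N \<Longrightarrow> e j \<in> V" "\<And>j. j < N \<Longrightarrow> e j \<in> L2" "\<And>j. j < N \<Longrightarrow> L2norm (e j) \<le> 1"
    and c: "\<And>x. End_map gmul Xmap (\<lambda>\<tau>. \<Sum>j<N. x j *\<^sub>R e j \<tau>) = lmap N d c x"
    and u: "u \<in> Crit_End_on gmul Xmap V" "u \<in> L2"
    and x: "\<And>j. j < N \<Longrightarrow> \<bar>x j\<bar> \<le> \<rho>" and \<rho>: "1 \<le> \<rho>" and \<eta>: "0 < \<eta>" "\<eta> \<le> \<rho>"
    and ap: "L2norm (\<lambda>t. u t - (\<Sum>j<N. x j *\<^sub>R e j t)) \<le> \<eta>"
  shows "norm (End_map gmul Xmap u - lmap N d c x) \<le> C * (real N + 2) ^ d * (real d * \<rho> ^ d * \<eta>)"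
    and "\<exists>\<xi> b0. b0 \<in> Basis \<and> \<xi> \<bullet> b0 = 1 \<and> (\<forall>b\<in>Basis. \<bar>\<xi> \<bullet> b\<bar> \<le> 1) \<and>
      (\<forall>j<N. \<bar>\<xi> \<bullet> dlmap N d c j x\<bar> \<le> real DIM('g) * (C * (real N + 2) ^ d * ((real d)\<^sup>2 * \<rho> ^ d * \<eta>)))"
proof -
  \<comment> \<open>Division by \<open>\<eta>\<close> places the remainder in the unit ball, where
    the uniform coefficient bound applies.\<close>
  define w where "w = (\<lambda>t. (1 / \<eta>) *\<^sub>R (u t - (\<Sum>j<N. x j *\<^sub>R e j t)))"
  have dL: "(\<lambda>t. u t - (\<Sum>j<N. x j *\<^sub>R e j t)) \<in> L2" using e(2) by (intro L2_diff[OF u(2)] L2_sum) simp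
  have w: "w \<in> L2" unfolding w_def by (rule L2_scale[OF dL])
  have wn: "L2norm w \<le> 1" unfolding w_def L2norm_scale using ap \<eta> by (simp add: field_simps)
  define e' where "e' = (\<lambda>j. if j < N then e j else w)"
  have e': "\<forall>j<Suc N. e' j \<in> L2 \<and> L2norm (e' j) \<le> 1" using e w wn by (simp add: e'_def)
  have se: "(\<Sum>j<Suc N. y j *\<^sub>R e' j \<tau>) = (\<Sum>j<N. y j *\<^sub>R e j \<tau>) + y N *\<^sub>R w \<tau>" for y \<tau>
    by (simp add: e'_def)
  from EP[OF e'] obtain c' where c'C: "\<And>I. I \<in> lists_n (Suc N) d \<Longrightarrow> norm (c' I) \<le> C"
    and c': "\<And>y. End_map gmul Xmap (\<lambda>\<tau>. (\<Sum>j<N. y j *\<^sub>R e j \<tau>) + y N *\<^sub>R w \<tau>) = lmap (Suc N) d c' y"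
    unfolding se by blast
  define y0 where "y0 = x(N := 0)"
  define y1 where "y1 = x(N := \<eta>)"
  \<comment> \<open>Setting the last coordinate to zero recovers the polynomial of the smaller
    family.\<close>
  have lm: "lmap N d c z = lmap (Suc N) d c' (z(N := 0))" for z
    using c[of z] c'[of "z(N := 0)"] by (simp add: fun_upd_def)
  have Eu: "(\<lambda>\<tau>. (\<Sum>j<N. y1 j *\<^sub>R e j \<tau>) + y1 N *\<^sub>R w \<tau>) = u"
  proof
    fix \<tau>
    have "(\<Sum>j<N. y1 j *\<^sub>R e j \<tau>) = (\<Sum>j<N. x j *\<^sub>R e j \<tau>)" by (intro sum.cong) (auto simp: y1_def)
    then show "(\<Sum>j<N. y1 j *\<^sub>R e j \<tau>) + y1 N *\<^sub>R w \<tau> = u \<tau>" using \<eta> by (simp add: y1_def w_def)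
  qed
  have y0: "\<bar>y0 i\<bar> \<le> \<rho>" if "i < Suc N" for i using x that \<rho> by (auto simp: y0_def less_Suc_eq)
  have y1: "\<bar>y1 i\<bar> \<le> \<rho>" if "i < Suc N" for i using x that \<eta> by (auto simp: y1_def less_Suc_eq)
  have yd: "\<bar>y1 i - y0 i\<bar> \<le> \<eta>" if "i < Suc N" for i using \<eta> by (auto simp: y0_def y1_def)
  have \<eta>0: "0 \<le> \<eta>" using \<eta> by simp
  have N2: "real (Suc N) + 1 = real N + 2" by simp
  have D: "norm (lmap (Suc N) d c' y1 - lmap (Suc N) d c' y0) \<le> C * (real N + 2) ^ d * (real d * \<rho> ^ d * \<eta>)"
    "norm (dlmap (Suc N) d c' j y1 - dlmap (Suc N) d c' j y0) \<le> C * (real N + 2) ^ d * ((real d)\<^sup>2 * \<rho> ^ d * \<eta>)" for j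
    unfolding N2[symmetric]
    by (rule lmap_diff[where \<eta> = \<eta> and \<rho> = \<rho>]; use c'C \<rho> y1 y0 yd \<eta>0 in simp)+
  have "End_map gmul Xmap u = lmap (Suc N) d c' y1" using c'[of y1] unfolding Eu .
  moreover have "lmap N d c x = lmap (Suc N) d c' y0" unfolding y0_def by (rule lm)
  ultimately show "norm (End_map gmul Xmap u - lmap N d c x) \<le> C * (real N + 2) ^ d * (real d * \<rho> ^ d * \<eta>)"
    using D(1) by simp
  \<comment> \<open>The coefficients \<open>c\<close> and \<open>c'\<close> need not correspond;
    only the functions agree. The partial derivatives are therefore compared through uniqueness of
    derivatives.\<close>
  have dl: "dlmap N d c j x = dlmap (Suc N) d c' j y0" if j: "j < N" for j
  proof -
    have "((\<lambda>t. lmap N d c (x(j := x j + t))) has_vector_derivative dlmap N d c j x) (at 0)"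
      by (rule lmap_line_derivative[OF j])
    moreover have "lmap N d c (x(j := x j + t)) = lmap (Suc N) d c' (y0(j := y0 j + t))" for t
    proof -
      have "(x(j := x j + t))(N := 0) = y0(j := y0 j + t)" using j by (auto simp: y0_def)
      then show ?thesis unfolding lm by simp
    qed
    ultimately have "((\<lambda>t. lmap (Suc N) d c' (y0(j := y0 j + t))) has_vector_derivative dlmap N d c j x) (at 0)" by simp
    moreover have "((\<lambda>t. lmap (Suc N) d c' (y0(j := y0 j + t))) has_vector_derivative dlmap (Suc N) d c' j y0) (at 0)"
      by (rule lmap_line_derivative) (use j in simp)
    ultimately show ?thesis by (rule vector_derivative_unique_at)
  qed
  from Crit_covector[OF u(1)] obtain L \<xi> b0 where L: "has_End_deriv gmul Xmap u L" and b0: "b0 \<in> Basis" "\<xi> \<bullet> b0 = 1"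
    and \<xi>: "\<forall>b\<in>Basis. \<bar>\<xi> \<bullet> b\<bar> \<le> 1" and LV: "\<forall>v\<in>V. \<xi> \<bullet> L v = 0" by blast
  \<comment> \<open>At \<open>u\<close> itself the partial derivatives are values of the
    differential, and the covector annihilates these on \<open>V\<close>.\<close>
  have Lj: "L (e j) = dlmap (Suc N) d c' j y1" if j: "j < N" for j
  proof -
    have "((\<lambda>t. End_map gmul Xmap (\<lambda>\<tau>. u \<tau> + t *\<^sub>R e j \<tau>)) has_vector_derivative L (e j)) (at 0)"
      by (rule End_deriv_line[OF L e(2)[OF j]])
    moreover have "End_map gmul Xmap (\<lambda>\<tau>. u \<tau> + t *\<^sub>R e j \<tau>) = lmap (Suc N) d c' (y1(j := y1 j + t))" for t
    proof -
      have "(\<Sum>i<N. (y1(j := y1 j + t)) i *\<^sub>R e i \<tau>) + (y1(j := y1 j + t)) N *\<^sub>R w \<tau> = u \<tau> + t *\<^sub>R e j \<tau>" for \<tau>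
      proof -
        have "(\<Sum>i<N. (y1(j := y1 j + t)) i *\<^sub>R e i \<tau>) = (\<Sum>i<N. y1 i *\<^sub>R e i \<tau> + (if i = j then t *\<^sub>R e i \<tau> else 0))"
          by (intro sum.cong) (auto simp: scaleR_add_left)
        also have "\<dots> = (\<Sum>i<N. y1 i *\<^sub>R e i \<tau>) + t *\<^sub>R e j \<tau>" using j by (simp add: sum.distrib)
        finally show ?thesis using j fun_cong[OF Eu, of \<tau>] by (simp add: algebra_simps)
      qed
      then show ?thesis using c'[of "y1(j := y1 j + t)"] by (simp only:)
    qed
    ultimately have "((\<lambda>t. lmap (Suc N) d c' (y1(j := y1 j + t))) has_vector_derivative L (e j)) (at 0)" by simp
    moreover have "((\<lambda>t. lmap (Suc N) d c' (y1(j := y1 j + t))) has_vector_derivative dlmap (Suc N) d c' j y1) (at 0)"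
      by (rule lmap_line_derivative) (use j in simp)
    ultimately show ?thesis by (rule vector_derivative_unique_at)
  qed
  have "\<bar>\<xi> \<bullet> dlmap N d c j x\<bar> \<le> real DIM('g) * (C * (real N + 2) ^ d * ((real d)\<^sup>2 * \<rho> ^ d * \<eta>))" if j: "j < N" for j
  proof -
    have "\<xi> \<bullet> dlmap (Suc N) d c' j y1 = 0" using LV e(1)[OF j] Lj[OF j] by metis
    then have "\<xi> \<bullet> dlmap N d c j x = - (\<xi> \<bullet> (dlmap (Suc N) d c' j y1 - dlmap (Suc N) d c' j y0))"
      by (simp add: dl[OF j] inner_diff_right)
    then have "\<bar>\<xi> \<bullet> dlmap N d c j x\<bar> \<le> norm \<xi> * norm (dlmap (Suc N) d c' j y1 - dlmap (Suc N) d c' j y0)"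
      using Cauchy_Schwarz_ineq2 by simp
    also have "\<dots> \<le> real DIM('g) * (C * (real N + 2) ^ d * ((real d)\<^sup>2 * \<rho> ^ d * \<eta>))"
    proof (rule mult_mono)
      have "norm \<xi> \<le> (\<Sum>b\<in>Basis. \<bar>\<xi> \<bullet> b\<bar>)" by (rule norm_le_l1)
      also have "\<dots> \<le> (\<Sum>b\<in>(Basis::'g set). 1)" by (rule sum_mono) (use \<xi> in blast)
      finally show "norm \<xi> \<le> real DIM('g)" by simp
      show "norm (dlmap (Suc N) d c' j y1 - dlmap (Suc N) d c' j y0) \<le> C * (real N + 2) ^ d * ((real d)\<^sup>2 * \<rho> ^ d * \<eta>)"
        by (rule D(2))
    qed auto
    finally show ?thesis .
  qed
  then show "\<exists>\<xi> b0. b0 \<in> Basis \<and> \<xi> \<bullet> b0 = 1 \<and> (\<forall>b\<in>Basis. \<bar>\<xi> \<bullet> b\<bar> \<le> 1) \<and>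
      (\<forall>j<N. \<bar>\<xi> \<bullet> dlmap N d c j x\<bar> \<le> real DIM('g) * (C * (real N + 2) ^ d * ((real d)\<^sup>2 * \<rho> ^ d * \<eta>)))"
    using b0 \<xi> by (intro exI[of _ \<xi>] exI[of _ b0]) simp
qed

end

section \<open>Polynomial growth against geometric decay\<close>

definition poly_bounded :: "(nat \<Rightarrow> real) \<Rightarrow> bool" where
  "poly_bounded f \<longleftrightarrow> (\<exists>A E. 0 \<le> A \<and> (\<forall>n. 0 \<le> f n \<and> f n \<le> A * (real n + 1) ^ E))"

lemma poly_boundedI: "0 \<le> A \<Longrightarrow> (\<And>n. 0 \<le> f n \<and> f n \<le> A * (real n + 1) ^ E) \<Longrightarrow> poly_bounded f"
  unfolding poly_bounded_def by blast

lemma poly_bounded_const: "0 \<le> c \<Longrightarrow> poly_bounded (\<lambda>n. c)"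
  by (rule poly_boundedI[of c _ 0]) auto

lemma poly_bounded_linear: "poly_bounded (\<lambda>n. real (n * k))"
  by (rule poly_boundedI[of "real k" _ 1]) (auto simp: algebra_simps)

lemma poly_bounded_add:
  assumes "poly_bounded f" "poly_bounded g"
  shows "poly_bounded (\<lambda>n. f n + g n)"
proof -
  obtain A E where f: "0 \<le> A" "\<And>n. 0 \<le> f n \<and> f n \<le> A * (real n + 1) ^ E" using assms(1) unfolding poly_bounded_def by blast
  obtain B F where g: "0 \<le> B" "\<And>n. 0 \<le> g n \<and> g n \<le> B * (real n + 1) ^ F" using assms(2) unfolding poly_bounded_def by blast
  show ?thesis
  proof (rule poly_boundedI[of "A + B" _ "E + F"])
    fix n
    have "A * (real n + 1) ^ E \<le> A * (real n + 1) ^ (E + F)" "B * (real n + 1) ^ F \<le> B * (real n + 1) ^ (E + F)"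
      using f(1) g(1) by (intro mult_left_mono power_increasing; simp)+
    then show "0 \<le> f n + g n \<and> f n + g n \<le> (A + B) * (real n + 1) ^ (E + F)"
      using f(2)[of n] g(2)[of n] unfolding distrib_right by linarith
  qed (use f g in simp)
qed

lemma poly_bounded_mult:
  assumes "poly_bounded f" "poly_bounded g"
  shows "poly_bounded (\<lambda>n. f n * g n)"
proof -
  obtain A E where f: "0 \<le> A" "\<And>n. 0 \<le> f n \<and> f n \<le> A * (real n + 1) ^ E" using assms(1) unfolding poly_bounded_def by blast
  obtain B F where g: "0 \<le> B" "\<And>n. 0 \<le> g n \<and> g n \<le> B * (real n + 1) ^ F" using assms(2) unfolding poly_bounded_def by blast
  show ?thesis
  proof (rule poly_boundedI[of "A * B" _ "E + F"])
    fix n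
    have "f n * g n \<le> (A * (real n + 1) ^ E) * (B * (real n + 1) ^ F)"
      using f g by (intro mult_mono) (auto intro: order_trans)
    then show "0 \<le> f n * g n \<and> f n * g n \<le> A * B * (real n + 1) ^ (E + F)"
      using f(2)[of n] g(2)[of n] by (simp add: power_add mult_ac)
  qed (use f g in simp)
qed

lemma poly_bounded_power: "poly_bounded f \<Longrightarrow> poly_bounded (\<lambda>n. f n ^ k)"
  by (induction k) (simp_all add: poly_bounded_const poly_bounded_mult)

text \<open>Writing \<open>\<theta>\<close> as \<open>t ^ Suc E\<close> turns the bound into a
  multiple of a power of \<open>(real n + 1) * t ^ n\<close>, which tends to zero.\<close>

lemma poly_bounded_geometric:
  fixes \<theta> :: real
  assumes f: "poly_bounded f" and \<theta>: "0 < \<theta>" "\<theta> < 1"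
  shows "(\<lambda>n. f n * \<theta> ^ n) \<longlonglongrightarrow> 0"
proof -
  obtain A E where A: "0 \<le> A" "\<And>n. 0 \<le> f n \<and> f n \<le> A * (real n + 1) ^ E" using f unfolding poly_bounded_def by blast
  define t where "t = root (Suc E) \<theta>"
  have t: "0 < t" "t < 1" "t ^ Suc E = \<theta>" using \<theta> by (simp_all add: t_def real_root_pow_pos del: power_Suc)
  have "(\<lambda>n. of_nat n * t ^ n + t ^ n) \<longlonglongrightarrow> 0 + 0"
    using t by (intro tendsto_add powser_times_n_limit_0 LIMSEQ_power_zero) auto
  from tendsto_mult_left[OF tendsto_power[OF this, of "Suc E"], of A]
  have lim: "(\<lambda>n. A * (real n * t ^ n + t ^ n) ^ Suc E) \<longlonglongrightarrow> 0" by simp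
  have le: "f n * \<theta> ^ n \<le> A * (real n * t ^ n + t ^ n) ^ Suc E" for n
  proof -
    have "f n \<le> A * (real n + 1) ^ Suc E"
      by (rule order_trans[OF conjunct2[OF A(2)]]) (intro mult_left_mono power_increasing A(1); simp)
    then have "f n * \<theta> ^ n \<le> A * (real n + 1) ^ Suc E * \<theta> ^ n" using \<theta> by (intro mult_right_mono) auto
    also have "A * (real n + 1) ^ Suc E * \<theta> ^ n = A * (real n * t ^ n + t ^ n) ^ Suc E"
    proof -
      have "\<theta> ^ n = (t ^ n) ^ Suc E" unfolding t(3)[symmetric] by (simp only: power_mult[symmetric] mult.commute)
      then show ?thesis by (simp only: mult.assoc power_mult_distrib[symmetric] distrib_right mult_1)
    qed
    finally show ?thesis .
  qed
  show ?thesis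
    by (rule tendsto_sandwich[OF _ _ tendsto_const lim]) (use A \<theta> le in auto)
qed

section \<open>Choice of scales and thinness of the critical values\<close>

context carnot begin

text \<open>A single scale \<open>T\<close> governs the estimate: \<open>\<epsilon> = T ^ P\<close>,
  \<open>R = 1 / T ^ 2\<close>, and \<open>q ^ n\<close> is at most \<open>T ^ (2 * P)\<close>. The
  hypotheses \<open>F1\<close> to \<open>F6\<close> say that each factor growing polynomially in
  \<open>n\<close> is absorbed by one power of \<open>T\<close>. The balls would have radius
  \<open>\<epsilon> * R = T ^ (P - 2)\<close>; one more power of \<open>T\<close> is given up for
  such a factor.\<close>

lemma cover_step:
  fixes T C q :: real and n l M P d :: nat
  defines "m \<equiv> DIM('g)" and "N \<equiv> n * (l * DIM('k))"
  defines "\<rho> \<equiv> real (DIM('k) * M)" and "Y0 \<equiv> C * (real N + 1) ^ d * real M ^ d"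
  defines "A \<equiv> 1 + real (d + P + 2) * real M ^ (d + P + 1)" and "B \<equiv> real M ^ (d + P + 2)"
  assumes C: "0 \<le> C"
    and EP: "\<And>N (e::nat \<Rightarrow> real \<Rightarrow> 'k). (\<forall>j<N. e j \<in> L2 \<and> L2norm (e j) \<le> 1) \<Longrightarrow>
     \<exists>c. (\<forall>I\<in>lists_n N d. norm (c I) \<le> C) \<and> (\<forall>x. End_map gmul Xmap (\<lambda>\<tau>. \<Sum>j<N. x j *\<^sub>R e j \<tau>) = lmap N d c x)"
    and d: "1 \<le> d" and V: "Cw_pw_entire l \<subseteq> V" "V \<subseteq> L2" and l: "1 \<le> l" and M: "1 \<le> M" and P: "4 \<le> P"
    and T: "0 < T" "T \<le> 1" and q: "0 < q" "q ^ n \<le> T ^ (2 * P)"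
    and F1: "(real m * (C * (real N + 2) ^ d * ((real d + 1)\<^sup>2 * \<rho> ^ d * \<rho>))) * T \<le> 1"
    and F2: "((1 + 2 * real m) * (C * (real N + 1) ^ d * real d + (Y0 + 1)) + 1) * T \<le> 1"
    and F3: "8 * A * T \<le> 1"
    and F5: "(2 * real m + 1 + 18 * (real N + real m + 1) * A + (real N + real m) * B) * T \<le> 1"
    and F6: "(2 * Y0 + 3) * T \<le> 1"
  shows "\<exists>Q. finite Q \<and> real (card Q) \<le> real m * ((1 / T) ^ ((P + 1) * (m - 1)) * real (d + P + 1) ^ (N + m)) \<and>
    End_map gmul Xmap ` {u \<in> Crit_End_on gmul Xmap V. \<exists>X. taylor_bounds l q M u X} \<subseteq> (\<Union>p\<in>Q. cball p (T ^ (P - 3)))"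
proof -
  have kp: "1 \<le> DIM('k)" using DIM_positive[where 'a='k] by linarith
  have m1: "1 \<le> m" unfolding m_def using DIM_positive[where 'a='g] by linarith
  have \<rho>M: "real M \<le> \<rho>" unfolding \<rho>_def using mult_right_mono[of 1 "real DIM('k)" "real M"] kp by simp
  have \<rho>1: "1 \<le> \<rho>" by (rule order_trans[OF _ \<rho>M]) (use M in simp)
  define \<epsilon> where "\<epsilon> = T ^ P"
  \<comment> \<open>With this choice \<open>\<epsilon> * R ^ P\<close> equals
    \<open>1 / T ^ P\<close>, which dominates the growth constant of the gradient.\<close>
  define R where "R = 1 / T\<^sup>2"
  define \<eta> where "\<eta> = \<rho> * q ^ n"
  define E where "E = real m * (C * (real N + 2) ^ d * ((real d + 1)\<^sup>2 * \<rho> ^ d * \<eta>))"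
  have \<epsilon>: "0 < \<epsilon>" "\<epsilon> \<le> T" "\<epsilon> \<le> 1"
  proof -
    show "0 < \<epsilon>" using T by (simp add: \<epsilon>_def)
    have "T ^ P \<le> T ^ 1" using T P by (intro power_decreasing) auto
    then show "\<epsilon> \<le> T" "\<epsilon> \<le> 1" using T by (auto simp: \<epsilon>_def)
  qed
  have R: "1 \<le> R" using T by (simp add: R_def power_le_one)
  have TP: "T ^ (2 * P) = T * (T ^ (P - 1) * T ^ P)"
  proof -
    have "2 * P = Suc ((P - 1) + P)" using P by simp
    then show ?thesis by (simp only: power_Suc power_add)
  qed
  have \<eta>: "0 < \<eta>" "\<eta> \<le> \<rho>"
  proof -
    show "0 < \<eta>" using \<rho>1 q by (simp add: \<eta>_def)
    have "q ^ n \<le> 1" by (rule order_trans[OF q(2)]) (use T in \<open>simp add: power_le_one\<close>)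
    then show "\<eta> \<le> \<rho>" using \<rho>1 by (simp add: \<eta>_def mult_le_cancel_left1)
  qed
  have E\<epsilon>: "E \<le> \<epsilon>"
  proof -
    let ?G = "real m * (C * (real N + 2) ^ d * ((real d + 1)\<^sup>2 * \<rho> ^ d * \<rho>))"
    have G0: "0 \<le> ?G" using C \<rho>1 by simp
    have "E = ?G * q ^ n" by (simp add: E_def \<eta>_def mult_ac)
    also have "\<dots> \<le> ?G * T ^ (2 * P)" by (rule mult_left_mono[OF q(2) G0])
    also have "\<dots> = (?G * T) * (T ^ (P - 1) * T ^ P)" unfolding TP by (simp only: mult.assoc)
    also have "\<dots> \<le> 1 * (T ^ (P - 1) * T ^ P)" using F1 T by (intro mult_right_mono) auto
    also have "\<dots> \<le> 1 * (1 * T ^ P)" using T by (intro mult_left_mono mult_right_mono) (auto simp: power_le_one)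
    finally show ?thesis by (simp add: \<epsilon>_def)
  qed
  from control_basis[where 'k='k, OF l, of n, folded N_def] obtain e :: "nat \<Rightarrow> real \<Rightarrow> 'k" where e: "\<forall>j<N. e j \<in> Cw_pw_entire l \<and> L2norm (e j) \<le> 1"
    and ex: "\<forall>q M u X. u \<in> L2 \<longrightarrow> 0 \<le> q \<longrightarrow> taylor_bounds l q M u X \<longrightarrow>
      (\<exists>x. (\<forall>j<N. \<bar>x j\<bar> \<le> real M) \<and> L2norm (\<lambda>t. u t - (\<Sum>j<N. x j *\<^sub>R e j t)) \<le> real DIM('k) * real M * q ^ n)"
    by (elim exE conjE) (rule that)
  have eV: "e j \<in> V" and eL: "e j \<in> L2" and e1: "L2norm (e j) \<le> 1" if "j < N" for j
    using e that V by auto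
  have "\<forall>j<N. e j \<in> L2 \<and> L2norm (e j) \<le> 1" using eL e1 by simp
  from EP[OF this] obtain c where cC: "\<And>I. I \<in> lists_n N d \<Longrightarrow> norm (c I) \<le> C"
    and c: "\<And>x. End_map gmul Xmap (\<lambda>\<tau>. \<Sum>j<N. x j *\<^sub>R e j \<tau>) = lmap N d c x" by blast
  have Y00: "0 \<le> Y0" using C by (simp add: Y0_def)
  \<comment> \<open>The grid has to reach \<open>Y0\<close>, which bounds the polynomial wherever
    the coordinates are at most \<open>M\<close>.\<close>
  define Z where "Z = nat \<lceil>Y0 / \<epsilon>\<rceil>"
  have Z0: "0 \<le> Y0 / \<epsilon>" using Y00 \<epsilon> by simp
  have Z: "Y0 / \<epsilon> \<le> real Z" "real Z \<le> Y0 / \<epsilon> + 1" unfolding Z_def using Z0 by linarith+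
  have Z1: "Y0 \<le> \<epsilon> * real Z" using Z(1) \<epsilon> by (simp add: field_simps)
  have Z2: "\<epsilon> * real Z \<le> Y0 + 1"
  proof -
    have "\<epsilon> * real Z \<le> \<epsilon> * (Y0 / \<epsilon> + 1)" using Z(2) \<epsilon> by (intro mult_left_mono) auto
    also have "\<dots> = Y0 + \<epsilon>" using \<epsilon> by (simp add: algebra_simps)
    finally show ?thesis using \<epsilon> by simp
  qed
  have RP: "(1 + 2 * real m) * (C * (real N + 1) ^ d * real d + (Y0 + 1)) + 1 \<le> \<epsilon> * R ^ P"
  proof -
    have "T ^ 1 \<ge> T ^ P" using T P by (intro power_decreasing) auto
    then have "1 / T \<le> 1 / T ^ P" using T by (simp add: frac_le)
    also have "1 / T ^ P = \<epsilon> * R ^ P"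
    proof -
      have "\<epsilon> * R ^ P = T ^ P / (T ^ P * T ^ P)"
        by (simp add: \<epsilon>_def R_def power_divide flip: power_mult power_add mult_2)
      then show ?thesis using T by simp
    qed
    finally have "1 / T \<le> \<epsilon> * R ^ P" .
    moreover have "(1 + 2 * real m) * (C * (real N + 1) ^ d * real d + (Y0 + 1)) + 1 \<le> 1 / T"
      using F2 T by (simp only: pos_le_divide_eq)
    ultimately show ?thesis by linarith
  qed
  have small: "\<epsilon> * (1 + real (d + P + 2) * real M ^ (d + P + 1)) \<le> 1/8"
  proof -
    have A0: "0 \<le> A" by (simp add: A_def)
    have "\<epsilon> * A \<le> T * A" by (rule mult_right_mono[OF \<epsilon>(2) A0])
    then have "\<epsilon> * A \<le> 1 / 8" using F3 by (simp add: mult_ac)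
    then show ?thesis unfolding A_def .
  qed
  have P1: "1 \<le> P" and M1: "1 \<le> real M" and Y1: "0 \<le> Y0 + 1" using P M Y00 by auto
  from near_critical_cover[where N = N and c = c, OF d P1 cC Y1 C M1 \<epsilon>(1) R RP[unfolded m_def] small Z2, folded m_def] obtain Q where fQ: "finite Q"
    and cQ: "card Q \<le> m * ((2 * Z + 1) ^ (m - 1) * (d + P + 1) ^ (N + m))"
    and Q: "\<forall>x l b0. b0 \<in> Basis \<longrightarrow> l \<bullet> b0 = 1 \<longrightarrow> (\<forall>b\<in>Basis. \<bar>l \<bullet> b\<bar> \<le> 1) \<longrightarrow> (\<forall>i<N. \<bar>x i\<bar> \<le> real M) \<longrightarrow>
      (\<forall>j<N. \<bar>l \<bullet> dlmap N d c j x\<bar> \<le> \<epsilon>) \<longrightarrow> (\<forall>b\<in>Basis. \<bar>lmap N d c x \<bullet> b\<bar> \<le> \<epsilon> * real Z) \<longrightarrow>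
      (\<exists>q\<in>Q. dist (lmap N d c x) q \<le> (real m + cover_const N m d P (real M) R) * \<epsilon>)" by blast
  show ?thesis
  proof (rule exI[of _ Q], intro conjI)
    show "finite Q" by (rule fQ)
    have "real (card Q) \<le> real m * (real (2 * Z + 1) ^ (m - 1) * real (d + P + 1) ^ (N + m))"
      using cQ by (simp only: of_nat_le_iff of_nat_mult[symmetric] of_nat_power[symmetric])
    also have "\<dots> \<le> real m * (((1 / T) ^ (P + 1)) ^ (m - 1) * real (d + P + 1) ^ (N + m))"
    proof (intro mult_left_mono mult_right_mono power_mono)
      \<comment> \<open>The grid has about \<open>1 / \<epsilon>\<close> points per coordinate; the
        factor \<open>2 * Y0 + 3\<close> is paid for by \<open>1 / T\<close>.\<close>
      have "real (2 * Z + 1) \<le> 2 * (Y0 / \<epsilon>) + 3 * 1" using Z(2) by simp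
      also have "\<dots> \<le> 2 * (Y0 / \<epsilon>) + 3 * (1 / \<epsilon>)" using \<epsilon> by (intro add_left_mono mult_left_mono) auto
      also have "\<dots> = (2 * Y0 + 3) / \<epsilon>" by (simp add: add_divide_distrib)
      also have "\<dots> \<le> (1 / T) / \<epsilon>" using F6 T \<epsilon> by (intro divide_right_mono) (auto simp: field_simps)
      also have "\<dots> = (1 / T) ^ (P + 1)" by (simp add: \<epsilon>_def power_divide)
      finally show "real (2 * Z + 1) \<le> (1 / T) ^ (P + 1)" .
    qed auto
    finally show "real (card Q) \<le> real m * ((1 / T) ^ ((P + 1) * (m - 1)) * real (d + P + 1) ^ (N + m))"
      by (simp only: power_mult)
    show "End_map gmul Xmap ` {u \<in> Crit_End_on gmul Xmap V. \<exists>X. taylor_bounds l q M u X} \<subseteq> (\<Union>p\<in>Q. cball p (T ^ (P - 3)))"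
    proof
      fix z assume "z \<in> End_map gmul Xmap ` {u \<in> Crit_End_on gmul Xmap V. \<exists>X. taylor_bounds l q M u X}"
      then obtain u X where z: "z = End_map gmul Xmap u" and u: "u \<in> Crit_End_on gmul Xmap V" and X: "taylor_bounds l q M u X" by blast
      have uL: "u \<in> L2" using u V(2) unfolding Crit_End_on_def by blast
      from ex[rule_format, OF uL _ X] q obtain x where x: "\<forall>j<N. \<bar>x j\<bar> \<le> real M"
        and xa: "L2norm (\<lambda>t. u t - (\<Sum>j<N. x j *\<^sub>R e j t)) \<le> real DIM('k) * real M * q ^ n" by auto
      have xa': "L2norm (\<lambda>t. u t - (\<Sum>j<N. x j *\<^sub>R e j t)) \<le> \<eta>" using xa by (simp add: \<eta>_def \<rho>_def)
      have x\<rho>: "\<bar>x j\<bar> \<le> \<rho>" if "j < N" for j by (rule order_trans[OF x[rule_format, OF that] \<rho>M])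
      note ac = approx_critical[OF C EP eV eL e1 c u uL x\<rho> \<rho>1 \<eta> xa']
      let ?H = "C * (real N + 2) ^ d"
      have H0: "0 \<le> ?H" using C by simp
      have pos: "0 \<le> ?H * ((real d + 1)\<^sup>2 * \<rho> ^ d * \<eta>)"
        using C \<rho>1 \<eta> by simp
      have "norm (End_map gmul Xmap u - lmap N d c x) \<le> ?H * (real d * \<rho> ^ d * \<eta>)" by (rule ac(1))
      also have "\<dots> \<le> ?H * ((real d + 1)\<^sup>2 * \<rho> ^ d * \<eta>)"
        using C \<rho>1 \<eta> by (intro mult_left_mono mult_right_mono) (auto simp: power2_eq_square algebra_simps)
      also have "\<dots> \<le> E" unfolding E_def using mult_right_mono[OF _ pos, of 1 "real m"] m1 by simp
      finally have d1: "dist (lmap N d c x) z \<le> \<epsilon>" using E\<epsilon> by (simp add: z dist_norm norm_minus_commute)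
      from ac(2) obtain \<xi> b0 where b0: "b0 \<in> Basis" "\<xi> \<bullet> b0 = 1" "\<forall>b\<in>Basis. \<bar>\<xi> \<bullet> b\<bar> \<le> 1"
        and \<xi>: "\<forall>j<N. \<bar>\<xi> \<bullet> dlmap N d c j x\<bar> \<le> real DIM('g) * (?H * ((real d)\<^sup>2 * \<rho> ^ d * \<eta>))" by blast
      have "real DIM('g) * (?H * ((real d)\<^sup>2 * \<rho> ^ d * \<eta>)) \<le> E" unfolding E_def m_def[symmetric]
        using C \<rho>1 \<eta> by (intro mult_left_mono mult_right_mono power_mono) auto
      then have \<xi>': "\<forall>j<N. \<bar>\<xi> \<bullet> dlmap N d c j x\<bar> \<le> \<epsilon>" using \<xi> E\<epsilon> by (meson order_trans)
      have Yb: "\<forall>b\<in>Basis. \<bar>lmap N d c x \<bullet> b\<bar> \<le> \<epsilon> * real Z"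
      proof
        fix b :: 'g assume b: "b \<in> Basis"
        have "\<bar>lmap N d c x \<bullet> b\<bar> \<le> norm (lmap N d c x)" by (rule Basis_le_norm[OF b])
        also have "\<dots> \<le> Y0" unfolding Y0_def by (rule norm_lmap[OF cC M1]) (use x in auto)
        finally show "\<bar>lmap N d c x \<bullet> b\<bar> \<le> \<epsilon> * real Z" using Z1 by simp
      qed
      from Q[rule_format, OF b0(1,2)] b0(3) x \<xi>' Yb obtain p where p: "p \<in> Q"
        "dist (lmap N d c x) p \<le> (real m + cover_const N m d P (real M) R) * \<epsilon>" by blast
      have "dist p z \<le> dist (lmap N d c x) p + dist (lmap N d c x) z" by (simp add: dist_triangle2 dist_commute dist_triangle3)
      also have "\<dots> \<le> (real m + cover_const N m d P (real M) R) * \<epsilon> + 1 * \<epsilon>" using p(2) d1 by simp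
      also have "\<dots> = (real m + cover_const N m d P (real M) R + 1) * \<epsilon>" by (simp add: distrib_right)
      also have "\<dots> \<le> ((2 * real m + 1 + 18 * (real N + real m + 1) * A + (real N + real m) * B) * R) * \<epsilon>"
      proof (rule mult_right_mono)
        have AB: "0 \<le> A" "0 \<le> B" by (simp_all add: A_def B_def)
        have "9 * (real (N + m) + 1) * (R + 1) * A \<le> 9 * (real (N + m) + 1) * (2 * R) * A"
          using R AB by (intro mult_right_mono mult_left_mono) auto
        moreover have "real (N + m) * B * 1 \<le> real (N + m) * B * R" using R AB by (intro mult_left_mono) auto
        moreover have "(2 * real m + 1) * 1 \<le> (2 * real m + 1) * R" using R by (intro mult_left_mono) auto
        ultimately show "real m + cover_const N m d P (real M) R + 1 \<le> (2 * real m + 1 + 18 * (real N + real m + 1) * A + (real N + real m) * B) * R"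
          unfolding cover_const_def A_def[symmetric] B_def[symmetric] by (simp add: algebra_simps)
      qed (use \<epsilon> in simp)
      also have "\<dots> = ((2 * real m + 1 + 18 * (real N + real m + 1) * A + (real N + real m) * B) * T) * T ^ (P - 3)"
      proof -
        have "P = 1 + (P - 3) + 2" using P by simp
        then have "T ^ P = T * T ^ (P - 3) * T\<^sup>2" by (metis power_add power_one_right)
        then have "R * \<epsilon> = T * T ^ (P - 3)" using T by (simp add: R_def \<epsilon>_def)
        then show ?thesis by (simp only: mult.assoc)
      qed
      also have "\<dots> \<le> 1 * T ^ (P - 3)" using F5 T by (intro mult_right_mono) auto
      finally show "z \<in> (\<Union>p\<in>Q. cball p (T ^ (P - 3)))" using p(1) by auto
    qed
  qed
qed

text \<open>With \<open>T = \<theta> ^ n\<close>, a constant multiple of \<open>(1 / T) ^ ((P + 1) * (m - 1)) * \<beta> ^ n\<close> balls of radius \<open>T ^ (P - 3)\<close> suffice.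
  The condition on \<open>P\<close> makes the relevant product at most a multiple of \<open>(\<beta> * \<theta>) ^ n = (1/2) ^ n\<close>.\<close>
lemma thin_critical:
  fixes \<tau> q :: real and l M P :: nat
  defines "m \<equiv> DIM('g)" and "d \<equiv> picard_degree s s"
  defines "\<theta> \<equiv> 1 / (2 * real (d + P + 1) ^ (l * DIM('k)))"
  assumes \<tau>: "0 < \<tau>" and P: "4 \<le> P" "4 * real (m - 1) + 1 \<le> real (P - 3) * \<tau>"
    and q: "0 < q" "q \<le> \<theta> ^ (2 * P)" and l: "1 \<le> l" and M: "1 \<le> M"
    and V: "Cw_pw_entire l \<subseteq> V" "V \<subseteq> L2"
  shows "thin (real m - 1 + \<tau>) (End_map gmul Xmap ` {u \<in> Crit_End_on gmul Xmap V. \<exists>X. taylor_bounds l q M u X})"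
proof -
  have d1: "1 \<le> d" unfolding d_def by (rule picard_degree_pos[OF step_pos])
  have m1: "1 \<le> m" unfolding m_def using DIM_positive[where 'a='g] by linarith
  obtain C where C: "0 \<le> C"
    and EP: "\<And>N (e::nat \<Rightarrow> real \<Rightarrow> 'k). (\<forall>j<N. e j \<in> L2 \<and> L2norm (e j) \<le> 1) \<Longrightarrow>
     \<exists>c. (\<forall>I\<in>lists_n N d. norm (c I) \<le> C) \<and> (\<forall>x. End_map gmul Xmap (\<lambda>\<tau>. \<Sum>j<N. x j *\<^sub>R e j \<tau>) = lmap N d c x)"
    using End_poly unfolding d_def by blast
  \<comment> \<open>The number of variables is \<open>n * k\<close>, so the number of critical
    points is \<open>\<beta> ^ n\<close> up to a constant factor, and \<open>\<theta>\<close>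
    satisfies \<open>\<beta> * \<theta> = 1/2\<close>.\<close>
  define k where "k = l * DIM('k)"
  define \<beta> where "\<beta> = real (d + P + 1) ^ k"
  have \<beta>: "1 \<le> \<beta>" by (simp add: \<beta>_def)
  have \<theta>: "\<theta> = 1 / (2 * \<beta>)" by (simp add: \<theta>_def \<beta>_def k_def)
  have \<theta>0: "0 < \<theta>" and \<theta>1: "\<theta> < 1" and \<theta>\<beta>: "\<beta> * \<theta> = 1/2" using \<beta> by (simp_all add: \<theta>)
  define \<rho> where "\<rho> = real (DIM('k) * M)"
  define A where "A = 1 + real (d + P + 2) * real M ^ (d + P + 1)"
  define B where "B = real M ^ (d + P + 2)"
  define Y where "Y = (\<lambda>n. C * (real (n * k) + 1) ^ d * real M ^ d)"
  define F1 where "F1 = (\<lambda>n. real m * (C * (real (n * k) + 2) ^ d * ((real d + 1)\<^sup>2 * \<rho> ^ d * \<rho>)))"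
  define F2 where "F2 = (\<lambda>n. (1 + 2 * real m) * (C * (real (n * k) + 1) ^ d * real d + (Y n + 1)) + 1)"
  define F3 where "F3 = (\<lambda>n::nat. 8 * A)"
  define F5 where "F5 = (\<lambda>n. 2 * real m + 1 + 18 * (real (n * k) + real m + 1) * A + (real (n * k) + real m) * B)"
  define F6 where "F6 = (\<lambda>n. 2 * Y n + 3)"
  note pb = poly_bounded_const poly_bounded_linear poly_bounded_add poly_bounded_mult poly_bounded_power
  have nn: "0 \<le> A" "0 \<le> B" "0 \<le> \<rho>" by (simp_all add: A_def B_def \<rho>_def)
  have pY: "poly_bounded Y" unfolding Y_def by (intro pb) (use C in simp_all)
  have p1: "poly_bounded F1" unfolding F1_def by (intro pb) (use C nn in simp_all)
  have p2: "poly_bounded F2" unfolding F2_def by (intro pb pY) (use C in simp_all)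
  have p3: "poly_bounded F3" unfolding F3_def by (intro pb) (use nn in simp_all)
  have p5: "poly_bounded F5" unfolding F5_def by (intro pb) (use nn in simp_all)
  have p6: "poly_bounded F6" unfolding F6_def by (intro pb pY) simp_all
  have small: "\<forall>\<^sub>F n in sequentially. F n * \<theta> ^ n \<le> 1" if "poly_bounded F" for F
  proof -
    have "\<forall>\<^sub>F n in sequentially. F n * \<theta> ^ n < 1"
      by (rule order_tendstoD(2)[OF poly_bounded_geometric[OF that \<theta>0 \<theta>1]]) simp
    then show ?thesis by eventually_elim simp
  qed
  define K where "K = real m * real (d + P + 1) ^ m"
  have K0: "0 \<le> K" by (simp add: K_def)
  show ?thesis unfolding thin_def
  proof (intro allI impI)
    fix \<epsilon> \<delta> :: real assume \<epsilon>: "0 < \<epsilon>" and \<delta>: "0 < \<delta>"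
    have e1: "\<forall>\<^sub>F n in sequentially. \<theta> ^ n < \<delta>"
      by (rule order_tendstoD(2)[OF LIMSEQ_power_zero]) (use \<theta>0 \<theta>1 \<delta> in simp_all)
    have "(\<lambda>n. K * (1/2::real) ^ n) \<longlonglongrightarrow> K * 0" by (intro tendsto_intros LIMSEQ_power_zero) simp
    then have e2: "\<forall>\<^sub>F n in sequentially. K * (1/2) ^ n < \<epsilon>" by (rule order_tendstoD(2)) (use \<epsilon> in simp)
    have "\<forall>\<^sub>F n in sequentially. F1 n * \<theta> ^ n \<le> 1 \<and> F2 n * \<theta> ^ n \<le> 1 \<and> F3 n * \<theta> ^ n \<le> 1 \<and> F5 n * \<theta> ^ n \<le> 1 \<and> F6 n * \<theta> ^ n \<le> 1
        \<and> \<theta> ^ n < \<delta> \<and> K * (1/2) ^ n < \<epsilon>"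
      by (intro eventually_conj small p1 p2 p3 p5 p6 e1 e2)
    \<comment> \<open>The constants that depend on the group and on \<open>M\<close> affect only how
      large \<open>n\<close> has to be.\<close>
    then obtain n where F: "F1 n * \<theta> ^ n \<le> 1" "F2 n * \<theta> ^ n \<le> 1" "F3 n * \<theta> ^ n \<le> 1" "F5 n * \<theta> ^ n \<le> 1" "F6 n * \<theta> ^ n \<le> 1"
      and n\<delta>: "\<theta> ^ n < \<delta>" and n\<epsilon>: "K * (1/2) ^ n < \<epsilon>"
      using eventually_happens'[OF sequentially_bot] by blast
    define T where "T = \<theta> ^ n"
    have T: "0 < T" "T \<le> 1" using \<theta>0 \<theta>1 by (simp_all add: T_def power_le_one)
    have qT: "q ^ n \<le> T ^ (2 * P)"
    proof -
      have "q ^ n \<le> (\<theta> ^ (2 * P)) ^ n" using q by (intro power_mono) auto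
      then show ?thesis by (simp add: T_def mult.commute flip: power_mult)
    qed
    from cover_step[OF C EP d1 V l M P(1) T q(1) qT] F obtain Q where fQ: "finite Q"
      and cQ: "real (card Q) \<le> real m * ((1 / T) ^ ((P + 1) * (m - 1)) * real (d + P + 1) ^ (n * k + m))"
      and Q: "End_map gmul Xmap ` {u \<in> Crit_End_on gmul Xmap V. \<exists>X. taylor_bounds l q M u X} \<subseteq> (\<Union>p\<in>Q. cball p (T ^ (P - 3)))"
      unfolding F1_def F2_def F3_def F5_def F6_def Y_def T_def[symmetric] A_def B_def \<rho>_def m_def k_def by blast
    show "\<exists>Q \<rho>. finite Q \<and> 0 < \<rho> \<and> \<rho> \<le> \<delta> \<and> End_map gmul Xmap ` {u \<in> Crit_End_on gmul Xmap V. \<exists>X. taylor_bounds l q M u X} \<subseteq> (\<Union>q\<in>Q. cball q \<rho>) \<and>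
       real (card Q) * \<rho> powr (real m - 1 + \<tau>) \<le> \<epsilon>"
    proof (rule exI[of _ Q], rule exI[of _ "T ^ (P - 3)"], intro conjI)
      show "finite Q" by (rule fQ)
      show "0 < T ^ (P - 3)" using T by simp
      have "T ^ (P - 3) \<le> T ^ 1" using T P(1) by (intro power_decreasing) auto
      then show "T ^ (P - 3) \<le> \<delta>" using n\<delta> by (simp add: T_def)
      show "End_map gmul Xmap ` {u \<in> Crit_End_on gmul Xmap V. \<exists>X. taylor_bounds l q M u X} \<subseteq> (\<Union>q\<in>Q. cball q (T ^ (P - 3)))" by (rule Q)
      \<comment> \<open>The exponents of \<open>1 / T\<close> in the number of balls and of
        \<open>T\<close> in the power of the radius. Their gap is
        \<open>(P - 3) * \<tau> - 4 * (m - 1)\<close>, where \<open>4\<close> is the difference of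
        \<open>P + 1\<close> and \<open>P - 3\<close>; it leaves at least one power of
        \<open>T\<close> to beat \<open>\<beta> ^ n\<close>.\<close>
      define a where "a = real ((P + 1) * (m - 1))"
      define b where "b = real (P - 3) * (real m - 1 + \<tau>)"
      have ab: "1 \<le> b - a"
      proof -
        have "b - a = real (P - 3) * \<tau> - 4 * real (m - 1)"
        proof -
          have "real m = real (m - 1) + 1" "real P = real (P - 3) + 3" using P(1) m1 by simp_all
          then show ?thesis unfolding a_def b_def of_nat_mult of_nat_add by (simp only: algebra_simps of_nat_1)
        qed
        then show ?thesis using P(2) by linarith
      qed
      have ra: "(1 / T) ^ ((P + 1) * (m - 1)) = T powr (- a)"
        unfolding a_def powr_minus powr_realpow[OF T(1)] by (simp only: power_one_over inverse_eq_divide)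
      have rb: "(T ^ (P - 3)) powr (real m - 1 + \<tau>) = T powr b"
        using T by (simp add: b_def powr_powr flip: powr_realpow)
      have bn: "real (d + P + 1) ^ (n * k + m) = \<beta> ^ n * real (d + P + 1) ^ m"
        by (simp only: power_add \<beta>_def power_mult[symmetric] mult.commute[of n k])
      have "real (card Q) * (T ^ (P - 3)) powr (real m - 1 + \<tau>) \<le> (real m * (T powr (- a) * (\<beta> ^ n * real (d + P + 1) ^ m))) * T powr b"
        unfolding rb using cQ unfolding ra bn by (intro mult_right_mono) simp_all
      also have "\<dots> = K * \<beta> ^ n * T powr (b - a)"
        by (simp add: K_def powr_diff powr_minus divide_inverse mult_ac)
      also have "\<dots> \<le> K * \<beta> ^ n * T powr 1"
        using K0 \<beta> T ab by (intro mult_left_mono powr_mono') auto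
      also have "\<dots> = K * (\<beta> * \<theta>) ^ n" using T by (simp add: T_def power_mult_distrib)
      also have "\<dots> \<le> \<epsilon>" unfolding \<theta>\<beta> using n\<epsilon> by simp
      finally show "real (card Q) * (T ^ (P - 3)) powr (real m - 1 + \<tau>) \<le> \<epsilon>" .
    qed
  qed
qed

end

lemma Cw_pw_entire_subset: "Cw_pw_entire l \<subseteq> Cw_pw r l"
proof
  fix u :: "real \<Rightarrow> 'k::euclidean_space" assume u: "u \<in> Cw_pw_entire l"
  have "analytic_radius_gt J r u" if "analytic_entire J u" for J
    unfolding analytic_radius_gt_def
  proof (intro exI[of _ "r + 1"] conjI ballI)
    fix b :: 'k assume "b \<in> Basis"
    with that obtain F where "F holomorphic_on UNIV" "AE t in lebesgue_on J. F (complex_of_real t) = complex_of_real (u t \<bullet> b)"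
      unfolding analytic_entire_def by blast
    then show "\<exists>F. F holomorphic_on {z. infdist z (complex_of_real ` J) < r + 1} \<and>
        (AE t in lebesgue_on J. F (complex_of_real t) = complex_of_real (u t \<bullet> b))"
      by (intro exI[of _ F]) (auto intro: holomorphic_on_subset)
  qed simp
  then show "u \<in> Cw_pw r l" using u by (simp add: Cw_pw_def Cw_pw_entire_def)
qed

text \<open>Both classes of controls in the theorem are instances of \<open>V\<close>: the lower
  inclusion makes the approximating controls admissible variations, the upper one gives the rate of
  approximation. The radius \<open>r\<close> can be fixed before the group because the coefficient
  bound, which depends on the group, influences only the size of \<open>n\<close> and not
  \<open>\<theta>\<close> or \<open>P\<close>.\<close>

lemma critical_values_thin_union:
  fixes l s :: nat and \<tau> :: real
  assumes l: "1 \<le> l" and \<tau>: "0 < \<tau>"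
  shows "\<exists>r>0. \<forall>(gmul :: 'g::euclidean_space \<Rightarrow> 'g \<Rightarrow> 'g) Vs (Xmap :: 'k::euclidean_space \<Rightarrow> 'g) V.
    carnot_group gmul s Vs Xmap \<longrightarrow> Cw_pw_entire l \<subseteq> V \<longrightarrow> V \<subseteq> Cw_pw r l \<longrightarrow>
    (\<exists>A. (\<forall>M::nat. thin (real DIM('g) - 1 + \<tau>) (A M)) \<and> End_map gmul Xmap ` Crit_End_on gmul Xmap V \<subseteq> (\<Union>M. A M))"
proof -
  define m where "m = DIM('g)"
  define P where "P = nat \<lceil>(4 * real (m - 1) + 1) / \<tau>\<rceil> + 4"
  define \<theta> where "\<theta> = 1 / (2 * real (picard_degree s s + P + 1) ^ (l * DIM('k)))"
  \<comment> \<open>The maximum with \<open>1\<close> serves \<open>taylor_piece\<close>; the other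
    entry yields \<open>q \<le> \<theta> ^ (2 * P)\<close>.\<close>
  define r where "r = max 1 (1 / (2 * real l * \<theta> ^ (2 * P)))"
  define q where "q = 1 / (2 * real l * r)"
  have \<theta>0: "0 < \<theta>" unfolding \<theta>_def by (intro divide_pos_pos mult_pos_pos zero_less_power) simp_all
  have r1: "1 \<le> r" by (simp add: r_def)
  have q0: "0 < q" using l r1 by (simp add: q_def)
  have q\<theta>: "q \<le> \<theta> ^ (2 * P)"
  proof -
    have "1 / (2 * real l * \<theta> ^ (2 * P)) \<le> r" by (simp add: r_def)
    then have "1 \<le> r * (2 * real l * \<theta> ^ (2 * P))" using l \<theta>0 by (simp add: pos_divide_le_eq)
    then show ?thesis using l r1 by (simp add: q_def pos_divide_le_eq mult_ac)
  qed
  have P4: "4 \<le> P" by (simp add: P_def)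
  have P\<tau>: "4 * real (m - 1) + 1 \<le> real (P - 3) * \<tau>"
  proof -
    have "(4 * real (m - 1) + 1) / \<tau> \<le> real (P - 3)" unfolding P_def by linarith
    then show ?thesis using \<tau> by (simp only: pos_divide_le_eq)
  qed
  show ?thesis
  proof (rule exI[of _ r], intro conjI allI impI)
    show "0 < r" using r1 by simp
    fix gmul :: "'g \<Rightarrow> 'g \<Rightarrow> 'g" and Vs and Xmap :: "'k \<Rightarrow> 'g" and V :: "(real \<Rightarrow> 'k) set"
    assume cg: "carnot_group gmul s Vs Xmap" and V: "Cw_pw_entire l \<subseteq> V" "V \<subseteq> Cw_pw r l"
    interpret carnot gmul s Vs Xmap by (rule carnot.intro[OF cg])
    have VL: "V \<subseteq> L2" using V(2) by (auto simp: Cw_pw_def)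
    \<comment> \<open>The strata of the Taylor bound, shifted by one because that bound is at least
      \<open>1\<close>.\<close>
    define A where "A = (\<lambda>M. End_map gmul Xmap ` {u \<in> Crit_End_on gmul Xmap V. \<exists>X. taylor_bounds l q (Suc M) u X})"
    have "thin (real DIM('g) - 1 + \<tau>) (A M)" for M
      unfolding A_def
      by (rule thin_critical[OF \<tau> P4 P\<tau>[unfolded m_def] q0 q\<theta>[unfolded \<theta>_def] l _ V(1) VL]) simp
    moreover have "End_map gmul Xmap ` Crit_End_on gmul Xmap V \<subseteq> (\<Union>M. A M)"
    proof
      fix z assume "z \<in> End_map gmul Xmap ` Crit_End_on gmul Xmap V"
      then obtain u where u: "u \<in> Crit_End_on gmul Xmap V" "z = End_map gmul Xmap u" by blast
      then have "u \<in> Cw_pw r l" using V(2) unfolding Crit_End_on_def by blast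
      from Cw_pw_taylor_bounds[OF this r1 l] obtain M X where M: "1 \<le> M" "taylor_bounds l q M u X" unfolding q_def by blast
      then have "z \<in> A (M - 1)" using u unfolding A_def by auto
      then show "z \<in> (\<Union>M. A M)" by blast
    qed
    ultimately show "\<exists>A. (\<forall>M::nat. thin (real DIM('g) - 1 + \<tau>) (A M)) \<and> End_map gmul Xmap ` Crit_End_on gmul Xmap V \<subseteq> (\<Union>M. A M)"
      by blast
  qed
qed

text \<open>Restricting the differential to \<open>V\<close> can only lower its rank.\<close>

lemma Crit_End_Int_subset:
  fixes Xmap :: "'k::euclidean_space \<Rightarrow> 'g::euclidean_space"
  assumes "V \<subseteq> L2"
  shows "Crit_End gmul Xmap \<inter> V \<subseteq> Crit_End_on gmul Xmap V"
proof
  fix u assume "u \<in> Crit_End gmul Xmap \<inter> V"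
  then obtain L where L: "u \<in> V" "has_End_deriv gmul Xmap u L" "dim (L ` L2) \<le> DIM('g) - 1"
    unfolding Crit_End_def by blast
  have "dim (L ` V) \<le> dim (L ` L2)" using assms by (intro dim_subset image_mono)
  then show "u \<in> Crit_End_on gmul Xmap V" using L unfolding Crit_End_on_def by (blast intro: order_trans)
qed

theorem theoremJ:
  fixes s l :: nat
  assumes "l \<ge> 1"
  shows "(\<exists>r>0. \<forall>(gmul :: 'g::euclidean_space \<Rightarrow> 'g \<Rightarrow> 'g) Vs (Xmap :: 'k::euclidean_space \<Rightarrow> 'g).
            carnot_group gmul s Vs Xmap \<longrightarrow>
              End_map gmul Xmap ` (Crit_End gmul Xmap \<inter> Cw_pw r l) \<in> null_sets lebesgue \<and>
              End_map gmul Xmap ` (Crit_End_on gmul Xmap (Cw_pw r l)) \<in> null_sets lebesgue)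
       \<and> (\<forall>(gmul :: 'g \<Rightarrow> 'g \<Rightarrow> 'g) Vs (Xmap :: 'k \<Rightarrow> 'g).
            carnot_group gmul s Vs Xmap \<longrightarrow>
              hausdorff_dim (End_map gmul Xmap ` (Crit_End gmul Xmap \<inter> Cw_pw_entire l))
                \<le> hausdorff_dim (End_map gmul Xmap ` (Crit_End_on gmul Xmap (Cw_pw_entire l))) \<and>
              hausdorff_dim (End_map gmul Xmap ` (Crit_End_on gmul Xmap (Cw_pw_entire l)))
                \<le> real DIM('g) - 1)"
proof (rule conjI)
  \<comment> \<open>With \<open>\<tau> = 1\<close> the exponent is the full dimension, the case of
    Lebesgue measure.\<close>
  have one: "0 < (1::real)" by simp
  from critical_values_thin_union[OF assms one, where s=s and 'g='g and 'k='k]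
  obtain r where r: "0 < r" and R: "\<forall>(gmul :: 'g \<Rightarrow> 'g \<Rightarrow> 'g) Vs (Xmap :: 'k \<Rightarrow> 'g) V.
    carnot_group gmul s Vs Xmap \<longrightarrow> Cw_pw_entire l \<subseteq> V \<longrightarrow> V \<subseteq> Cw_pw r l \<longrightarrow>
    (\<exists>A. (\<forall>M::nat. thin (real DIM('g) - 1 + 1) (A M)) \<and> End_map gmul Xmap ` Crit_End_on gmul Xmap V \<subseteq> (\<Union>M. A M))"
    by (elim exE conjE) (rule that)
  show "\<exists>r>0. \<forall>(gmul :: 'g \<Rightarrow> 'g \<Rightarrow> 'g) Vs (Xmap :: 'k \<Rightarrow> 'g).
            carnot_group gmul s Vs Xmap \<longrightarrow>
              End_map gmul Xmap ` (Crit_End gmul Xmap \<inter> Cw_pw r l) \<in> null_sets lebesgue \<and>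
              End_map gmul Xmap ` (Crit_End_on gmul Xmap (Cw_pw r l)) \<in> null_sets lebesgue"
  proof (rule exI[of _ r], intro conjI[OF r] allI impI)
    fix gmul :: "'g \<Rightarrow> 'g \<Rightarrow> 'g" and Vs and Xmap :: "'k \<Rightarrow> 'g"
    assume cg: "carnot_group gmul s Vs Xmap"
    from R[rule_format, OF cg Cw_pw_entire_subset order_refl] obtain A
      where A: "\<And>M::nat. thin (real DIM('g) - 1 + 1) (A M)"
        and sub: "End_map gmul Xmap ` Crit_End_on gmul Xmap (Cw_pw r l) \<subseteq> (\<Union>M. A M)"
      by (elim exE conjE) (rule that, erule spec)
    have "negligible (A M)" for M by (rule thin_negligible) (use A[of M] in simp)
    then have "negligible (\<Union>M. A M)" by (intro negligible_countable_Union) auto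
    then have n: "negligible (End_map gmul Xmap ` Crit_End_on gmul Xmap (Cw_pw r l))"
      by (rule negligible_subset[OF _ sub])
    moreover have "negligible (End_map gmul Xmap ` (Crit_End gmul Xmap \<inter> Cw_pw r l))"
      by (rule negligible_subset[OF n image_mono[OF Crit_End_Int_subset]]) (auto simp: Cw_pw_def)
    ultimately show "End_map gmul Xmap ` (Crit_End gmul Xmap \<inter> Cw_pw r l) \<in> null_sets lebesgue \<and>
              End_map gmul Xmap ` (Crit_End_on gmul Xmap (Cw_pw r l)) \<in> null_sets lebesgue"
      by (simp add: negligible_iff_null_sets)
  qed
  show "\<forall>(gmul :: 'g \<Rightarrow> 'g \<Rightarrow> 'g) Vs (Xmap :: 'k \<Rightarrow> 'g).
            carnot_group gmul s Vs Xmap \<longrightarrow>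
              hausdorff_dim (End_map gmul Xmap ` (Crit_End gmul Xmap \<inter> Cw_pw_entire l))
                \<le> hausdorff_dim (End_map gmul Xmap ` (Crit_End_on gmul Xmap (Cw_pw_entire l))) \<and>
              hausdorff_dim (End_map gmul Xmap ` (Crit_End_on gmul Xmap (Cw_pw_entire l)))
                \<le> real DIM('g) - 1"
  proof (intro allI impI)
    fix gmul :: "'g \<Rightarrow> 'g \<Rightarrow> 'g" and Vs and Xmap :: "'k \<Rightarrow> 'g"
    assume cg: "carnot_group gmul s Vs Xmap"
    define W where "W = End_map gmul Xmap ` Crit_End_on gmul Xmap (Cw_pw_entire l)"
    have m: "1 \<le> real DIM('g)" using DIM_positive[where 'a='g] by linarith
    \<comment> \<open>Each \<open>\<tau>\<close> comes with its own radius \<open>r\<close>;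
      piecewise entire controls satisfy all these requirements at once.\<close>
    have H: "hausdorff_measure (real DIM('g) - 1 + \<tau>) W = 0" if \<tau>: "0 < \<tau>" for \<tau>
    proof -
      from critical_values_thin_union[OF assms \<tau>, where s=s and 'g='g and 'k='k]
      obtain r where R: "\<forall>(gmul :: 'g \<Rightarrow> 'g \<Rightarrow> 'g) Vs (Xmap :: 'k \<Rightarrow> 'g) V.
        carnot_group gmul s Vs Xmap \<longrightarrow> Cw_pw_entire l \<subseteq> V \<longrightarrow> V \<subseteq> Cw_pw r l \<longrightarrow>
        (\<exists>A. (\<forall>M::nat. thin (real DIM('g) - 1 + \<tau>) (A M)) \<and> End_map gmul Xmap ` Crit_End_on gmul Xmap V \<subseteq> (\<Union>M. A M))"
        by (elim exE conjE) (rule that)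
      from R[rule_format, OF cg order_refl Cw_pw_entire_subset] obtain A
        where A: "\<And>M::nat. thin (real DIM('g) - 1 + \<tau>) (A M)" and sub: "W \<subseteq> (\<Union>M. A M)"
        unfolding W_def[symmetric] by (elim exE conjE) (rule that, erule spec)
      have "hausdorff_measure (real DIM('g) - 1 + \<tau>) (\<Union>M. A M) = 0"
        by (rule thin_UN_hausdorff[OF A]) (use m \<tau> in linarith)
      then show ?thesis using hausdorff_measure_mono[OF sub, of "real DIM('g) - 1 + \<tau>"] by simp
    qed
    have "hausdorff_dim W \<le> real DIM('g) - 1"
      by (rule hausdorff_dim_le) (use m H in auto)
    moreover have "End_map gmul Xmap ` (Crit_End gmul Xmap \<inter> Cw_pw_entire l) \<subseteq> W"
      unfolding W_def by (intro image_mono Crit_End_Int_subset) (auto simp: Cw_pw_entire_def)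
    then have "hausdorff_dim (End_map gmul Xmap ` (Crit_End gmul Xmap \<inter> Cw_pw_entire l)) \<le> hausdorff_dim W"
      by (rule hausdorff_dim_mono[OF _ _ H[OF one]]) (use m in linarith)
    ultimately show "hausdorff_dim (End_map gmul Xmap ` (Crit_End gmul Xmap \<inter> Cw_pw_entire l))
                \<le> hausdorff_dim (End_map gmul Xmap ` (Crit_End_on gmul Xmap (Cw_pw_entire l))) \<and>
              hausdorff_dim (End_map gmul Xmap ` (Crit_End_on gmul Xmap (Cw_pw_entire l)))
                \<le> real DIM('g) - 1" unfolding W_def by simp
  qed
qed

end
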